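(* Let the suspension satisfy the assumptions (A1)--(A9) listed in the context, and let the local behavior of every particle in the suspension be determined by the asymptotic one-particle model (R1)--(R4) and by the asymptotic model (T) of the stresses in the particle domain, both given in the context. Then the suspension is macroscopically described up to an error of $\mathcal{O}(\epsilon^4)$ (in the sense explained in the context) by $$\mathrm{Re}\left(\partial_t u+(u\cdot\nabla_x)u\right)=\nabla_x\cdot\left(S[u]+\Sigma^p\right)^T+b^p+\mathrm{Re}\,\mathrm{Fr}^{-2}e_g,\qquad \nabla_x\cdot u=0\qquad\text{in }\Omega\times\mathbb{R}^+,$$ supplemented with appropriate initial and boundary conditions, where the particle-induced stress and force are $$\Sigma^p(x,t)=\frac{1}{|\mathcal{V}(x,t)|}\sum_{j=1}^{N(x,t)}\epsilon^3R_0^j(t)\cdot\left(\int_{\partial\mathcal{E}}(S[u_{loc,1}^{j}](y,t)\cdot n)\otimes y-h_1^j(y,t)\otimes n-n\otimes h_1^j(y,t)\,ds(y)\right)\cdot R_0^{j}(t)^T,$$ $$b^p(x,t)=\frac{1}{|\mathcal{V}(x,t)|}\sum_{j=1}^{N(x,t)}\left(\epsilon^2R_0^j(t)\cdot f_1^j(t)+\epsilon^3\left(R_0^j(t)\cdot f_2^j(t)+R_1^j(t)\cdot f_1^j(t)\right)\right).$$ Here $N(x,t)$ is the number of particles in the averaging volume $\mathcal{V}(x,t)$ and the superscript $j$ marks the asymptotic coefficients of the $j$-th particle.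
   Context: **Notation.** Vectors are in $\mathbb{R}^3$, matrices in $\mathbb{R}^{3\times 3}$; $\cdot$ is the usual contraction, $(a\otimes b)_{ij}=a_ib_j$, $A:B=\sum_{ij}A_{ij}B_{ij}$, $B(v)$ is the skew matrix with $B(v)\cdot x=v\times x$. $(\nabla\cdot M^T)_i=\sum_j\partial_jM_{ij}$, $(\partial_x f)_{ij}=\partial_{x_j}f_i$, $\nabla f=(\partial_x f)^T$. For a velocity $u$ with associated pressure $p$, $S[u]=-pI+\nabla u+\nabla u^T$ (derivatives with respect to the variable of $u$: $x$ for $u,u_0$, and $y$ for the local fields $u_{loc,i}$). $\mathrm{Re},\mathrm{Fr}>0$ are the Reynolds and Froude numbers, $e_g$ a unit vector, $m>0$ a mass ratio, $\epsilon>0$ the size parameter (ratio of particle to fluid length scale). $\mathcal{E}\subset\mathbb{R}^3$ is the reference particle: bounded, open, smooth boundary, center of mass $0$, outer normal $n$. $\hat J=|\mathcal{E}|^{-1}\int_{\mathcal{E}}\|y\|^2I-y\otimes y\,dy$. A particle at time $t$ is $\mathcal{E}(t)=\{\epsilon R(t)\cdot y+c(t):y\in\mathcal{E}\}$, $R(t)\in SO(3)$, with linear and angular velocities $v,\omega$; $y(x,t,\epsilon)=\epsilon^{-1}R^T(t)\cdot(x-c(t))$. The ratio of particle to fluid density is $\rho=\epsilon^{\kappa-3}m/|\mathcal{E}|$, i.e. the mass function is $\alpha_{mass}(\epsilon)=\epsilon^\kappa$. **Asymptotic one-particle model.** Expansions $a=\sum_{i\ge0}\epsilon^ia_i$ for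 $a\in\{c,v,\omega,R\}$; flow $=u_0+R\cdot u_{loc}$, pressure $=p_0+p_{loc}$, $u_{loc}=\sum_{i\ge1}\epsilon^iu_{loc,i}(y(x,t,\epsilon),t)$, $p_{loc}=\sum_{i\ge1}\epsilon^{i-1}p_{loc,i}(y(x,t,\epsilon),t)$. Put $x_1=R_0\cdot y+c_1$, $x_2=R_1\cdot y+c_2$, $D_1=x_1\cdot\nabla$, $D_2=x_2\cdot\nabla+\tfrac12x_1\otimes x_1:\nabla^2$. Derivatives of $u_0$ and $S[u_0]$ below are evaluated at $c_0$. Define $k_0=m\mathrm{Re}R_0^T\cdot(\frac{d}{dt}v_0-\mathrm{Fr}^{-2}e_g)$, $k_1=m\mathrm{Re}R_0^T\cdot\frac{d}{dt}v_1$, $\ell_0=m\mathrm{Re}R_0^T\cdot\frac{d}{dt}(R_0\cdot\hat J\cdot R_0^T\cdot\omega_0)$, $h_1=R_0^T\cdot(v_1+B(\omega_0)\cdot R_0\cdot y-D_1u_0)$, $h_2=R_0^T\cdot(v_2+(B(\omega_0)\cdot R_1+B(\omega_1)\cdot R_0)\cdot y-D_2u_0-R_1\cdot u_{loc,1})$, $f_1=0$ if $\kappa\ge3$, $f_1=k_0$ if $\kappa=2$, $f_2=-R_0^T\cdot R_1\cdot f_1-|\mathcal{E}|R_0^T\cdot\nabla_x\cdot S[u_0]^T+\{0\ (\kappa\ge4),\ k_0\ (\kappa=3),\ k_1\ (\kappa=2)\}$, $g_1=0$, $g_2=-\int_{\partial\mathcal{E}}y\times(R_0^T\cdot D_1S[u_0]\cdot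 R_0\cdot n)\,ds+\{0\ (\kappa\ge3),\ \ell_0\ (\kappa=2)\}$. The requirements are: (R1) $u_0,p_0$ solve $\mathrm{Re}(\partial_tu_0+(u_0\cdot\nabla)u_0)=\nabla\cdot S[u_0]^T+\mathrm{Re}\,\mathrm{Fr}^{-2}e_g$, $\nabla\cdot u_0=0$ in $\Omega\times\mathbb{R}^+$, with boundary values on $\partial\Omega$ of the full flow and initial values equal to those of the full flow outside $\mathcal{E}(0)$ and to $\omega(0)\times(x-c(0))+v(0)$ in $\mathcal{E}(0)$. (R2) $\frac{d}{dt}c_i=v_i$ ($i=0,1,2$), $c_0(0)=c(0)$, $c_1(0)=c_2(0)=0$; $v_0(t)=u_0(c_0(t),t)$; $\frac{d}{dt}R_0=B(\omega_0)\cdot R_0$, $\frac{d}{dt}R_1=B(\omega_1)\cdot R_0+B(\omega_0)\cdot R_1$, $R_0(0)=R(0)$, $R_1(0)=0$. (R3) For $t>0$, $i=1,2$: $\nabla_yp_{loc,i}=\Delta_yu_{loc,i}$, $\nabla_y\cdot u_{loc,i}=0$ in $\mathbb{R}^3\setminus\overline{\mathcal{E}}$; $u_{loc,i}=h_i$ on $\partial\mathcal{E}$; $\int_{\partial\mathcal{E}}S[u_{loc,i}]\cdot n\,ds=f_i$; $\int_{\partial\mathcal{E}}y\times(S[u_{loc,i}]\cdot n)\,ds=g_i$; and $\|u_{loc,i}\|\le C_i/\|y\|$, $\|\nabla_yu_{loc,i}\|,|p_{loc,i}|\le C_i'/\|y\|^2$ for $\|y\|\geq C_i''>0$, with constants independent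 of $y$. (R4) $\alpha_{mass}(\epsilon)=\epsilon^\kappa$, $\kappa\in\mathbb{N}$, $\kappa\ge2$. **Model (T) of stresses in the particle domain.** $T_{loc,i}=\nabla_y\lambda_{loc,i}+\nabla_y\lambda_{loc,i}^T$, $i=1,2$, solve $\nabla_y\cdot T_{loc,i}^T=\hat f_i$ in $\mathcal{E}$, $T_{loc,i}\cdot n=S[u_{loc,i}]\cdot n$ on $\partial\mathcal{E}$, with $\hat f_1=0$ ($\kappa\ge3$), $\hat f_1=|\mathcal{E}|^{-1}k_0$ ($\kappa=2$), and $\hat f_2=-R_0^T\cdot\nabla_x\cdot S[u_0]^T-R_0^T\cdot R_1\cdot\hat f_1+\{0\ (\kappa\ge4),\ |\mathcal{E}|^{-1}k_0\ (\kappa=3),\ |\mathcal{E}|^{-1}m\mathrm{Re}R_0^T\cdot(\frac{d}{dt}v_1+\frac{d^2}{dt^2}R_0\cdot y)\ (\kappa=2)\}$. One writes $T_{loc}=\sum_{i\ge1}\epsilon^{i-1}T_{loc,i}$. Inside $\mathcal{E}$ the local velocities are extended by $u_{loc,i}=h_i$ (the formula for $h_i$ used for all $y\in\mathcal{E}$). **Suspension framework.** On a probability space $(\mathcal{W},\mathcal{A},\mu)$, the random suspension velocity $w$ and pressure $q$ satisfy almost surely $\mathrm{Re}(\partial_tw+(w\cdot\nabla)w)=\nabla\cdot\Sigma^T+\mathrm{Re}\,\mathrm{Fr}^{-2}e_g$, $\nabla\cdot w=0$ in $\Omega\times\mathbb{R}^+$. Decompose $w=u+u'$, $q=p+p'$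 with $u=\mathbb{E}[w]$, $p=\mathbb{E}[q]$, and split $\nabla\cdot\Sigma^T=\nabla\cdot(\Sigma^s)^T+b$ (surface stresses and body force). The averaged description is $$\mathrm{Re}(\partial_tu+(u\cdot\nabla)u)=\nabla\cdot\mathbb{E}[\Sigma^s]^T+\mathbb{E}[b]-\mathrm{Re}\nabla\cdot\mathbb{E}[u'\otimes u']^T+\mathrm{Re}\,\mathrm{Fr}^{-2}e_g,\quad\nabla\cdot u=0.$$ Assumptions: (A1) The suspension consists of similar, independent and identically distributed particles $\mathcal{E}_j(t)$. (A2) It is dilute: the mean particle spacing is sufficiently big (particle interactions are neglected). (A3) For every particle: the fluid is essentially undisturbed by it, the fluid motion induces a rotation of the particle of order $\mathcal{O}(1)$, and the particle is far away from $\partial\Omega$. (A4) No outer forces or moments act on particles except gravity. (A5) The characteristic fluid length scale is much bigger than the particle length scale and the mean particle spacing. (A6) The fluctuations are generated by superposition of the local disturbance fields of the particles. (A7) The suspension is Newtonian up to an error of $\mathcal{O}(\epsilon)$. (A8) The suspension is locally statistically homogeneous. (A9) Ergodicity: for any involved random function $f$, almost surely $\mathbb{E}[f](x,t)=\frac1{|\mathcal{V}(x,t)|}\int_{\mathcal{V}(x,t)}f(\xi,t,\omega)\,d\xi=:\mathbb{E}[f]^{\mathcal{V}}(x,t)$ for a suitable region $\mathcal{V}(x,t)\subset\Omega$ (containing $N(x,t)$ particles). The fluctuations are modeled as follows, $u$ playing the role of the global flow $u_0$ in the one-particle models. The velocity fluctuation $u'$ is the superposition of the fields $R^j\cdot u_{loc}^j$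 (with corresponding pressures $p_{loc}^j$). The surface stress is $\mathbb{E}[\Sigma^s]^{\mathcal{V}}=S[u]+\frac1{|\mathcal{V}|}\int_{\mathcal{V}\setminus\cup\mathcal{E}_j}(-p'I+\nabla u'+\nabla u'^T)\,d\xi+\frac1{|\mathcal{V}|}\int_{\cup\mathcal{E}_j}T'\,d\xi$, with $T'=R^j\cdot T_{loc}^j\cdot R^{jT}$ on $\mathcal{E}_j$; on $\mathcal{E}_j$ and $\partial\mathcal{E}_j$ only the local fields of the $j$-th particle are taken into account, and $\mathbb{E}[\nabla u']^{\mathcal{V}}=0$. The body force is $b=\sum_j\nabla\cdot(R^j\cdot T_{loc}^j\cdot R^{jT})^T\,\mathbb{I}_{\mathcal{E}_j(t)}$ with indicator function $\mathbb{I}$, and $\mathbb{E}[b]$ is its volume average over $\mathcal{V}$. The isotropic contribution $-\frac{1}{|\mathcal{V}|}\int_{\mathcal{V}\setminus\cup\mathcal{E}_j}p'I\,d\xi$ is incorporated in the pressure of the Newtonian stress $S[u]$. **Meaning of "described up to an error of $\mathcal{O}(\epsilon^4)$".** In the averaged description above, as $\epsilon\to0$, $\mathbb{E}[\Sigma^s]=S[u]+\Sigma^p+\mathcal{O}(\epsilon^4)$ (with isotropic part absorbed in the pressure as said), $\mathbb{E}[b]=b^p+\mathcal{O}(\epsilon^4)$ and $\mathbb{E}[u'\otimes u']=\mathcal{O}(\epsilon^4)$. *)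

theory Defs
  imports "HOL-Probability.Probability" "HOL-Library.Landau_Symbols"
begin

section \<open>Vector calculus\<close>

type_synonym vec3 = "real ^ 3"
type_synonym mat3 = "real ^ 3 ^ 3"

definition outer :: "vec3 \<Rightarrow> vec3 \<Rightarrow> mat3" where
  "outer a b = (\<chi> i j. a $ i * b $ j)"

definition skew :: "vec3 \<Rightarrow> mat3" where
  "skew v = matrix (\<lambda>x. cross3 v x)"

definition pd :: "3 \<Rightarrow> (vec3 \<Rightarrow> 'b::real_normed_vector) \<Rightarrow> vec3 \<Rightarrow> 'b" where
  "pd j f x = frechet_derivative f (at x) (axis j 1)"

text \<open>The gradient of a vector field is the transposed Jacobian: its entry \<open>(i, j)\<close> is the
  \<open>i\<close>-th partial derivative of component \<open>j\<close>.\<close>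

definition grad :: "(vec3 \<Rightarrow> vec3) \<Rightarrow> vec3 \<Rightarrow> mat3" where
  "grad f x = transpose (jacobian f (at x))"

definition sgrad :: "(vec3 \<Rightarrow> real) \<Rightarrow> vec3 \<Rightarrow> vec3" where
  "sgrad f x = (\<chi> j. pd j f x)"

definition vdiv :: "(vec3 \<Rightarrow> vec3) \<Rightarrow> vec3 \<Rightarrow> real" where
  "vdiv f x = (\<Sum>j\<in>UNIV. pd j f x $ j)"

text \<open>Row-wise divergence, that is, the divergence of the transposed matrix in the convention in
  which divergence contracts the first index.\<close>

definition mdiv :: "(vec3 \<Rightarrow> mat3) \<Rightarrow> vec3 \<Rightarrow> vec3" where
  "mdiv A x = (\<chi> i. \<Sum>j\<in>UNIV. pd j A x $ i $ j)"

definition lap :: "(vec3 \<Rightarrow> vec3) \<Rightarrow> vec3 \<Rightarrow> vec3" where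
  "lap f x = (\<Sum>j\<in>UNIV. pd j (pd j f) x)"

definition conv :: "(vec3 \<Rightarrow> vec3) \<Rightarrow> vec3 \<Rightarrow> vec3" where
  "conv f x = jacobian f (at x) *v f x"

definition sym_grad :: "(vec3 \<Rightarrow> vec3) \<Rightarrow> vec3 \<Rightarrow> mat3" where
  "sym_grad f x = grad f x + transpose (grad f x)"

definition newton_stress :: "(vec3 \<Rightarrow> vec3) \<Rightarrow> (vec3 \<Rightarrow> real) \<Rightarrow> vec3 \<Rightarrow> mat3" where
  "newton_stress u p x = - (p x *\<^sub>R mat 1) + sym_grad u x"

definition vol_avg :: "vec3 set \<Rightarrow> (vec3 \<Rightarrow> 'b::{banach,second_countable_topology}) \<Rightarrow> 'b" where
  "vol_avg V f = (1 / measure lborel V) *\<^sub>R (LINT \<xi>:V|lborel. f \<xi>)"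

text \<open>\<open>k\<close> times continuously differentiable on an open set.\<close>

fun Cdiff :: "nat \<Rightarrow> ('a::real_normed_vector \<Rightarrow> 'b::real_normed_vector) \<Rightarrow> 'a set \<Rightarrow> bool" where
  "Cdiff 0 f S \<longleftrightarrow> continuous_on S f"
| "Cdiff (Suc k) f S \<longleftrightarrow>
     f differentiable_on S \<and> (\<forall>v. Cdiff k (\<lambda>x. frechet_derivative f (at x) v) S)"


section \<open>The reference particle, its surface measure and its outer normal\<close>

text \<open>Near each boundary point the set is, after relabelling and reorienting the coordinate axes,
  the part of a ball lying above the graph of a smooth function of two variables.\<close>

definition smooth_boundary :: "vec3 set \<Rightarrow> bool" where
  "smooth_boundary E \<longleftrightarrow> (\<forall>z\<in>frontier E. \<exists>r>0. \<exists>\<pi>::3 \<Rightarrow> 3. \<exists>s\<in>{-1, 1}. \<exists>g::real^2 \<Rightarrow> real.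
     bij \<pi> \<and> (\<forall>k. Cdiff k g UNIV) \<and>
     E \<inter> ball z r = {x \<in> ball z r. s * x $ \<pi> 3 > g (vector [x $ \<pi> 1, x $ \<pi> 2])})"

definition reference_particle :: "vec3 set \<Rightarrow> bool" where
  "reference_particle E \<longleftrightarrow> open E \<and> bounded E \<and> E \<noteq> {} \<and> smooth_boundary E \<and>
     (LINT y:E|lborel. y) = 0"

definition outer_normal :: "vec3 set \<Rightarrow> vec3 \<Rightarrow> vec3" where
  "outer_normal E z = (THE n. norm n = 1 \<and>
     (\<forall>v. v \<bullet> n < 0 \<longrightarrow> (\<forall>\<^sub>F s in at_right 0. z + s *\<^sub>R v \<in> E)) \<and>
     (\<forall>v. v \<bullet> n > 0 \<longrightarrow> (\<forall>\<^sub>F s in at_right 0. z + s *\<^sub>R v \<notin> closure E)))"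

text \<open>The surface measure \<open>ds\<close>: the Borel measure carried by the boundary that on every regular
  parametrised patch \<open>\<gamma>\<close> is given by the usual area element. For a smooth boundary it exists and
  is uniquely determined by these conditions.\<close>

definition regular_patch :: "vec3 set \<Rightarrow> (real^2) set \<Rightarrow> (real^2 \<Rightarrow> vec3) \<Rightarrow> bool" where
  "regular_patch E U \<gamma> \<longleftrightarrow> open U \<and> Cdiff 1 \<gamma> U \<and> inj_on \<gamma> U \<and> \<gamma> ` U \<subseteq> frontier E \<and>
     (\<forall>s\<in>U. cross3 (frechet_derivative \<gamma> (at s) (axis 1 1))
                    (frechet_derivative \<gamma> (at s) (axis 2 1)) \<noteq> 0)"

definition is_surface_measure :: "vec3 set \<Rightarrow> vec3 measure \<Rightarrow> bool" where
  "is_surface_measure E \<sigma> \<longleftrightarrow> sets \<sigma> = sets borel \<and> emeasure \<sigma> (- frontier E) = 0 \<and>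
     (\<forall>U \<gamma>. regular_patch E U \<gamma> \<longrightarrow> (\<forall>B\<in>sets borel. emeasure \<sigma> (B \<inter> \<gamma> ` U) =
        (\<integral>\<^sup>+ s. indicator U s * indicator B (\<gamma> s) *
           ennreal (norm (cross3 (frechet_derivative \<gamma> (at s) (axis 1 1))
                                 (frechet_derivative \<gamma> (at s) (axis 2 1)))) \<partial>lborel)))"

text \<open>Boundary values from outside and from inside.\<close>

definition outer_trace :: "vec3 set \<Rightarrow> (vec3 \<Rightarrow> mat3) \<Rightarrow> vec3 \<Rightarrow> mat3" where
  "outer_trace E A y = Lim (at y within - closure E) A"

definition inner_trace :: "vec3 set \<Rightarrow> (vec3 \<Rightarrow> mat3) \<Rightarrow> vec3 \<Rightarrow> mat3" where
  "inner_trace E A y = Lim (at y within E) A"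


section \<open>Physical data and particles\<close>

record config =
  Rey :: real
  Frn :: real
  mass :: real
  grav :: vec3
  kappa :: nat
  alpha_mass :: "real \<Rightarrow> real"
  shape :: "vec3 set"
  area :: "vec3 measure"

definition valid_config :: "config \<Rightarrow> bool" where
  "valid_config S \<longleftrightarrow> Rey S > 0 \<and> Frn S > 0 \<and> mass S > 0 \<and> norm (grav S) = 1 \<and>
     2 \<le> kappa S \<and> (\<forall>\<epsilon>>0. alpha_mass S \<epsilon> = \<epsilon> ^ kappa S) \<and>
     reference_particle (shape S) \<and> is_surface_measure (shape S) (area S)"

abbreviation vol :: "config \<Rightarrow> real" where
  "vol S \<equiv> measure lborel (shape S)"

abbreviation nrm :: "config \<Rightarrow> vec3 \<Rightarrow> vec3" where
  "nrm S \<equiv> outer_normal (shape S)"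

definition inertia :: "config \<Rightarrow> mat3" where
  "inertia S = (1 / vol S) *\<^sub>R (LINT y:shape S|lborel. (norm y)\<^sup>2 *\<^sub>R mat 1 - outer y y)"

text \<open>All data of one particle for one value of the size parameter. The first block is the actual
  state (centre, velocities, rotation; local velocity, pressure and stress as functions of time and
  of the local variable), the second one consists of the coefficients of its expansion. The fields
  \<open>lvelc\<close>, \<open>lprsc\<close>, \<open>lamc\<close> are meaningful for the indices 1 and 2.\<close>

record particle =
  pos :: "real \<Rightarrow> vec3"
  vel :: "real \<Rightarrow> vec3"
  ang :: "real \<Rightarrow> vec3"
  rot :: "real \<Rightarrow> mat3"
  lvel :: "real \<Rightarrow> vec3 \<Rightarrow> vec3"
  lprs :: "real \<Rightarrow> vec3 \<Rightarrow> real"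
  lstr :: "real \<Rightarrow> vec3 \<Rightarrow> mat3"
  posc :: "nat \<Rightarrow> real \<Rightarrow> vec3"
  velc :: "nat \<Rightarrow> real \<Rightarrow> vec3"
  angc :: "nat \<Rightarrow> real \<Rightarrow> vec3"
  rotc :: "nat \<Rightarrow> real \<Rightarrow> mat3"
  lvelc :: "nat \<Rightarrow> real \<Rightarrow> vec3 \<Rightarrow> vec3"
  lprsc :: "nat \<Rightarrow> real \<Rightarrow> vec3 \<Rightarrow> real"
  lamc :: "nat \<Rightarrow> real \<Rightarrow> vec3 \<Rightarrow> vec3"

definition body :: "config \<Rightarrow> real \<Rightarrow> particle \<Rightarrow> real \<Rightarrow> vec3 set" where
  "body S \<epsilon> P t = (\<lambda>y. \<epsilon> *\<^sub>R (rot P t *v y) + pos P t) ` shape S"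

definition local_coord :: "real \<Rightarrow> particle \<Rightarrow> real \<Rightarrow> vec3 \<Rightarrow> vec3" where
  "local_coord \<epsilon> P t x = (1 / \<epsilon>) *\<^sub>R (transpose (rot P t) *v (x - pos P t))"

text \<open>The local fields as fields of the macroscopic variable.\<close>

definition local_vel :: "real \<Rightarrow> particle \<Rightarrow> real \<Rightarrow> vec3 \<Rightarrow> vec3" where
  "local_vel \<epsilon> P t x = rot P t *v lvel P t (local_coord \<epsilon> P t x)"

definition local_prs :: "real \<Rightarrow> particle \<Rightarrow> real \<Rightarrow> vec3 \<Rightarrow> real" where
  "local_prs \<epsilon> P t x = lprs P t (local_coord \<epsilon> P t x)"

definition local_str :: "real \<Rightarrow> particle \<Rightarrow> real \<Rightarrow> vec3 \<Rightarrow> mat3" where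
  "local_str \<epsilon> P t x = rot P t ** lstr P t (local_coord \<epsilon> P t x) ** transpose (rot P t)"


section \<open>The asymptotic one-particle model\<close>

text \<open>In this section \<open>u\<close> and \<open>p\<close> are the global velocity and pressure.\<close>

type_synonym vfield = "vec3 \<Rightarrow> real \<Rightarrow> vec3"
type_synonym sfield = "vec3 \<Rightarrow> real \<Rightarrow> real"

abbreviation stress_at :: "vfield \<Rightarrow> sfield \<Rightarrow> real \<Rightarrow> vec3 \<Rightarrow> mat3" where
  "stress_at u p t \<equiv> newton_stress (\<lambda>z. u z t) (\<lambda>z. p z t)"

definition k0 :: "config \<Rightarrow> particle \<Rightarrow> real \<Rightarrow> vec3" where
  "k0 S P t = (mass S * Rey S) *\<^sub>R (transpose (rotc P 0 t) *v
     (vector_derivative (velc P 0) (at t) - (1 / (Frn S)\<^sup>2) *\<^sub>R grav S))"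

definition k1 :: "config \<Rightarrow> particle \<Rightarrow> real \<Rightarrow> vec3" where
  "k1 S P t = (mass S * Rey S) *\<^sub>R (transpose (rotc P 0 t) *v vector_derivative (velc P 1) (at t))"

definition ang_mom :: "config \<Rightarrow> particle \<Rightarrow> real \<Rightarrow> vec3" where
  "ang_mom S P t = (rotc P 0 t ** inertia S ** transpose (rotc P 0 t)) *v angc P 0 t"

definition l0 :: "config \<Rightarrow> particle \<Rightarrow> real \<Rightarrow> vec3" where
  "l0 S P t = (mass S * Rey S) *\<^sub>R (transpose (rotc P 0 t) *v vector_derivative (ang_mom S P) (at t))"

definition x1 :: "particle \<Rightarrow> real \<Rightarrow> vec3 \<Rightarrow> vec3" where
  "x1 P t y = rotc P 0 t *v y + posc P 1 t"

definition x2 :: "particle \<Rightarrow> real \<Rightarrow> vec3 \<Rightarrow> vec3" where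
  "x2 P t y = rotc P 1 t *v y + posc P 2 t"

definition D1 :: "particle \<Rightarrow> real \<Rightarrow> vec3 \<Rightarrow> (vec3 \<Rightarrow> 'b::real_normed_vector) \<Rightarrow> 'b" where
  "D1 P t y f = frechet_derivative f (at (posc P 0 t)) (x1 P t y)"

definition D2 :: "particle \<Rightarrow> real \<Rightarrow> vec3 \<Rightarrow> (vec3 \<Rightarrow> 'b::real_normed_vector) \<Rightarrow> 'b" where
  "D2 P t y f = frechet_derivative f (at (posc P 0 t)) (x2 P t y) +
     (1/2) *\<^sub>R (\<Sum>i\<in>UNIV. \<Sum>j\<in>UNIV. (x1 P t y $ i * x1 P t y $ j) *\<^sub>R pd i (pd j f) (posc P 0 t))"

definition h1 :: "vfield \<Rightarrow> particle \<Rightarrow> real \<Rightarrow> vec3 \<Rightarrow> vec3" where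
  "h1 u P t y = transpose (rotc P 0 t) *v
     (velc P 1 t + skew (angc P 0 t) *v (rotc P 0 t *v y) - D1 P t y (\<lambda>z. u z t))"

definition h2 :: "vfield \<Rightarrow> particle \<Rightarrow> real \<Rightarrow> vec3 \<Rightarrow> vec3" where
  "h2 u P t y = transpose (rotc P 0 t) *v
     (velc P 2 t + (skew (angc P 0 t) ** rotc P 1 t + skew (angc P 1 t) ** rotc P 0 t) *v y
      - D2 P t y (\<lambda>z. u z t) - rotc P 1 t *v lvelc P 1 t y)"

definition f1 :: "config \<Rightarrow> particle \<Rightarrow> real \<Rightarrow> vec3" where
  "f1 S P t = (if kappa S = 2 then k0 S P t else 0)"

definition f2 :: "config \<Rightarrow> vfield \<Rightarrow> sfield \<Rightarrow> particle \<Rightarrow> real \<Rightarrow> vec3" where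
  "f2 S u p P t =
     - (transpose (rotc P 0 t) *v (rotc P 1 t *v f1 S P t))
     - vol S *\<^sub>R (transpose (rotc P 0 t) *v mdiv (stress_at u p t) (posc P 0 t))
     + (if kappa S = 2 then k1 S P t else if kappa S = 3 then k0 S P t else 0)"

definition g1 :: vec3 where
  "g1 = 0"

definition g2 :: "config \<Rightarrow> vfield \<Rightarrow> sfield \<Rightarrow> particle \<Rightarrow> real \<Rightarrow> vec3" where
  "g2 S u p P t =
     - (LINT y|area S. cross3 y (transpose (rotc P 0 t) *v
          (D1 P t y (stress_at u p t) *v (rotc P 0 t *v nrm S y))))
     + (if kappa S = 2 then l0 S P t else 0)"

text \<open>The forces and moments contain no external contribution other than gravity (in \<open>k0\<close>).\<close>

definition kinematics :: "vfield \<Rightarrow> particle \<Rightarrow> bool" where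
  "kinematics u P \<longleftrightarrow>
     (\<forall>t\<ge>0. rotation_matrix (rot P t)
       \<and> (pos P has_vector_derivative vel P t) (at t within {0..})
       \<and> (rot P has_vector_derivative skew (ang P t) ** rot P t) (at t within {0..})
       \<and> (\<forall>i\<in>{0, 1, 2}. (posc P i has_vector_derivative velc P i t) (at t within {0..}))
       \<and> velc P 0 t = u (posc P 0 t) t
       \<and> (rotc P 0 has_vector_derivative skew (angc P 0 t) ** rotc P 0 t) (at t within {0..})
       \<and> (rotc P 1 has_vector_derivative
            skew (angc P 1 t) ** rotc P 0 t + skew (angc P 0 t) ** rotc P 1 t) (at t within {0..})) \<and>
     posc P 0 0 = pos P 0 \<and> posc P 1 0 = 0 \<and> posc P 2 0 = 0 \<and>
     rotc P 0 0 = rot P 0 \<and> rotc P 1 0 = 0"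

text \<open>The time derivatives occurring in the forces and moments exist.\<close>

definition dynamics_regular :: "config \<Rightarrow> particle \<Rightarrow> bool" where
  "dynamics_regular S P \<longleftrightarrow> (\<forall>t>0. velc P 0 differentiable at t \<and> velc P 1 differentiable at t \<and>
     ang_mom S P differentiable at t \<and>
     (\<lambda>s. vector_derivative (rotc P 0) (at s)) differentiable at t)"

text \<open>A Stokes problem in the exterior domain with prescribed boundary velocity, force and moment.
  The solution is classical: velocity and stress have boundary values from outside. The decay at
  infinity is required in \<open>local_decay\<close>.\<close>

definition exterior_stokes ::
  "config \<Rightarrow> (vec3 \<Rightarrow> vec3) \<Rightarrow> vec3 \<Rightarrow> vec3 \<Rightarrow> (vec3 \<Rightarrow> vec3) \<Rightarrow> (vec3 \<Rightarrow> real) \<Rightarrow> bool" where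
  "exterior_stokes S h f g U Pr \<longleftrightarrow>
     Cdiff 2 U (- closure (shape S)) \<and> Cdiff 1 Pr (- closure (shape S)) \<and>
     continuous_on (- shape S) U \<and>
     (\<forall>y\<in>frontier (shape S).
        \<exists>l. (newton_stress U Pr \<longlongrightarrow> l) (at y within - closure (shape S))) \<and>
     (\<forall>y\<in>- closure (shape S). sgrad Pr y = lap U y \<and> vdiv U y = 0) \<and>
     (\<forall>y\<in>frontier (shape S). U y = h y) \<and>
     (LINT y|area S. outer_trace (shape S) (newton_stress U Pr) y *v nrm S y) = f \<and>
     (LINT y|area S. cross3 y (outer_trace (shape S) (newton_stress U Pr) y *v nrm S y)) = g"

definition local_flow :: "config \<Rightarrow> vfield \<Rightarrow> sfield \<Rightarrow> particle \<Rightarrow> bool" where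
  "local_flow S u p P \<longleftrightarrow> (\<forall>t>0.
     exterior_stokes S (h1 u P t) (f1 S P t) g1 (lvelc P 1 t) (lprsc P 1 t) \<and>
     exterior_stokes S (h2 u P t) (f2 S u p P t) (g2 S u p P t) (lvelc P 2 t) (lprsc P 2 t) \<and>
     (\<forall>y\<in>shape S. lvelc P 1 t y = h1 u P t y \<and> lvelc P 2 t y = h2 u P t y))"

text \<open>Model of the stresses in the particle domain.\<close>

definition fhat1 :: "config \<Rightarrow> particle \<Rightarrow> real \<Rightarrow> vec3" where
  "fhat1 S P t = (if kappa S = 2 then (1 / vol S) *\<^sub>R k0 S P t else 0)"

definition fhat2 :: "config \<Rightarrow> vfield \<Rightarrow> sfield \<Rightarrow> particle \<Rightarrow> real \<Rightarrow> vec3 \<Rightarrow> vec3" where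
  "fhat2 S u p P t y =
     - (transpose (rotc P 0 t) *v mdiv (stress_at u p t) (posc P 0 t))
     - transpose (rotc P 0 t) *v (rotc P 1 t *v fhat1 S P t)
     + (if kappa S = 2 then (mass S * Rey S / vol S) *\<^sub>R (transpose (rotc P 0 t) *v
           (vector_derivative (velc P 1) (at t)
            + vector_derivative (\<lambda>s. vector_derivative (rotc P 0) (at s)) (at t) *v y))
        else if kappa S = 3 then (1 / vol S) *\<^sub>R k0 S P t else 0)"

definition lstrc :: "particle \<Rightarrow> nat \<Rightarrow> real \<Rightarrow> vec3 \<Rightarrow> mat3" where
  "lstrc P i t = sym_grad (lamc P i t)"

definition particle_stress_problem ::
  "config \<Rightarrow> (vec3 \<Rightarrow> vec3) \<Rightarrow> (vec3 \<Rightarrow> mat3) \<Rightarrow> (vec3 \<Rightarrow> vec3) \<Rightarrow> bool" where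
  "particle_stress_problem S f A lam \<longleftrightarrow> Cdiff 2 lam (shape S) \<and>
     (\<forall>y\<in>frontier (shape S). \<exists>l. (sym_grad lam \<longlongrightarrow> l) (at y within shape S)) \<and>
     (\<forall>y\<in>shape S. mdiv (sym_grad lam) y = f y) \<and>
     (\<forall>y\<in>frontier (shape S). inner_trace (shape S) (sym_grad lam) y *v nrm S y =
        outer_trace (shape S) A y *v nrm S y)"

definition local_stress :: "config \<Rightarrow> vfield \<Rightarrow> sfield \<Rightarrow> particle \<Rightarrow> bool" where
  "local_stress S u p P \<longleftrightarrow> (\<forall>t>0.
     particle_stress_problem S (\<lambda>y. fhat1 S P t)
       (newton_stress (lvelc P 1 t) (lprsc P 1 t)) (lamc P 1 t) \<and>
     particle_stress_problem S (fhat2 S u p P t)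
       (newton_stress (lvelc P 2 t) (lprsc P 2 t)) (lamc P 2 t))"


section \<open>Expansions in the size parameter\<close>

text \<open>\<open>expands Y [a\<^sub>0, \<dots>, a\<^sub>n] f\<close>: up to an error of order \<open>n + 1\<close>, uniformly on \<open>Y\<close>, the
  function \<open>f\<close> is the sum of the \<open>\<epsilon> ^ k *\<^sub>R a\<^sub>k\<close>. In a suspension the global flow is the mean
  velocity, which itself depends on \<open>\<epsilon>\<close>; hence the coefficients may depend on \<open>\<epsilon>\<close> and are required
  to be of order one.\<close>

definition expands ::
  "'y set \<Rightarrow> (real \<Rightarrow> 'y \<Rightarrow> 'b::real_normed_vector) list \<Rightarrow> (real \<Rightarrow> 'y \<Rightarrow> 'b) \<Rightarrow> bool" where
  "expands Y as f \<longleftrightarrow> (\<exists>C. \<forall>\<^sub>F \<epsilon> in at_right 0. \<forall>y\<in>Y.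
     (\<forall>k<length as. norm ((as ! k) \<epsilon> y) \<le> C) \<and>
     norm (f \<epsilon> y - (\<Sum>k<length as. \<epsilon> ^ k *\<^sub>R (as ! k) \<epsilon> y)) \<le> C * \<epsilon> ^ length as)"

text \<open>Here \<open>Q\<close> is the family of states of one particle, indexed by \<open>\<epsilon>\<close>. The expansions of the local
  velocity and of the particle stress may be differentiated termwise inside the particle.\<close>

definition particle_expansions :: "config \<Rightarrow> (real \<Rightarrow> particle) \<Rightarrow> real \<Rightarrow> bool" where
  "particle_expansions S Q t \<longleftrightarrow>
     expands {t} [\<lambda>\<epsilon>. posc (Q \<epsilon>) 0, \<lambda>\<epsilon>. posc (Q \<epsilon>) 1, \<lambda>\<epsilon>. posc (Q \<epsilon>) 2] (\<lambda>\<epsilon>. pos (Q \<epsilon>)) \<and>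
     expands {t} [\<lambda>\<epsilon>. velc (Q \<epsilon>) 0, \<lambda>\<epsilon>. velc (Q \<epsilon>) 1, \<lambda>\<epsilon>. velc (Q \<epsilon>) 2] (\<lambda>\<epsilon>. vel (Q \<epsilon>)) \<and>
     expands {t} [\<lambda>\<epsilon>. angc (Q \<epsilon>) 0, \<lambda>\<epsilon>. angc (Q \<epsilon>) 1] (\<lambda>\<epsilon>. ang (Q \<epsilon>)) \<and>
     expands {t} [\<lambda>\<epsilon>. rotc (Q \<epsilon>) 0, \<lambda>\<epsilon>. rotc (Q \<epsilon>) 1] (\<lambda>\<epsilon>. rot (Q \<epsilon>)) \<and>
     expands UNIV [\<lambda>\<epsilon> y. 0, \<lambda>\<epsilon>. lvelc (Q \<epsilon>) 1 t, \<lambda>\<epsilon>. lvelc (Q \<epsilon>) 2 t] (\<lambda>\<epsilon>. lvel (Q \<epsilon>) t) \<and>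
     expands (- closure (shape S)) [\<lambda>\<epsilon>. lprsc (Q \<epsilon>) 1 t, \<lambda>\<epsilon>. lprsc (Q \<epsilon>) 2 t] (\<lambda>\<epsilon>. lprs (Q \<epsilon>) t) \<and>
     expands (shape S) [\<lambda>\<epsilon>. lstrc (Q \<epsilon>) 1 t, \<lambda>\<epsilon>. lstrc (Q \<epsilon>) 2 t] (\<lambda>\<epsilon>. lstr (Q \<epsilon>) t) \<and>
     expands (shape S) [\<lambda>\<epsilon> y. 0, \<lambda>\<epsilon>. grad (lvelc (Q \<epsilon>) 1 t), \<lambda>\<epsilon>. grad (lvelc (Q \<epsilon>) 2 t)]
       (\<lambda>\<epsilon>. grad (lvel (Q \<epsilon>) t)) \<and>
     expands (shape S) [\<lambda>\<epsilon>. mdiv (lstrc (Q \<epsilon>) 1 t), \<lambda>\<epsilon>. mdiv (lstrc (Q \<epsilon>) 2 t)]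
       (\<lambda>\<epsilon>. mdiv (lstr (Q \<epsilon>) t)) \<and>
     (\<forall>\<^sub>F \<epsilon> in at_right 0. Cdiff 1 (lvel (Q \<epsilon>) t) (shape S) \<and> Cdiff 1 (lstr (Q \<epsilon>) t) (shape S))"

definition local_decay :: "config \<Rightarrow> (real \<Rightarrow> particle) \<Rightarrow> real \<Rightarrow> bool" where
  "local_decay S Q t \<longleftrightarrow> (\<forall>i\<in>{1, 2}. \<exists>C C' C''. C'' > 0 \<and>
     (\<forall>\<^sub>F \<epsilon> in at_right 0. \<forall>y. norm y \<ge> C'' \<longrightarrow>
        norm (lvelc (Q \<epsilon>) i t y) \<le> C / norm y \<and>
        norm (grad (lvelc (Q \<epsilon>) i t) y) \<le> C' / (norm y)\<^sup>2 \<and>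
        \<bar>lprsc (Q \<epsilon>) i t y\<bar> \<le> C' / (norm y)\<^sup>2))"


section \<open>Suspensions\<close>

text \<open>All random fields depend on the size parameter and on the sample point. The particles are
  numbered from 1 to \<open>npart\<close>, and \<open>avgV x t\<close> is the averaging region.\<close>

record 'w suspension =
  dom :: "vec3 set"
  eps0 :: real
  npart :: nat
  avgV :: "vec3 \<Rightarrow> real \<Rightarrow> vec3 set"
  wvel :: "real \<Rightarrow> 'w \<Rightarrow> vfield"
  wprs :: "real \<Rightarrow> 'w \<Rightarrow> sfield"
  Sig :: "real \<Rightarrow> 'w \<Rightarrow> vec3 \<Rightarrow> real \<Rightarrow> mat3"
  Sigs :: "real \<Rightarrow> 'w \<Rightarrow> vec3 \<Rightarrow> real \<Rightarrow> mat3"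
  bforce :: "real \<Rightarrow> 'w \<Rightarrow> vfield"
  part :: "real \<Rightarrow> 'w \<Rightarrow> nat \<Rightarrow> particle"

definition mean :: "'w measure \<Rightarrow> ('w \<Rightarrow> vec3 \<Rightarrow> real \<Rightarrow> 'b::{banach,second_countable_topology}) \<Rightarrow>
    vec3 \<Rightarrow> real \<Rightarrow> 'b" where
  "mean M f x t = (LINT \<omega>|M. f \<omega> x t)"

abbreviation umean :: "'w measure \<Rightarrow> 'w suspension \<Rightarrow> real \<Rightarrow> vfield" where
  "umean M F \<epsilon> \<equiv> mean M (wvel F \<epsilon>)"

abbreviation pmean :: "'w measure \<Rightarrow> 'w suspension \<Rightarrow> real \<Rightarrow> sfield" where
  "pmean M F \<epsilon> \<equiv> mean M (wprs F \<epsilon>)"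

definition fluct_vel :: "'w measure \<Rightarrow> 'w suspension \<Rightarrow> real \<Rightarrow> 'w \<Rightarrow> vfield" where
  "fluct_vel M F \<epsilon> \<omega> x t = wvel F \<epsilon> \<omega> x t - umean M F \<epsilon> x t"

definition fluct_prs :: "'w measure \<Rightarrow> 'w suspension \<Rightarrow> real \<Rightarrow> 'w \<Rightarrow> sfield" where
  "fluct_prs M F \<epsilon> \<omega> x t = wprs F \<epsilon> \<omega> x t - pmean M F \<epsilon> x t"

definition reynolds :: "'w measure \<Rightarrow> 'w suspension \<Rightarrow> real \<Rightarrow> 'w \<Rightarrow> vec3 \<Rightarrow> real \<Rightarrow> mat3" where
  "reynolds M F \<epsilon> \<omega> x t = outer (fluct_vel M F \<epsilon> \<omega> x t) (fluct_vel M F \<epsilon> \<omega> x t)"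

abbreviation particles :: "'w suspension \<Rightarrow> nat set" where
  "particles F \<equiv> {1..npart F}"

definition occupied :: "config \<Rightarrow> 'w suspension \<Rightarrow> real \<Rightarrow> 'w \<Rightarrow> real \<Rightarrow> vec3 set" where
  "occupied S F \<epsilon> \<omega> t = (\<Union>j\<in>particles F. body S \<epsilon> (part F \<epsilon> \<omega> j) t)"

text \<open>The (numbers of the) particles in the averaging region.\<close>

definition inside :: "config \<Rightarrow> 'w suspension \<Rightarrow> real \<Rightarrow> 'w \<Rightarrow> vec3 \<Rightarrow> real \<Rightarrow> nat set" where
  "inside S F \<epsilon> \<omega> x t = {j \<in> particles F. body S \<epsilon> (part F \<epsilon> \<omega> j) t \<subseteq> avgV F x t}"

definition fluct_stress :: "'w measure \<Rightarrow> 'w suspension \<Rightarrow> real \<Rightarrow> 'w \<Rightarrow> vec3 \<Rightarrow> real \<Rightarrow> mat3" where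
  "fluct_stress M F \<epsilon> \<omega> x t =
     newton_stress (\<lambda>z. fluct_vel M F \<epsilon> \<omega> z t) (\<lambda>z. fluct_prs M F \<epsilon> \<omega> z t) x"

definition part_stress :: "config \<Rightarrow> 'w suspension \<Rightarrow> real \<Rightarrow> 'w \<Rightarrow> vec3 \<Rightarrow> real \<Rightarrow> mat3" where
  "part_stress S F \<epsilon> \<omega> x t = (\<Sum>j\<in>particles F.
     indicator (body S \<epsilon> (part F \<epsilon> \<omega> j) t) x *\<^sub>R local_str \<epsilon> (part F \<epsilon> \<omega> j) t x)"

definition part_force :: "config \<Rightarrow> 'w suspension \<Rightarrow> real \<Rightarrow> 'w \<Rightarrow> vfield" where
  "part_force S F \<epsilon> \<omega> x t = (\<Sum>j\<in>particles F.
     indicator (body S \<epsilon> (part F \<epsilon> \<omega> j) t) x *\<^sub>R mdiv (local_str \<epsilon> (part F \<epsilon> \<omega> j) t) x)"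

text \<open>Domains, averaging regions and smoothness of the mean fields.\<close>

definition suspension_frame :: "'w measure \<Rightarrow> 'w suspension \<Rightarrow> bool" where
  "suspension_frame M F \<longleftrightarrow> prob_space M \<and> eps0 F > 0 \<and> open (dom F) \<and>
     (\<forall>x\<in>dom F. \<forall>t>0. avgV F x t \<in> sets lborel \<and> bounded (avgV F x t) \<and>
        measure lborel (avgV F x t) > 0 \<and> avgV F x t \<subseteq> dom F) \<and>
     (\<forall>\<epsilon>\<in>{0<..<eps0 F}. \<forall>t>0. Cdiff 2 (\<lambda>x. umean M F \<epsilon> x t) (dom F) \<and>
        Cdiff 1 (\<lambda>x. pmean M F \<epsilon> x t) (dom F))"

text \<open>The random balance equations at one point; all derivatives occurring exist.\<close>

definition random_balance :: "config \<Rightarrow> 'w suspension \<Rightarrow> real \<Rightarrow> 'w \<Rightarrow> vec3 \<Rightarrow> real \<Rightarrow> bool" where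
  "random_balance S F \<epsilon> \<omega> x t \<longleftrightarrow>
     (\<lambda>s. wvel F \<epsilon> \<omega> x s) differentiable at t \<and>
     (\<lambda>z. wvel F \<epsilon> \<omega> z t) differentiable at x \<and>
     (\<lambda>z. Sig F \<epsilon> \<omega> z t) differentiable at x \<and>
     (\<lambda>z. Sigs F \<epsilon> \<omega> z t) differentiable at x \<and>
     Rey S *\<^sub>R (vector_derivative (\<lambda>s. wvel F \<epsilon> \<omega> x s) (at t) + conv (\<lambda>z. wvel F \<epsilon> \<omega> z t) x) =
       mdiv (\<lambda>z. Sig F \<epsilon> \<omega> z t) x + (Rey S / (Frn S)\<^sup>2) *\<^sub>R grav S \<and>
     vdiv (\<lambda>z. wvel F \<epsilon> \<omega> z t) x = 0 \<and>
     mdiv (\<lambda>z. Sig F \<epsilon> \<omega> z t) x = mdiv (\<lambda>z. Sigs F \<epsilon> \<omega> z t) x + bforce F \<epsilon> \<omega> x t"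

text \<open>The random fields and their derivatives have expectations, and taking expectations commutes
  with differentiation. For the surface stress and the momentum flux this is only needed for the
  divergence; single derivatives of the stress may jump at the particle surfaces.\<close>

definition averaging_rules :: "'w measure \<Rightarrow> 'w suspension \<Rightarrow> real \<Rightarrow> vec3 \<Rightarrow> real \<Rightarrow> bool" where
  "averaging_rules M F \<epsilon> x t \<longleftrightarrow>
     integrable M (\<lambda>\<omega>. wvel F \<epsilon> \<omega> x t) \<and>
     integrable M (\<lambda>\<omega>. outer (wvel F \<epsilon> \<omega> x t) (wvel F \<epsilon> \<omega> x t)) \<and>
     integrable M (\<lambda>\<omega>. wprs F \<epsilon> \<omega> x t) \<and>
     integrable M (\<lambda>\<omega>. Sigs F \<epsilon> \<omega> x t) \<and>
     integrable M (\<lambda>\<omega>. bforce F \<epsilon> \<omega> x t) \<and>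
     integrable M (\<lambda>\<omega>. vector_derivative (\<lambda>s. wvel F \<epsilon> \<omega> x s) (at t)) \<and>
     ((\<lambda>s. umean M F \<epsilon> x s) has_vector_derivative
        (LINT \<omega>|M. vector_derivative (\<lambda>s. wvel F \<epsilon> \<omega> x s) (at t))) (at t) \<and>
     integrable M (\<lambda>\<omega>. jacobian (\<lambda>z. wvel F \<epsilon> \<omega> z t) (at x)) \<and>
     jacobian (\<lambda>z. umean M F \<epsilon> z t) (at x) = (LINT \<omega>|M. jacobian (\<lambda>z. wvel F \<epsilon> \<omega> z t) (at x)) \<and>
     integrable M (\<lambda>\<omega>. mdiv (\<lambda>z. outer (wvel F \<epsilon> \<omega> z t) (wvel F \<epsilon> \<omega> z t)) x) \<and>
     (\<lambda>z. mean M (\<lambda>\<omega> z t. outer (wvel F \<epsilon> \<omega> z t) (wvel F \<epsilon> \<omega> z t)) z t) differentiable at x \<and>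
     mdiv (\<lambda>z. mean M (\<lambda>\<omega> z t. outer (wvel F \<epsilon> \<omega> z t) (wvel F \<epsilon> \<omega> z t)) z t) x =
       (LINT \<omega>|M. mdiv (\<lambda>z. outer (wvel F \<epsilon> \<omega> z t) (wvel F \<epsilon> \<omega> z t)) x) \<and>
     integrable M (\<lambda>\<omega>. mdiv (\<lambda>z. Sigs F \<epsilon> \<omega> z t) x) \<and>
     (\<lambda>z. mean M (Sigs F \<epsilon>) z t) differentiable at x \<and>
     mdiv (\<lambda>z. mean M (Sigs F \<epsilon>) z t) x = (LINT \<omega>|M. mdiv (\<lambda>z. Sigs F \<epsilon> \<omega> z t) x)"

definition averaged_balance :: "'w measure \<Rightarrow> config \<Rightarrow> 'w suspension \<Rightarrow> real \<Rightarrow> vec3 \<Rightarrow> real \<Rightarrow> bool" where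
  "averaged_balance M S F \<epsilon> x t \<longleftrightarrow>
     Rey S *\<^sub>R (vector_derivative (\<lambda>s. umean M F \<epsilon> x s) (at t) + conv (\<lambda>z. umean M F \<epsilon> z t) x) =
       mdiv (\<lambda>z. mean M (Sigs F \<epsilon>) z t) x + mean M (bforce F \<epsilon>) x t
       - Rey S *\<^sub>R mdiv (\<lambda>z. mean M (reynolds M F \<epsilon>) z t) x + (Rey S / (Frn S)\<^sup>2) *\<^sub>R grav S \<and>
     vdiv (\<lambda>z. umean M F \<epsilon> z t) x = 0"

text \<open>Part of the surface stress that is incorporated in the pressure, and the Newtonian stress with
  the modified pressure.\<close>

definition iso_prs :: "'w measure \<Rightarrow> config \<Rightarrow> 'w suspension \<Rightarrow> real \<Rightarrow> 'w \<Rightarrow> sfield" where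
  "iso_prs M S F \<epsilon> \<omega> x t = (1 / measure lborel (avgV F x t)) *
     (LINT \<xi>:avgV F x t - occupied S F \<epsilon> \<omega> t|lborel. fluct_prs M F \<epsilon> \<omega> \<xi> t)"

definition mean_newton_stress ::
  "'w measure \<Rightarrow> config \<Rightarrow> 'w suspension \<Rightarrow> real \<Rightarrow> 'w \<Rightarrow> vec3 \<Rightarrow> real \<Rightarrow> mat3" where
  "mean_newton_stress M S F \<epsilon> \<omega> x t =
     newton_stress (\<lambda>z. umean M F \<epsilon> z t) (\<lambda>z. pmean M F \<epsilon> z t + iso_prs M S F \<epsilon> \<omega> z t) x"

text \<open>Identically distributed, independent trajectories of the particle states.\<close>

definition trajectory :: "particle \<Rightarrow> real \<Rightarrow> vec3 \<times> mat3 \<times> vec3 \<times> vec3" where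
  "trajectory P = (\<lambda>t\<in>{0..}. (pos P t, rot P t, vel P t, ang P t))"

definition iid_particles :: "'w measure \<Rightarrow> 'w suspension \<Rightarrow> bool" where
  "iid_particles M F \<longleftrightarrow> (\<forall>\<epsilon>\<in>{0<..<eps0 F}.
     prob_space.indep_vars M (\<lambda>_. PiM {0..} (\<lambda>_. borel))
       (\<lambda>j \<omega>. trajectory (part F \<epsilon> \<omega> j)) (particles F) \<and>
     (\<forall>i\<in>particles F. \<forall>j\<in>particles F.
        distr M (PiM {0..} (\<lambda>_. borel)) (\<lambda>\<omega>. trajectory (part F \<epsilon> \<omega> i)) =
        distr M (PiM {0..} (\<lambda>_. borel)) (\<lambda>\<omega>. trajectory (part F \<epsilon> \<omega> j))))"

text \<open>Interactions of particles are neglected already in the model of the single particle; what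
  remains of diluteness is that particles do not touch each other. For independent identically
  distributed particles this can hold almost surely only in the limit of small \<open>\<epsilon>\<close>, hence the
  order of the quantifiers over \<open>\<omega>\<close> and \<open>\<epsilon>\<close>, here and below.\<close>

definition dilute :: "'w measure \<Rightarrow> config \<Rightarrow> 'w suspension \<Rightarrow> bool" where
  "dilute M S F \<longleftrightarrow> (\<forall>t>0. AE \<omega> in M. \<forall>\<^sub>F \<epsilon> in at_right 0.
     \<forall>i\<in>particles F. \<forall>j\<in>particles F. i \<noteq> j \<longrightarrow>
       closure (body S \<epsilon> (part F \<epsilon> \<omega> i) t) \<inter> closure (body S \<epsilon> (part F \<epsilon> \<omega> j) t) = {})"

text \<open>Rotations of order one and particles at a positive distance from the boundary of the domain.
  That the disturbance of the flow is of order \<open>\<epsilon>\<close> is part of \<open>particle_expansions\<close>.\<close>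

definition suspended :: "'w measure \<Rightarrow> 'w suspension \<Rightarrow> bool" where
  "suspended M F \<longleftrightarrow> (\<forall>t>0. AE \<omega> in M. \<forall>j\<in>particles F.
     (\<lambda>\<epsilon>. norm (ang (part F \<epsilon> \<omega> j) t)) \<in> O[at_right 0](\<lambda>_. 1) \<and>
     (\<exists>\<delta>>0. \<forall>\<^sub>F \<epsilon> in at_right 0. cball (pos (part F \<epsilon> \<omega> j) t) \<delta> \<subseteq> dom F))"

text \<open>Every particle follows the asymptotic one-particle model, with the mean flow as global flow.\<close>

definition particles_follow_model :: "'w measure \<Rightarrow> config \<Rightarrow> 'w suspension \<Rightarrow> bool" where
  "particles_follow_model M S F \<longleftrightarrow> (AE \<omega> in M. \<forall>j\<in>particles F.
     (\<forall>\<^sub>F \<epsilon> in at_right 0.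
        kinematics (umean M F \<epsilon>) (part F \<epsilon> \<omega> j) \<and>
        dynamics_regular S (part F \<epsilon> \<omega> j) \<and>
        local_flow S (umean M F \<epsilon>) (pmean M F \<epsilon>) (part F \<epsilon> \<omega> j) \<and>
        local_stress S (umean M F \<epsilon>) (pmean M F \<epsilon>) (part F \<epsilon> \<omega> j)) \<and>
     (\<forall>t>0. particle_expansions S (\<lambda>\<epsilon>. part F \<epsilon> \<omega> j) t \<and> local_decay S (\<lambda>\<epsilon>. part F \<epsilon> \<omega> j) t))"

text \<open>In a suspension, the Navier--Stokes equations that the one-particle model requires of its
  global flow can hold for the mean flow only up to the error with which the suspension is
  Newtonian.\<close>

definition newtonian_up_to_first_order :: "'w measure \<Rightarrow> config \<Rightarrow> 'w suspension \<Rightarrow> bool" where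
  "newtonian_up_to_first_order M S F \<longleftrightarrow> (\<forall>x\<in>dom F. \<forall>t>0.
     (AE \<omega> in M. (\<lambda>\<epsilon>. norm (mean M (Sigs F \<epsilon>) x t - mean_newton_stress M S F \<epsilon> \<omega> x t))
        \<in> O[at_right 0](\<lambda>\<epsilon>. \<epsilon>)) \<and>
     (\<lambda>\<epsilon>. norm (Rey S *\<^sub>R (vector_derivative (\<lambda>s. umean M F \<epsilon> x s) (at t)
             + conv (\<lambda>z. umean M F \<epsilon> z t) x)
          - mdiv (stress_at (umean M F \<epsilon>) (pmean M F \<epsilon>) t) x - (Rey S / (Frn S)\<^sup>2) *\<^sub>R grav S))
        \<in> O[at_right 0](\<lambda>\<epsilon>. \<epsilon>))"

text \<open>The fluctuations are superpositions of the local disturbance fields; in and on a particle only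
  its own field counts.\<close>

definition superposition :: "'w measure \<Rightarrow> config \<Rightarrow> 'w suspension \<Rightarrow> real \<Rightarrow> 'w \<Rightarrow> real \<Rightarrow> bool" where
  "superposition M S F \<epsilon> \<omega> t \<longleftrightarrow>
     (\<forall>\<xi>\<in>dom F. \<forall>j\<in>particles F. \<xi> \<in> closure (body S \<epsilon> (part F \<epsilon> \<omega> j) t) \<longrightarrow>
        fluct_vel M F \<epsilon> \<omega> \<xi> t = local_vel \<epsilon> (part F \<epsilon> \<omega> j) t \<xi>) \<and>
     (\<forall>\<xi>\<in>dom F. (\<forall>j\<in>particles F. \<xi> \<notin> closure (body S \<epsilon> (part F \<epsilon> \<omega> j) t)) \<longrightarrow>
        fluct_vel M F \<epsilon> \<omega> \<xi> t = (\<Sum>j\<in>particles F. local_vel \<epsilon> (part F \<epsilon> \<omega> j) t \<xi>) \<and>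
        fluct_prs M F \<epsilon> \<omega> \<xi> t = (\<Sum>j\<in>particles F. local_prs \<epsilon> (part F \<epsilon> \<omega> j) t \<xi>)) \<and>
     (\<forall>\<xi>\<in>dom F. bforce F \<epsilon> \<omega> \<xi> t = part_force S F \<epsilon> \<omega> \<xi> t)"

text \<open>By separation of scales the Newtonian stress of the mean flow is constant on the averaging
  region and enters with its value at \<open>x\<close>; no particle is cut by the boundary of the region.\<close>

definition averaged_stress_model ::
  "'w measure \<Rightarrow> config \<Rightarrow> 'w suspension \<Rightarrow> real \<Rightarrow> 'w \<Rightarrow> vec3 \<Rightarrow> real \<Rightarrow> bool" where
  "averaged_stress_model M S F \<epsilon> \<omega> x t \<longleftrightarrow>
     (\<forall>j\<in>particles F. body S \<epsilon> (part F \<epsilon> \<omega> j) t \<subseteq> avgV F x t \<or>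
        body S \<epsilon> (part F \<epsilon> \<omega> j) t \<inter> avgV F x t = {}) \<and>
     set_integrable lborel (avgV F x t) (grad (\<lambda>z. fluct_vel M F \<epsilon> \<omega> z t)) \<and>
     set_integrable lborel (avgV F x t - occupied S F \<epsilon> \<omega> t) (\<lambda>\<xi>. fluct_prs M F \<epsilon> \<omega> \<xi> t) \<and>
     vol_avg (avgV F x t) (grad (\<lambda>z. fluct_vel M F \<epsilon> \<omega> z t)) = 0 \<and>
     vol_avg (avgV F x t) (\<lambda>\<xi>. Sigs F \<epsilon> \<omega> \<xi> t) =
       stress_at (umean M F \<epsilon>) (pmean M F \<epsilon>) t x
       + (1 / measure lborel (avgV F x t)) *\<^sub>R
           (LINT \<xi>:avgV F x t - occupied S F \<epsilon> \<omega> t|lborel. fluct_stress M F \<epsilon> \<omega> \<xi> t)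
       + (1 / measure lborel (avgV F x t)) *\<^sub>R
           (LINT \<xi>:avgV F x t \<inter> occupied S F \<epsilon> \<omega> t|lborel. part_stress S F \<epsilon> \<omega> \<xi> t)"

definition fluctuation_model :: "'w measure \<Rightarrow> config \<Rightarrow> 'w suspension \<Rightarrow> bool" where
  "fluctuation_model M S F \<longleftrightarrow>
     (\<forall>t>0. AE \<omega> in M. \<forall>\<^sub>F \<epsilon> in at_right 0. superposition M S F \<epsilon> \<omega> t) \<and>
     (\<forall>x\<in>dom F. \<forall>t>0. AE \<omega> in M. \<forall>\<^sub>F \<epsilon> in at_right 0. averaged_stress_model M S F \<epsilon> \<omega> x t)"

text \<open>On the averaging region, ensemble means may be replaced by their spatial average.\<close>

definition locally_homogeneous :: "'w measure \<Rightarrow> 'w suspension \<Rightarrow>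
    (real \<Rightarrow> 'w \<Rightarrow> vec3 \<Rightarrow> real \<Rightarrow> 'b::{banach,second_countable_topology}) \<Rightarrow> bool" where
  "locally_homogeneous M F f \<longleftrightarrow> (\<forall>x\<in>dom F. \<forall>t>0. \<forall>\<^sub>F \<epsilon> in at_right 0.
     mean M (f \<epsilon>) x t = vol_avg (avgV F x t) (\<lambda>\<xi>. mean M (f \<epsilon>) \<xi> t))"

definition ergodic :: "'w measure \<Rightarrow> 'w suspension \<Rightarrow>
    (real \<Rightarrow> 'w \<Rightarrow> vec3 \<Rightarrow> real \<Rightarrow> 'b::{banach,second_countable_topology}) \<Rightarrow> bool" where
  "ergodic M F f \<longleftrightarrow> (\<forall>x\<in>dom F. \<forall>t>0. AE \<omega> in M. \<forall>\<^sub>F \<epsilon> in at_right 0.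
     mean M (f \<epsilon>) x t = vol_avg (avgV F x t) (\<lambda>\<xi>. f \<epsilon> \<omega> \<xi> t))"


section \<open>Particle-induced stress and force\<close>

definition particle_stress ::
  "'w measure \<Rightarrow> config \<Rightarrow> 'w suspension \<Rightarrow> real \<Rightarrow> 'w \<Rightarrow> vec3 \<Rightarrow> real \<Rightarrow> mat3" where
  "particle_stress M S F \<epsilon> \<omega> x t = (1 / measure lborel (avgV F x t)) *\<^sub>R
     (\<Sum>j\<in>inside S F \<epsilon> \<omega> x t. let P = part F \<epsilon> \<omega> j in
        \<epsilon> ^ 3 *\<^sub>R (rotc P 0 t **
          (LINT y|area S.
             outer (outer_trace (shape S) (newton_stress (lvelc P 1 t) (lprsc P 1 t)) y *v nrm S y) y
             - outer (h1 (umean M F \<epsilon>) P t y) (nrm S y)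
             - outer (nrm S y) (h1 (umean M F \<epsilon>) P t y))
          ** transpose (rotc P 0 t)))"

definition particle_force ::
  "'w measure \<Rightarrow> config \<Rightarrow> 'w suspension \<Rightarrow> real \<Rightarrow> 'w \<Rightarrow> vfield" where
  "particle_force M S F \<epsilon> \<omega> x t = (1 / measure lborel (avgV F x t)) *\<^sub>R
     (\<Sum>j\<in>inside S F \<epsilon> \<omega> x t. let P = part F \<epsilon> \<omega> j in
        \<epsilon>\<^sup>2 *\<^sub>R (rotc P 0 t *v f1 S P t)
        + \<epsilon> ^ 3 *\<^sub>R (rotc P 0 t *v f2 S (umean M F \<epsilon>) (pmean M F \<epsilon>) P t + rotc P 1 t *v f1 S P t))"

end

theory Submission
  imports Defs
begin

text \<open>Inside a particle the fluctuation is the local field of that particle, so all averages reduce to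
  integrals over the reference particle. Since the averaged gradient of the fluctuation vanishes, its
  integral over the fluid is minus its integral over the particles, where to leading order the local
  velocity is the affine field \<open>h\<^sub>1\<close>. The divergence theorem turns the volume integrals of the
  particle stress and of the gradient of \<open>h\<^sub>1\<close> into the surface integral in \<open>\<Sigma>\<^sup>p\<close>; the body force does not
  contribute to it because the centre of mass is 0. The velocity fluctuation of a particle with centre \<open>c\<close>
  is at most a constant times \<open>\<epsilon>\<^sup>2 (1 + 1 / |x - c|)\<close>, whose square is locally integrable; this makes the
  Reynolds stress of order 4.

  The divergence theorem itself is proved for fields that are continuously differentiable only in the
  interior: localised by a partition of unity and multiplied by a cutoff in the height over the
  boundary, the field has compact support, so the integral of its divergence vanishes by translation
  invariance; the derivative of the cutoff produces the flux in the limit.\<close>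

section \<open>Partial derivatives\<close>

text \<open>The obstacle is the regularity of the stress inside a particle. \<open>lamc\<close> is
  twice differentiable only in the open particle, and its symmetric gradient merely has limits at
  the boundary, so single derivatives of the stress may be unbounded there. Its divergence is the
  prescribed body force, which is bounded. This is why \<open>flux_field\<close> bounds the
  divergence and not the gradient.

  The powers of \<epsilon> come from scaling: a particle has volume of order \<epsilon>^3, and the
  inner derivative of the local coordinate gives 1 / \<epsilon>. The stress starts at order 0 and
  the local velocity at order 1, so stress and velocity gradient both enter with \<epsilon>^3 and
  one coefficient of each leaves an error of order 4. The divergence of the stress enters with
  \<epsilon>^2 and needs two coefficients, of the rotation as well.

  The mean flow depends on \<epsilon>, and with it every coefficient. No limits of coefficients are
  available, so all estimates are bounds with constants uniform for small \<epsilon>. Near a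
  particle the fluctuation is only of order \<epsilon>; the second power comes from the decay of the
  local field in (x - c) / \<epsilon>.\<close>

lemma pd_eqI:
  assumes "(f has_derivative D) (at x)"
  shows "pd j f x = D (axis j 1)"
  using frechet_derivative_at[OF assms] by (simp add: pd_def)

lemma has_derivative_pd:
  fixes f :: "vec3 \<Rightarrow> 'b::real_normed_vector"
  assumes "f differentiable at x"
  shows "(f has_derivative (\<lambda>v. \<Sum>j\<in>UNIV. v $ j *\<^sub>R pd j f x)) (at x)"
proof -
  have D: "(f has_derivative frechet_derivative f (at x)) (at x)"
    using assms frechet_derivative_works by blast
  then have lin: "linear (frechet_derivative f (at x))"
    by (rule has_derivative_linear)
  have "frechet_derivative f (at x) v = (\<Sum>j\<in>UNIV. v $ j *\<^sub>R pd j f x)" for v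
  proof -
    have "v = (\<Sum>j\<in>UNIV. v $ j *\<^sub>R axis j 1)"
      using basis_expansion[of v] by (simp add: scalar_mult_eq_scaleR)
    then have "frechet_derivative f (at x) v = frechet_derivative f (at x) (\<Sum>j\<in>UNIV. v $ j *\<^sub>R axis j 1)"
      by simp
    also have "\<dots> = (\<Sum>j\<in>UNIV. v $ j *\<^sub>R pd j f x)"
      by (simp add: linear_sum[OF lin] linear_scale[OF lin] pd_def)
    finally show ?thesis .
  qed
  with D show ?thesis by (metis (no_types, lifting) ext)
qed

text \<open>\<open>frechet_derivative\<close> is a choice operator, so both sides agree as soon as
  the predicates \<open>has_derivative\<close> agree for every candidate \<open>D\<close>. Points
  without a derivative are covered as well.\<close>

lemma pd_cong_open:
  assumes "open S" "x \<in> S" "\<And>y. y \<in> S \<Longrightarrow> f y = g y"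
  shows "pd j f x = pd j g x"
proof -
  have "(f has_derivative D) (at x) = (g has_derivative D) (at x)" for D
    using has_derivative_transform_within_open[of f D x UNIV S g]
      has_derivative_transform_within_open[of g D x UNIV S f] assms by metis
  then show ?thesis by (simp add: pd_def frechet_derivative_def)
qed

lemma pd_vec_nth:
  assumes "f differentiable at x"
  shows "pd j f x $ i = pd j (\<lambda>y. f y $ i) x"
proof -
  have "(f has_derivative (\<lambda>v. \<Sum>j\<in>UNIV. v $ j *\<^sub>R pd j f x)) (at x)"
    by (rule has_derivative_pd[OF assms])
  from pd_eqI[OF bounded_linear.has_derivative[OF bounded_linear_vec_nth this, of i], of j]
    pd_eqI[OF this, of j] show ?thesis by simp
qed

lemma jacobian_nth: "jacobian f (at x) $ i $ j = pd j f x $ i"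
  by (simp add: jacobian_def matrix_def pd_def)

lemma grad_nth: "grad f x $ i $ j = pd i f x $ j"
  by (simp add: grad_def transpose_def jacobian_nth)

lemma Cdiff_1_iff:
  "Cdiff 1 f S \<longleftrightarrow> f differentiable_on S \<and> (\<forall>v. continuous_on S (\<lambda>x. frechet_derivative f (at x) v))"
  by (simp add: One_nat_def del: One_nat_def[symmetric])

lemma Cdiff_1_D:
  assumes "Cdiff 1 f S" "open S"
  shows "\<And>x. x \<in> S \<Longrightarrow> f differentiable at x" "continuous_on S (pd j f)"
  using assms unfolding Cdiff_1_iff pd_def[abs_def]
  by (auto simp: differentiable_on_eq_differentiable_at)

lemma Cdiff_Suc_D: "Cdiff (Suc k) f S \<Longrightarrow> Cdiff k f S"
proof (induction k arbitrary: f)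
  case 0
  then show ?case by (auto intro: differentiable_imp_continuous_on)
next
  case (Suc k)
  then show ?case by auto
qed

text \<open>Mean value inequality along one coordinate line. It bounds the difference quotients
  uniformly, as dominated convergence requires when it passes from their integrals to the integral
  of the partial derivative.\<close>

lemma norm_pd_le_imp_dist_le:
  fixes f :: "vec3 \<Rightarrow> real"
  assumes "\<And>x. f differentiable at x" "\<And>x. \<bar>pd j f x\<bar> \<le> C"
  shows "\<bar>f (x + t *\<^sub>R axis j 1) - f x\<bar> \<le> C * \<bar>t\<bar>"
proof -
  have "((\<lambda>s. f (x + s *\<^sub>R axis j 1)) has_derivative (\<lambda>h. h *\<^sub>R pd j f (x + s *\<^sub>R axis j 1))) (at s)" for s
  proof -
    have d: "((\<lambda>s. x + s *\<^sub>R axis j 1) has_derivative (\<lambda>h. h *\<^sub>R axis j 1)) (at s)"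
      by (auto intro!: derivative_eq_intros)
    have "((\<lambda>s. f (x + s *\<^sub>R axis j 1)) has_derivative (\<lambda>h. \<Sum>i\<in>UNIV. (h *\<^sub>R axis j 1 :: vec3) $ i *\<^sub>R pd i f (x + s *\<^sub>R axis j 1))) (at s)"
      using has_derivative_compose[OF d has_derivative_pd[OF assms(1)]] by simp
    moreover have "(\<Sum>i\<in>UNIV. (h *\<^sub>R axis j 1 :: vec3) $ i *\<^sub>R pd i f z) = h *\<^sub>R pd j f z" for h z
    proof -
      have "(\<Sum>i\<in>UNIV. (h *\<^sub>R axis j 1 :: vec3) $ i *\<^sub>R pd i f z) = (\<Sum>i\<in>UNIV. if i = j then h *\<^sub>R pd i f z else 0)"
        by (intro sum.cong) (auto simp: axis_def)
      then show ?thesis by simp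
    qed
    ultimately show ?thesis by simp
  qed
  then have "norm (f (x + t *\<^sub>R axis j 1) - f (x + 0 *\<^sub>R axis j 1)) \<le> C * norm (t - 0)"
  proof (intro differentiable_bound[of UNIV])
    show "onorm (\<lambda>h. h *\<^sub>R pd j f (x + s *\<^sub>R axis j 1)) \<le> C" for s
    proof (rule onorm_bound)
      show "0 \<le> C" using order_trans[OF abs_ge_zero assms(2)] .
      show "norm (h *\<^sub>R pd j f (x + s *\<^sub>R axis j 1)) \<le> C * norm h" for h
        using mult_right_mono[OF assms(2)[of "x + s *\<^sub>R axis j 1"], of "\<bar>h\<bar>"]
        by (simp add: abs_mult mult.commute)
    qed
  qed auto
  then show ?thesis by simp
qed

text \<open>The difference quotients have integral zero by translation invariance.\<close>

lemma integral_pd_compact_support: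
  fixes f :: "vec3 \<Rightarrow> real"
  assumes diff: "\<And>x. f differentiable at x" and cont: "continuous_on UNIV (pd j f)"
    and supp: "\<And>x. x \<notin> cball z R \<Longrightarrow> f x = 0"
  shows "integrable lborel (pd j f)" "(LINT x|lborel. pd j f x) = 0"
proof -
  have contf: "continuous_on UNIV f"
    using diff differentiable_imp_continuous_on differentiable_on_eq_differentiable_at by blast
  have pd0: "pd j f x = 0" if "x \<notin> cball z R" for x
  proof -
    have "pd j f x = pd j (\<lambda>_. 0) x"
      by (rule pd_cong_open[of "- cball z R"]) (use that supp in auto)
    also have "\<dots> = 0" by (simp add: pd_eqI[OF has_derivative_const])
    finally show ?thesis .
  qed
  have "bounded (pd j f ` cball z R)"
    by (intro compact_imp_bounded compact_continuous_image continuous_on_subset[OF cont]) auto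
  then obtain C where C: "C > 0" "\<And>x. x \<in> cball z R \<Longrightarrow> \<bar>pd j f x\<bar> \<le> C"
    unfolding bounded_pos by auto
  have bnd: "\<bar>pd j f x\<bar> \<le> C" for x
    using C pd0[of x] by (cases "x \<in> cball z R") auto
  let ?e = "axis j 1 :: vec3"
  define q where "q n x = (f (x + (1 / Suc n) *\<^sub>R ?e) - f x) * Suc n" for n x
  have meas: "f \<in> borel_measurable lborel" "pd j f \<in> borel_measurable lborel"
    using contf cont by (auto intro: borel_measurable_continuous_onI)
  have qb: "\<bar>q n x\<bar> \<le> C" for n x
  proof -
    have "\<bar>q n x\<bar> = \<bar>f (x + (1 / Suc n) *\<^sub>R ?e) - f x\<bar> * Suc n"
      by (simp add: q_def abs_mult)
    also have "\<dots> \<le> (C * \<bar>1 / real (Suc n)\<bar>) * Suc n"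
      by (intro mult_right_mono norm_pd_le_imp_dist_le diff bnd) auto
    finally show ?thesis by simp
  qed
  have q0: "q n x = 0" if "x \<notin> cball z (R + 1)" for n x
  proof -
    have "norm ((1 / Suc n) *\<^sub>R ?e) \<le> 1" by (simp add: field_simps)
    then have "dist x z \<le> dist (x + (1 / Suc n) *\<^sub>R ?e) z + 1"
      by (smt (verit, ccfv_SIG) add_diff_cancel_left' dist_commute dist_norm dist_triangle)
    then have "x + (1 / Suc n) *\<^sub>R ?e \<notin> cball z R" "x \<notin> cball z R"
      using that by (auto simp: dist_commute)
    with supp show ?thesis by (simp add: q_def)
  qed
  have lim: "(\<lambda>n. q n x) \<longlonglongrightarrow> pd j f x" for x
  proof -
    have d: "((\<lambda>s. x + s *\<^sub>R ?e) has_derivative (\<lambda>h. h *\<^sub>R ?e)) (at 0)"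
      by (auto intro!: derivative_eq_intros)
    have D: "(f has_derivative frechet_derivative f (at x)) (at x)"
      using diff[of x] by (simp only: frechet_derivative_works)
    then have "(f has_derivative frechet_derivative f (at x)) (at (x + 0 *\<^sub>R ?e))"
      by simp
    from has_derivative_compose[OF d this]
    have "((\<lambda>s. f (x + s *\<^sub>R ?e)) has_derivative (\<lambda>h. h * pd j f x)) (at 0)"
      by (simp add: pd_def linear_scale[OF has_derivative_linear[OF D]])
    then have "((\<lambda>s. f (x + s *\<^sub>R ?e)) has_real_derivative pd j f x) (at 0)"
      by (simp add: has_field_derivative_def mult.commute[of _ "pd j f x"])
    then have "((\<lambda>h. (f (x + h *\<^sub>R ?e) - f x) / h) \<longlongrightarrow> pd j f x) (at 0)"
      by (simp add: DERIV_def)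
    moreover have "filterlim (\<lambda>n. 1 / real (Suc n)) (at 0) sequentially"
      by (intro filterlim_atI) (use LIMSEQ_inverse_real_of_nat in \<open>auto simp: inverse_eq_divide\<close>)
    ultimately have "(\<lambda>n. (f (x + (1 / real (Suc n)) *\<^sub>R ?e) - f x) / (1 / real (Suc n))) \<longlonglongrightarrow> pd j f x"
      by (rule filterlim_compose)
    then show ?thesis by (simp add: q_def)
  qed
  have intf: "integrable lborel f"
  proof -
    have "bounded (f ` cball z R)"
      by (intro compact_imp_bounded compact_continuous_image continuous_on_subset[OF contf]) auto
    then obtain B where "\<And>x. x \<in> cball z R \<Longrightarrow> \<bar>f x\<bar> \<le> B" unfolding bounded_iff by force
    then have "integrable lborel (\<lambda>x. indicator (cball z R) x *\<^sub>R f x)"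
      by (intro integrableI_bounded_set_indicator[where B=B] meas) (auto simp: emeasure_lborel_cball_finite[unfolded infinity_ennreal_def])
    moreover have "(\<lambda>x. indicator (cball z R) x *\<^sub>R f x) = f"
      using supp by (auto simp: indicator_def fun_eq_iff)
    ultimately show ?thesis by simp
  qed
  have q_int0: "(LINT x|lborel. q n x) = 0" for n
  proof -
    have "integrable (distr lborel borel ((+) ((1 / Suc n) *\<^sub>R ?e))) f"
      using intf by (simp add: lborel_distr_plus)
    then have i: "integrable lborel (\<lambda>x. f ((1 / Suc n) *\<^sub>R ?e + x))"
      by (subst (asm) integrable_distr_eq) (use contf in \<open>auto intro: borel_measurable_continuous_onI\<close>)
    have "(LINT x|lborel. f x) = (LINT x|distr lborel borel ((+) ((1 / Suc n) *\<^sub>R ?e)). f x)"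
      by (simp add: lborel_distr_plus)
    also have "\<dots> = (LINT x|lborel. f ((1 / Suc n) *\<^sub>R ?e + x))"
      by (subst integral_distr) (use contf in \<open>auto intro: borel_measurable_continuous_onI\<close>)
    finally have "(LINT x|lborel. f (x + (1 / Suc n) *\<^sub>R ?e)) = (LINT x|lborel. f x)"
      by (simp add: add.commute)
    then show ?thesis using i intf by (simp add: q_def add.commute)
  qed
  have w: "integrable lborel (\<lambda>x. C * indicator (cball z (R + 1)) x :: real)"
    by (auto simp: emeasure_lborel_cball_finite[unfolded infinity_ennreal_def])
  have ms: "q n \<in> borel_measurable lborel" for n
    unfolding q_def using contf by (auto intro!: borel_measurable_continuous_onI continuous_intros continuous_on_compose2[OF contf])
  have dom: "AE x in lborel. norm (q n x) \<le> C * indicator (cball z (R + 1)) x" for n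
    using qb q0[of _ n] by (auto simp: indicator_def)
  have lim': "AE x in lborel. (\<lambda>n. q n x) \<longlonglongrightarrow> pd j f x"
    using lim by simp
  show "integrable lborel (pd j f)"
    by (rule integrable_dominated_convergence[OF meas(2) ms w lim' dom])
  have "(\<lambda>n. LINT x|lborel. q n x) \<longlonglongrightarrow> (LINT x|lborel. pd j f x)"
    by (rule integral_dominated_convergence[OF meas(2) ms w lim' dom])
  then show "(LINT x|lborel. pd j f x) = 0"
    by (simp add: q_int0 LIMSEQ_const_iff)
qed

section \<open>Graph charts\<close>

text \<open>The squared positive part is a piecewise polynomial whose derivative is continuous
  across the node. Both cutoffs, \<open>step\<close> in the height and \<open>bump\<close> for the
  partition of unity, are assembled from it.\<close>

lemma has_real_derivative_pos_part_squared:
  "((\<lambda>x. (max 0 x)\<^sup>2) has_real_derivative 2 * max 0 x) (at x)"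
proof (cases "x = 0")
  case True
  have "((\<lambda>h::real. (max 0 h)\<^sup>2 / h) \<longlongrightarrow> 0) (at 0)"
  proof (rule tendsto_rabs_zero_cancel, rule tendsto_sandwich[of "\<lambda>_. 0" _ _ "\<lambda>h. \<bar>h\<bar>"])
    show "\<forall>\<^sub>F h::real in at 0. \<bar>(max 0 h)\<^sup>2 / h\<bar> \<le> \<bar>h\<bar>"
      by (rule always_eventually) (auto simp: max_def power2_eq_square)
    show "((\<lambda>h::real. \<bar>h\<bar>) \<longlongrightarrow> 0) (at 0)"
      by (intro tendsto_rabs_zero tendsto_ident_at)
  qed auto
  then show ?thesis using True by (simp add: DERIV_def)
next
  case False
  show ?thesis
  proof (cases "x > 0")
    case True
    have "((\<lambda>x. x\<^sup>2) has_real_derivative 2 * max 0 x) (at x)"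
      using True by (auto intro!: derivative_eq_intros)
    then show ?thesis
      by (rule has_field_derivative_transform_within_open[where S="{0<..}"]) (use True in auto)
  next
    case F: False
    have "((\<lambda>x. 0) has_real_derivative 2 * max 0 x) (at x)"
      using F False by (auto intro!: derivative_eq_intros)
    then show ?thesis
      by (rule has_field_derivative_transform_within_open[where S="{..<0}"]) (use F False in auto)
  qed
qed

text \<open>The cutoff is the integral of the tent function with nodes 1, 2, 3.\<close>

definition step :: "real \<Rightarrow> real" where
  "step \<theta> = ((max 0 (\<theta> - 1))\<^sup>2 - 2 * (max 0 (\<theta> - 2))\<^sup>2 + (max 0 (\<theta> - 3))\<^sup>2) / 2"

definition step' :: "real \<Rightarrow> real" where
  "step' \<theta> = max 0 (\<theta> - 1) - 2 * max 0 (\<theta> - 2) + max 0 (\<theta> - 3)"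

lemma step_eq_0: "\<theta> \<le> 1 \<Longrightarrow> step \<theta> = 0"
  by (simp add: step_def)

lemma step_eq_1: "3 \<le> \<theta> \<Longrightarrow> step \<theta> = 1"
  by (simp add: step_def max_def power2_eq_square field_simps)

lemma step'_eq_0: "\<theta> \<le> 1 \<or> 3 \<le> \<theta> \<Longrightarrow> step' \<theta> = 0"
  by (auto simp: step'_def max_def)

lemma step'_bounds: "0 \<le> step' \<theta>" "step' \<theta> \<le> 1"
  by (auto simp: step'_def max_def)

lemma has_real_derivative_step: "(step has_real_derivative step' \<theta>) (at \<theta>)"
proof -
  have *: "((\<lambda>x. (max 0 (x - c))\<^sup>2) has_real_derivative 2 * max 0 (\<theta> - c)) (at \<theta>)" for c :: real
  proof -
    have "((\<lambda>x. x - c) has_real_derivative 1) (at \<theta>)"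
      by (auto intro!: derivative_eq_intros)
    from DERIV_chain2[OF has_real_derivative_pos_part_squared this] show ?thesis by simp
  qed
  show ?thesis unfolding step_def[abs_def] step'_def
    by (rule derivative_eq_intros * refl | simp add: field_simps)+
qed

lemma continuous_on_step' [continuous_intros]:
  "continuous_on S f \<Longrightarrow> continuous_on S (\<lambda>x. step' (f x))"
  unfolding step'_def by (intro continuous_intros)

lemma continuous_on_step [continuous_intros]:
  "continuous_on S f \<Longrightarrow> continuous_on S (\<lambda>x. step (f x))"
  unfolding step_def by (intro continuous_intros) auto

lemma step_bounds: "0 \<le> step \<theta>" "step \<theta> \<le> 1"
proof -
  have mono: "step a \<le> step b" if "a \<le> b" for a b
    using that by (rule DERIV_nonneg_imp_nondecreasing) (use has_real_derivative_step step'_bounds in blast)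
  show "0 \<le> step \<theta>" using mono[of "min 0 \<theta>" \<theta>] step_eq_0[of "min 0 \<theta>"] by simp
  show "step \<theta> \<le> 1" using mono[of \<theta> "max 3 \<theta>"] step_eq_1[of "max 3 \<theta>"] by simp
qed

text \<open>The derivative of the cutoff is a probability density supported between 1 and 3. Its
  total mass is what gives the limiting flux the factor 1. The interval \<open>{0..4}\<close> just
  contains the support.\<close>

lemma step'_integral: "integrable lborel step'" "(LINT \<theta>|lborel. step' \<theta>) = 1"
proof -
  have "has_bochner_integral lborel (\<lambda>x. step' x * indicator {0..4} x) (step 4 - step 0)"
    by (rule has_bochner_integral_FTC_Icc_real)
      (use has_real_derivative_step in \<open>auto intro!: continuous_at_imp_continuous_on[OF ballI]
         continuous_on_interior[of UNIV] continuous_intros\<close>)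
  moreover have "(\<lambda>x. step' x * indicator {0..4} x) = step'"
  proof
    fix x show "step' x * indicator {0..4} x = step' x"
      using step'_eq_0[of x] by (cases "x \<in> {0..4}") auto
  qed
  ultimately have "has_bochner_integral lborel step' 1"
    by (simp add: step_eq_0 step_eq_1)
  then show "integrable lborel step'" "(LINT \<theta>|lborel. step' \<theta>) = 1"
    by (auto simp: has_bochner_integral_iff)
qed

lemma Basis_cart: "(Basis :: (real^'n) set) = range (\<lambda>k. axis k 1)"
  by (auto simp: Basis_vec_def)

lemma prod_Basis_cart: "(\<Prod>b\<in>(Basis :: (real^'n) set). f b) = (\<Prod>k\<in>UNIV. f (axis k 1))"
  unfolding Basis_cart by (subst prod.reindex) (auto simp: inj_on_def axis_eq_axis)

lemma prod_UNIV_2: "(\<Prod>k\<in>(UNIV::2 set). f k) = f 1 * f 2"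
  unfolding UNIV_2 by simp

lemma prod_UNIV_3: "(\<Prod>k\<in>(UNIV::3 set). f k) = f 1 * f 2 * f 3"
  unfolding UNIV_3 by (simp add: ac_simps)

section \<open>Coordinates adapted to a graph\<close>

locale graph_chart =
  fixes \<pi> :: "3 \<Rightarrow> 3" and s :: real and g :: "real^2 \<Rightarrow> real"
  assumes bij: "bij \<pi>" and s: "s \<in> {-1, 1}" and g: "Cdiff 1 g UNIV"
begin

definition proj :: "vec3 \<Rightarrow> real^2" where
  "proj x = vector [x $ \<pi> 1, x $ \<pi> 2]"

text \<open>Vertical, not Euclidean, distance from the graph, with the sign for which the particle
  lies at positive height. It is affine in the third coordinate, so that \<open>lift\<close> is an
  explicit inverse and no Jacobian factor arises.\<close>

definition height :: "vec3 \<Rightarrow> real" where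
  "height x = s * x $ \<pi> 3 - g (proj x)"

text \<open>Inverse of the map from x to (\<open>proj x\<close>, \<open>height x\<close>). Division
  by \<open>s\<close> is multiplication by \<open>s\<close>, since it is 1 or -1.\<close>

definition lift :: "real^2 \<Rightarrow> real \<Rightarrow> vec3" where
  "lift a \<tau> = a $ 1 *\<^sub>R axis (\<pi> 1) 1 + a $ 2 *\<^sub>R axis (\<pi> 2) 1 + (s * (g a + \<tau>)) *\<^sub>R axis (\<pi> 3) 1"

text \<open>Gradient of \<open>height\<close>: a normal of its level surfaces that points to larger
  heights and is not normalised. Its norm is the area element of the graph.\<close>

definition conormal :: "vec3 \<Rightarrow> vec3" where
  "conormal x = s *\<^sub>R axis (\<pi> 3) 1
     - frechet_derivative g (at (proj x)) (axis 1 1) *\<^sub>R axis (\<pi> 1) 1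
     - frechet_derivative g (at (proj x)) (axis 2 1) *\<^sub>R axis (\<pi> 2) 1"

lemma s_square: "s * s = 1" "s * (s * c) = c" "s \<noteq> 0"
  using s by auto

lemma pi_eq [simp]: "\<pi> i = \<pi> k \<longleftrightarrow> i = k"
  using bij by (auto simp: bij_def inj_def)

lemma all_pi: "(\<forall>k. P k) \<longleftrightarrow> P (\<pi> 1) \<and> P (\<pi> 2) \<and> P (\<pi> 3)"
proof -
  have "(\<forall>k. P k) \<longleftrightarrow> (\<forall>i. P (\<pi> i))"
    using bij by (metis bij_pointE)
  then show ?thesis by (simp add: forall_3)
qed

lemma sum_pi: "(\<Sum>k\<in>UNIV. f k) = f (\<pi> 1) + f (\<pi> 2) + f (\<pi> 3)"
  using sum.reindex_bij_betw[OF bij, of f] by (simp add: sum_3)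

lemma prod_pi: "(\<Prod>k\<in>UNIV. f k) = f (\<pi> 1) * f (\<pi> 2) * f (\<pi> 3)"
  using prod.reindex_bij_betw[OF bij, of f] by (simp add: prod_UNIV_3)

lemma axis_pi [simp]: "axis (\<pi> i) (c::real) $ \<pi> k = (if i = k then c else 0)"
  by (simp add: axis_def)

lemma lift_nth [simp]:
  "lift a \<tau> $ \<pi> 1 = a $ 1" "lift a \<tau> $ \<pi> 2 = a $ 2" "lift a \<tau> $ \<pi> 3 = s * (g a + \<tau>)"
  by (simp_all add: lift_def)

lemma proj_nth [simp]: "proj x $ 1 = x $ \<pi> 1" "proj x $ 2 = x $ \<pi> 2"
  by (simp_all add: proj_def vector_2)

lemma proj_lift [simp]: "proj (lift a \<tau>) = a"
  by (simp add: vec_eq_iff forall_2)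

lemma height_lift [simp]: "height (lift a \<tau>) = \<tau>"
  by (simp add: height_def s_square algebra_simps)

lemma lift_proj [simp]: "lift (proj x) (height x) = x"
  unfolding vec_eq_iff all_pi by (simp add: height_def s_square algebra_simps)

lemma bounded_linear_proj: "bounded_linear proj"
  unfolding linear_conv_bounded_linear[symmetric]
  by (rule linearI) (simp_all add: vec_eq_iff forall_2)

lemma continuous_on_proj [continuous_intros]:
  "continuous_on S f \<Longrightarrow> continuous_on S (\<lambda>x. proj (f x))"
  by (rule bounded_linear.continuous_on[OF bounded_linear_proj])

lemma g_has_derivative:
  "(g has_derivative (\<lambda>v. v $ 1 * frechet_derivative g (at a) (axis 1 1) +
     v $ 2 * frechet_derivative g (at a) (axis 2 1))) (at a)"
proof -
  have "g differentiable at a"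
    using g unfolding Cdiff_1_iff by (auto simp: differentiable_on_def)
  then have D: "(g has_derivative frechet_derivative g (at a)) (at a)"
    by (simp only: frechet_derivative_works)
  then interpret linear "frechet_derivative g (at a)"
    by (rule has_derivative_linear)
  have "frechet_derivative g (at a) v = v $ 1 * frechet_derivative g (at a) (axis 1 1) +
     v $ 2 * frechet_derivative g (at a) (axis 2 1)" for v
  proof -
    have "v = v $ 1 *\<^sub>R axis 1 1 + v $ 2 *\<^sub>R axis 2 1"
      by (simp add: vec_eq_iff forall_2 axis_def)
    then have "frechet_derivative g (at a) v =
        frechet_derivative g (at a) (v $ 1 *\<^sub>R axis 1 1 + v $ 2 *\<^sub>R axis 2 1)"
      by simp
    then show ?thesis by (simp only: add scale real_scaleR_def)
  qed
  with D show ?thesis by (metis (no_types, lifting) ext)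
qed

lemma continuous_on_g [continuous_intros]:
  assumes "continuous_on S f" shows "continuous_on S (\<lambda>x. g (f x))"
proof -
  have "continuous_on UNIV g"
    using g unfolding Cdiff_1_iff by (auto intro: differentiable_imp_continuous_on)
  from continuous_on_compose2[OF this assms] show ?thesis by simp
qed

lemma continuous_on_dg [continuous_intros]:
  assumes "continuous_on S f" shows "continuous_on S (\<lambda>x. frechet_derivative g (at (f x)) v)"
proof -
  have "continuous_on UNIV (\<lambda>a. frechet_derivative g (at a) v)"
    using g unfolding Cdiff_1_iff by blast
  from continuous_on_compose2[OF this assms] show ?thesis by simp
qed

lemma continuous_on_height [continuous_intros]:
  "continuous_on S f \<Longrightarrow> continuous_on S (\<lambda>x. height (f x))"
  unfolding height_def by (intro continuous_intros)

lemma continuous_on_conormal [continuous_intros]: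
  "continuous_on S f \<Longrightarrow> continuous_on S (\<lambda>x. conormal (f x))"
  unfolding conormal_def by (intro continuous_intros)

lemma continuous_on_lift [continuous_intros]:
  "continuous_on S f \<Longrightarrow> continuous_on S h \<Longrightarrow> continuous_on S (\<lambda>x. lift (f x) (h x))"
  unfolding lift_def by (intro continuous_intros)

lemma height_has_derivative: "(height has_derivative (\<lambda>v. conormal x \<bullet> v)) (at x)"
proof -
  have "((\<lambda>y. g (proj y)) has_derivative (\<lambda>v. proj v $ 1 * frechet_derivative g (at (proj x)) (axis 1 1) +
     proj v $ 2 * frechet_derivative g (at (proj x)) (axis 2 1))) (at x)"
    by (rule has_derivative_compose[OF bounded_linear.has_derivative[OF bounded_linear_proj has_derivative_ident] g_has_derivative])
  then have "(height has_derivative (\<lambda>v. s * v $ \<pi> 3 - (proj v $ 1 * frechet_derivative g (at (proj x)) (axis 1 1) +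
     proj v $ 2 * frechet_derivative g (at (proj x)) (axis 2 1)))) (at x)"
    unfolding height_def[abs_def]
    by (intro has_derivative_diff has_derivative_mult_right
        bounded_linear.has_derivative[OF bounded_linear_vec_nth has_derivative_ident])
  moreover have "s * v $ \<pi> 3 - (proj v $ 1 * frechet_derivative g (at (proj x)) (axis 1 1) +
     proj v $ 2 * frechet_derivative g (at (proj x)) (axis 2 1)) = conormal x \<bullet> v" for v
    by (simp add: conormal_def inner_diff_left inner_axis' algebra_simps)
  ultimately show ?thesis by simp
qed

lemma norm_conormal_sq:
  "(norm (conormal x))\<^sup>2 = 1 + (frechet_derivative g (at (proj x)) (axis 1 1))\<^sup>2
     + (frechet_derivative g (at (proj x)) (axis 2 1))\<^sup>2"
  unfolding power2_norm_eq_inner inner_vec_def sum_pi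
  by (simp add: conormal_def s_square power2_eq_square)

lemma conormal_nonzero: "conormal x \<noteq> 0"
proof
  assume "conormal x = 0"
  then have "(norm (conormal x))\<^sup>2 = 0" by simp
  with norm_conormal_sq[of x] show False
    by (smt (verit) zero_le_power2)
qed

lemma lift_has_derivative:
  "((\<lambda>a. lift a \<tau>) has_derivative (\<lambda>v. v $ 1 *\<^sub>R axis (\<pi> 1) 1 + v $ 2 *\<^sub>R axis (\<pi> 2) 1 +
     (s * (v $ 1 * frechet_derivative g (at a) (axis 1 1) +
     v $ 2 * frechet_derivative g (at a) (axis 2 1))) *\<^sub>R axis (\<pi> 3) 1)) (at a)"
proof -
  have "((\<lambda>a. s * (g a + \<tau>)) has_derivative (\<lambda>v. s * (v $ 1 * frechet_derivative g (at a) (axis 1 1) +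
     v $ 2 * frechet_derivative g (at a) (axis 2 1)))) (at a)"
    by (rule has_derivative_mult_right) (use has_derivative_add[OF g_has_derivative has_derivative_const] in simp)
  then show ?thesis unfolding lift_def
    by (intro has_derivative_add has_derivative_scaleR_left
        bounded_linear.has_derivative[OF bounded_linear_vec_nth has_derivative_ident])
qed

lemma frechet_derivative_lift:
  "frechet_derivative (\<lambda>a. lift a \<tau>) (at a) = (\<lambda>v. v $ 1 *\<^sub>R axis (\<pi> 1) 1 + v $ 2 *\<^sub>R axis (\<pi> 2) 1 +
     (s * (v $ 1 * frechet_derivative g (at a) (axis 1 1) +
     v $ 2 * frechet_derivative g (at a) (axis 2 1))) *\<^sub>R axis (\<pi> 3) 1)"
  using frechet_derivative_at[OF lift_has_derivative] by simp

text \<open>The area element is the same for all vertical translates of the graph, since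
  \<open>conormal\<close> depends on its argument only through \<open>proj\<close>; hence the
  independent \<tau> and \<sigma>. Comparing squares by the Lagrange identity
  \<open>dot_cross\<close> makes the signs and the orientation of the permutation
  irrelevant.\<close>

lemma norm_cross_lift:
  "norm (cross3 (frechet_derivative (\<lambda>a. lift a \<tau>) (at a) (axis 1 1))
     (frechet_derivative (\<lambda>a. lift a \<tau>) (at a) (axis 2 1))) = norm (conormal (lift a \<sigma>))"
proof -
  let ?p = "frechet_derivative g (at a) (axis 1 1)" and ?q = "frechet_derivative g (at a) (axis 2 1)"
  have d: "frechet_derivative (\<lambda>a. lift a \<tau>) (at a) (axis 1 1) = axis (\<pi> 1) 1 + (s * ?p) *\<^sub>R axis (\<pi> 3) 1"
    "frechet_derivative (\<lambda>a. lift a \<tau>) (at a) (axis 2 1) = axis (\<pi> 2) 1 + (s * ?q) *\<^sub>R axis (\<pi> 3) 1"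
    unfolding frechet_derivative_lift by (simp_all add: axis_def)
  have "(norm (cross3 (axis (\<pi> 1) 1 + (s * ?p) *\<^sub>R axis (\<pi> 3) 1) (axis (\<pi> 2) 1 + (s * ?q) *\<^sub>R axis (\<pi> 3) 1)))\<^sup>2
      = 1 + ?p\<^sup>2 + ?q\<^sup>2"
    unfolding power2_norm_eq_inner dot_cross unfolding inner_vec_def sum_pi
    using s by (auto simp: power2_eq_square algebra_simps)
  then have "(norm (cross3 (frechet_derivative (\<lambda>a. lift a \<tau>) (at a) (axis 1 1))
     (frechet_derivative (\<lambda>a. lift a \<tau>) (at a) (axis 2 1))))\<^sup>2 = (norm (conormal (lift a \<sigma>)))\<^sup>2"
    unfolding d norm_conormal_sq proj_lift .
  then show ?thesis by (simp add: power2_eq_iff_nonneg)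
qed

text \<open>In the coordinates \<open>(a, \<tau>)\<close> the chart is a shear, up to a permutation and a reflection of the
  coordinate axes.\<close>

lemma measure_preserving_lift:
  "distr (lborel \<Otimes>\<^sub>M lborel) borel (\<lambda>(a, \<tau>). lift a \<tau>) = lborel"
proof (rule lborel_eqI[symmetric])
  have meas: "(\<lambda>(a, \<tau>). lift a \<tau>) \<in> borel_measurable (lborel \<Otimes>\<^sub>M lborel)"
    unfolding lborel_prod
    by (auto intro!: borel_measurable_continuous_onI continuous_intros simp: split_beta)
  fix l u :: vec3 assume le: "\<And>b. b \<in> Basis \<Longrightarrow> l \<bullet> b \<le> u \<bullet> b"
  then have lek: "l $ k \<le> u $ k" for k
    using le[of "axis k 1"] by (simp add: Basis_cart inner_axis)
  have lep: "proj l $ k \<le> proj u $ k" for k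
    using exhaust_2[of k] lek by auto
  let ?A = "(\<lambda>(a, \<tau>). lift a \<tau>) -` box l u \<inter> space (lborel \<Otimes>\<^sub>M lborel)"
  \<comment> \<open>Above a point of the projected box the preimage is an interval with the length
    of the third side of the box. For \<open>s\<close> equal to -1 its endpoints change
    places.\<close>
  have slice: "emeasure lborel (Pair a -` ?A) =
      ennreal (u $ \<pi> 3 - l $ \<pi> 3) * indicator (box (proj l) (proj u)) a" for a
  proof -
    have "Pair a -` ?A = (if a \<in> box (proj l) (proj u) then {\<tau>. l $ \<pi> 3 < s * (g a + \<tau>) \<and> s * (g a + \<tau>) < u $ \<pi> 3} else {})"
      by (auto simp: mem_box_cart all_pi forall_2 space_pair_measure)
    also have "{\<tau>. l $ \<pi> 3 < s * (g a + \<tau>) \<and> s * (g a + \<tau>) < u $ \<pi> 3} =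
        (if s = 1 then {l $ \<pi> 3 - g a <..< u $ \<pi> 3 - g a} else {- u $ \<pi> 3 - g a <..< - l $ \<pi> 3 - g a})"
      using s by auto
    finally show ?thesis using lek[of "\<pi> 3"] by (auto simp: indicator_def)
  qed
  have "emeasure (distr (lborel \<Otimes>\<^sub>M lborel) borel (\<lambda>(a, \<tau>). lift a \<tau>)) (box l u) =
      emeasure (lborel \<Otimes>\<^sub>M lborel) ?A"
    using meas by (intro emeasure_distr) auto
  also have "\<dots> = (\<integral>\<^sup>+ a. emeasure lborel (Pair a -` ?A) \<partial>lborel)"
    by (intro lborel.emeasure_pair_measure_alt measurable_sets[OF meas]) simp
  also have "\<dots> = ennreal (u $ \<pi> 3 - l $ \<pi> 3) * emeasure lborel (box (proj l) (proj u))"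
    unfolding slice by (subst nn_integral_cmult_indicator) auto
  also have "emeasure lborel (box (proj l) (proj u)) = ennreal (\<Prod>b\<in>Basis. (proj u - proj l) \<bullet> b)"
    by (rule emeasure_lborel_box) (auto simp: Basis_cart inner_axis lep)
  also have "ennreal (u $ \<pi> 3 - l $ \<pi> 3) * \<dots> = ennreal ((u $ \<pi> 3 - l $ \<pi> 3) * (\<Prod>b\<in>Basis. (proj u - proj l) \<bullet> b))"
    using lek by (simp add: ennreal_mult prod_Basis_cart prod_UNIV_2 inner_axis)
  also have "(u $ \<pi> 3 - l $ \<pi> 3) * (\<Prod>b\<in>Basis. (proj u - proj l) \<bullet> b) = (\<Prod>b\<in>Basis. (u - l) \<bullet> b)"
    unfolding prod_Basis_cart prod_pi prod_UNIV_2 by (simp add: inner_axis)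
  finally show "emeasure (distr (lborel \<Otimes>\<^sub>M lborel) borel (\<lambda>(a, \<tau>). lift a \<tau>)) (box l u) =
      ennreal (\<Prod>b\<in>Basis. (u - l) \<bullet> b)" .
qed simp

end

section \<open>Flux through a graph\<close>

context graph_chart
begin

lemma measurable_lift [measurable]: "(\<lambda>(a, \<tau>). lift a \<tau>) \<in> borel_measurable (lborel \<Otimes>\<^sub>M lborel)"
  unfolding lborel_prod
  by (auto intro!: borel_measurable_continuous_onI continuous_intros simp: split_beta)

text \<open>Slicing by the level surfaces of \<open>height\<close>. The height is the outer variable
  because the cutoff depends on it alone.\<close>

lemma integral_lift:
  fixes f :: "vec3 \<Rightarrow> real"
  assumes "integrable lborel f"
  shows "(LINT x|lborel. f x) = (LINT \<tau>|lborel. LINT a|lborel. f (lift a \<tau>))"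
proof -
  have [measurable]: "f \<in> borel_measurable borel"
    using assms by auto
  have "integrable (distr (lborel \<Otimes>\<^sub>M lborel) borel (\<lambda>(a, \<tau>). lift a \<tau>)) f"
    using assms by (simp add: measure_preserving_lift)
  then have i: "integrable (lborel \<Otimes>\<^sub>M lborel) (\<lambda>(a, \<tau>). f (lift a \<tau>))"
    using measurable_lift unfolding case_prod_beta' by (subst (asm) integrable_distr_eq) auto
  have "(LINT x|lborel. f x) = (LINT x|distr (lborel \<Otimes>\<^sub>M lborel) borel (\<lambda>(a, \<tau>). lift a \<tau>). f x)"
    by (simp add: measure_preserving_lift)
  also have "\<dots> = integral\<^sup>L (lborel \<Otimes>\<^sub>M lborel) (\<lambda>(a, \<tau>). f (lift a \<tau>))"
    using measurable_lift unfolding case_prod_beta' by (subst integral_distr) auto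
  also have "\<dots> = (LINT \<tau>|lborel. LINT a|lborel. f (lift a \<tau>))"
    using lborel_pair.integral_snd[OF i] by simp
  finally show ?thesis .
qed

text \<open>The weights are an approximate identity in the height. After slicing and rescaling, the
  integral is that of \<open>step' \<theta>\<close> times K (\<theta> / Suc n), where K is the
  integral of \<open>k\<close> over a level surface. Since \<open>step'\<close> lives on positive
  arguments, the surfaces approach the boundary from inside, and continuity of \<open>k\<close> on
  nonnegative heights is the right condition.\<close>

lemma flux_lift:
  fixes k :: "vec3 \<Rightarrow> real"
  assumes cont: "continuous_on {x. 0 \<le> height x} k"
    and supp: "\<And>x. x \<notin> cball z R \<Longrightarrow> k x = 0"
    and neg: "\<And>x. height x < 0 \<Longrightarrow> k x = 0"
  shows "(\<lambda>n. LINT x|lborel. Suc n * step' (Suc n * height x) * k x)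
           \<longlonglongrightarrow> (LINT a|lborel. k (lift a 0))"
proof -
  have closed: "closed {x. 0 \<le> height x}"
    by (intro closed_Collect_le continuous_intros)
  have [measurable]: "k \<in> borel_measurable borel"
  proof -
    have "(\<lambda>x. indicator {x. 0 \<le> height x} x *\<^sub>R k x) \<in> borel_measurable borel"
      using closed by (intro borel_measurable_continuous_on_indicator cont) auto
    also have "(\<lambda>x. indicator {x. 0 \<le> height x} x *\<^sub>R k x) = k"
      using neg by (auto simp: indicator_def fun_eq_iff not_le)
    finally show ?thesis .
  qed
  have hmeas [measurable]: "height \<in> borel_measurable borel"
    by (intro borel_measurable_continuous_onI continuous_intros)
  have smeas [measurable]: "step' \<in> borel_measurable borel"
    by (intro borel_measurable_continuous_onI continuous_intros)
  obtain B where B: "B > 0" "\<And>x. \<bar>k x\<bar> \<le> B"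
  proof -
    have "compact ({x. 0 \<le> height x} \<inter> cball z R)"
      using closed by (simp add: closed_Int_compact)
    then have "bounded (k ` ({x. 0 \<le> height x} \<inter> cball z R))"
      by (intro compact_imp_bounded compact_continuous_image continuous_on_subset[OF cont]) auto
    then obtain B where "B > 0" "\<forall>y\<in>k ` ({x. 0 \<le> height x} \<inter> cball z R). norm y \<le> B"
      unfolding bounded_pos by blast
    then have "\<bar>k x\<bar> \<le> B" for x
      using supp[of x] neg[of x] by (cases "x \<in> cball z R \<and> 0 \<le> height x") (auto simp: not_le)
    with \<open>B > 0\<close> that show ?thesis by blast
  qed
  \<comment> \<open>The shadow of the support ball in the parameter plane. Being compact, it has
    finite area and yields a dominating function that serves all heights simultaneously.\<close>
  define A where "A = proj ` cball z R"
  have "compact A"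
    unfolding A_def by (intro compact_continuous_image continuous_intros) auto
  then have A: "A \<in> sets lborel" "emeasure lborel A < \<infinity>"
    by (auto simp: emeasure_compact_finite[unfolded infinity_ennreal_def] compact_imp_closed)
  have kA: "\<bar>k (lift a \<tau>)\<bar> \<le> B * indicator A a" for a \<tau>
  proof (cases "lift a \<tau> \<in> cball z R")
    case True
    then have "a \<in> A" unfolding A_def by (metis image_eqI proj_lift)
    then show ?thesis using B by simp
  qed (use supp B in simp)
  define w where "w a = B * indicator A a" for a :: "real^2"
  have w: "integrable lborel w"
    unfolding w_def using A by (intro integrable_mult_right integrable_real_indicator) auto
  define K where "K \<tau> = (LINT a|lborel. k (lift a \<tau>))" for \<tau>
  have kmeas: "(\<lambda>a. k (lift a \<tau>)) \<in> borel_measurable lborel" for \<tau>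
  proof -
    have "(\<lambda>a. lift a \<tau>) \<in> borel_measurable borel"
      by (intro borel_measurable_continuous_onI continuous_intros)
    then show ?thesis by simp
  qed
  have Kmeas: "K \<in> borel_measurable borel"
  proof -
    have "(\<lambda>(\<tau>, a). k (lift a \<tau>)) \<in> borel_measurable (lborel \<Otimes>\<^sub>M lborel)"
    proof -
      have "(\<lambda>(\<tau>, a). lift a \<tau>) \<in> borel_measurable (lborel \<Otimes>\<^sub>M lborel)"
        unfolding lborel_prod
        by (auto intro!: borel_measurable_continuous_onI continuous_intros simp: split_beta)
      from measurable_compose[OF this, of k borel] show ?thesis by (simp add: split_beta)
    qed
    from lborel.borel_measurable_lebesgue_integral[OF this] show ?thesis
      unfolding K_def by simp
  qed
  have Kb: "\<bar>K \<tau>\<bar> \<le> integral\<^sup>L lborel w" for \<tau>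
  proof -
    have "\<bar>K \<tau>\<bar> \<le> (LINT a|lborel. \<bar>k (lift a \<tau>)\<bar>)"
      unfolding K_def by (rule integral_abs_bound)
    also have "\<dots> \<le> integral\<^sup>L lborel w"
    proof (rule integral_mono'[OF w])
      show "\<bar>k (lift a \<tau>)\<bar> \<le> w a" for a using kA by (simp add: w_def)
      show "0 \<le> w a" for a using B by (simp add: w_def)
    qed
    finally show ?thesis .
  qed
  have K0: "(\<lambda>n. K (\<theta> / Suc n)) \<longlonglongrightarrow> K 0" if "\<theta> \<ge> 0" for \<theta>
    unfolding K_def
  proof (rule integral_dominated_convergence[where w=w])
    show "AE a in lborel. (\<lambda>n. k (lift a (\<theta> / real (Suc n)))) \<longlonglongrightarrow> k (lift a 0)"
    proof (rule AE_I2)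
      fix a
      have "(\<lambda>n. lift a (\<theta> / real (Suc n))) \<longlonglongrightarrow> lift a 0"
        unfolding lift_def
        by (intro tendsto_intros) (use LIMSEQ_Suc[OF lim_const_over_n[of \<theta>]] in simp)
      then show "(\<lambda>n. k (lift a (\<theta> / real (Suc n)))) \<longlonglongrightarrow> k (lift a 0)"
        using cont that by (intro continuous_on_tendsto_compose[of _ k]) auto
    qed
  qed (use kmeas kA w in \<open>auto simp: w_def\<close>)
  have eq: "(LINT x|lborel. Suc n * step' (Suc n * height x) * k x) = (LINT \<theta>|lborel. step' \<theta> * K (\<theta> / Suc n))" for n
  proof -
    let ?N = "real (Suc n)"
    have "integrable lborel (\<lambda>x. indicator (cball z R) x *\<^sub>R (?N * step' (?N * height x) * k x))"
    proof (rule integrableI_bounded_set_indicator[where B="?N * B"])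
      show "AE x in lborel. x \<in> cball z R \<longrightarrow> norm (?N * step' (?N * height x) * k x) \<le> ?N * B"
      proof (intro AE_I2 impI)
        fix x
        have "norm (?N * step' (?N * height x) * k x) = ?N * (step' (?N * height x) * \<bar>k x\<bar>)"
          using step'_bounds by (simp add: abs_mult)
        also have "\<dots> \<le> ?N * (1 * B)"
          using step'_bounds B by (intro mult_left_mono mult_mono) auto
        finally show "norm (?N * step' (?N * height x) * k x) \<le> ?N * B" by simp
      qed
    qed (auto simp: emeasure_lborel_cball_finite[unfolded infinity_ennreal_def])
    also have "(\<lambda>x. indicator (cball z R) x *\<^sub>R (?N * step' (?N * height x) * k x)) =
        (\<lambda>x. ?N * step' (?N * height x) * k x)"
      using supp by (auto simp: indicator_def fun_eq_iff)
    finally have i: "integrable lborel (\<lambda>x. ?N * step' (?N * height x) * k x)" .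
    have "(LINT x|lborel. ?N * step' (?N * height x) * k x) =
        (LINT \<tau>|lborel. ?N * step' (?N * \<tau>) * K \<tau>)"
      unfolding integral_lift[OF i] K_def by simp
    \<comment> \<open>Substitution of \<theta> = N \<tau>; the Jacobian 1 / N cancels the weight
      N.\<close>
    also have "\<dots> = \<bar>1 / ?N\<bar> *\<^sub>R (LINT \<theta>|lborel. ?N * step' (?N * (0 + (1 / ?N) * \<theta>)) * K (0 + (1 / ?N) * \<theta>))"
      by (rule lborel_integral_real_affine) simp
    also have "\<dots> = (LINT \<theta>|lborel. step' \<theta> * K (\<theta> / ?N))"
      by (simp flip: integral_mult_right_zero)
    finally show ?thesis .
  qed
  have "(\<lambda>n. LINT \<theta>|lborel. step' \<theta> * K (\<theta> / Suc n)) \<longlonglongrightarrow> (LINT \<theta>|lborel. step' \<theta> * K 0)"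
  proof (rule integral_dominated_convergence[where w="\<lambda>\<theta>. step' \<theta> * integral\<^sup>L lborel w"])
    show "integrable lborel (\<lambda>\<theta>. step' \<theta> * integral\<^sup>L lborel w)"
      using step'_integral(1) by simp
    show "AE \<theta> in lborel. (\<lambda>n. step' \<theta> * K (\<theta> / real (Suc n))) \<longlonglongrightarrow> step' \<theta> * K 0"
    proof (rule AE_I2)
      fix \<theta> show "(\<lambda>n. step' \<theta> * K (\<theta> / real (Suc n))) \<longlonglongrightarrow> step' \<theta> * K 0"
      proof (cases "\<theta> \<ge> 0")
        case True
        from tendsto_mult_left[OF K0[OF this]] show ?thesis .
      qed (simp add: step'_eq_0)
    qed
    show "AE \<theta> in lborel. norm (step' \<theta> * K (\<theta> / real (Suc n))) \<le> step' \<theta> * integral\<^sup>L lborel w" for n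
      using Kb step'_bounds by (auto simp: abs_mult intro!: mult_left_mono)
  qed (use Kmeas in measurable)
  also have "(LINT \<theta>|lborel. step' \<theta> * K 0) = K 0"
    using step'_integral(2) by simp
  finally show ?thesis unfolding eq K_def .
qed

text \<open>Only the full divergence has to be bounded: the gradient enters the limit solely through
  \<open>vdiv G\<close>, which dominates the volume term, while the term with the derivative of the
  cutoff contains the values of \<open>G\<close> and not its derivatives. The minus sign appears
  because \<open>conormal\<close> points into the particle.\<close>

lemma divergence_chart:
  fixes G :: "vec3 \<Rightarrow> vec3" and z :: vec3 and r :: real
  defines "U \<equiv> {x \<in> ball z r. 0 < height x}"
  assumes r': "r' < r"
    and diff: "\<And>x. x \<in> U \<Longrightarrow> G differentiable at x"
    and cpd: "\<And>j. continuous_on U (pd j G)"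
    and cont: "continuous_on {x \<in> ball z r. 0 \<le> height x} G"
    and supp: "\<And>x. x \<notin> cball z r' \<Longrightarrow> G x = 0"
    and bnd: "\<And>x. x \<in> U \<Longrightarrow> \<bar>vdiv G x\<bar> \<le> D"
  shows "(LINT x:U|lborel. vdiv G x) =
     - (LINT a|lborel. indicator (ball z r) (lift a 0) * (conormal (lift a 0) \<bullet> G (lift a 0)))"
proof -
  \<comment> \<open>Below the graph \<open>G\<close> is arbitrary, so it is replaced by 0 there and
    outside the ball. The result is continuous on all nonnegative heights because r' < r makes
    \<open>G\<close> vanish near the sphere.\<close>
  define Q where "Q x = (if x \<in> ball z r \<and> 0 \<le> height x then G x else 0)" for x
  define V where "V x = indicator U x * vdiv G x" for x
  define k where "k x = conormal x \<bullet> Q x" for x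
  have openU: "open U"
  proof -
    have "open (ball z r \<inter> {x. 0 < height x})"
      by (intro open_Int open_ball open_Collect_less continuous_intros)
    also have "ball z r \<inter> {x. 0 < height x} = U" by (auto simp: U_def)
    finally show ?thesis .
  qed
  have closedH: "closed {x. 0 \<le> height x}"
    by (intro closed_Collect_le continuous_intros)
  have contQ: "continuous_on {x. 0 \<le> height x} Q"
  proof -
    have "continuous_on ({x. 0 \<le> height x} \<inter> ball z r \<union> {x. 0 \<le> height x} \<inter> - cball z r') Q"
    proof (rule continuous_on_Un_local_open)
      show "continuous_on ({x. 0 \<le> height x} \<inter> ball z r) Q"
        by (rule continuous_on_eq[OF continuous_on_subset[OF cont]]) (auto simp: Q_def)
      show "continuous_on ({x. 0 \<le> height x} \<inter> - cball z r') Q"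
        by (rule continuous_on_eq[OF continuous_on_const[of _ 0]]) (use supp in \<open>auto simp: Q_def\<close>)
    qed (auto simp: openin_open intro: exI[of _ "ball z r"] exI[of _ "- cball z r'"])
    moreover have "{x. 0 \<le> height x} \<inter> ball z r \<union> {x. 0 \<le> height x} \<inter> - cball z r' = {x. 0 \<le> height x}"
      using r' by auto
    ultimately show ?thesis by simp
  qed
  have QU: "Q x = G x" if "x \<in> U" for x using that by (auto simp: Q_def U_def)
  have contV: "continuous_on U (vdiv G)"
    unfolding vdiv_def by (intro continuous_intros cpd)
  have [measurable]: "V \<in> borel_measurable borel"
    unfolding V_def using openU contV borel_measurable_continuous_on_indicator[of U "vdiv G"] by simp
  have V0: "V x = 0" if "x \<notin> cball z r'" for x
  proof (cases "x \<in> U")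
    case True
    have "pd j G x = pd j (\<lambda>_. 0) x" for j
      by (rule pd_cong_open[of "- cball z r'"]) (use that supp in auto)
    then show ?thesis by (simp add: V_def vdiv_def pd_eqI[OF has_derivative_const])
  qed (simp add: V_def)
  have hmeas [measurable]: "height \<in> borel_measurable borel"
    by (intro borel_measurable_continuous_onI continuous_intros)
  have smeas [measurable]: "step \<in> borel_measurable borel"
    by (intro borel_measurable_continuous_onI continuous_intros)
  define w where "w x = \<bar>D\<bar> * indicator (cball z r') x" for x :: vec3
  have w: "integrable lborel w"
    unfolding w_def by (intro integrable_mult_right integrable_real_indicator)
      (auto simp: emeasure_lborel_cball_finite[unfolded infinity_ennreal_def])
  have Vw: "\<bar>V x\<bar> \<le> w x" for x
  proof (cases "x \<in> cball z r' \<and> x \<in> U")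
    case True
    then show ?thesis using bnd[of x] by (simp add: w_def V_def)
  next
    case False
    then show ?thesis using V0[of x] by (auto simp: w_def V_def)
  qed
  have key: "(LINT x|lborel. Suc n * step' (Suc n * height x) * k x) =
      - (LINT x|lborel. step (Suc n * height x) * V x)" for n
  proof -
    let ?N = "real (Suc n)"
    define H where "H x = step (?N * height x) *\<^sub>R Q x" for x
    \<comment> \<open>Together with \<open>U\<close> an open cover of the space. On \<open>U\<close>
      the product rule applies. On \<open>O2\<close> the field \<open>H\<close> vanishes, either by
      the support of \<open>G\<close> or because the cutoff is 0 up to the argument 1, that is, up
      to the height 1 / N.\<close>
    define O2 where "O2 = - (cball z r' \<inter> {x. 1 / ?N \<le> height x})"
    have openO2: "open O2"
      unfolding O2_def by (intro open_Compl closed_Int closed_Collect_le continuous_intros) auto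
    have cover: "U \<union> O2 = UNIV"
    proof -
      have "x \<in> U" if "x \<notin> O2" for x
      proof -
        have "1 / ?N \<le> height x" "x \<in> ball z r" using that r' by (auto simp: O2_def)
        moreover have "1 / ?N > 0" by simp
        ultimately show ?thesis unfolding U_def by (blast intro: less_le_trans)
      qed
      then show ?thesis by auto
    qed
    have H_O2: "H x = 0" if "x \<in> O2" for x
    proof (cases "x \<in> cball z r'")
      case True
      then have "?N * height x \<le> 1" using that by (auto simp: O2_def field_simps not_le)
      then show ?thesis by (simp add: H_def step_eq_0)
    next
      case False
      then show ?thesis by (simp add: H_def Q_def supp)
    qed
    \<comment> \<open>The partial derivatives of \<open>H\<close>, written by one formula on the
      whole space; the indicator switches off \<open>pd j G\<close> where it has no meaning.\<close>
    define d where "d j i x = ?N * step' (?N * height x) * (conormal x $ j * Q x $ i)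
        + step (?N * height x) * (indicator U x * pd j G x $ i)" for j i x
    have d_O2: "d j i x = 0" if "x \<in> O2" for i j x
    proof (cases "x \<in> cball z r'")
      case True
      then have "?N * height x \<le> 1" using that by (auto simp: O2_def field_simps not_le)
      then show ?thesis by (simp add: d_def step_eq_0 step'_eq_0)
    next
      case False
      have "pd j G x = pd j (\<lambda>_. 0) x" for j
        by (rule pd_cong_open[of "- cball z r'"]) (use False supp in auto)
      then show ?thesis using False by (simp add: d_def Q_def supp pd_eqI[OF has_derivative_const])
    qed
    have H_deriv: "((\<lambda>y. H y $ i) has_derivative (\<lambda>v. \<Sum>j\<in>UNIV. v $ j * d j i x)) (at x)" for i x
    proof (cases "x \<in> O2")
      case True
      have "((\<lambda>y. H y $ i) has_derivative (\<lambda>v. 0)) (at x)"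
        by (rule has_derivative_transform_within_open[OF has_derivative_const openO2 True]) (simp add: H_O2)
      then show ?thesis using d_O2[OF True] by simp
    next
      case False
      then have xU: "x \<in> U" using cover by auto
      have s: "((\<lambda>y. step (?N * height y)) has_derivative (\<lambda>v. ?N * (conormal x \<bullet> v) * step' (?N * height x))) (at x)"
        by (rule DERIV_compose_FDERIV[OF has_real_derivative_step])
           (intro has_derivative_mult_right height_has_derivative)
      have G: "((\<lambda>y. G y $ i) has_derivative (\<lambda>v. (\<Sum>j\<in>UNIV. v $ j *\<^sub>R pd j G x) $ i)) (at x)"
        by (rule bounded_linear.has_derivative[OF bounded_linear_vec_nth has_derivative_pd[OF diff[OF xU]]])
      have "((\<lambda>y. step (?N * height y) * G y $ i) has_derivative
          (\<lambda>v. step (?N * height x) * (\<Sum>j\<in>UNIV. v $ j *\<^sub>R pd j G x) $ i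
            + (?N * (conormal x \<bullet> v) * step' (?N * height x)) * G x $ i)) (at x)"
        by (rule has_derivative_mult[OF s G])
      also have "(\<lambda>v. step (?N * height x) * (\<Sum>j\<in>UNIV. v $ j *\<^sub>R pd j G x) $ i
            + (?N * (conormal x \<bullet> v) * step' (?N * height x)) * G x $ i) = (\<lambda>v. \<Sum>j\<in>UNIV. v $ j * d j i x)"
        by (simp add: fun_eq_iff d_def sum_3 inner_vec_def QU[OF xU] xU algebra_simps)
      finally show ?thesis
        by (rule has_derivative_transform_within_open[OF _ openU xU]) (simp add: H_def QU)
    qed
    have pdH: "pd j (\<lambda>y. H y $ i) x = d j i x" for i j x
    proof -
      have "pd j (\<lambda>y. H y $ i) x = (\<Sum>l\<in>UNIV. (axis j 1 :: vec3) $ l * d l i x)"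
        by (rule pd_eqI[OF H_deriv])
      also have "\<dots> = (\<Sum>l\<in>UNIV. if l = j then d l i x else 0)"
        by (intro sum.cong) (auto simp: axis_def)
      finally show ?thesis by simp
    qed
    have cd: "continuous_on UNIV (d j i)" for i j
    proof -
      have "continuous_on (U \<union> O2) (d j i)"
      proof (rule continuous_on_open_Un[OF openU openO2])
        have "continuous_on U (\<lambda>x. ?N * step' (?N * height x) * (conormal x $ j * Q x $ i)
            + step (?N * height x) * (pd j G x $ i))"
          by (intro continuous_intros cpd continuous_on_subset[OF contQ]) (auto simp: U_def)
        then show "continuous_on U (d j i)"
          by (rule continuous_on_eq) (simp add: d_def)
        show "continuous_on O2 (d j i)"
          by (rule continuous_on_eq[OF continuous_on_const[of _ 0]]) (simp add: d_O2)
      qed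
      then show ?thesis by (simp add: cover)
    qed
    have int: "integrable lborel (d j j)" "(LINT x|lborel. d j j x) = 0" for j
    proof -
      have eq: "pd j (\<lambda>y. H y $ j) = d j j" by (simp add: pdH fun_eq_iff)
      have "(\<lambda>y. H y $ j) differentiable at x" for x
        using H_deriv differentiable_def by blast
      moreover have "H x $ j = 0" if "x \<notin> cball z r'" for x
        using that by (simp add: H_def Q_def supp)
      ultimately show "integrable lborel (d j j)" "(LINT x|lborel. d j j x) = 0"
        using integral_pd_compact_support[of "\<lambda>y. H y $ j" j z r', unfolded eq] cd by auto
    qed
    have i2: "integrable lborel (\<lambda>x. step (?N * height x) * V x)"
    proof (rule Bochner_Integration.integrable_bound[OF w])
      show "AE x in lborel. norm (step (?N * height x) * V x) \<le> norm (w x)"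
      proof (rule AE_I2)
        fix x
        have "norm (step (?N * height x) * V x) \<le> 1 * \<bar>V x\<bar>"
          using step_bounds by (simp add: abs_mult mult_left_le_one_le)
        then show "norm (step (?N * height x) * V x) \<le> norm (w x)" using Vw[of x] by simp
      qed
    qed measurable
    have sum: "(\<Sum>j\<in>UNIV. d j j x) = ?N * step' (?N * height x) * k x + step (?N * height x) * V x" for x
      by (simp add: d_def k_def V_def vdiv_def sum_3 inner_vec_def algebra_simps)
    have isum: "integrable lborel (\<lambda>x. \<Sum>j\<in>UNIV. d j j x)"
      using int by (intro Bochner_Integration.integrable_sum) auto
    have "(LINT x|lborel. ?N * step' (?N * height x) * k x) =
        (LINT x|lborel. (\<Sum>j\<in>UNIV. d j j x) - step (?N * height x) * V x)"
      unfolding sum by simp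
    also have "\<dots> = (LINT x|lborel. (\<Sum>j\<in>UNIV. d j j x)) - (LINT x|lborel. step (?N * height x) * V x)"
      using isum i2 by (rule Bochner_Integration.integral_diff)
    also have "(LINT x|lborel. (\<Sum>j\<in>UNIV. d j j x)) = 0"
      using int by (subst Bochner_Integration.integral_sum) auto
    finally show ?thesis by simp
  qed
  have lim1: "(\<lambda>n. LINT x|lborel. step (Suc n * height x) * V x) \<longlonglongrightarrow> (LINT x|lborel. V x)"
  proof (rule integral_dominated_convergence[OF _ _ w])
    show "AE x in lborel. (\<lambda>n. step (Suc n * height x) * V x) \<longlonglongrightarrow> V x"
    proof (rule AE_I2)
      fix x show "(\<lambda>n. step (Suc n * height x) * V x) \<longlonglongrightarrow> V x"
      proof (cases "x \<in> U")
        case True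
        then have h: "height x > 0" by (simp add: U_def)
        have "\<forall>\<^sub>F n in sequentially. step (Suc n * height x) * V x = V x"
        proof -
          \<comment> \<open>3 is the node from which on the cutoff equals 1.\<close>
          obtain m :: nat where m: "3 / height x < m" using reals_Archimedean2 by blast
          have "step (Suc n * height x) * V x = V x" if "n \<ge> m" for n
          proof -
            have "3 \<le> m * height x" using m h by (simp add: field_simps)
            also have "\<dots> \<le> Suc n * height x" using that h by (intro mult_right_mono) auto
            finally show ?thesis by (simp add: step_eq_1)
          qed
          then show ?thesis unfolding eventually_sequentially by blast
        qed
        then show ?thesis by (rule tendsto_eventually)
      qed (simp add: V_def)
    qed
    show "AE x in lborel. norm (step (Suc n * height x) * V x) \<le> w x" for n
    proof (rule AE_I2)
      fix x
      have "norm (step (Suc n * height x) * V x) \<le> 1 * \<bar>V x\<bar>"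
        using step_bounds by (simp add: abs_mult mult_left_le_one_le)
      then show "norm (step (Suc n * height x) * V x) \<le> w x" using Vw[of x] by simp
    qed
  qed measurable
  have lim2: "(\<lambda>n. LINT x|lborel. Suc n * step' (Suc n * height x) * k x) \<longlonglongrightarrow> (LINT a|lborel. k (lift a 0))"
  proof (rule flux_lift)
    show "continuous_on {x. 0 \<le> height x} k"
      unfolding k_def by (intro continuous_intros contQ)
    show "k x = 0" if "x \<notin> cball z r'" for x
      using that by (simp add: k_def Q_def supp)
    show "k x = 0" if "height x < 0" for x
      using that by (simp add: k_def Q_def)
  qed
  have "(\<lambda>n. - (LINT x|lborel. step (Suc n * height x) * V x)) \<longlonglongrightarrow> - (LINT x|lborel. V x)"
    by (rule tendsto_minus[OF lim1])
  with lim2 have "(LINT a|lborel. k (lift a 0)) = - (LINT x|lborel. V x)"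
    unfolding key by (rule LIMSEQ_unique)
  moreover have "(LINT x|lborel. V x) = (LINT x:U|lborel. vdiv G x)"
    by (simp add: V_def set_lebesgue_integral_def)
  moreover have "k (lift a 0) = indicator (ball z r) (lift a 0) * (conormal (lift a 0) \<bullet> G (lift a 0))" for a
    by (simp add: k_def Q_def indicator_def)
  ultimately show ?thesis by simp
qed

end

section \<open>Charts of a smooth boundary\<close>

locale boundary_chart = graph_chart +
  fixes E :: "vec3 set" and z :: vec3 and r :: real
  assumes openE: "open E" and r_pos: "0 < r"
    and E_chart: "E \<inter> ball z r = {x \<in> ball z r. 0 < height x}"
begin

text \<open>A point of height 0 is reached by moving down vertically from points of positive height,
  while negative heights form an open set that misses the particle. So the particle lies on one side
  of its boundary only.\<close>

lemma closure_chart: "closure E \<inter> ball z r = {x \<in> ball z r. 0 \<le> height x}"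
proof (intro equalityI subsetI)
  fix x assume x: "x \<in> closure E \<inter> ball z r"
  have "0 \<le> height x"
  proof (rule ccontr)
    assume neg: "\<not> 0 \<le> height x"
    have o: "open (ball z r \<inter> {x. height x < 0})"
      by (intro open_Int open_ball open_Collect_less continuous_intros)
    have "x \<in> ball z r \<inter> {x. height x < 0}" using x neg by simp
    then have "ball z r \<inter> {x. height x < 0} \<inter> E \<noteq> {}"
      using x open_Int_closure_eq_empty[OF o, of E] by blast
    then obtain y where "y \<in> E" "y \<in> ball z r" "height y < 0" by blast
    then have "y \<in> {x \<in> ball z r. 0 < height x}" unfolding E_chart[symmetric] by blast
    with \<open>height y < 0\<close> show False by simp
  qed
  then show "x \<in> {x \<in> ball z r. 0 \<le> height x}" using x by simp
next
  fix x assume x: "x \<in> {x \<in> ball z r. 0 \<le> height x}"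
  define c where "c n = lift (proj x) (height x + 1 / Suc n)" for n :: nat
  have c: "c \<longlonglongrightarrow> x"
  proof -
    have "(\<lambda>n. height x + 1 / Suc n) \<longlonglongrightarrow> height x + 0"
      by (intro tendsto_intros) (use LIMSEQ_inverse_real_of_nat in \<open>simp add: inverse_eq_divide\<close>)
    then have "c \<longlonglongrightarrow> lift (proj x) (height x)"
      unfolding c_def lift_def by (intro tendsto_intros) simp
    then show ?thesis by simp
  qed
  have "eventually (\<lambda>n. c n \<in> ball z r) sequentially"
    using topological_tendstoD[OF c open_ball] x by auto
  then have ev: "eventually (\<lambda>n. c n \<in> closure E) sequentially"
  proof eventually_elim
    case (elim n)
    have "0 < height (c n)" using x by (simp add: c_def add_nonneg_pos)
    then have "c n \<in> E" using elim E_chart by blast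
    then show ?case using closure_subset by blast
  qed
  have "x \<in> closure E"
    by (rule Lim_in_closed_set[OF closed_closure ev trivial_limit_sequentially c])
  then show "x \<in> closure E \<inter> ball z r" using x by simp
qed

lemma frontier_chart: "frontier E \<inter> ball z r = {x \<in> ball z r. height x = 0}"
proof -
  have "frontier E \<inter> ball z r = (closure E \<inter> ball z r) - (E \<inter> ball z r)"
    using openE by (auto simp: frontier_def interior_open)
  also have "\<dots> = {x \<in> ball z r. height x = 0}"
    unfolding closure_chart E_chart by auto
  finally show ?thesis .
qed

text \<open>Along a ray that starts on the surface, the derivative decides the sign of the height.
  The factor \<open>c\<close> treats rays into the particle (1) and out of it (-1) by the same
  argument.\<close>

lemma eventually_height:
  assumes x: "height x = 0" and c: "0 < c * (conormal x \<bullet> v)"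
  shows "\<forall>\<^sub>F t in at_right 0. 0 < c * height (x + t *\<^sub>R v)"
proof -
  have d: "((\<lambda>t. x + t *\<^sub>R v) has_derivative (\<lambda>h. h *\<^sub>R v)) (at 0)"
    by (auto intro!: derivative_eq_intros)
  have "(height has_derivative (\<lambda>v. conormal x \<bullet> v)) (at (x + 0 *\<^sub>R v))"
    using height_has_derivative[of x] by simp
  from has_derivative_mult_right[OF has_derivative_compose[OF d this], of c]
  have "((\<lambda>t. c * height (x + t *\<^sub>R v)) has_real_derivative (c * (conormal x \<bullet> v))) (at 0)"
    by (simp add: has_field_derivative_def mult.commute[of _ "c * (conormal x \<bullet> v)"] mult.left_commute[of c])
  from DERIV_pos_inc_right[OF this c] obtain e
    where "e > 0" "\<And>h. 0 < h \<Longrightarrow> h < e \<Longrightarrow> c * height x < c * height (x + h *\<^sub>R v)"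
    by auto
  then show ?thesis
    unfolding eventually_at_right_field using x by (intro exI[of _ e]) simp
qed

lemma eventually_in_ball:
  assumes "x \<in> ball z r"
  shows "\<forall>\<^sub>F t in at_right 0. x + t *\<^sub>R v \<in> ball z r"
proof -
  have "((\<lambda>t. x + t *\<^sub>R v) \<longlongrightarrow> x + 0 *\<^sub>R v) (at_right 0)"
    by (intro tendsto_intros)
  from topological_tendstoD[OF this open_ball[of z r]] assms show ?thesis by simp
qed

text \<open>Existence is the sign of the height along rays. For uniqueness, take two different unit
  vectors n and m with the defining property: their inner product is below 1, so the direction n - m
  leaves the particle according to n and enters it according to m.\<close>

lemma outer_normal_chart:
  assumes x: "x \<in> frontier E \<inter> ball z r"
  shows "outer_normal E x = - (conormal x /\<^sub>R norm (conormal x))"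
proof -
  let ?n = "- (conormal x /\<^sub>R norm (conormal x))"
  define P where "P n \<longleftrightarrow> norm n = 1 \<and>
     (\<forall>v. v \<bullet> n < 0 \<longrightarrow> (\<forall>\<^sub>F s in at_right 0. x + s *\<^sub>R v \<in> E)) \<and>
     (\<forall>v. v \<bullet> n > 0 \<longrightarrow> (\<forall>\<^sub>F s in at_right 0. x + s *\<^sub>R v \<notin> closure E))" for n
  have h: "height x = 0" "x \<in> ball z r" using x unfolding frontier_chart by auto
  have N: "norm (conormal x) > 0" using conormal_nonzero by simp
  have "P ?n"
    unfolding P_def
  proof (intro conjI allI impI)
    show "norm ?n = 1" using N by simp
    fix v
    have vn: "v \<bullet> ?n = - ((conormal x \<bullet> v) / norm (conormal x))"
      by (simp add: inner_commute divide_inverse_commute)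
    {
      assume "v \<bullet> ?n < 0"
      then have "0 < 1 * (conormal x \<bullet> v)" using N unfolding vn by (simp add: zero_less_divide_iff)
      from eventually_height[OF h(1) this] eventually_in_ball[OF h(2), of v]
      show "\<forall>\<^sub>F s in at_right 0. x + s *\<^sub>R v \<in> E"
        by eventually_elim (use E_chart in auto)
    next
      assume "v \<bullet> ?n > 0"
      then have "0 < (- 1) * (conormal x \<bullet> v)" using N unfolding vn by (simp add: divide_less_0_iff)
      from eventually_height[OF h(1) this] eventually_in_ball[OF h(2), of v]
      show "\<forall>\<^sub>F s in at_right 0. x + s *\<^sub>R v \<notin> closure E"
      proof eventually_elim
        case (elim s)
        then have "x + s *\<^sub>R v \<notin> {x \<in> ball z r. 0 \<le> height x}" by simp
        then show ?case using elim(2) unfolding closure_chart[symmetric] by blast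
      qed
    }
  qed
  moreover have "n = m" if n: "P n" and m: "P m" for n m
  proof (rule ccontr)
    assume "n \<noteq> m"
    have nm: "n \<bullet> n = 1" "m \<bullet> m = 1" using n m by (auto simp: P_def norm_eq_1)
    have "0 < (n - m) \<bullet> (n - m)" using \<open>n \<noteq> m\<close> by simp
    then have "n \<bullet> m < 1" using nm by (simp add: algebra_simps inner_commute)
    then have "(n - m) \<bullet> n > 0" "(n - m) \<bullet> m < 0"
      using nm by (simp_all add: algebra_simps inner_commute)
    then have "\<forall>\<^sub>F s in at_right 0. x + s *\<^sub>R (n - m) \<notin> closure E" "\<forall>\<^sub>F s in at_right 0. x + s *\<^sub>R (n - m) \<in> E"
      using n m unfolding P_def by blast+
    then have "\<forall>\<^sub>F s in at_right (0::real). False"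
      by eventually_elim (use closure_subset in blast)
    then show False by (simp add: trivial_limit_at_right_real)
  qed
  ultimately show ?thesis
    unfolding outer_normal_def P_def[symmetric] by (intro the_equality) auto
qed

section \<open>The surface measure in a chart\<close>

lemma borel_measurable_area:
  "(\<lambda>a. indicator (ball z r) (lift a 0) * norm (conormal (lift a 0))) \<in> borel_measurable borel"
proof -
  have gm: "(\<lambda>a. lift a 0) \<in> borel_measurable borel"
    and cm: "(\<lambda>a. norm (conormal (lift a 0))) \<in> borel_measurable borel"
    by (intro borel_measurable_continuous_onI continuous_intros)+
  show ?thesis
    by (intro borel_measurable_times cm measurable_compose[OF gm borel_measurable_indicator]) auto
qed

definition patch :: "(real^2) set" where
  "patch = {a. lift a 0 \<in> ball z r}"

lemma open_patch: "open patch"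
proof -
  have "patch = (\<lambda>a. lift a 0) -` ball z r" by (auto simp: patch_def)
  then show ?thesis by (auto intro!: open_vimage continuous_intros)
qed

lemma lift_patch: "(\<lambda>a. lift a 0) ` patch = frontier E \<inter> ball z r"
  unfolding frontier_chart patch_def
proof (intro equalityI subsetI)
  fix x assume "x \<in> {x \<in> ball z r. height x = 0}"
  then show "x \<in> (\<lambda>a. lift a 0) ` {a. lift a 0 \<in> ball z r}"
    using lift_proj[of x] by (intro image_eqI[of _ _ "proj x"]) auto
qed auto

text \<open>Makes the defining condition of the surface measure, which speaks of regular patches,
  available in the chart.\<close>

lemma regular_patch_lift: "regular_patch E patch (\<lambda>a. lift a 0)"
  unfolding regular_patch_def
proof (intro conjI ballI)
  show "Cdiff 1 (\<lambda>a. lift a 0) patch"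
    unfolding Cdiff_1_iff frechet_derivative_lift
  proof (intro conjI allI)
    show "(\<lambda>a. lift a 0) differentiable_on patch"
      unfolding differentiable_on_def
      using lift_has_derivative by (meson differentiableI differentiable_at_withinI)
  qed (intro continuous_intros)
  show "inj_on (\<lambda>a. lift a 0) patch"
    by (metis inj_onI proj_lift)
  fix a
  have "norm (cross3 (frechet_derivative (\<lambda>a. lift a 0) (at a) (axis 1 1))
     (frechet_derivative (\<lambda>a. lift a 0) (at a) (axis 2 1))) \<noteq> 0"
    unfolding norm_cross_lift[where \<sigma>=0] using conormal_nonzero by simp
  then show "cross3 (frechet_derivative (\<lambda>a. lift a 0) (at a) (axis 1 1))
     (frechet_derivative (\<lambda>a. lift a 0) (at a) (axis 2 1)) \<noteq> 0"
    by (simp only: norm_eq_zero not_False_eq_True)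
qed (use open_patch lift_patch in auto)

context
  fixes \<sigma> :: "vec3 measure"
  assumes surf: "is_surface_measure E \<sigma>"
begin

text \<open>The condition on patches, tested on all Borel sets, says that the part of the surface
  measure seen by the chart is the image of Lebesgue measure weighted with the area element. Written
  as an equality of measures, it transfers every integral at once.\<close>

lemma density_chart:
  "density \<sigma> (indicator (frontier E \<inter> ball z r)) =
   distr (density lborel (\<lambda>a. ennreal (indicator (ball z r) (lift a 0) * norm (conormal (lift a 0))))) borel (\<lambda>a. lift a 0)"
  (is "?L = distr (density lborel ?w) borel ?\<gamma>")
proof (rule measure_eqI)
  have sets: "sets \<sigma> = sets borel" using surf by (simp add: is_surface_measure_def)
  show "sets ?L = sets (distr (density lborel ?w) borel ?\<gamma>)" by (simp add: sets)
  have gm [measurable]: "?\<gamma> \<in> borel_measurable borel"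
    by (intro borel_measurable_continuous_onI continuous_intros)
  have FB: "frontier E \<inter> ball z r \<in> sets \<sigma>" unfolding sets by (intro sets.Int) auto
  fix B assume "B \<in> sets ?L"
  then have B: "B \<in> sets borel" "B \<in> sets \<sigma>" by (auto simp: sets)
  have "emeasure ?L B = (\<integral>\<^sup>+ x. indicator (B \<inter> (frontier E \<inter> ball z r)) x \<partial>\<sigma>)"
  proof -
    have "emeasure ?L B = (\<integral>\<^sup>+ x. indicator (frontier E \<inter> ball z r) x * indicator B x \<partial>\<sigma>)"
      by (rule emeasure_density[OF borel_measurable_indicator[OF FB] B(2)])
    also have "\<dots> = (\<integral>\<^sup>+ x. indicator (B \<inter> (frontier E \<inter> ball z r)) x \<partial>\<sigma>)"
      by (intro nn_integral_cong) (auto simp: indicator_def)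
    finally show ?thesis .
  qed
  also have "\<dots> = emeasure \<sigma> (B \<inter> ?\<gamma> ` patch)"
    unfolding lift_patch by (intro nn_integral_indicator sets.Int[OF B(2) FB])
  also have "\<dots> = (\<integral>\<^sup>+ a. indicator patch a * indicator B (?\<gamma> a) *
      ennreal (norm (conormal (lift a 0))) \<partial>lborel)"
  proof -
    have "\<forall>B\<in>sets borel. emeasure \<sigma> (B \<inter> ?\<gamma> ` patch) =
        (\<integral>\<^sup>+ a. indicator patch a * indicator B (?\<gamma> a) *
           ennreal (norm (cross3 (frechet_derivative ?\<gamma> (at a) (axis 1 1))
                                 (frechet_derivative ?\<gamma> (at a) (axis 2 1)))) \<partial>lborel)"
      using surf regular_patch_lift unfolding is_surface_measure_def by blast
    then show ?thesis using B unfolding norm_cross_lift[where \<tau>=0 and \<sigma>=0] by blast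
  qed
  also have "\<dots> = (\<integral>\<^sup>+ a. ?w a * indicator (?\<gamma> -` B) a \<partial>lborel)"
    by (intro nn_integral_cong) (auto simp: indicator_def patch_def)
  also have "\<dots> = emeasure (density lborel ?w) (?\<gamma> -` B \<inter> space (density lborel ?w))"
    using B measurable_sets[OF gm, of B] borel_measurable_area by (subst emeasure_density) auto
  also have "\<dots> = emeasure (distr (density lborel ?w) borel ?\<gamma>) B"
    using B by (subst emeasure_distr) auto
  finally show "emeasure ?L B = emeasure (distr (density lborel ?w) borel ?\<gamma>) B" .
qed

lemma surface_integral_chart:
  fixes f :: "vec3 \<Rightarrow> real"
  assumes [measurable]: "f \<in> borel_measurable borel"
  shows "(LINT x|\<sigma>. indicator (frontier E \<inter> ball z r) x * f x) =
    (LINT a|lborel. indicator (ball z r) (lift a 0) * norm (conormal (lift a 0)) * f (lift a 0))"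
proof -
  have sets [measurable_cong]: "sets \<sigma> = sets borel" using surf by (simp add: is_surface_measure_def)
  have FB: "frontier E \<inter> ball z r \<in> sets \<sigma>" unfolding sets by (intro sets.Int) auto
  have gm [measurable]: "(\<lambda>a. lift a 0) \<in> borel_measurable borel"
    by (intro borel_measurable_continuous_onI continuous_intros)
  note wm = borel_measurable_area
  have "(LINT x|\<sigma>. indicator (frontier E \<inter> ball z r) x * f x) =
      integral\<^sup>L (density \<sigma> (\<lambda>x. ennreal (indicator (frontier E \<inter> ball z r) x))) f"
    using borel_measurable_indicator[OF FB, where 'b=real] by (subst integral_density) auto
  also have "(\<lambda>x. ennreal (indicator (frontier E \<inter> ball z r) x)) = indicator (frontier E \<inter> ball z r)"
    by (auto simp: indicator_def)
  also have "integral\<^sup>L (density \<sigma> \<dots>) f =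
      (LINT a|density lborel (\<lambda>a. ennreal (indicator (ball z r) (lift a 0) * norm (conormal (lift a 0)))). f (lift a 0))"
    unfolding density_chart by (subst integral_distr) auto
  also have "\<dots> = (LINT a|lborel. indicator (ball z r) (lift a 0) * norm (conormal (lift a 0)) * f (lift a 0))"
    by (subst integral_density) (use wm in auto)
  finally show ?thesis .
qed

text \<open>The area element is continuous, hence bounded on the compact shadow of the ball in the
  parameter plane.\<close>

lemma surface_finite_chart: "emeasure \<sigma> (frontier E \<inter> ball z r) < \<infinity>"
proof -
  have sets: "sets \<sigma> = sets borel" using surf by (simp add: is_surface_measure_def)
  have FB: "frontier E \<inter> ball z r \<in> sets \<sigma>" unfolding sets by (intro sets.Int) auto
  have spc: "space \<sigma> = UNIV" using sets_eq_imp_space_eq[OF sets] by simp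
  have gm [measurable]: "(\<lambda>a. lift a 0) \<in> borel_measurable borel"
    by (intro borel_measurable_continuous_onI continuous_intros)
  note wm = borel_measurable_area
  define A where "A = proj ` cball z r"
  have A: "compact A"
    unfolding A_def by (intro compact_continuous_image continuous_intros) auto
  have "bounded ((\<lambda>a. norm (conormal (lift a 0))) ` A)"
    by (intro compact_imp_bounded compact_continuous_image continuous_intros A)
  then obtain C where C: "C > 0" "\<And>a. a \<in> A \<Longrightarrow> norm (conormal (lift a 0)) \<le> C"
    unfolding bounded_pos by force
  have "emeasure \<sigma> (frontier E \<inter> ball z r) = emeasure (density \<sigma> (indicator (frontier E \<inter> ball z r))) UNIV"
    using FB by (subst emeasure_density) (auto simp: spc[symmetric])
  also have "\<dots> = (\<integral>\<^sup>+ a. ennreal (indicator (ball z r) (lift a 0) * norm (conormal (lift a 0))) \<partial>lborel)"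
    unfolding density_chart by (subst emeasure_distr) (auto, subst emeasure_density, use wm in auto)
  also have "\<dots> \<le> (\<integral>\<^sup>+ a. ennreal C * indicator A a \<partial>lborel)"
  proof (intro nn_integral_mono)
    fix a
    show "ennreal (indicator (ball z r) (lift a 0) * norm (conormal (lift a 0))) \<le> ennreal C * indicator A a"
    proof (cases "lift a 0 \<in> ball z r")
      case True
      then have "a \<in> A" unfolding A_def by (metis ball_subset_cball image_eqI proj_lift subsetD)
      then show ?thesis using True C by (simp add: ennreal_leI)
    qed simp
  qed
  also have "\<dots> = ennreal C * emeasure lborel A"
    using compact_imp_closed[OF A] by (subst nn_integral_cmult_indicator) auto
  also have "\<dots> < \<infinity>"
    using emeasure_compact_finite[OF A] by (simp add: ennreal_mult_less_top)
  finally show ?thesis .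
qed

text \<open>The length that normalises \<open>conormal\<close> to the outer normal is the area
  element, so the parameter integral of the flux of \<open>conormal\<close> is, up to sign, the
  surface integral of the normal component. The strict inequality r' < r confines both sides to the
  chart.\<close>

lemma divergence_boundary_chart:
  fixes G :: "vec3 \<Rightarrow> vec3"
  assumes r': "r' < r"
    and diff: "\<And>x. x \<in> E \<Longrightarrow> G differentiable at x"
    and cpd: "\<And>j. continuous_on E (pd j G)"
    and cont: "continuous_on (closure E) G"
    and supp: "\<And>x. x \<notin> cball z r' \<Longrightarrow> G x = 0"
    and bnd: "\<And>x. x \<in> E \<Longrightarrow> \<bar>vdiv G x\<bar> \<le> D"
    and meas: "(\<lambda>x. indicator (frontier E) x * (G x \<bullet> outer_normal E x)) \<in> borel_measurable borel"
  shows "(LINT x:E|lborel. vdiv G x) = (LINT y:frontier E|\<sigma>. G y \<bullet> outer_normal E y)"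
proof -
  let ?U = "{x \<in> ball z r. 0 < height x}"
  have UE: "x \<in> E" if "x \<in> ?U" for x using that E_chart by blast
  have V0: "vdiv G x = 0" if "x \<notin> cball z r'" for x
  proof -
    have "pd j G x = pd j (\<lambda>_. 0) x" for j
      by (rule pd_cong_open[of "- cball z r'"]) (use that supp in auto)
    then show ?thesis by (simp add: vdiv_def pd_eqI[OF has_derivative_const])
  qed
  have "(LINT x:E|lborel. vdiv G x) = (LINT x:?U|lborel. vdiv G x)"
    unfolding set_lebesgue_integral_def
  proof (rule Bochner_Integration.integral_cong)
    fix x
    show "indicator E x *\<^sub>R vdiv G x = indicator ?U x *\<^sub>R vdiv G x"
    proof (cases "x \<in> ball z r")
      case True
      then have "x \<in> E \<longleftrightarrow> x \<in> ?U" using E_chart by blast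
      then show ?thesis by (simp add: indicator_def)
    next
      case False
      then have "x \<notin> cball z r'" using r' by auto
      then show ?thesis by (simp add: V0)
    qed
  qed simp
  also have "\<dots> = - (LINT a|lborel. indicator (ball z r) (lift a 0) * (conormal (lift a 0) \<bullet> G (lift a 0)))"
  proof (rule divergence_chart[OF r'])
    show "continuous_on {x \<in> ball z r. 0 \<le> height x} G"
      by (rule continuous_on_subset[OF cont]) (use closure_chart in blast)
    show "continuous_on ?U (pd j G)" for j
      by (rule continuous_on_subset[OF cpd]) (use UE in blast)
  qed (use UE diff supp bnd in auto)
  also have "\<dots> = (LINT a|lborel. indicator (ball z r) (lift a 0) * norm (conormal (lift a 0)) *
      (indicator (frontier E) (lift a 0) * (G (lift a 0) \<bullet> outer_normal E (lift a 0))))"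
    unfolding Bochner_Integration.integral_minus[symmetric]
  proof (rule Bochner_Integration.integral_cong)
    fix a
    show "- (indicator (ball z r) (lift a 0) * (conormal (lift a 0) \<bullet> G (lift a 0))) =
      indicator (ball z r) (lift a 0) * norm (conormal (lift a 0)) *
      (indicator (frontier E) (lift a 0) * (G (lift a 0) \<bullet> outer_normal E (lift a 0)))"
    proof (cases "lift a 0 \<in> ball z r")
      case True
      then have F: "lift a 0 \<in> frontier E \<inter> ball z r" unfolding frontier_chart by simp
      then show ?thesis
        using conormal_nonzero[of "lift a 0"] by (simp add: outer_normal_chart[OF F] inner_commute)
    qed simp
  qed simp
  also have "\<dots> = (LINT x|\<sigma>. indicator (frontier E \<inter> ball z r) x * (indicator (frontier E) x * (G x \<bullet> outer_normal E x)))"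
    by (rule surface_integral_chart[OF meas, symmetric])
  also have "\<dots> = (LINT y:frontier E|\<sigma>. G y \<bullet> outer_normal E y)"
    unfolding set_lebesgue_integral_def
  proof (rule Bochner_Integration.integral_cong)
    fix x
    show "indicator (frontier E \<inter> ball z r) x * (indicator (frontier E) x * (G x \<bullet> outer_normal E x)) =
      indicator (frontier E) x *\<^sub>R (G x \<bullet> outer_normal E x)"
    proof (cases "x \<in> ball z r")
      case False
      then have "x \<notin> cball z r'" using r' by auto
      then show ?thesis by (simp add: supp)
    qed (simp add: indicator_def)
  qed simp
  finally show ?thesis .
qed

end

end

section \<open>The surface measure\<close>

lemma smooth_boundary_chart:
  assumes "open E" "smooth_boundary E" "z \<in> frontier E"
  obtains r \<pi> s g where "boundary_chart \<pi> s g E z r"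
proof -
  obtain r s and \<pi> :: "3 \<Rightarrow> 3" and g :: "real^2 \<Rightarrow> real" where *: "r > 0" "s \<in> {-1, 1}" "bij \<pi>" "\<forall>k. Cdiff k g UNIV"
    "E \<inter> ball z r = {x \<in> ball z r. s * x $ \<pi> 3 > g (vector [x $ \<pi> 1, x $ \<pi> 2])}"
    using assms(2)[unfolded smooth_boundary_def, rule_format, OF assms(3)]
    by (elim exE conjE bexE) (rule that; assumption)
  interpret graph_chart \<pi> s g
    using * by unfold_locales auto
  have "boundary_chart \<pi> s g E z r"
    by unfold_locales (use * assms in \<open>auto simp: height_def proj_def\<close>)
  then show thesis by (rule that)
qed

text \<open>Away from the boundary no vector has the defining property: near x all points are in the
  particle, or all are outside its closure. The description then takes its default value, one
  constant for all such points. This makes the normal piecewise continuous, hence measurable on the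
  whole space on which the surface integrals are written.\<close>

lemma outer_normal_off_frontier:
  assumes "open E" "x \<notin> frontier E"
  shows "outer_normal E x = (THE n. False)"
proof -
  have "\<not> (norm n = 1 \<and>
     (\<forall>v. v \<bullet> n < 0 \<longrightarrow> (\<forall>\<^sub>F s in at_right 0. x + s *\<^sub>R v \<in> E)) \<and>
     (\<forall>v. v \<bullet> n > 0 \<longrightarrow> (\<forall>\<^sub>F s in at_right 0. x + s *\<^sub>R v \<notin> closure E)))" (is "\<not> ?P n") for n
  proof
    assume n: "?P n"
    then have "n \<bullet> n > 0" "- n \<bullet> n < 0" by (simp_all add: norm_eq_1)
    with n have ev: "\<forall>\<^sub>F s in at_right 0. x + s *\<^sub>R n \<notin> closure E" "\<forall>\<^sub>F s in at_right 0. x + s *\<^sub>R (- n) \<in> E"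
      by blast+
    have lim: "((\<lambda>s. x + s *\<^sub>R v) \<longlongrightarrow> x) (at_right 0)" for v
    proof -
      have "((\<lambda>s. x + s *\<^sub>R v) \<longlongrightarrow> x + 0 *\<^sub>R v) (at_right 0)" by (intro tendsto_intros)
      then show ?thesis by simp
    qed
    have "x \<in> E \<or> x \<in> - closure E"
      using assms by (auto simp: frontier_def interior_open)
    then show False
    proof
      assume "x \<in> E"
      then have "\<forall>\<^sub>F s in at_right 0. x + s *\<^sub>R n \<in> E"
        by (rule topological_tendstoD[OF lim assms(1)])
      with ev(1) have "\<forall>\<^sub>F s in at_right (0::real). False"
        by eventually_elim (use closure_subset in blast)
      then show False by simp
    next
      assume "x \<in> - closure E"
      then have "\<forall>\<^sub>F s in at_right 0. x + s *\<^sub>R (- n) \<in> - closure E"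
        by (intro topological_tendstoD[OF lim]) auto
      with ev(2) have "\<forall>\<^sub>F s in at_right (0::real). False"
        by eventually_elim (use closure_subset in blast)
      then show False by simp
    qed
  qed
  then have "(\<lambda>n. ?P n) = (\<lambda>n. False)"
    by (intro ext) blast
  then show ?thesis unfolding outer_normal_def by (rule arg_cong)
qed

lemma continuous_on_outer_normal:
  assumes "open E" "smooth_boundary E"
  shows "continuous_on (frontier E) (outer_normal E)"
proof (rule continuous_on_eq_continuous_within[THEN iffD2], rule ballI)
  fix z assume z: "z \<in> frontier E"
  obtain r \<pi> s g where "boundary_chart \<pi> s g E z r"
    using smooth_boundary_chart[OF assms z] .
  then interpret boundary_chart \<pi> s g E z r .
  have "continuous_on (frontier E \<inter> ball z r) (\<lambda>x. - (conormal x /\<^sub>R norm (conormal x)))"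
    by (intro continuous_intros) (simp add: conormal_nonzero)
  then have "continuous_on (frontier E \<inter> ball z r) (outer_normal E)"
    by (rule continuous_on_eq) (simp add: outer_normal_chart)
  then have "continuous (at z within frontier E \<inter> ball z r) (outer_normal E)"
    using z r_pos by (simp add: continuous_on_eq_continuous_within)
  then show "continuous (at z within frontier E) (outer_normal E)"
    using r_pos at_within_nhd[of z "ball z r" "frontier E \<inter> ball z r" "frontier E"]
    by auto
qed

lemma borel_measurable_piecewise:
  fixes f :: "'a::topological_space \<Rightarrow> 'b::{second_countable_topology,real_normed_vector}"
  assumes sets: "A \<in> sets borel" "B \<in> sets borel" "C \<in> sets borel"
    and cont: "continuous_on A f" "continuous_on B f" "continuous_on C f"
    and part: "A \<union> B \<union> C = UNIV" "A \<inter> B = {}" "A \<inter> C = {}" "B \<inter> C = {}"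
  shows "f \<in> borel_measurable borel"
proof -
  have "(\<lambda>x. indicator A x *\<^sub>R f x + indicator B x *\<^sub>R f x + indicator C x *\<^sub>R f x) \<in> borel_measurable borel"
    by (intro borel_measurable_add borel_measurable_continuous_on_indicator sets cont)
  also have "(\<lambda>x. indicator A x *\<^sub>R f x + indicator B x *\<^sub>R f x + indicator C x *\<^sub>R f x) = f"
  proof
    fix x
    have "x \<in> A \<and> x \<notin> B \<and> x \<notin> C \<or> x \<notin> A \<and> x \<in> B \<and> x \<notin> C \<or> x \<notin> A \<and> x \<notin> B \<and> x \<in> C"
      using part by blast
    then show "indicator A x *\<^sub>R f x + indicator B x *\<^sub>R f x + indicator C x *\<^sub>R f x = f x"
      by auto
  qed
  finally show ?thesis .
qed

lemma borel_measurable_outer_normal: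
  assumes "open E" "smooth_boundary E"
  shows "outer_normal E \<in> borel_measurable borel"
proof (rule borel_measurable_piecewise[of "frontier E" "- frontier E" "{}"])
  show "continuous_on (- frontier E) (outer_normal E)"
    by (rule continuous_on_eq[OF continuous_on_const]) (simp add: outer_normal_off_frontier[OF assms(1)])
qed (use continuous_on_outer_normal[OF assms] in auto)

text \<open>Finiteness holds in each chart, and compactness of the boundary reduces the claim to
  finitely many charts.\<close>

lemma finite_surface_measure:
  assumes E: "open E" "bounded E" "smooth_boundary E" and surf: "is_surface_measure E \<sigma>"
  shows "finite_measure \<sigma>"
proof (rule finite_measureI)
  have sets: "sets \<sigma> = sets borel" and null: "emeasure \<sigma> (- frontier E) = 0"
    using surf by (simp_all add: is_surface_measure_def)
  have spc: "space \<sigma> = UNIV" using sets_eq_imp_space_eq[OF sets] by simp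
  have "\<forall>z\<in>frontier E. \<exists>r>0. emeasure \<sigma> (frontier E \<inter> ball z r) < \<infinity>"
  proof
    fix z assume z: "z \<in> frontier E"
    obtain r \<pi> s g where "boundary_chart \<pi> s g E z r"
      using smooth_boundary_chart[OF E(1,3) z] .
    then interpret boundary_chart \<pi> s g E z r .
    show "\<exists>r>0. emeasure \<sigma> (frontier E \<inter> ball z r) < \<infinity>"
      using surface_finite_chart[OF surf] r_pos by blast
  qed
  then obtain r where r: "\<And>z. z \<in> frontier E \<Longrightarrow> 0 < r z"
    "\<And>z. z \<in> frontier E \<Longrightarrow> emeasure \<sigma> (frontier E \<inter> ball z (r z)) < \<infinity>"
    by metis
  have cpt: "compact (frontier E)"
    using E(2) by (rule compact_frontier_bounded)
  obtain Z where Z: "Z \<subseteq> frontier E" "finite Z" "frontier E \<subseteq> (\<Union>z\<in>Z. ball z (r z))"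
    using r(1) by (rule_tac compactE_image[OF cpt, of "frontier E" "\<lambda>z. ball z (r z)"]) auto
  have FB: "frontier E \<inter> ball z (r z) \<in> sets \<sigma>" for z unfolding sets by (intro sets.Int) auto
  have "emeasure \<sigma> (frontier E) \<le> emeasure \<sigma> (\<Union>z\<in>Z. frontier E \<inter> ball z (r z))"
    using Z FB by (intro emeasure_mono sets.finite_UN) auto
  also have "\<dots> \<le> (\<Sum>z\<in>Z. emeasure \<sigma> (frontier E \<inter> ball z (r z)))"
    using Z FB by (intro emeasure_subadditive_finite) auto
  also have "\<dots> < \<infinity>"
    using r(2) Z by (auto simp: subset_iff)
  finally have fin: "emeasure \<sigma> (frontier E) < \<infinity>" .
  have "emeasure \<sigma> (space \<sigma>) = emeasure \<sigma> (frontier E \<union> - frontier E)"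
    by (simp add: spc)
  also have "\<dots> \<le> emeasure \<sigma> (frontier E) + emeasure \<sigma> (- frontier E)"
    by (intro emeasure_subadditive) (auto simp: sets)
  finally show "emeasure \<sigma> (space \<sigma>) \<noteq> \<infinity>"
    using fin null by auto
qed

lemma surface_integrable:
  fixes f :: "vec3 \<Rightarrow> 'b::{banach,second_countable_topology}"
  assumes E: "open E" "bounded E" "smooth_boundary E" and surf: "is_surface_measure E \<sigma>"
    and f: "continuous_on (frontier E) f"
  shows "set_integrable \<sigma> (frontier E) f"
proof -
  interpret finite_measure \<sigma> by (rule finite_surface_measure[OF E surf])
  have sets: "sets \<sigma> = sets borel"
    using surf by (simp_all add: is_surface_measure_def)
  have cpt: "compact (frontier E)"
    using E(2) by (rule compact_frontier_bounded)
  then have "bounded (f ` frontier E)"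
    by (intro compact_imp_bounded compact_continuous_image f)
  then obtain B where "\<And>x. x \<in> frontier E \<Longrightarrow> norm (f x) \<le> B"
    unfolding bounded_iff by force
  moreover have "(\<lambda>x. indicator (frontier E) x *\<^sub>R f x) \<in> borel_measurable \<sigma>"
    unfolding measurable_cong_sets[OF sets refl]
    by (intro borel_measurable_continuous_on_indicator f) auto
  ultimately show ?thesis
    unfolding set_integrable_def
    by (intro integrable_const_bound[of _ "max B 0"]) (auto simp: indicator_def le_max_iff_disj)
qed

section \<open>The divergence theorem\<close>

lemma set_integrable_bounded_continuous:
  fixes f :: "vec3 \<Rightarrow> 'b::{banach,second_countable_topology}"
  assumes "open E" "bounded E" "continuous_on E f" "bounded (f ` E)"
  shows "set_integrable lborel E f"
proof -
  obtain B where B: "\<And>x. x \<in> E \<Longrightarrow> norm (f x) \<le> B"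
    using assms(4) unfolding bounded_iff by force
  have "emeasure lborel E < \<infinity>"
    using emeasure_bounded_finite[OF assms(2)] by simp
  moreover have "(\<lambda>x. indicator E x *\<^sub>R f x) \<in> borel_measurable lborel"
    using borel_measurable_continuous_on_indicator[OF _ assms(3)] assms(1) by simp
  ultimately show ?thesis
    unfolding set_integrable_def
    using assms(1) B
    by (intro integrableI_bounded_set[where A=E and B="max B 0"]) (auto simp: indicator_def le_max_iff_disj)
qed

text \<open>The class of fields for the divergence theorem. It admits an unbounded gradient near the
  boundary, as the particle stress requires, and it is stable under multiplication by functions that
  are continuously differentiable up to the boundary: the additional term in the divergence contains
  the field but not its derivatives.\<close>

definition flux_field :: "vec3 set \<Rightarrow> (vec3 \<Rightarrow> vec3) \<Rightarrow> bool" where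
  "flux_field E G \<longleftrightarrow> continuous_on (closure E) G \<and> (\<forall>x\<in>E. G differentiable at x) \<and>
     (\<forall>j. continuous_on E (pd j G)) \<and> bounded (vdiv G ` E)"

lemma flux_field_integrable:
  assumes "open E" "bounded E" "flux_field E G"
  shows "set_integrable lborel E (vdiv G)"
proof (rule set_integrable_bounded_continuous[OF assms(1,2)])
  show "continuous_on E (vdiv G)"
    using assms(3) unfolding vdiv_def flux_field_def by (intro continuous_intros) auto
qed (use assms(3) in \<open>simp add: flux_field_def\<close>)

lemma vdiv_eq_0_off_support:
  assumes "\<And>y. y \<notin> cball z r \<Longrightarrow> G y = 0" "x \<notin> cball z r"
  shows "pd j G x = 0" "vdiv G x = 0"
proof -
  have "pd j G x = pd j (\<lambda>_. 0) x" for j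
    by (rule pd_cong_open[of "- cball z r"]) (use assms in auto)
  then show "pd j G x = 0" "vdiv G x = 0" by (simp_all add: vdiv_def pd_eqI[OF has_derivative_const])
qed

text \<open>The radius depends on the point alone and not on the field, so the covering can be fixed
  before the partition of unity is built. Near an interior point both sides are 0, since the field
  extends by zero to the whole space; near a boundary point a chart applies.\<close>

lemma local_divergence:
  assumes E: "open E" "bounded E" "smooth_boundary E" and surf: "is_surface_measure E \<sigma>"
    and z: "z \<in> closure E"
  shows "\<exists>r>0. \<forall>G r'. flux_field E G \<longrightarrow> r' < r \<longrightarrow> (\<forall>x. x \<notin> cball z r' \<longrightarrow> G x = 0) \<longrightarrow>
    (LINT x:E|lborel. vdiv G x) = (LINT y:frontier E|\<sigma>. G y \<bullet> outer_normal E y)"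
proof (cases "z \<in> E")
  case True
  then obtain r where r: "r > 0" "ball z r \<subseteq> E"
    using E(1) open_contains_ball by blast
  have "(LINT x:E|lborel. vdiv G x) = (LINT y:frontier E|\<sigma>. G y \<bullet> outer_normal E y)"
    if G: "flux_field E G" and r': "r' < r" and supp: "\<And>x. x \<notin> cball z r' \<Longrightarrow> G x = 0" for G r'
  proof -
    have sub: "cball z r' \<subseteq> E" using r r' by (auto simp: subset_iff)
    have cover: "E \<union> - cball z r' = UNIV" using sub by auto
    have off: "pd j G x = 0" "vdiv G x = 0" if "x \<notin> cball z r'" for j x
      using vdiv_eq_0_off_support[where G=G and z=z and r=r'] supp that by blast+
    have diff: "G differentiable at x" for x
    proof (cases "x \<in> E")
      case True
      then show ?thesis using G by (simp add: flux_field_def)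
    next
      case False
      then have "x \<in> - cball z r'" using sub by auto
      then have "(G has_derivative (\<lambda>_. 0)) (at x)"
        by (intro has_derivative_transform_within_open[OF has_derivative_const, of "- cball z r'"])
          (auto simp: supp)
      then show ?thesis by (auto simp: differentiable_def)
    qed
    have pdn: "pd j (\<lambda>x. G x $ j) = (\<lambda>x. pd j G x $ j)" for j
      using pd_vec_nth[OF diff] by (intro ext) simp
    have "continuous_on (E \<union> - cball z r') (pd j G)" for j
    proof (rule continuous_on_open_Un[OF E(1)])
      show "continuous_on (- cball z r') (pd j G)"
        by (rule continuous_on_eq[OF continuous_on_const[of _ 0]])
          (simp add: off(1))
    qed (use G in \<open>auto simp: flux_field_def\<close>)
    then have cont: "continuous_on UNIV (\<lambda>x. pd j G x $ j)" for j
      unfolding cover by (intro continuous_intros)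
    have "(\<lambda>x. G x $ j) differentiable at x" for j x
      using diff[of x] unfolding differentiable_def
      by (blast intro: bounded_linear.has_derivative[OF bounded_linear_vec_nth])
    then have int: "integrable lborel (\<lambda>x. pd j G x $ j)" "(LINT x|lborel. pd j G x $ j) = 0" for j
      using integral_pd_compact_support[of "\<lambda>x. G x $ j" j z r', unfolded pdn] cont supp by auto
    have "(LINT x:E|lborel. vdiv G x) = (LINT x|lborel. vdiv G x)"
      unfolding set_lebesgue_integral_def
    proof (rule Bochner_Integration.integral_cong)
      fix x show "indicator E x *\<^sub>R vdiv G x = vdiv G x"
      proof (cases "x \<in> E")
        case False
        then have "x \<notin> cball z r'" using sub by blast
        from off(2)[OF this] show ?thesis by simp
      qed simp
    qed simp
    also have "\<dots> = 0" unfolding vdiv_def using int by simp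
    also have "0 = (LINT y:frontier E|\<sigma>. G y \<bullet> outer_normal E y)"
    proof -
      have "G y = 0" if "y \<in> frontier E" for y
        using that sub E(1) by (intro supp) (auto simp: frontier_def interior_open)
      then have "(\<lambda>y. indicator (frontier E) y *\<^sub>R (G y \<bullet> outer_normal E y)) = (\<lambda>_. 0)"
        by (auto simp: indicator_def)
      then show ?thesis unfolding set_lebesgue_integral_def by simp
    qed
    finally show ?thesis .
  qed
  with r(1) show ?thesis by blast
next
  case False
  then have zf: "z \<in> frontier E" using z E(1) by (simp add: frontier_def interior_open)
  obtain r \<pi> s g where "boundary_chart \<pi> s g E z r"
    using smooth_boundary_chart[OF E(1,3) zf] .
  then interpret boundary_chart \<pi> s g E z r .
  have "(LINT x:E|lborel. vdiv G x) = (LINT y:frontier E|\<sigma>. G y \<bullet> outer_normal E y)"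
    if G: "flux_field E G" and r': "r' < r" and supp: "\<And>x. x \<notin> cball z r' \<Longrightarrow> G x = 0" for G r'
  proof -
    obtain D where D: "\<And>x. x \<in> E \<Longrightarrow> \<bar>vdiv G x\<bar> \<le> D"
      using G unfolding flux_field_def bounded_iff by force
    have "continuous_on (frontier E) (\<lambda>x. G x \<bullet> outer_normal E x)"
      using G continuous_on_outer_normal[OF E(1,3)] unfolding flux_field_def
      by (intro continuous_on_inner) (auto intro: continuous_on_subset simp: frontier_def)
    then have "(\<lambda>x. indicator (frontier E) x *\<^sub>R (G x \<bullet> outer_normal E x)) \<in> borel_measurable borel"
      by (intro borel_measurable_continuous_on_indicator) auto
    then show ?thesis
      using G by (intro divergence_boundary_chart[OF surf r' _ _ _ supp D]) (auto simp: flux_field_def)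
  qed
  with r_pos show ?thesis by blast
qed

text \<open>Polynomial inside the ball, zero outside, with a continuous derivative across the
  sphere.\<close>

definition bump :: "vec3 \<Rightarrow> real \<Rightarrow> vec3 \<Rightarrow> real" where
  "bump z r x = (max 0 (r\<^sup>2 - (x - z) \<bullet> (x - z)))\<^sup>2"

text \<open>The differential of \<open>bump z r\<close> at \<open>x\<close>. The factor -4 is the
  product of the 2 from the outer square and the -2 from the inner one.\<close>

definition bump' :: "vec3 \<Rightarrow> real \<Rightarrow> vec3 \<Rightarrow> vec3 \<Rightarrow> real" where
  "bump' z r x v = - 4 * max 0 (r\<^sup>2 - (x - z) \<bullet> (x - z)) * ((x - z) \<bullet> v)"

lemma bump_has_derivative: "(bump z r has_derivative bump' z r x) (at x)"
proof -
  have d: "((\<lambda>x. r\<^sup>2 - (x - z) \<bullet> (x - z)) has_derivative (\<lambda>v. - 2 * ((x - z) \<bullet> v))) (at x)"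
    by (rule derivative_eq_intros refl | simp add: inner_commute)+
  show ?thesis
    unfolding bump_def[abs_def] bump'_def[abs_def]
    using DERIV_compose_FDERIV[OF has_real_derivative_pos_part_squared d] by (simp add: mult_ac)
qed

lemma bump_nonneg: "0 \<le> bump z r x"
  by (simp add: bump_def)

lemma bump_pos_iff:
  assumes "0 < r" shows "0 < bump z r x \<longleftrightarrow> x \<in> ball z r"
proof -
  have "0 < bump z r x \<longleftrightarrow> (x - z) \<bullet> (x - z) < r\<^sup>2"
    by (auto simp: bump_def max_def)
  also have "\<dots> \<longleftrightarrow> norm (x - z) < r"
    unfolding power2_norm_eq_inner[symmetric] using assms by (auto intro: power_strict_mono dest: power2_less_imp_less)
  finally show ?thesis by (simp add: dist_norm norm_minus_commute)
qed

lemma continuous_on_bump: "continuous_on S (bump z r)" "continuous_on S (\<lambda>x. bump' z r x v)"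
  unfolding bump_def bump'_def by (intro continuous_intros)+

theorem divergence_theorem:
  assumes E: "open E" "bounded E" "smooth_boundary E" and surf: "is_surface_measure E \<sigma>"
    and F: "flux_field E F"
  shows "(LINT x:E|lborel. vdiv F x) = (LINT y:frontier E|\<sigma>. F y \<bullet> outer_normal E y)"
proof -
  have cptE: "compact (closure E)" using E(2) by (simp add: compact_closure)
  have EcE: "E \<subseteq> closure E" by (rule closure_subset)
  obtain r where r: "\<And>z. z \<in> closure E \<Longrightarrow> 0 < r z"
    "\<And>z G r'. z \<in> closure E \<Longrightarrow> flux_field E G \<Longrightarrow> r' < r z \<Longrightarrow> (\<And>x. x \<notin> cball z r' \<Longrightarrow> G x = 0) \<Longrightarrow>
      (LINT x:E|lborel. vdiv G x) = (LINT y:frontier E|\<sigma>. G y \<bullet> outer_normal E y)"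
  proof -
    define Q where "Q z r \<longleftrightarrow> r > 0 \<and> (\<forall>G r'. flux_field E G \<longrightarrow> r' < r \<longrightarrow> (\<forall>x. x \<notin> cball z r' \<longrightarrow> G x = 0) \<longrightarrow>
      (LINT x:E|lborel. vdiv G x) = (LINT y:frontier E|\<sigma>. G y \<bullet> outer_normal E y))" for z r
    have "\<forall>z\<in>closure E. \<exists>r. Q z r"
      using local_divergence[OF E surf] unfolding Q_def by blast
    from bchoice[OF this] obtain r where r: "\<forall>z\<in>closure E. Q z (r z)" ..
    show thesis
    proof (rule that)
      show "0 < r z" if "z \<in> closure E" for z
        using r that by (simp add: Q_def)
      show "(LINT x:E|lborel. vdiv G x) = (LINT y:frontier E|\<sigma>. G y \<bullet> outer_normal E y)"
        if "z \<in> closure E" "flux_field E G" "r' < r z" "\<And>x. x \<notin> cball z r' \<Longrightarrow> G x = 0" for z G r'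
        using r that unfolding Q_def by blast
    qed
  qed
  \<comment> \<open>Half radii: the functions of the partition are then supported in closed balls
    that lie strictly inside the balls where the local theorem holds.\<close>
  obtain Z where Z: "Z \<subseteq> closure E" "finite Z" "closure E \<subseteq> (\<Union>z\<in>Z. ball z (r z / 2))"
    using r(1) by (rule_tac compactE_image[OF cptE, of "closure E" "\<lambda>z. ball z (r z / 2)"]) auto
  define b where "b z = bump z (r z / 2)" for z
  define b' where "b' z = bump' z (r z / 2)" for z
  define \<Phi> where "\<Phi> x = (\<Sum>z\<in>Z. b z x)" for x
  define \<Phi>' where "\<Phi>' x v = (\<Sum>z\<in>Z. b' z x v)" for x v
  define \<psi> where "\<psi> z x = b z x / \<Phi> x" for z x
  define \<psi>' where "\<psi>' z x v = (b' z x v * \<Phi> x - b z x * \<Phi>' x v) / (\<Phi> x * \<Phi> x)" for z x v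
  define G where "G z x = \<psi> z x *\<^sub>R F x" for z x
  have pos: "\<Phi> x > 0" if x: "x \<in> closure E" for x
  proof -
    obtain z where z: "z \<in> Z" "x \<in> ball z (r z / 2)" using Z(3) x by blast
    then have "0 < b z x" using bump_pos_iff[of "r z / 2" z x] r(1)[of z] Z(1) by (auto simp: b_def)
    then show ?thesis unfolding \<Phi>_def using z Z(2)
      by (intro sum_pos2[of _ z]) (auto simp: b_def bump_nonneg)
  qed
  have d\<psi>: "(\<psi> z has_derivative \<psi>' z x) (at x)" if "x \<in> closure E" for z x
  proof -
    have "(\<Phi> has_derivative \<Phi>' x) (at x)"
      unfolding \<Phi>_def[abs_def] \<Phi>'_def[abs_def] b_def b'_def
      by (intro has_derivative_sum bump_has_derivative)
    moreover have "(b z has_derivative b' z x) (at x)"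
      unfolding b_def b'_def by (rule bump_has_derivative)
    ultimately show ?thesis
      unfolding \<psi>_def[abs_def] \<psi>'_def[abs_def] using pos[OF that]
      by (intro has_derivative_divide') auto
  qed
  have cb: "continuous_on S (b z)" "continuous_on S (\<lambda>x. b' z x v)" for S z v
    unfolding b_def b'_def by (rule continuous_on_bump)+
  have c\<Phi>: "continuous_on S \<Phi>" "continuous_on S (\<lambda>x. \<Phi>' x v)" for S v
    unfolding \<Phi>_def \<Phi>'_def by (intro continuous_intros cb)+
  have c\<psi>: "continuous_on (closure E) (\<psi> z)" "continuous_on (closure E) (\<lambda>x. \<psi>' z x v)" for z v
    unfolding \<psi>_def \<psi>'_def by (intro continuous_intros cb c\<Phi>; use pos in force)+
  have dG: "(G z has_derivative (\<lambda>v. \<psi> z x *\<^sub>R (\<Sum>j\<in>UNIV. v $ j *\<^sub>R pd j F x) + \<psi>' z x v *\<^sub>R F x)) (at x)"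
    if "x \<in> E" for z x
    unfolding G_def[abs_def]
    by (intro has_derivative_scaleR d\<psi> has_derivative_pd) (use that EcE F in \<open>auto simp: flux_field_def\<close>)
  have pdG: "pd j (G z) x = \<psi> z x *\<^sub>R pd j F x + \<psi>' z x (axis j 1) *\<^sub>R F x" if "x \<in> E" for j z x
  proof -
    have "(\<Sum>l\<in>UNIV. (axis j 1 :: vec3) $ l *\<^sub>R pd l F x) = (\<Sum>l\<in>UNIV. if l = j then pd l F x else 0)"
      by (intro sum.cong) (auto simp: axis_def)
    then show ?thesis using pd_eqI[OF dG[OF that], of j z] by simp
  qed
  \<comment> \<open>The second term involves only \<open>F\<close> and the derivatives of \<psi>,
    which are continuous on the compact closure. So boundedness of the divergence passes from
    \<open>F\<close> to every piece.\<close>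
  have vdG: "vdiv (G z) x = \<psi> z x * vdiv F x + (\<Sum>j\<in>UNIV. \<psi>' z x (axis j 1) * F x $ j)" if "x \<in> E" for z x
    by (simp add: vdiv_def pdG[OF that] sum.distrib sum_distrib_left)
  have FF: "continuous_on (closure E) F" "bounded (vdiv F ` E)" "\<And>j. continuous_on E (pd j F)"
    using F by (auto simp: flux_field_def)
  have flux: "flux_field E (G z)" for z
    unfolding flux_field_def
  proof (intro conjI ballI allI)
    show "continuous_on (closure E) (G z)"
      unfolding G_def by (intro continuous_intros c\<psi> FF)
    show "G z differentiable at x" if "x \<in> E" for x
      using dG[OF that] by (auto simp: differentiable_def)
    have "continuous_on E (\<lambda>x. \<psi> z x *\<^sub>R pd j F x + \<psi>' z x (axis j 1) *\<^sub>R F x)" for j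
      by (intro continuous_intros FF continuous_on_subset[OF c\<psi>(1)] continuous_on_subset[OF c\<psi>(2)]
          continuous_on_subset[OF FF(1)] EcE)
    then show "continuous_on E (pd j (G z))" for j
      by (rule continuous_on_eq) (simp add: pdG)
    have "bounded ((\<lambda>x. \<Sum>j\<in>UNIV. \<psi>' z x (axis j 1) * F x $ j) ` closure E)"
      by (intro compact_imp_bounded compact_continuous_image continuous_intros c\<psi> FF cptE)
    then obtain C1 where C1: "\<And>x. x \<in> closure E \<Longrightarrow> \<bar>\<Sum>j\<in>UNIV. \<psi>' z x (axis j 1) * F x $ j\<bar> \<le> C1"
      unfolding bounded_iff by force
    have "bounded (\<psi> z ` closure E)"
      by (intro compact_imp_bounded compact_continuous_image c\<psi> cptE)
    then obtain C2 where C2: "\<And>x. x \<in> closure E \<Longrightarrow> \<bar>\<psi> z x\<bar> \<le> C2"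
      unfolding bounded_iff by force
    obtain C3 where C3: "\<And>x. x \<in> E \<Longrightarrow> \<bar>vdiv F x\<bar> \<le> C3"
      using FF(2) unfolding bounded_iff by force
    have "norm (vdiv (G z) x) \<le> C2 * C3 + C1" if "x \<in> E" for x
    proof -
      have "\<bar>\<psi> z x * vdiv F x\<bar> \<le> C2 * C3"
        unfolding abs_mult using C2[of x] C3[OF that] that EcE by (intro mult_mono) auto
      then show ?thesis unfolding vdG[OF that] using C1[of x] that EcE by (auto intro: order_trans[OF abs_triangle_ineq])
    qed
    then show "bounded (vdiv (G z) ` E)" unfolding bounded_iff by blast
  qed
  have sumF: "(\<Sum>z\<in>Z. G z x) = F x" if "x \<in> closure E" for x
  proof -
    have "(\<Sum>z\<in>Z. \<psi> z x) = 1"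
      unfolding \<psi>_def sum_divide_distrib[symmetric] using pos[OF that] by (simp add: \<Phi>_def)
    then show ?thesis unfolding G_def by (simp flip: scaleR_sum_left)
  qed
  have vdF: "vdiv F x = (\<Sum>z\<in>Z. vdiv (G z) x)" if "x \<in> E" for x
  proof -
    have "pd j F x = (\<Sum>z\<in>Z. pd j (G z) x)" for j
    proof -
      have "pd j F x = pd j (\<lambda>x. \<Sum>z\<in>Z. G z x) x"
        by (rule pd_cong_open[OF E(1) that]) (use sumF EcE in force)
      also have "\<dots> = (\<Sum>z\<in>Z. pd j (G z) x)"
        by (rule pd_eqI[OF has_derivative_sum, of _ _ "\<lambda>z. frechet_derivative (G z) (at x)", folded pd_def])
          (use flux that in \<open>simp add: flux_field_def frechet_derivative_works[symmetric]\<close>)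
      finally show ?thesis .
    qed
    then show ?thesis by (simp add: vdiv_def sum.swap[of _ UNIV Z])
  qed
  \<comment> \<open>Off the closed half ball the numerator of \<psi> is 0, whatever the denominator;
    \<Phi> is known to be positive only on the closure of the particle.\<close>
  have local: "(LINT x:E|lborel. vdiv (G z) x) = (LINT y:frontier E|\<sigma>. G z y \<bullet> outer_normal E y)" if "z \<in> Z" for z
  proof (rule r(2)[of z "G z" "r z / 2"])
    show "G z x = 0" if "x \<notin> cball z (r z / 2)" for x
    proof -
      have "\<not> 0 < b z x" using that bump_pos_iff[of "r z / 2" z x] r(1)[of z] Z(1) \<open>z \<in> Z\<close> by (auto simp: b_def)
      then have "b z x = 0" using bump_nonneg[of z "r z / 2" x] by (simp add: b_def)
      then show ?thesis by (simp add: G_def \<psi>_def)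
    qed
    show "r z / 2 < r z" using r(1) that Z(1) by auto
  qed (use that Z(1) flux in auto)
  have "(LINT x:E|lborel. vdiv F x) = (LINT x:E|lborel. (\<Sum>z\<in>Z. vdiv (G z) x))"
    by (rule set_lebesgue_integral_cong) (use E(1) vdF in auto)
  also have "\<dots> = (\<Sum>z\<in>Z. LINT x:E|lborel. vdiv (G z) x)"
    unfolding set_lebesgue_integral_def scaleR_sum_right
    using flux_field_integrable[OF E(1,2) flux] unfolding set_integrable_def
    by (intro Bochner_Integration.integral_sum)
  also have "\<dots> = (\<Sum>z\<in>Z. LINT y:frontier E|\<sigma>. G z y \<bullet> outer_normal E y)"
    using local by simp
  also have "\<dots> = (LINT y:frontier E|\<sigma>. (\<Sum>z\<in>Z. G z y \<bullet> outer_normal E y))"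
  proof -
    have "set_integrable \<sigma> (frontier E) (\<lambda>y. G z y \<bullet> outer_normal E y)" for z
      using flux[of z] continuous_on_outer_normal[OF E(1,3)] unfolding flux_field_def
      by (intro surface_integrable[OF E surf] continuous_on_inner)
        (auto intro: continuous_on_subset simp: frontier_def)
    then show ?thesis
      unfolding set_lebesgue_integral_def scaleR_sum_right set_integrable_def
      by (intro Bochner_Integration.integral_sum[symmetric])
  qed
  also have "\<dots> = (LINT y:frontier E|\<sigma>. F y \<bullet> outer_normal E y)"
    unfolding set_lebesgue_integral_def
  proof (rule Bochner_Integration.integral_cong)
    fix y
    show "indicator (frontier E) y *\<^sub>R (\<Sum>z\<in>Z. G z y \<bullet> outer_normal E y) =
        indicator (frontier E) y *\<^sub>R (F y \<bullet> outer_normal E y)"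
      using sumF[of y] by (cases "y \<in> frontier E") (auto simp: frontier_def simp flip: inner_sum_left)
  qed simp
  finally show ?thesis .
qed

section \<open>Traces and surface moments of the particle stress\<close>

lemma at_within_closure_nontrivial:
  fixes E :: "'a::{real_normed_vector,perfect_space} set"
  assumes "open E" "x \<in> closure E"
  shows "at x within E \<noteq> bot"
proof (cases "x \<in> E")
  case True
  then show ?thesis by (simp only: at_within_open[OF True assms(1)] at_neq_bot not_False_eq_True)
next
  case False
  then have "x islimpt E" using assms(2) by (simp add: closure_def)
  then show ?thesis by (simp add: trivial_limit_within)
qed

text \<open>Values of \<open>f\<close> near x are close to \<open>l x\<close>, and
  \<open>l y\<close> for a neighbouring y is itself a limit of such values. The closed ball of
  radius e / 2 keeps that limit at a distance below e.\<close>

lemma continuous_on_limits: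
  fixes f :: "'a::{real_normed_vector,perfect_space} \<Rightarrow> 'b::metric_space"
  assumes E: "open E" and lim: "\<And>x. x \<in> closure E \<Longrightarrow> (f \<longlongrightarrow> l x) (at x within E)"
  shows "continuous_on (closure E) l"
  unfolding continuous_on_iff
proof (intro ballI allI impI)
  fix x and e :: real assume x: "x \<in> closure E" and e: "e > 0"
  have "eventually (\<lambda>y. dist (f y) (l x) < e / 2) (at x within E)"
    using tendstoD[OF lim[OF x], of "e / 2"] e by simp
  then obtain d where d: "d > 0" "\<And>y. y \<in> E \<Longrightarrow> y \<noteq> x \<Longrightarrow> dist y x < d \<Longrightarrow> dist (f y) (l x) < e / 2"
    unfolding eventually_at by blast
  show "\<exists>d>0. \<forall>x'\<in>closure E. dist x' x < d \<longrightarrow> dist (l x') (l x) < e"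
  proof (intro exI[of _ d] conjI ballI impI d(1))
    fix y assume y: "y \<in> closure E" "dist y x < d"
    show "dist (l y) (l x) < e"
    proof (cases "y = x")
      case False
      \<comment> \<open>The point x is removed because the limit of \<open>f\<close> at x says
        nothing about \<open>f x\<close>.\<close>
      have "eventually (\<lambda>z. z \<in> ball x d - {x}) (at y within E)"
        using y(2) False by (intro topological_tendstoD[OF tendsto_ident_at]) (auto simp: dist_commute)
      moreover have "eventually (\<lambda>z. z \<in> E) (at y within E)"
        by (simp add: eventually_at_filter)
      ultimately have "eventually (\<lambda>z. f z \<in> cball (l x) (e / 2)) (at y within E)"
        by eventually_elim (use d(2) in \<open>force simp: dist_commute\<close>)
      from Lim_in_closed_set[OF closed_cball this at_within_closure_nontrivial[OF E y(1)] lim[OF y(1)]]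
      show ?thesis using e by (simp add: dist_commute)
    qed (use e in simp)
  qed
qed

lemma inner_trace_eq:
  assumes "open E" "x \<in> closure E" "(A \<longlongrightarrow> l) (at x within E)"
  shows "inner_trace E A x = l"
  unfolding inner_trace_def by (rule tendsto_Lim[OF at_within_closure_nontrivial[OF assms(1,2)] assms(3)])

lemma inner_trace_interior:
  assumes "open E" "x \<in> E" "continuous_on E A"
  shows "inner_trace E A x = A x"
  using assms by (intro inner_trace_eq) (auto simp: continuous_on_def intro: subsetD[OF closure_subset])

text \<open>The stress model supplies only a limit at each single boundary point. That these limits
  extend the stress continuously is what places it among the fields of the divergence
  theorem.\<close>

lemma continuous_on_inner_trace:
  assumes E: "open E" and A: "continuous_on E A"
    and lim: "\<And>x. x \<in> frontier E \<Longrightarrow> \<exists>l. (A \<longlongrightarrow> l) (at x within E)"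
  shows "continuous_on (closure E) (inner_trace E A)"
proof (rule continuous_on_limits[OF E, of A])
  fix x assume x: "x \<in> closure E"
  have "\<exists>l. (A \<longlongrightarrow> l) (at x within E)"
  proof (cases "x \<in> E")
    case True
    then show ?thesis using A by (auto simp: continuous_on_def)
  next
    case False
    then show ?thesis using x E by (intro lim) (simp add: frontier_def interior_open)
  qed
  then show "(A \<longlongrightarrow> inner_trace E A x) (at x within E)"
    using inner_trace_eq[OF E x] by auto
qed

section \<open>Dyadic products and the symmetric gradient\<close>

lemma bounded_linear_outer_left: "bounded_linear (\<lambda>v. outer v a)"
  unfolding linear_conv_bounded_linear[symmetric]
  by (rule linearI) (simp_all add: outer_def vec_eq_iff algebra_simps)

lemma bounded_linear_outer_right: "bounded_linear (outer a)"
  unfolding linear_conv_bounded_linear[symmetric]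
  by (rule linearI) (simp_all add: outer_def vec_eq_iff algebra_simps)

lemma outer_nth [simp]: "outer a b $ i $ j = a $ i * b $ j"
  by (simp add: outer_def)

lemma continuous_on_outer [continuous_intros]:
  assumes "continuous_on S f" "continuous_on S g"
  shows "continuous_on S (\<lambda>x. outer (f x) (g x))"
  unfolding outer_def by (intro continuous_intros assms)

lemma continuous_on_matrix_vector_mult:
  fixes A :: "'a::topological_space \<Rightarrow> mat3"
  assumes "continuous_on S A" "continuous_on S f"
  shows "continuous_on S (\<lambda>x. A x *v f x)"
  unfolding matrix_vector_mult_def by (intro continuous_intros assms)

lemma sym_grad_nth: "sym_grad f x $ i $ j = pd i f x $ j + pd j f x $ i"
  by (simp add: sym_grad_def grad_nth transpose_def)

text \<open>A sum of fixed linear maps applied to the partial derivatives; in this form regularity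
  of the partial derivatives carries over to the symmetric gradient.\<close>

lemma sym_grad_eq_sum:
  "sym_grad f x = (\<Sum>i\<in>UNIV. outer (axis i 1) (pd i f x) + outer (pd i f x) (axis i 1))"
proof -
  have "(\<Sum>i\<in>UNIV. (axis i 1 :: vec3) $ a * pd i f x $ b + pd i f x $ a * (axis i 1 :: vec3) $ b) =
      pd a f x $ b + pd b f x $ a" for a b
  proof -
    have "(\<Sum>i\<in>UNIV. (axis i 1 :: vec3) $ a * pd i f x $ b + pd i f x $ a * (axis i 1 :: vec3) $ b) =
      (\<Sum>i\<in>UNIV. (if i = a then pd i f x $ b else 0) + (if i = b then pd i f x $ a else 0))"
      by (intro sum.cong) (auto simp: axis_def)
    then show ?thesis by (simp add: sum.distrib)
  qed
  then show ?thesis by (simp add: vec_eq_iff sym_grad_nth)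
qed

lemma Cdiff_2_sym_grad:
  assumes "open E" "Cdiff 2 f E"
  shows "\<And>x. x \<in> E \<Longrightarrow> sym_grad f differentiable at x" "continuous_on E (pd j (sym_grad f))"
    "continuous_on E (sym_grad f)"
proof -
  have "Cdiff 1 (pd i f) E" for i
    using assms(2) by (simp add: numeral_2_eq_2 pd_def[abs_def])
  note C = Cdiff_1_D[OF this assms(1)]
  let ?L = "\<lambda>i v. outer (axis i 1) v + outer v (axis i 1)"
  have L: "bounded_linear (?L i)" for i
    by (intro bounded_linear_add bounded_linear_outer_left bounded_linear_outer_right)
  have eq: "sym_grad f = (\<lambda>x. \<Sum>i\<in>UNIV. ?L i (pd i f x))"
    by (simp add: sym_grad_eq_sum fun_eq_iff)
  have D: "(sym_grad f has_derivative (\<lambda>v. \<Sum>i\<in>UNIV. ?L i (\<Sum>j\<in>UNIV. v $ j *\<^sub>R pd j (pd i f) x))) (at x)"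
    if "x \<in> E" for x
    unfolding eq
    by (intro has_derivative_sum bounded_linear.has_derivative[OF L] has_derivative_pd C(1) that)
  then show diff: "\<And>x. x \<in> E \<Longrightarrow> sym_grad f differentiable at x"
    by (auto simp: differentiable_def)
  have "continuous_on E (\<lambda>x. \<Sum>i\<in>UNIV. ?L i (\<Sum>l\<in>UNIV. (axis j 1 :: vec3) $ l *\<^sub>R pd l (pd i f) x))"
    by (intro continuous_intros C(2))
  then show "continuous_on E (pd j (sym_grad f))"
    by (rule continuous_on_eq) (simp only: pd_eqI[OF D])
  show "continuous_on E (sym_grad f)"
    using diff assms(1) by (simp add: differentiable_imp_continuous_on differentiable_on_eq_differentiable_at)
qed

text \<open>The particle stress is an integral over the whole space against a measure carried by the
  boundary, whereas the divergence theorem uses the integral over the boundary. Measurability off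
  the boundary is what allows passing from one to the other.\<close>

lemma surface_integral_eq_set_integral:
  fixes f :: "vec3 \<Rightarrow> 'b::{banach,second_countable_topology}"
  assumes E: "open E" "bounded E" "smooth_boundary E" and surf: "is_surface_measure E \<sigma>"
    and f: "f \<in> borel_measurable borel" "continuous_on (frontier E) f"
  shows "integrable \<sigma> f" "(LINT y|\<sigma>. f y) = (LINT y:frontier E|\<sigma>. f y)"
proof -
  have sets: "sets \<sigma> = sets borel" and null: "emeasure \<sigma> (- frontier E) = 0"
    using surf by (simp_all add: is_surface_measure_def)
  have "- frontier E \<in> null_sets \<sigma>"
    using null by (simp add: null_sets_def sets)
  then have "AE y in \<sigma>. y \<in> frontier E"
    by (rule AE_I') auto
  then have ae: "AE y in \<sigma>. indicator (frontier E) y *\<^sub>R f y = f y"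
    by eventually_elim simp
  have fm: "f \<in> borel_measurable \<sigma>"
    using f(1) measurable_cong_sets[OF sets refl] by blast
  have si: "integrable \<sigma> (\<lambda>y. indicator (frontier E) y *\<^sub>R f y)"
    using surface_integrable[OF E surf f(2)] by (simp add: set_integrable_def)
  then show "integrable \<sigma> f"
    by (subst integrable_cong_AE[OF fm _ AE_mp[OF ae]]) auto
  show "(LINT y|\<sigma>. f y) = (LINT y:frontier E|\<sigma>. f y)"
    unfolding set_lebesgue_integral_def using si ae fm
    by (intro integral_cong_AE) auto
qed

text \<open>Off the surface, where the integrand of the particle stress has no meaning, it is still
  measurable: normal and trace are constant inside the particle.\<close>

lemma borel_measurable_traction:
  assumes E: "open E" "smooth_boundary E" and A: "continuous_on (- closure E) A"
    and c: "continuous_on (frontier E) (\<lambda>y. outer_trace E A y *v outer_normal E y)"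
  shows "(\<lambda>y. outer_trace E A y *v outer_normal E y) \<in> borel_measurable borel"
proof (rule borel_measurable_piecewise[of "frontier E" E "- closure E"])
  have "outer_trace E A y = Lim bot A" if "y \<in> E" for y
  proof -
    have "at y within - closure E = bot"
    proof -
      have "E \<inter> (- closure E - {y}) = {}" using closure_subset by blast
      then have "E \<inter> closure (- closure E - {y}) = {}"
        using open_Int_closure_eq_empty[OF E(1)] by blast
      then show ?thesis using that unfolding at_within_eq_bot_iff by blast
    qed
    then show ?thesis by (simp add: outer_trace_def)
  qed
  then show "continuous_on E (\<lambda>y. outer_trace E A y *v outer_normal E y)"
    by (intro continuous_on_eq[OF continuous_on_const[of E "Lim bot A *v (THE n. False)"]])
      (use E in \<open>auto simp: outer_normal_off_frontier frontier_def interior_open\<close>)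
  have "outer_trace E A y = A y" if "y \<in> - closure E" for y
  proof -
    have "at y within - closure E = at y"
      by (rule at_within_open[OF that]) auto
    then have "at y within - closure E \<noteq> bot"
      by (simp only: at_neq_bot not_False_eq_True)
    moreover have "(A \<longlongrightarrow> A y) (at y within - closure E)"
      using A that unfolding continuous_on_def by blast
    ultimately show ?thesis unfolding outer_trace_def by (rule tendsto_Lim)
  qed
  then have eq: "A y *v (THE n. False) = outer_trace E A y *v outer_normal E y" if "y \<in> - closure E" for y
    using that outer_normal_off_frontier[OF E(1), of y] by (simp add: frontier_def)
  have "continuous_on (- closure E) (\<lambda>y. A y *v (THE n. False))"
    by (intro continuous_on_matrix_vector_mult A continuous_on_const)
  from continuous_on_eq[OF this eq]
  show "continuous_on (- closure E) (\<lambda>y. outer_trace E A y *v outer_normal E y)" .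
qed (use E c closure_subset[of E] in \<open>auto simp: frontier_def interior_open\<close>)

section \<open>Volume, centre of mass and surface moment of the reference particle\<close>

lemma reference_particleD:
  assumes "valid_config S"
  shows "open (shape S)" "bounded (shape S)" "smooth_boundary (shape S)"
    "is_surface_measure (shape S) (area S)" "(LINT y:shape S|lborel. y) = 0" "0 < vol S"
    "emeasure lborel (shape S) < \<infinity>"
proof -
  have ref: "reference_particle (shape S)" and "is_surface_measure (shape S) (area S)"
    using assms by (auto simp: valid_config_def)
  then show "open (shape S)" "bounded (shape S)" "smooth_boundary (shape S)"
    "is_surface_measure (shape S) (area S)" "(LINT y:shape S|lborel. y) = 0"
    by (auto simp: reference_particle_def)
  then show fin: "emeasure lborel (shape S) < \<infinity>"
    using emeasure_bounded_finite by blast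
  have "shape S \<notin> null_sets lborel"
    using open_not_negligible[of "shape S"] ref
    by (auto simp: reference_particle_def negligible_iff_null_sets null_sets_completion_iff)
  then have "emeasure lborel (shape S) \<noteq> 0"
    using ref by (auto simp: reference_particle_def null_sets_def)
  then show "0 < vol S"
    using fin by (simp add: measure_def enn2real_positive_iff zero_less_iff_neq_zero less_top)
qed

lemma centre_of_mass_component:
  assumes "valid_config S"
  shows "set_integrable lborel (shape S) (\<lambda>y. y $ j)" "(LINT y:shape S|lborel. y $ j) = 0"
proof -
  note R = reference_particleD[OF assms]
  have i: "set_integrable lborel (shape S) (\<lambda>y. y)"
    by (rule set_integrable_bounded_continuous) (use R in auto)
  have "(LINT y:shape S|lborel. y) $ j = (LINT y:shape S|lborel. y $ j)"
    unfolding set_lebesgue_integral_def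
    using integral_bounded_linear[OF bounded_linear_vec_nth[of j] i[unfolded set_integrable_def]] by simp
  then show "(LINT y:shape S|lborel. y $ j) = 0" using R(5) by simp
  show "set_integrable lborel (shape S) (\<lambda>y. y $ j)"
    using integrable_bounded_linear[OF bounded_linear_vec_nth[of j] i[unfolded set_integrable_def]]
    by (simp add: set_integrable_def)
qed

text \<open>The divergence theorem for \<open>y \<otimes> T - h \<otimes> I - I \<otimes> h\<close>: since the body force is constant and the centre
  of mass is 0, only the stress itself remains.\<close>

lemma particle_stress_moment:
  assumes S: "valid_config S" and prob: "particle_stress_problem S (\<lambda>_. c) A lam"
    and A: "continuous_on (- closure (shape S)) A"
    and h: "\<And>x. (h has_derivative (\<lambda>v. B *v v)) (at x)"
  shows "(LINT y|area S. outer (outer_trace (shape S) A y *v nrm S y) y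
             - outer (h y) (nrm S y) - outer (nrm S y) (h y)) =
    (LINT y:shape S|lborel. sym_grad lam y - sym_grad h y)"
proof -
  let ?E = "shape S" and ?\<sigma> = "area S"
  note R = reference_particleD[OF S]
  note openE = R(1)
  define T where "T = sym_grad lam"
  define Tb where "Tb = inner_trace ?E T"
  have lam: "Cdiff 2 lam ?E" and lim: "\<And>y. y \<in> frontier ?E \<Longrightarrow> \<exists>l. (T \<longlongrightarrow> l) (at y within ?E)"
    and div: "\<And>y. y \<in> ?E \<Longrightarrow> mdiv T y = c"
    and trac: "\<And>y. y \<in> frontier ?E \<Longrightarrow> Tb y *v nrm S y = outer_trace ?E A y *v nrm S y"
    using prob unfolding particle_stress_problem_def T_def Tb_def by auto
  note T = Cdiff_2_sym_grad[OF openE lam, folded T_def]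
  have cTb: "continuous_on (closure ?E) Tb"
    unfolding Tb_def by (rule continuous_on_inner_trace[OF openE T(3) lim])
  have TbE: "Tb y = T y" if "y \<in> ?E" for y
    unfolding Tb_def by (rule inner_trace_interior[OF openE that T(3)])
  have cn: "continuous_on (frontier ?E) (nrm S)"
    by (rule continuous_on_outer_normal[OF R(1,3)])
  have fr: "frontier ?E \<subseteq> closure ?E" by (simp add: frontier_def)
  have ch: "continuous_on X h" for X
    using h by (meson continuous_at_imp_continuous_on has_derivative_continuous)
  have ctr: "continuous_on (frontier ?E) (\<lambda>y. outer_trace ?E A y *v nrm S y)"
    by (rule continuous_on_eq[OF continuous_on_matrix_vector_mult[OF continuous_on_subset[OF cTb fr] cn]])
      (simp add: trac)
  define I where "I y = outer (outer_trace ?E A y *v nrm S y) y - outer (h y) (nrm S y) - outer (nrm S y) (h y)" for y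
  have Imeas: "I \<in> borel_measurable borel"
  proof -
    have [measurable]: "(\<lambda>y. outer_trace ?E A y *v nrm S y) \<in> borel_measurable borel"
      by (rule borel_measurable_traction[OF R(1,3) A ctr])
    have [measurable]: "nrm S \<in> borel_measurable borel"
      by (rule borel_measurable_outer_normal[OF R(1,3)])
    have [measurable]: "h \<in> borel_measurable borel"
      by (rule borel_measurable_continuous_onI[OF ch])
    have o: "(\<lambda>y. outer (f y) (g y)) \<in> borel_measurable borel"
      if "f \<in> borel_measurable borel" "g \<in> borel_measurable borel" for f g :: "vec3 \<Rightarrow> vec3"
    proof -
      have "(\<lambda>p. outer (fst p) (snd p)) \<in> borel_measurable (borel :: (vec3 \<times> vec3) measure)"
        by (intro borel_measurable_continuous_onI continuous_intros)
      from measurable_compose[OF borel_measurable_Pair[OF that] this] show ?thesis by simp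
    qed
    show ?thesis unfolding I_def[abs_def] by (intro borel_measurable_diff o) measurable
  qed
  have cI: "continuous_on (frontier ?E) I"
    unfolding I_def[abs_def] by (intro continuous_intros ctr cn ch)
  note surf = surface_integral_eq_set_integral[OF R(1-4) Imeas cI]
  have sh: "sym_grad h y $ i $ j = B $ j $ i + B $ i $ j" for y i j
    unfolding sym_grad_nth pd_eqI[OF h] by (simp add: matrix_vector_mul_component inner_axis)
  have bT: "set_integrable lborel ?E T"
  proof (rule set_integrable_bounded_continuous[OF R(1,2) T(3)])
    have "bounded (Tb ` closure ?E)"
      using R(2) by (intro compact_imp_bounded compact_continuous_image cTb) (simp add: compact_closure)
    then show "bounded (T ` ?E)"
      by (rule bounded_subset) (use TbE closure_subset in force)
  qed
  have csh: "sym_grad h = (\<lambda>y. transpose B + B)"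
    by (simp add: fun_eq_iff vec_eq_iff sh transpose_def)
  have bV: "set_integrable lborel ?E (\<lambda>y. sym_grad h y)"
    unfolding csh by (rule set_integrable_bounded_continuous[OF R(1,2)]) (auto simp: image_constant_conv)
  note i12 = set_integral_diff(1)[OF bT bV]
  have nth: "(LINT y|M. f y) $ i $ j = (LINT y|M. f y $ i $ j)" if "integrable M f"
    for M :: "vec3 measure" and f :: "vec3 \<Rightarrow> mat3" and i j
    using integral_bounded_linear[OF bounded_linear_compose[OF bounded_linear_vec_nth[of j] bounded_linear_vec_nth[of i]] that] by simp
  have entry: "(LINT y:frontier ?E|?\<sigma>. I y $ i $ j) = (LINT y:?E|lborel. T y $ i $ j - sym_grad h y $ i $ j)" for i j
  proof -
    \<comment> \<open>The field that belongs to the entry (i, j). The row i of the stress weighted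
      with the coordinate j has divergence T i j + y j c i; the other two terms produce the
      corresponding entry of the symmetric gradient of \<open>h\<close>.\<close>
    define F where "F y = y $ j *\<^sub>R Tb y $ i - h y $ i *\<^sub>R axis j 1 - h y $ j *\<^sub>R axis i 1" for y
    have dF: "(F has_derivative (\<lambda>v. (y $ j *\<^sub>R (\<Sum>k\<in>UNIV. v $ k *\<^sub>R pd k T y) $ i + v $ j *\<^sub>R T y $ i)
        - (B *v v) $ i *\<^sub>R axis j 1 - (B *v v) $ j *\<^sub>R axis i 1)) (at y)" if y: "y \<in> ?E" for y
    proof -
      have "((\<lambda>y. y $ j *\<^sub>R T y $ i - h y $ i *\<^sub>R axis j 1 - h y $ j *\<^sub>R axis i 1) has_derivative
        (\<lambda>v. (y $ j *\<^sub>R (\<Sum>k\<in>UNIV. v $ k *\<^sub>R pd k T y) $ i + v $ j *\<^sub>R T y $ i)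
        - (B *v v) $ i *\<^sub>R axis j 1 - (B *v v) $ j *\<^sub>R axis i 1)) (at y)"
        by (intro has_derivative_diff has_derivative_scaleR has_derivative_scaleR_left
            bounded_linear.has_derivative[OF bounded_linear_vec_nth] has_derivative_ident
            has_derivative_pd T(1) y h)
      then show ?thesis
        by (rule has_derivative_transform_within_open[OF _ openE y]) (simp add: F_def TbE)
    qed
    have pdF: "pd k F y = y $ j *\<^sub>R pd k T y $ i + (if k = j then T y $ i else 0)
        - B $ i $ k *\<^sub>R axis j 1 - B $ j $ k *\<^sub>R axis i 1" if y: "y \<in> ?E" for k y
    proof -
      have "(\<Sum>l\<in>UNIV. (axis k 1 :: vec3) $ l *\<^sub>R pd l T y) = (\<Sum>l\<in>UNIV. if l = k then pd l T y else 0)"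
        by (intro sum.cong) (auto simp: axis_def)
      then have s: "(\<Sum>l\<in>UNIV. (axis k 1 :: vec3) $ l *\<^sub>R pd l T y) = pd k T y" by simp
      have b: "(B *v axis k 1) $ l = B $ l $ k" for l
        by (simp add: matrix_vector_mul_component inner_axis)
      show ?thesis unfolding pd_eqI[OF dF[OF y]] s b by (simp add: axis_def)
    qed
    have vdF: "vdiv F y = T y $ i $ j + y $ j * c $ i - sym_grad h y $ i $ j" if y: "y \<in> ?E" for y
    proof -
      have "vdiv F y = y $ j * (\<Sum>k\<in>UNIV. pd k T y $ i $ k) + (\<Sum>k\<in>UNIV. if k = j then T y $ i $ k else 0)
          - (\<Sum>k\<in>UNIV. if k = j then B $ i $ k else 0) - (\<Sum>k\<in>UNIV. if k = i then B $ j $ k else 0)"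
        unfolding vdiv_def pdF[OF y] sum_distrib_left sum.distrib[symmetric] sum_subtractf[symmetric]
        by (intro sum.cong) (auto simp: axis_def)
      also have "(\<Sum>k\<in>UNIV. pd k T y $ i $ k) = c $ i"
        using arg_cong[OF div[OF y], of "\<lambda>v. v $ i"] by (simp add: mdiv_def)
      finally show ?thesis by (simp add: sh)
    qed
    have cF: "continuous_on (closure ?E) F"
      unfolding F_def[abs_def] by (intro continuous_intros cTb ch)
    have flux: "flux_field ?E F"
      unfolding flux_field_def
    proof (intro conjI ballI allI)
      show "F differentiable at y" if "y \<in> ?E" for y
        using dF[OF that] by (auto simp: differentiable_def)
      have "continuous_on ?E (\<lambda>y. y $ j *\<^sub>R pd k T y $ i + (if k = j then T y $ i else 0)
        - B $ i $ k *\<^sub>R axis j 1 - B $ j $ k *\<^sub>R axis i 1)" for k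
        by (cases "k = j") (auto intro!: continuous_intros T)
      then show "continuous_on ?E (pd k F)" for k
        by (rule continuous_on_eq) (simp add: pdF)
      have "bounded ((\<lambda>y. Tb y $ i $ j + y $ j * c $ i - sym_grad h y $ i $ j) ` closure ?E)"
        unfolding sh using R(2)
        by (intro compact_imp_bounded compact_continuous_image continuous_intros cTb) (simp add: compact_closure)
      then show "bounded (vdiv F ` ?E)"
        by (rule bounded_subset) (use vdF TbE closure_subset in force)
    qed (rule cF)
    \<comment> \<open>On the boundary the interior and exterior tractions agree, so the exterior one
      in \<open>I\<close> may be replaced by that of the continuous extension
      \<open>Tb\<close>.\<close>
    have "(LINT y:frontier ?E|?\<sigma>. I y $ i $ j) = (LINT y:frontier ?E|?\<sigma>. F y \<bullet> nrm S y)"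
      unfolding set_lebesgue_integral_def
    proof (rule Bochner_Integration.integral_cong)
      fix y
      have "I y $ i $ j = F y \<bullet> nrm S y" if "y \<in> frontier ?E"
        unfolding I_def trac[OF that, symmetric]
        by (simp add: F_def inner_diff_left inner_axis' matrix_vector_mul_component algebra_simps)
      then show "indicator (frontier ?E) y *\<^sub>R (I y $ i $ j) = indicator (frontier ?E) y *\<^sub>R (F y \<bullet> nrm S y)"
        by (auto simp: indicator_def)
    qed simp
    also have "\<dots> = (LINT y:?E|lborel. vdiv F y)"
      by (rule divergence_theorem[OF R(1-4) flux, symmetric])
    also have "\<dots> = (LINT y:?E|lborel. (T y $ i $ j - sym_grad h y $ i $ j) + y $ j * c $ i)"
      by (rule set_lebesgue_integral_cong) (use openE in \<open>auto simp: vdF\<close>)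
    also have "\<dots> = (LINT y:?E|lborel. T y $ i $ j - sym_grad h y $ i $ j) + (LINT y:?E|lborel. y $ j * c $ i)"
    proof (rule set_integral_add(2))
      show "set_integrable lborel ?E (\<lambda>y. T y $ i $ j - sym_grad h y $ i $ j)"
        using integrable_bounded_linear[OF bounded_linear_compose[OF bounded_linear_vec_nth[of j] bounded_linear_vec_nth[of i]]
            i12[unfolded set_integrable_def]] by (simp add: set_integrable_def)
      show "set_integrable lborel ?E (\<lambda>y. y $ j * c $ i)"
        using centre_of_mass_component(1)[OF S] by (intro set_integrable_mult_left)
    qed
    also have "(LINT y:?E|lborel. y $ j * c $ i) = 0"
      using centre_of_mass_component(2)[OF S] by simp
    finally show ?thesis by simp
  qed
  have "(LINT y|?\<sigma>. I y) = (LINT y:?E|lborel. T y - sym_grad h y)"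
  proof -
    have si: "integrable ?\<sigma> (\<lambda>y. indicator (frontier ?E) y *\<^sub>R I y)"
      using surface_integrable[OF R(1-4) cI] by (simp add: set_integrable_def)
    have "(LINT y|?\<sigma>. I y) $ i $ j = (LINT y:?E|lborel. T y - sym_grad h y) $ i $ j" for i j
      using entry[of i j] unfolding surf(2) set_lebesgue_integral_def nth[OF si] nth[OF i12[unfolded set_integrable_def]]
      by simp
    then show ?thesis by (simp add: vec_eq_iff)
  qed
  then show ?thesis by (simp add: I_def T_def)
qed

section \<open>Change of variables on a particle\<close>

text \<open>Keeps products with a transposed rotation in the form \<open>transpose R *v v\<close>,
  on which the associativity rules for matrix products act.\<close>

declare transpose_matrix_vector [simp del]

text \<open>It suffices to measure preimages of boxes. Such a preimage is the image under the
  transposed matrix, and an orthogonal matrix has determinant 1 or -1.\<close>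

lemma lborel_distr_orthogonal:
  fixes R :: mat3
  assumes "orthogonal_matrix R"
  shows "distr lborel borel ((*v) R) = lborel"
proof (rule lborel_eqI[symmetric])
  have m: "(*v) R \<in> borel_measurable lborel"
    by (simp add: borel_measurable_continuous_onI linear_continuous_on)
  have inv: "transpose R ** R = mat 1" "R ** transpose R = mat 1"
    using assms by (auto simp: orthogonal_matrix_def)
  fix l u :: vec3 assume le: "\<And>b. b \<in> Basis \<Longrightarrow> l \<bullet> b \<le> u \<bullet> b"
  have vim: "(*v) R -` box l u = (*v) (transpose R) ` box l u"
  proof (intro equalityI subsetI)
    fix y assume "y \<in> (*v) R -` box l u"
    then show "y \<in> (*v) (transpose R) ` box l u"
      by (intro image_eqI[of _ _ "R *v y"]) (simp_all add: matrix_vector_mul_assoc inv)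
  qed (auto simp: matrix_vector_mul_assoc inv)
  have S: "(*v) R -` box l u \<in> sets borel"
    using measurable_sets[OF m, of "box l u"] by simp
  have lm: "(*v) (transpose R) ` box l u \<in> lmeasurable"
    by (intro measurable_linear_image) auto
  have det: "\<bar>det R\<bar> = 1"
    using det_orthogonal_matrix[OF assms] by auto
  have "emeasure (distr lborel borel ((*v) R)) (box l u) = emeasure lborel ((*v) R -` box l u)"
    using m by (subst emeasure_distr) auto
  also have "\<dots> = emeasure lebesgue ((*v) (transpose R) ` box l u)"
    unfolding vim[symmetric] using S by simp
  also have "\<dots> = ennreal (measure lebesgue ((*v) (transpose R) ` box l u))"
    using lm by (intro emeasure_eq_measure2) (auto simp: fmeasurable_def)
  also have "measure lebesgue ((*v) (transpose R) ` box l u) = measure lebesgue (box l u)"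
    by (subst measure_linear_image) (auto simp: det)
  also have "ennreal (measure lebesgue (box l u)) = ennreal (\<Prod>b\<in>Basis. (u - l) \<bullet> b)"
    using le by (simp add: measure_lborel_box_eq)
  finally show "emeasure (distr lborel borel ((*v) R)) (box l u) = ennreal (\<Prod>b\<in>Basis. (u - l) \<bullet> b)" .
qed simp

lemma set_integral_bounded_linear:
  assumes "bounded_linear T" "set_integrable M A f"
  shows "set_integrable M A (\<lambda>x. T (f x))" "(LINT x:A|M. T (f x)) = T (LINT x:A|M. f x)"
proof -
  have eq: "(\<lambda>x. indicator A x *\<^sub>R T (f x)) = (\<lambda>x. T (indicator A x *\<^sub>R f x))"
    by (simp add: linear_scale[OF bounded_linear.linear[OF assms(1)]])
  show "set_integrable M A (\<lambda>x. T (f x))"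
    unfolding set_integrable_def eq
    by (rule integrable_bounded_linear[OF assms(1) assms(2)[unfolded set_integrable_def]])
  show "(LINT x:A|M. T (f x)) = T (LINT x:A|M. f x)"
    unfolding set_lebesgue_integral_def eq
    by (rule integral_bounded_linear[OF assms(1) assms(2)[unfolded set_integrable_def]])
qed

lemma bounded_linear_congruence:
  fixes R Q :: mat3
  shows "bounded_linear (\<lambda>A. R ** A ** Q)"
  unfolding linear_conv_bounded_linear[symmetric]
  by (rule linearI) (simp_all add: matrix_matrix_mult_def vec_eq_iff sum_distrib_left sum_distrib_right
      sum.distrib algebra_simps)

lemma matrix_congruence_nth:
  fixes R A Q :: mat3
  shows "(R ** A ** transpose Q) $ i $ j = (\<Sum>b\<in>UNIV. (\<Sum>a\<in>UNIV. R $ i $ a * A $ a $ b) * Q $ j $ b)"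
  by (simp add: matrix_matrix_mult_def transpose_def)

section \<open>Local and global coordinates of a particle\<close>

definition global_coord :: "real \<Rightarrow> particle \<Rightarrow> real \<Rightarrow> vec3 \<Rightarrow> vec3" where
  "global_coord \<epsilon> P t y = \<epsilon> *\<^sub>R (rot P t *v y) + pos P t"

context
  fixes \<epsilon> :: real and P :: particle and t :: real
  assumes eps: "0 < \<epsilon>" and R: "rotation_matrix (rot P t)"
begin

lemma rot_inv:
  "transpose (rot P t) ** rot P t = mat 1" "rot P t ** transpose (rot P t) = mat 1"
  using R by (auto simp: rotation_matrix_def orthogonal_matrix_def)

lemma local_global_coord [simp]: "local_coord \<epsilon> P t (global_coord \<epsilon> P t y) = y"
  using eps by (simp add: local_coord_def global_coord_def matrix_vector_mul_assoc rot_inv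
      matrix_vector_mult_scaleR)

lemma global_local_coord [simp]: "global_coord \<epsilon> P t (local_coord \<epsilon> P t x) = x"
  using eps by (simp add: local_coord_def global_coord_def matrix_vector_mul_assoc rot_inv
      matrix_vector_mult_scaleR)

lemma body_eq_image: "body S \<epsilon> P t = global_coord \<epsilon> P t ` shape S"
  by (simp add: body_def global_coord_def)

lemma body_eq_vimage: "body S \<epsilon> P t = local_coord \<epsilon> P t -` shape S"
proof (intro equalityI subsetI)
  fix x assume "x \<in> local_coord \<epsilon> P t -` shape S"
  then show "x \<in> body S \<epsilon> P t"
    unfolding body_eq_image by (intro image_eqI[of _ _ "local_coord \<epsilon> P t x"]) auto
qed (auto simp: body_eq_image)

lemma local_coord_has_derivative:
  "(local_coord \<epsilon> P t has_derivative (\<lambda>v. (1 / \<epsilon>) *\<^sub>R (transpose (rot P t) *v v))) (at x)"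
proof -
  have "((\<lambda>x. x - pos P t) has_derivative (\<lambda>v. v)) (at x)"
    by (auto intro!: derivative_eq_intros)
  from has_derivative_scaleR_right[OF bounded_linear.has_derivative[OF matrix_vector_mul_bounded_linear this]]
  show ?thesis by (simp add: local_coord_def[abs_def])
qed

lemma continuous_on_local_coord: "continuous_on A (local_coord \<epsilon> P t)"
  using local_coord_has_derivative by (meson continuous_at_imp_continuous_on has_derivative_continuous)

lemma continuous_on_global_coord: "continuous_on A (global_coord \<epsilon> P t)"
  unfolding global_coord_def by (intro continuous_intros linear_continuous_on) auto

lemma open_body: "open (shape S) \<Longrightarrow> open (body S \<epsilon> P t)"
  unfolding body_eq_vimage by (rule open_vimage[OF _ continuous_on_local_coord])

text \<open>Rotation and translation preserve volume and the dilation multiplies it by \<epsilon>^3.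
  This is the power of \<epsilon> in front of every integral over a particle.\<close>

lemma distr_global_coord:
  "lborel = density (distr lborel borel (global_coord \<epsilon> P t)) (\<lambda>_. ennreal (\<epsilon> ^ 3))"
proof -
  have "lborel = density (distr lborel borel (\<lambda>x::vec3. pos P t + \<epsilon> *\<^sub>R x)) (\<lambda>_. ennreal (\<bar>\<epsilon>\<bar> ^ DIM(vec3)))"
    using eps by (intro lborel_affine) simp
  also have "distr lborel borel (\<lambda>x::vec3. pos P t + \<epsilon> *\<^sub>R x) =
      distr (distr lborel borel ((*v) (rot P t))) borel (\<lambda>x. pos P t + \<epsilon> *\<^sub>R x)"
    using R by (simp add: lborel_distr_orthogonal rotation_matrix_def)
  also have "\<dots> = distr lborel borel ((\<lambda>x. pos P t + \<epsilon> *\<^sub>R x) \<circ> (*v) (rot P t))"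
    by (rule distr_distr) (auto intro!: borel_measurable_continuous_onI continuous_intros linear_continuous_on)
  also have "(\<lambda>x. pos P t + \<epsilon> *\<^sub>R x) \<circ> (*v) (rot P t) = global_coord \<epsilon> P t"
    by (simp add: fun_eq_iff global_coord_def add.commute)
  finally show ?thesis using eps by simp
qed

text \<open>\<open>f\<close> has to be known in local coordinates only on the body; this suits
  gradients and divergences of local fields, whose formulas hold there.\<close>

lemma integral_body:
  fixes f :: "vec3 \<Rightarrow> 'b::{banach,second_countable_topology}"
  assumes k: "set_integrable lborel (shape S) k" and f: "\<And>x. x \<in> body S \<epsilon> P t \<Longrightarrow> f x = k (local_coord \<epsilon> P t x)"
  shows "set_integrable lborel (body S \<epsilon> P t) f"
    "(LINT \<xi>:body S \<epsilon> P t|lborel. f \<xi>) = \<epsilon> ^ 3 *\<^sub>R (LINT y:shape S|lborel. k y)"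
proof -
  define K where "K y = indicator (shape S) y *\<^sub>R k y" for y
  have K: "integrable lborel K" using k unfolding set_integrable_def K_def[abs_def] .
  have eq: "indicator (body S \<epsilon> P t) x *\<^sub>R f x = K (local_coord \<epsilon> P t x)" for x
    using f[of x] by (cases "local_coord \<epsilon> P t x \<in> shape S") (simp_all add: K_def body_eq_vimage)
  have lm: "local_coord \<epsilon> P t \<in> borel_measurable borel" "global_coord \<epsilon> P t \<in> borel_measurable borel"
    by (intro borel_measurable_continuous_onI continuous_on_local_coord continuous_on_global_coord)+
  have Km: "K \<in> borel_measurable borel" using K by auto
  have m: "(\<lambda>x. K (local_coord \<epsilon> P t x)) \<in> borel_measurable borel"
    by (rule measurable_compose[OF lm(1) Km])
  have "integrable (distr lborel borel (global_coord \<epsilon> P t)) (\<lambda>x. K (local_coord \<epsilon> P t x))"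
    using K m lm by (subst integrable_distr_eq) auto
  then show "set_integrable lborel (body S \<epsilon> P t) f"
    unfolding set_integrable_def eq using eps m
    by (subst distr_global_coord, subst integrable_density) auto
  have "(LINT \<xi>:body S \<epsilon> P t|lborel. f \<xi>) = (LINT x|lborel. K (local_coord \<epsilon> P t x))"
    unfolding set_lebesgue_integral_def eq ..
  also have "\<dots> = (LINT x|density (distr lborel borel (global_coord \<epsilon> P t)) (\<lambda>_. ennreal (\<epsilon> ^ 3)). K (local_coord \<epsilon> P t x))"
    using distr_global_coord by simp
  also have "\<dots> = \<epsilon> ^ 3 *\<^sub>R (LINT x|distr lborel borel (global_coord \<epsilon> P t). K (local_coord \<epsilon> P t x))"
    using eps m by (subst integral_density) auto
  also have "(LINT x|distr lborel borel (global_coord \<epsilon> P t). K (local_coord \<epsilon> P t x)) = (LINT y|lborel. K y)"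
    using m lm by (subst integral_distr) auto
  finally show "(LINT \<xi>:body S \<epsilon> P t|lborel. f \<xi>) = \<epsilon> ^ 3 *\<^sub>R (LINT y:shape S|lborel. k y)"
    by (simp add: set_lebesgue_integral_def K_def)
qed

text \<open>The chain rule gives the factor 1 / \<epsilon> and a conjugation by the rotation.
  Conjugation commutes with transposition, so the formula for the Jacobian is also the one for its
  transpose \<open>grad\<close>.\<close>

lemma grad_local_vel:
  assumes "lvel P t differentiable at (local_coord \<epsilon> P t x)"
  shows "grad (local_vel \<epsilon> P t) x =
    (1 / \<epsilon>) *\<^sub>R (rot P t ** grad (lvel P t) (local_coord \<epsilon> P t x) ** transpose (rot P t))"
proof -
  let ?R = "rot P t" and ?J = "jacobian (lvel P t) (at (local_coord \<epsilon> P t x))"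
  have J: "(lvel P t has_derivative (\<lambda>h. ?J *v h)) (at (local_coord \<epsilon> P t x))"
    using assms by (simp add: jacobian_works)
  have "(local_vel \<epsilon> P t has_derivative (\<lambda>v. ?R *v (?J *v ((1 / \<epsilon>) *\<^sub>R (transpose ?R *v v))))) (at x)"
    unfolding local_vel_def[abs_def]
    by (rule bounded_linear.has_derivative[OF matrix_vector_mul_bounded_linear
        has_derivative_compose[OF local_coord_has_derivative J]])
  also have "(\<lambda>v. ?R *v (?J *v ((1 / \<epsilon>) *\<^sub>R (transpose ?R *v v)))) =
      (*v) ((1 / \<epsilon>) *\<^sub>R (?R ** ?J ** transpose ?R))"
    by (simp add: fun_eq_iff matrix_vector_mult_scaleR matrix_vector_mul_assoc scaleR_matrix_vector_assoc
        matrix_mul_assoc matrix_scalar_ac flip: scalar_matrix_assoc)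
  finally have "frechet_derivative (local_vel \<epsilon> P t) (at x) = (*v) ((1 / \<epsilon>) *\<^sub>R (?R ** ?J ** transpose ?R))"
    using frechet_derivative_at by metis
  then have "jacobian (local_vel \<epsilon> P t) (at x) = (1 / \<epsilon>) *\<^sub>R (?R ** ?J ** transpose ?R)"
    by (simp add: jacobian_def)
  then show ?thesis
    by (simp add: grad_def transpose_scalar matrix_transpose_mul matrix_mul_assoc)
qed

text \<open>Of the three rotations, one from the inner derivative and two from the conjugated
  stress, two meet in the contracted index and cancel by orthogonality. One rotation and the factor
  1 / \<epsilon> remain.\<close>

lemma mdiv_local_str:
  assumes "lstr P t differentiable at (local_coord \<epsilon> P t x)"
  shows "mdiv (local_str \<epsilon> P t) x = (1 / \<epsilon>) *\<^sub>R (rot P t *v mdiv (lstr P t) (local_coord \<epsilon> P t x))"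
proof -
  let ?R = "rot P t" and ?y = "local_coord \<epsilon> P t x"
  let ?L = "\<lambda>k. pd k (lstr P t) ?y"
  have D: "(local_str \<epsilon> P t has_derivative (\<lambda>v. ?R ** (\<Sum>k\<in>UNIV. ((1 / \<epsilon>) *\<^sub>R (transpose ?R *v v)) $ k *\<^sub>R ?L k) ** transpose ?R)) (at x)"
    unfolding local_str_def[abs_def]
    by (rule bounded_linear.has_derivative[OF bounded_linear_congruence
        has_derivative_compose[OF local_coord_has_derivative has_derivative_pd[OF assms]]])
  \<comment> \<open>Orthogonality in coordinates, contracted over the index that the divergence
    sums.\<close>
  have orth: "(\<Sum>j\<in>UNIV. ?R $ j $ k * ?R $ j $ b) = (if k = b then 1 else 0)" for k b
    using arg_cong[OF rot_inv(1), of "\<lambda>M. M $ k $ b"] by (simp add: matrix_matrix_mult_def transpose_def mat_def)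
  have e: "(transpose ?R *v axis j 1) $ k = ?R $ j $ k" for j k
    by (simp add: matrix_vector_mul_component inner_axis transpose_def)
  have "mdiv (local_str \<epsilon> P t) x $ i = ((1 / \<epsilon>) *\<^sub>R (?R *v mdiv (lstr P t) ?y)) $ i" for i
  proof -
    have "mdiv (local_str \<epsilon> P t) x $ i = (\<Sum>j\<in>UNIV. \<Sum>b\<in>UNIV. (\<Sum>a\<in>UNIV. ?R $ i $ a * (\<Sum>k\<in>UNIV. ?R $ j $ k / \<epsilon> * ?L k $ a $ b)) * ?R $ j $ b)"
      by (simp add: mdiv_def pd_eqI[OF D] matrix_congruence_nth e)
    also have "\<dots> = (\<Sum>j\<in>UNIV. \<Sum>b\<in>UNIV. \<Sum>a\<in>UNIV. \<Sum>k\<in>UNIV. (?R $ i $ a * ?L k $ a $ b / \<epsilon>) * (?R $ j $ k * ?R $ j $ b))"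
      by (simp add: sum_distrib_left sum_distrib_right mult_ac)
    also have "\<dots> = (\<Sum>b\<in>UNIV. \<Sum>a\<in>UNIV. \<Sum>k\<in>UNIV. \<Sum>j\<in>UNIV. (?R $ i $ a * ?L k $ a $ b / \<epsilon>) * (?R $ j $ k * ?R $ j $ b))"
      by (rule trans[OF sum.swap], rule sum.cong[OF refl], rule trans[OF sum.swap], rule sum.cong[OF refl], rule sum.swap)
    also have "\<dots> = (\<Sum>b\<in>UNIV. \<Sum>a\<in>UNIV. \<Sum>k\<in>UNIV. if k = b then ?R $ i $ a * ?L k $ a $ b / \<epsilon> else 0)"
      unfolding sum_distrib_left[symmetric] orth by (intro sum.cong refl) simp
    also have "\<dots> = (\<Sum>b\<in>UNIV. \<Sum>a\<in>UNIV. ?R $ i $ a * ?L b $ a $ b / \<epsilon>)"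
      by simp
    also have "\<dots> = (\<Sum>a\<in>UNIV. \<Sum>b\<in>UNIV. ?R $ i $ a * ?L b $ a $ b / \<epsilon>)"
      by (rule sum.swap)
    also have "\<dots> = ((1 / \<epsilon>) *\<^sub>R (?R *v mdiv (lstr P t) ?y)) $ i"
      by (simp add: matrix_vector_mult_def mdiv_def sum_distrib_left)
    finally show ?thesis .
  qed
  then show ?thesis by (simp add: vec_eq_iff)
qed

end

section \<open>Orders in the size parameter\<close>

text \<open>A Landau class for functions with values in any normed space, such as vectors and
  matrices, with an explicit constant. \<open>order_eps_bigo\<close> translates it to the norm form
  of the final statement.\<close>

definition order_eps :: "nat \<Rightarrow> (real \<Rightarrow> 'b::real_normed_vector) \<Rightarrow> bool" where
  "order_eps k f \<longleftrightarrow> (\<exists>C. \<forall>\<^sub>F \<epsilon> in at_right 0. norm (f \<epsilon>) \<le> C * \<epsilon> ^ k)"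

lemma eventually_eps_pos: "\<forall>\<^sub>F \<epsilon> in at_right (0::real). 0 < \<epsilon> \<and> \<epsilon> < 1"
  unfolding eventually_at_right_field by (intro exI[of _ 1]) simp

lemma order_epsI: "\<forall>\<^sub>F \<epsilon> in at_right 0. norm (f \<epsilon>) \<le> C * \<epsilon> ^ k \<Longrightarrow> order_eps k f"
  unfolding order_eps_def by blast

lemma order_epsE:
  assumes "order_eps k f"
  obtains C where "0 \<le> C" "\<forall>\<^sub>F \<epsilon> in at_right 0. norm (f \<epsilon>) \<le> C * \<epsilon> ^ k"
proof -
  obtain C where C: "\<forall>\<^sub>F \<epsilon> in at_right 0. norm (f \<epsilon>) \<le> C * \<epsilon> ^ k"
    using assms unfolding order_eps_def by blast
  have "\<forall>\<^sub>F \<epsilon> in at_right 0. norm (f \<epsilon>) \<le> max C 0 * \<epsilon> ^ k"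
    using C eventually_eps_pos
  proof eventually_elim
    case (elim \<epsilon>)
    have "C * \<epsilon> ^ k \<le> max C 0 * \<epsilon> ^ k"
      using elim(2) by (intro mult_right_mono) auto
    with elim(1) show ?case by simp
  qed
  then show thesis by (intro that[of "max C 0"]) auto
qed

lemma order_eps_cong:
  assumes "order_eps k f" "\<forall>\<^sub>F \<epsilon> in at_right 0. f \<epsilon> = g \<epsilon>"
  shows "order_eps k g"
proof -
  obtain C where C: "\<forall>\<^sub>F \<epsilon> in at_right 0. norm (f \<epsilon>) \<le> C * \<epsilon> ^ k"
    using assms(1) unfolding order_eps_def by blast
  show ?thesis
    by (rule order_epsI[of _ C], use C assms(2) in eventually_elim) simp
qed

lemma order_eps_zero [simp]: "order_eps k (\<lambda>_. 0)"
  by (rule order_epsI[of _ 0]) simp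

lemma order_eps_add:
  assumes "order_eps k f" "order_eps k g"
  shows "order_eps k (\<lambda>\<epsilon>. f \<epsilon> + g \<epsilon>)"
proof -
  obtain C where C: "0 \<le> C" "\<forall>\<^sub>F \<epsilon> in at_right 0. norm (f \<epsilon>) \<le> C * \<epsilon> ^ k" using order_epsE[OF assms(1)] .
  obtain D where D: "0 \<le> D" "\<forall>\<^sub>F \<epsilon> in at_right 0. norm (g \<epsilon>) \<le> D * \<epsilon> ^ k" using order_epsE[OF assms(2)] .
  show ?thesis
  proof (rule order_epsI[of _ "C + D"])
    show "\<forall>\<^sub>F \<epsilon> in at_right 0. norm (f \<epsilon> + g \<epsilon>) \<le> (C + D) * \<epsilon> ^ k"
      using C(2) D(2) by eventually_elim (use norm_triangle_mono in \<open>force simp: algebra_simps\<close>)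
  qed
qed

lemma order_eps_bounded_linear:
  assumes T: "bounded_linear T" and f: "order_eps k f"
  shows "order_eps k (\<lambda>\<epsilon>. T (f \<epsilon>))"
proof -
  obtain K where K: "0 < K" "\<And>x. norm (T x) \<le> norm x * K"
    using bounded_linear.pos_bounded[OF T] by blast
  obtain C where C: "\<forall>\<^sub>F \<epsilon> in at_right 0. norm (f \<epsilon>) \<le> C * \<epsilon> ^ k"
    using f unfolding order_eps_def by blast
  show ?thesis
  proof (rule order_epsI[of _ "C * K"], use C in eventually_elim)
    fix \<epsilon> :: real assume "norm (f \<epsilon>) \<le> C * \<epsilon> ^ k"
    then have "norm (f \<epsilon>) * K \<le> C * \<epsilon> ^ k * K" using K(1) by (intro mult_right_mono) auto
    with K(2)[of "f \<epsilon>"] show "norm (T (f \<epsilon>)) \<le> C * K * \<epsilon> ^ k" by (simp add: mult_ac)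
  qed
qed

lemma order_eps_uminus: "order_eps k f \<Longrightarrow> order_eps k (\<lambda>\<epsilon>. - f \<epsilon>)"
  by (rule order_eps_bounded_linear[OF bounded_linear_minus[OF bounded_linear_ident]])

lemma order_eps_diff: "order_eps k f \<Longrightarrow> order_eps k g \<Longrightarrow> order_eps k (\<lambda>\<epsilon>. f \<epsilon> - g \<epsilon>)"
  using order_eps_add[OF _ order_eps_uminus] by force

lemma order_eps_sum:
  "(\<And>i. i \<in> I \<Longrightarrow> order_eps k (f i)) \<Longrightarrow> order_eps k (\<lambda>\<epsilon>. \<Sum>i\<in>I. f i \<epsilon>)"
  by (induction I rule: infinite_finite_induct) (auto intro: order_eps_add)

lemma order_eps_le:
  assumes "order_eps k f" "l \<le> k"
  shows "order_eps l f"
proof -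
  obtain C where C: "0 \<le> C" "\<forall>\<^sub>F \<epsilon> in at_right 0. norm (f \<epsilon>) \<le> C * \<epsilon> ^ k" using order_epsE[OF assms(1)] .
  show ?thesis
  proof (rule order_epsI[of _ C], use C(2) eventually_eps_pos in eventually_elim)
    fix \<epsilon> :: real assume e: "norm (f \<epsilon>) \<le> C * \<epsilon> ^ k" "0 < \<epsilon> \<and> \<epsilon> < 1"
    then have "C * \<epsilon> ^ k \<le> C * \<epsilon> ^ l"
      using C(1) assms(2) by (intro mult_left_mono power_decreasing) auto
    with e show "norm (f \<epsilon>) \<le> C * \<epsilon> ^ l" by linarith
  qed
qed

text \<open>One rule for scaling by powers of \<epsilon>, matrix products and products of matrices
  with vectors. The telescoping identities for rotated quantities are arranged so that it applies to
  each summand.\<close>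

lemma order_eps_bilinear:
  assumes B: "bounded_bilinear B" and f: "order_eps k f" and g: "order_eps l g"
  shows "order_eps (k + l) (\<lambda>\<epsilon>. B (f \<epsilon>) (g \<epsilon>))"
proof -
  obtain K where K: "0 < K" "\<And>x y. norm (B x y) \<le> norm x * norm y * K"
    using bounded_bilinear.pos_bounded[OF B] by blast
  obtain C where C: "0 \<le> C" "\<forall>\<^sub>F \<epsilon> in at_right 0. norm (f \<epsilon>) \<le> C * \<epsilon> ^ k" using order_epsE[OF f] .
  obtain D where D: "0 \<le> D" "\<forall>\<^sub>F \<epsilon> in at_right 0. norm (g \<epsilon>) \<le> D * \<epsilon> ^ l" using order_epsE[OF g] .
  show ?thesis
  proof (rule order_epsI[of _ "C * D * K"], use C(2) D(2) eventually_eps_pos in eventually_elim)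
    fix \<epsilon> :: real assume e: "norm (f \<epsilon>) \<le> C * \<epsilon> ^ k" "norm (g \<epsilon>) \<le> D * \<epsilon> ^ l" "0 < \<epsilon> \<and> \<epsilon> < 1"
    have "norm (f \<epsilon>) * norm (g \<epsilon>) * K \<le> (C * \<epsilon> ^ k) * (D * \<epsilon> ^ l) * K"
      using e K C(1) by (intro mult_right_mono mult_mono) auto
    with K(2)[of "f \<epsilon>" "g \<epsilon>"] show "norm (B (f \<epsilon>) (g \<epsilon>)) \<le> C * D * K * \<epsilon> ^ (k + l)"
      by (simp add: power_add mult_ac)
  qed
qed

lemma order_eps_power: "order_eps k (\<lambda>\<epsilon>. \<epsilon> ^ k :: real)"
  by (rule order_epsI[of _ 1], use eventually_eps_pos in eventually_elim) auto

lemma order_eps_scale: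
  "order_eps l f \<Longrightarrow> order_eps (k + l) (\<lambda>\<epsilon>. \<epsilon> ^ k *\<^sub>R f \<epsilon>)"
  by (rule order_eps_bilinear[OF bounded_bilinear_scaleR order_eps_power])

lemma order_eps_bigo:
  assumes "order_eps k f"
  shows "(\<lambda>\<epsilon>. norm (f \<epsilon>)) \<in> O[at_right 0](\<lambda>\<epsilon>. \<epsilon> ^ k)"
proof -
  obtain C where C: "\<forall>\<^sub>F \<epsilon> in at_right 0. norm (f \<epsilon>) \<le> C * \<epsilon> ^ k"
    using assms unfolding order_eps_def by blast
  show ?thesis
    by (rule bigoI[of _ C], use C eventually_eps_pos in eventually_elim) simp
qed

lemma bounded_bilinear_matrix_mult: "bounded_bilinear ((**) :: mat3 \<Rightarrow> mat3 \<Rightarrow> mat3)"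
  unfolding bilinear_conv_bounded_bilinear[symmetric] bilinear_def
  by (auto intro!: linearI simp: matrix_matrix_mult_def vec_eq_iff sum_distrib_left sum.distrib algebra_simps)

lemma bounded_bilinear_matrix_vector_mult: "bounded_bilinear ((*v) :: mat3 \<Rightarrow> vec3 \<Rightarrow> vec3)"
  unfolding bilinear_conv_bounded_bilinear[symmetric] bilinear_def
  by (auto intro!: linearI simp: matrix_vector_mult_def vec_eq_iff sum_distrib_left sum.distrib algebra_simps)

lemma bounded_linear_transpose: "bounded_linear (transpose :: mat3 \<Rightarrow> mat3)"
  unfolding linear_conv_bounded_linear[symmetric]
  by (rule linearI) (simp_all add: transpose_def vec_eq_iff)

text \<open>Covers every \<open>f\<close>, since the integral of a nonintegrable function is 0 by
  convention.\<close>

lemma norm_set_integral_le: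
  fixes f :: "vec3 \<Rightarrow> 'b::{banach,second_countable_topology}"
  assumes A: "A \<in> sets lborel" "emeasure lborel A < \<infinity>"
    and f: "\<And>y. y \<in> A \<Longrightarrow> norm (f y) \<le> B" "0 \<le> B"
  shows "norm (LINT y:A|lborel. f y) \<le> B * measure lborel A"
proof -
  have i: "integrable lborel (\<lambda>y. B * indicator A y)"
    using A by (intro integrable_mult_right integrable_real_indicator) auto
  have "norm (LINT y:A|lborel. f y) \<le> (LINT y|lborel. norm (indicator A y *\<^sub>R f y))"
    unfolding set_lebesgue_integral_def by (rule integral_norm_bound)
  also have "\<dots> \<le> (LINT y|lborel. B * indicator A y)"
    by (rule integral_mono'[OF i]) (use f in \<open>auto simp: indicator_def\<close>)
  also have "\<dots> = B * measure lborel A"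
    using A by simp
  finally show ?thesis .
qed

lemma order_eps_set_integral:
  fixes f :: "real \<Rightarrow> vec3 \<Rightarrow> 'b::{banach,second_countable_topology}"
  assumes A: "A \<in> sets lborel" "emeasure lborel A < \<infinity>"
    and f: "\<forall>\<^sub>F \<epsilon> in at_right 0. \<forall>y\<in>A. norm (f \<epsilon> y) \<le> C * \<epsilon> ^ k"
  shows "order_eps k (\<lambda>\<epsilon>. LINT y:A|lborel. f \<epsilon> y)"
proof (rule order_epsI[of _ "\<bar>C\<bar> * measure lborel A"], use f eventually_eps_pos in eventually_elim)
  fix \<epsilon> :: real assume e: "\<forall>y\<in>A. norm (f \<epsilon> y) \<le> C * \<epsilon> ^ k" "0 < \<epsilon> \<and> \<epsilon> < 1"
  then have "C * \<epsilon> ^ k \<le> \<bar>C\<bar> * \<epsilon> ^ k" by (intro mult_right_mono) auto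
  then have "\<And>y. y \<in> A \<Longrightarrow> norm (f \<epsilon> y) \<le> \<bar>C\<bar> * \<epsilon> ^ k"
    using e(1) order_trans by blast
  from norm_set_integral_le[OF A this] e
  show "norm (LINT y:A|lborel. f \<epsilon> y) \<le> \<bar>C\<bar> * measure lborel A * \<epsilon> ^ k"
    by (simp add: mult_ac)
qed

text \<open>The factor \<epsilon>^0 gives all three conclusions the shape that
  \<open>order_eps_set_integral\<close> and \<open>order_eps_of_ball\<close> take as input.\<close>

lemma expands_two:
  assumes "expands Y [a, b] f"
  obtains C where "\<forall>\<^sub>F \<epsilon> in at_right 0. \<forall>y\<in>Y. norm (a \<epsilon> y) \<le> C * \<epsilon> ^ 0"
    "\<forall>\<^sub>F \<epsilon> in at_right 0. \<forall>y\<in>Y. norm (b \<epsilon> y) \<le> C * \<epsilon> ^ 0"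
    "\<forall>\<^sub>F \<epsilon> in at_right 0. \<forall>y\<in>Y. norm (f \<epsilon> y - (a \<epsilon> y + \<epsilon> *\<^sub>R b \<epsilon> y)) \<le> C * \<epsilon> ^ 2"
  using assms unfolding expands_def
  by (auto simp: numeral_2_eq_2 less_Suc_eq_0_disj lessThan_Suc all_conj_distrib ex_disj_distrib
      eventually_conj_iff ball_conj_distrib algebra_simps)

lemma expands_three:
  assumes "expands Y [a, b, c] f"
  obtains C where "\<forall>\<^sub>F \<epsilon> in at_right 0. \<forall>y\<in>Y. norm (a \<epsilon> y) \<le> C * \<epsilon> ^ 0"
    "\<forall>\<^sub>F \<epsilon> in at_right 0. \<forall>y\<in>Y. norm (b \<epsilon> y) \<le> C * \<epsilon> ^ 0"
    "\<forall>\<^sub>F \<epsilon> in at_right 0. \<forall>y\<in>Y. norm (c \<epsilon> y) \<le> C * \<epsilon> ^ 0"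
    "\<forall>\<^sub>F \<epsilon> in at_right 0. \<forall>y\<in>Y. norm (f \<epsilon> y - (a \<epsilon> y + \<epsilon> *\<^sub>R b \<epsilon> y + \<epsilon>\<^sup>2 *\<^sub>R c \<epsilon> y)) \<le> C * \<epsilon> ^ 3"
proof -
  obtain C where C: "\<forall>\<^sub>F \<epsilon> in at_right 0. \<forall>y\<in>Y.
     (\<forall>k<3. norm (([a, b, c] ! k) \<epsilon> y) \<le> C) \<and>
     norm (f \<epsilon> y - (\<Sum>k<3. \<epsilon> ^ k *\<^sub>R ([a, b, c] ! k) \<epsilon> y)) \<le> C * \<epsilon> ^ 3"
    using assms unfolding expands_def by (auto simp: numeral_3_eq_3)
  have nth: "norm (([a, b, c] ! k) \<epsilon> y) \<le> C" if "\<forall>k<3. norm (([a, b, c] ! k) \<epsilon> y) \<le> C" "k < 3" for k \<epsilon> y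
    using that by blast
  have sum: "(\<Sum>k<3. \<epsilon> ^ k *\<^sub>R ([a, b, c] ! k) \<epsilon> y) = a \<epsilon> y + \<epsilon> *\<^sub>R b \<epsilon> y + \<epsilon>\<^sup>2 *\<^sub>R c \<epsilon> y" for \<epsilon> y
    by (simp add: numeral_3_eq_3 numeral_2_eq_2)
  show thesis
  proof (rule that[of C])
    show "\<forall>\<^sub>F \<epsilon> in at_right 0. \<forall>y\<in>Y. norm (a \<epsilon> y) \<le> C * \<epsilon> ^ 0"
      using C by eventually_elim (use nth[where k=0] in simp)
    show "\<forall>\<^sub>F \<epsilon> in at_right 0. \<forall>y\<in>Y. norm (b \<epsilon> y) \<le> C * \<epsilon> ^ 0"
      using C by eventually_elim (use nth[where k=1] in simp)
    show "\<forall>\<^sub>F \<epsilon> in at_right 0. \<forall>y\<in>Y. norm (c \<epsilon> y) \<le> C * \<epsilon> ^ 0"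
      using C by eventually_elim (use nth[where k=2] in simp)
    show "\<forall>\<^sub>F \<epsilon> in at_right 0. \<forall>y\<in>Y. norm (f \<epsilon> y - (a \<epsilon> y + \<epsilon> *\<^sub>R b \<epsilon> y + \<epsilon>\<^sup>2 *\<^sub>R c \<epsilon> y)) \<le> C * \<epsilon> ^ 3"
      using C unfolding sum by eventually_elim blast
  qed
qed

lemma order_eps_of_ball:
  "\<forall>\<^sub>F \<epsilon> in at_right 0. \<forall>y\<in>Y. norm (f \<epsilon> y) \<le> C * \<epsilon> ^ k \<Longrightarrow> z \<in> Y \<Longrightarrow> order_eps k (\<lambda>\<epsilon>. f \<epsilon> z)"
  by (rule order_epsI[of _ C], erule eventually_mono) blast

section \<open>Expansion of the particle force\<close>

lemma continuous_on_grad: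
  assumes "open E" "Cdiff 1 f E"
  shows "continuous_on E (grad f)"
proof -
  have "continuous_on E (\<lambda>x. \<chi> i j. pd i f x $ j)"
    by (intro continuous_intros Cdiff_1_D(2)[OF assms(2,1)])
  then show ?thesis
    by (rule continuous_on_eq) (simp add: vec_eq_iff grad_nth)
qed

lemma continuous_on_mdiv:
  assumes "open E" "Cdiff 1 A E"
  shows "continuous_on E (mdiv A)"
  unfolding mdiv_def by (intro continuous_intros Cdiff_1_D(2)[OF assms(2,1)])

lemma grad_cong_open:
  assumes "open E" "x \<in> E" "\<And>y. y \<in> E \<Longrightarrow> f y = g y"
  shows "grad f x = grad g x"
  using pd_cong_open[OF assms] by (simp add: vec_eq_iff grad_nth)

lemma bounded_imageI: "\<forall>y\<in>A. norm (f y) \<le> C \<Longrightarrow> bounded (f ` A)"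
  unfolding bounded_iff by blast

lemma set_integrable_image_bound:
  fixes f :: "vec3 \<Rightarrow> 'b::{banach,second_countable_topology}"
  assumes "valid_config S" "continuous_on (shape S) f" "\<forall>y\<in>shape S. norm (f y) \<le> C"
  shows "set_integrable lborel (shape S) f"
  by (rule set_integrable_bounded_continuous)
    (use reference_particleD[OF assms(1)] assms(2) bounded_imageI[OF assms(3)] in auto)

text \<open>\<open>D1\<close> applies the derivative of the global flow at one fixed point to a
  vector that is affine in y. So \<open>h1\<close> is affine and its derivative is the same matrix
  everywhere, once differentiability at that point identifies the derivative with the
  Jacobian.\<close>

lemma h1_has_derivative:
  assumes "(\<lambda>z. u z t) differentiable at (posc P 0 t)"
  shows "(h1 u P t has_derivative (\<lambda>v. (transpose (rotc P 0 t) ** (skew (angc P 0 t) ** rotc P 0 t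
     - jacobian (\<lambda>z. u z t) (at (posc P 0 t)) ** rotc P 0 t)) *v v)) (at y)"
proof -
  let ?J = "jacobian (\<lambda>z. u z t) (at (posc P 0 t))"
  have "frechet_derivative (\<lambda>z. u z t) (at (posc P 0 t)) = (*v) ?J"
    using assms frechet_derivative_at[of "\<lambda>z. u z t" "(*v) ?J"] by (simp add: jacobian_works)
  then have eq: "h1 u P t = (\<lambda>y. transpose (rotc P 0 t) *v
     (velc P 1 t + skew (angc P 0 t) *v (rotc P 0 t *v y) - ?J *v (rotc P 0 t *v y + posc P 1 t)))"
    by (simp add: fun_eq_iff h1_def D1_def x1_def)
  have m: "((\<lambda>y. A *v f y) has_derivative (\<lambda>v. A *v f' v)) (at y)"
    if "(f has_derivative f') (at y)" for f :: "vec3 \<Rightarrow> vec3" and f' A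
    by (rule bounded_linear.has_derivative[OF matrix_vector_mul_bounded_linear that])
  have "(h1 u P t has_derivative (\<lambda>v. transpose (rotc P 0 t) *v
     (0 + skew (angc P 0 t) *v (rotc P 0 t *v v) - ?J *v (rotc P 0 t *v v + 0)))) (at y)"
    unfolding eq by (intro m has_derivative_add has_derivative_diff has_derivative_const has_derivative_ident)
  then show ?thesis
    by (simp add: matrix_vector_mul_assoc matrix_vector_mult_diff_rdistrib matrix_vector_mult_diff_distrib
        bounded_bilinear.diff_right[OF bounded_bilinear_matrix_mult] matrix_mul_assoc)
qed

text \<open>Global force balance: the body force in the particle is the hydrodynamic force
  \<open>f1\<close> divided by the volume.\<close>

lemma integral_fhat1:
  assumes "valid_config S"
  shows "(LINT y:shape S|lborel. fhat1 S P t) = f1 S P t"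
proof -
  note R = reference_particleD[OF assms]
  have "(LINT y:shape S|lborel. fhat1 S P t) = vol S *\<^sub>R fhat1 S P t"
    using R by (simp add: set_lebesgue_integral_def)
  then show ?thesis using R by (simp add: fhat1_def f1_def)
qed

lemma continuous_on_fhat2: "continuous_on A (fhat2 S u p P t)"
proof -
  note mv = bounded_linear.continuous_on[OF matrix_vector_mul_bounded_linear]
  have "continuous_on A (\<lambda>y. if kappa S = 2 then (mass S * Rey S / vol S) *\<^sub>R (transpose (rotc P 0 t) *v
           (vector_derivative (velc P 1) (at t)
            + vector_derivative (\<lambda>s. vector_derivative (rotc P 0) (at s)) (at t) *v y))
        else if kappa S = 3 then (1 / vol S) *\<^sub>R k0 S P t else 0)"
  proof (cases "kappa S = 2")
    case True
    show ?thesis unfolding if_P[OF True]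
      by (intro continuous_on_scaleR continuous_on_const mv continuous_on_add continuous_on_id)
  qed (cases "kappa S = 3"; simp)
  then show ?thesis
    unfolding fhat2_def by (intro continuous_on_add continuous_on_diff continuous_on_const)
qed

text \<open>For mass exponent 2 the density contains the acceleration of the rotation, linear in y;
  it integrates to 0 because the centre of mass is 0. The constant part, multiplied by the volume,
  is \<open>f2\<close>.\<close>

lemma integral_fhat2:
  assumes S: "valid_config S"
  shows "(LINT y:shape S|lborel. fhat2 S u p P t y) = f2 S u p P t"
proof -
  note R = reference_particleD[OF S]
  let ?L = "if kappa S = 2 then (mass S * Rey S / vol S) *\<^sub>R (transpose (rotc P 0 t) **
            vector_derivative (\<lambda>s. vector_derivative (rotc P 0) (at s)) (at t)) else 0"
  let ?c = "- (transpose (rotc P 0 t) *v mdiv (stress_at u p t) (posc P 0 t))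
     - transpose (rotc P 0 t) *v (rotc P 1 t *v fhat1 S P t)
     + (if kappa S = 2 then (mass S * Rey S / vol S) *\<^sub>R (transpose (rotc P 0 t) *v vector_derivative (velc P 1) (at t))
        else if kappa S = 3 then (1 / vol S) *\<^sub>R k0 S P t else 0)"
  have eq: "fhat2 S u p P t y = ?c + ?L *v y" for y
    by (simp add: fhat2_def matrix_vector_right_distrib matrix_vector_mul_assoc scaleR_matrix_vector_assoc
        scaleR_right_distrib)
  have id: "set_integrable lborel (shape S) (\<lambda>y. y)"
    by (rule set_integrable_bounded_continuous) (use R in auto)
  note L = set_integral_bounded_linear[OF matrix_vector_mul_bounded_linear[of ?L] id]
  have c: "set_integrable lborel (shape S) (\<lambda>y. ?c)" "(LINT y:shape S|lborel. ?c) = vol S *\<^sub>R ?c"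
    using R by (auto simp: set_lebesgue_integral_def set_integrable_def)
  have "(LINT y:shape S|lborel. fhat2 S u p P t y) = vol S *\<^sub>R ?c + ?L *v (LINT y:shape S|lborel. y)"
    unfolding eq set_integral_add(2)[OF c(1) L(1)] c(2) L(2) ..
  also have "\<dots> = vol S *\<^sub>R ?c" using R by simp
  also have "\<dots> = f2 S u p P t"
    using R(6) by (simp add: f2_def f1_def fhat1_def k1_def scaleR_right_distrib scaleR_right_diff_distrib
        matrix_vector_mult_scaleR)
  finally show ?thesis .
qed

text \<open>A snapshot of the one-particle model at one time and one value of \<epsilon>, together
  with differentiability of the global flow at the leading-order centre, where the model evaluates
  it.\<close>

definition model_at :: "config \<Rightarrow> vfield \<Rightarrow> sfield \<Rightarrow> particle \<Rightarrow> real \<Rightarrow> bool" where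
  "model_at S u p P t \<longleftrightarrow> rotation_matrix (rot P t) \<and> (\<lambda>z. u z t) differentiable at (posc P 0 t) \<and>
     exterior_stokes S (h1 u P t) (f1 S P t) g1 (lvelc P 1 t) (lprsc P 1 t) \<and>
     (\<forall>y\<in>shape S. lvelc P 1 t y = h1 u P t y) \<and>
     particle_stress_problem S (\<lambda>y. fhat1 S P t)
       (newton_stress (lvelc P 1 t) (lprsc P 1 t)) (lamc P 1 t) \<and>
     particle_stress_problem S (fhat2 S u p P t)
       (newton_stress (lvelc P 2 t) (lprsc P 2 t)) (lamc P 2 t)"

text \<open>Rewrites the surface integral of the particle stress as the leading coefficients of two
  volume integrals that averaging produces: the stress in the particle, and the symmetrised velocity
  gradient in the particle. The bound \<open>C\<close> makes the stress integrable, so that the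
  integral of the difference splits.\<close>

lemma surface_moment:
  assumes S: "valid_config S" and m: "model_at S u p P t"
    and b: "\<forall>y\<in>shape S. norm (lstrc P 1 t y) \<le> C"
  shows "(LINT y|area S.
             outer (outer_trace (shape S) (newton_stress (lvelc P 1 t) (lprsc P 1 t)) y *v nrm S y) y
             - outer (h1 u P t y) (nrm S y) - outer (nrm S y) (h1 u P t y)) =
    (LINT y:shape S|lborel. lstrc P 1 t y) - ((LINT y:shape S|lborel. grad (lvelc P 1 t) y) +
      transpose (LINT y:shape S|lborel. grad (lvelc P 1 t) y))"
proof -
  note R = reference_particleD[OF S]
  have diff: "(\<lambda>z. u z t) differentiable at (posc P 0 t)"
    and st: "exterior_stokes S (h1 u P t) (f1 S P t) g1 (lvelc P 1 t) (lprsc P 1 t)"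
    and ext: "\<And>y. y \<in> shape S \<Longrightarrow> lvelc P 1 t y = h1 u P t y"
    and prob: "particle_stress_problem S (\<lambda>y. fhat1 S P t)
       (newton_stress (lvelc P 1 t) (lprsc P 1 t)) (lamc P 1 t)"
    using m by (auto simp: model_at_def)
  have cA: "continuous_on (- closure (shape S)) (newton_stress (lvelc P 1 t) (lprsc P 1 t))"
  proof -
    have C: "Cdiff 2 (lvelc P 1 t) (- closure (shape S))" "Cdiff 1 (lprsc P 1 t) (- closure (shape S))"
      using st by (auto simp: exterior_stokes_def)
    have "continuous_on (- closure (shape S)) (lprsc P 1 t)"
      using Cdiff_Suc_D[of 0 "lprsc P 1 t"] C(2) by simp
    moreover have "continuous_on (- closure (shape S)) (sym_grad (lvelc P 1 t))"
      by (rule Cdiff_2_sym_grad(3)[OF _ C(1)]) auto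
    ultimately show ?thesis
      unfolding newton_stress_def[abs_def] by (intro continuous_intros)
  qed
  note h = h1_has_derivative[where u=u and P=P and t=t, OF diff]
  let ?B = "transpose (rotc P 0 t) ** (skew (angc P 0 t) ** rotc P 0 t
     - jacobian (\<lambda>z. u z t) (at (posc P 0 t)) ** rotc P 0 t)"
  have gh: "grad (h1 u P t) y = transpose ?B" for y
    by (simp add: vec_eq_iff grad_nth pd_eqI[OF h] matrix_vector_mul_component inner_axis transpose_def[of ?B])
  have gE: "grad (lvelc P 1 t) y = transpose ?B" if "y \<in> shape S" for y
    using grad_cong_open[OF R(1) that ext] gh by simp
  have gI: "(LINT y:shape S|lborel. grad (lvelc P 1 t) y) = (LINT y:shape S|lborel. transpose ?B)"
    by (rule set_lebesgue_integral_cong) (use R gE in auto)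
  have ci: "set_integrable lborel (shape S) (\<lambda>y. M)" for M :: mat3
    using R by (auto simp: set_integrable_def)
  have sI: "set_integrable lborel (shape S) (lstrc P 1 t)"
    using prob by (intro set_integrable_image_bound[OF S _ b])
      (auto simp: particle_stress_problem_def lstrc_def intro: Cdiff_2_sym_grad(3)[OF R(1)])
  have "(LINT y|area S.
             outer (outer_trace (shape S) (newton_stress (lvelc P 1 t) (lprsc P 1 t)) y *v nrm S y) y
             - outer (h1 u P t y) (nrm S y) - outer (nrm S y) (h1 u P t y)) =
      (LINT y:shape S|lborel. lstrc P 1 t y - (transpose ?B + transpose (transpose ?B)))"
    unfolding particle_stress_moment[OF S prob cA h] by (simp add: lstrc_def sym_grad_def gh)
  also have "\<dots> = (LINT y:shape S|lborel. lstrc P 1 t y) - ((LINT y:shape S|lborel. transpose ?B) +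
      (LINT y:shape S|lborel. transpose (transpose ?B)))"
    unfolding set_integral_diff(2)[OF sI ci] set_integral_add(2)[OF ci ci] ..
  also have "(LINT y:shape S|lborel. transpose (transpose ?B)) = transpose (LINT y:shape S|lborel. transpose ?B)"
    by (rule set_integral_bounded_linear(2)[OF bounded_linear_transpose ci])
  finally show ?thesis unfolding gI .
qed

text \<open>The global flow carries \<epsilon> as an argument because it is the mean flow of the
  suspension. The time is fixed and the model is required for small \<epsilon> only.\<close>

locale asymptotic_particle =
  fixes S :: config and u :: "real \<Rightarrow> vfield" and p :: "real \<Rightarrow> sfield" and Q :: "real \<Rightarrow> particle" and t :: real
  assumes S: "valid_config S" and ex: "particle_expansions S Q t"
    and model: "\<forall>\<^sub>F \<epsilon> in at_right 0. model_at S (u \<epsilon>) (p \<epsilon>) (Q \<epsilon>) t"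
begin

lemmas shape_facts = reference_particleD[OF S]

lemma shape_measurable: "shape S \<in> sets lborel" using shape_facts(1) by simp

lemma rot_orders:
  "order_eps 0 (\<lambda>\<epsilon>. rotc (Q \<epsilon>) 0 t)" "order_eps 0 (\<lambda>\<epsilon>. rotc (Q \<epsilon>) 1 t)"
  "order_eps 2 (\<lambda>\<epsilon>. rot (Q \<epsilon>) t - (rotc (Q \<epsilon>) 0 t + \<epsilon> *\<^sub>R rotc (Q \<epsilon>) 1 t))"
  "order_eps 1 (\<lambda>\<epsilon>. rot (Q \<epsilon>) t - rotc (Q \<epsilon>) 0 t)" "order_eps 0 (\<lambda>\<epsilon>. rot (Q \<epsilon>) t)"
proof -
  have "expands {t} [\<lambda>\<epsilon>. rotc (Q \<epsilon>) 0, \<lambda>\<epsilon>. rotc (Q \<epsilon>) 1] (\<lambda>\<epsilon>. rot (Q \<epsilon>))"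
    using ex by (simp add: particle_expansions_def)
  from expands_two[OF this] obtain C where
    C: "\<forall>\<^sub>F \<epsilon> in at_right 0. \<forall>y\<in>{t}. norm (rotc (Q \<epsilon>) 0 y) \<le> C * \<epsilon> ^ 0"
    "\<forall>\<^sub>F \<epsilon> in at_right 0. \<forall>y\<in>{t}. norm (rotc (Q \<epsilon>) 1 y) \<le> C * \<epsilon> ^ 0"
    "\<forall>\<^sub>F \<epsilon> in at_right 0. \<forall>y\<in>{t}. norm (rot (Q \<epsilon>) y - (rotc (Q \<epsilon>) 0 y + \<epsilon> *\<^sub>R rotc (Q \<epsilon>) 1 y)) \<le> C * \<epsilon> ^ 2" .
  show o0: "order_eps 0 (\<lambda>\<epsilon>. rotc (Q \<epsilon>) 0 t)" and o1: "order_eps 0 (\<lambda>\<epsilon>. rotc (Q \<epsilon>) 1 t)"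
    and o2: "order_eps 2 (\<lambda>\<epsilon>. rot (Q \<epsilon>) t - (rotc (Q \<epsilon>) 0 t + \<epsilon> *\<^sub>R rotc (Q \<epsilon>) 1 t))"
    using order_eps_of_ball[OF C(1)] order_eps_of_ball[OF C(2)] order_eps_of_ball[OF C(3)] by auto
  have "order_eps 1 (\<lambda>\<epsilon>. \<epsilon> *\<^sub>R rotc (Q \<epsilon>) 1 t)"
    using order_eps_scale[OF o1, of 1] by simp
  moreover have "order_eps 1 (\<lambda>\<epsilon>. rot (Q \<epsilon>) t - (rotc (Q \<epsilon>) 0 t + \<epsilon> *\<^sub>R rotc (Q \<epsilon>) 1 t))"
    by (rule order_eps_le[OF o2]) simp
  ultimately have "order_eps 1 (\<lambda>\<epsilon>. \<epsilon> *\<^sub>R rotc (Q \<epsilon>) 1 t + (rot (Q \<epsilon>) t - (rotc (Q \<epsilon>) 0 t + \<epsilon> *\<^sub>R rotc (Q \<epsilon>) 1 t)))"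
    by (rule order_eps_add)
  then show r1: "order_eps 1 (\<lambda>\<epsilon>. rot (Q \<epsilon>) t - rotc (Q \<epsilon>) 0 t)" by (simp add: algebra_simps)
  from order_eps_add[OF order_eps_le[OF r1 le0] o0]
  show "order_eps 0 (\<lambda>\<epsilon>. rot (Q \<epsilon>) t)" by simp
qed

text \<open>Telescoping: rotation, matrix and transposed rotation are replaced by their leading
  coefficients one after the other, and each replacement costs one order while the remaining factors
  stay bounded.\<close>

lemma congruence_order:
  assumes M: "order_eps 1 (\<lambda>\<epsilon>. M \<epsilon> - M1 \<epsilon>)" and M1: "order_eps 0 M1"
  shows "order_eps 1 (\<lambda>\<epsilon>. rot (Q \<epsilon>) t ** M \<epsilon> ** transpose (rot (Q \<epsilon>) t)
    - rotc (Q \<epsilon>) 0 t ** M1 \<epsilon> ** transpose (rotc (Q \<epsilon>) 0 t))"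
proof -
  let ?Rot = "\<lambda>\<epsilon>. rot (Q \<epsilon>) t" and ?R0 = "\<lambda>\<epsilon>. rotc (Q \<epsilon>) 0 t"
  note bm = order_eps_bilinear[OF bounded_bilinear_matrix_mult]
  note tr = order_eps_bounded_linear[OF bounded_linear_transpose]
  have M0: "order_eps 0 M" using order_eps_add[OF order_eps_le[OF M le0] M1] by simp
  have 1: "order_eps (0 + 0 + 1) (\<lambda>\<epsilon>. ?Rot \<epsilon> ** M \<epsilon> ** transpose (?Rot \<epsilon> - ?R0 \<epsilon>))"
    by (rule bm[OF bm[OF rot_orders(5) M0] tr[OF rot_orders(4)]])
  have 2: "order_eps (0 + 1 + 0) (\<lambda>\<epsilon>. ?Rot \<epsilon> ** (M \<epsilon> - M1 \<epsilon>) ** transpose (?R0 \<epsilon>))"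
    by (rule bm[OF bm[OF rot_orders(5) M] tr[OF rot_orders(1)]])
  have 3: "order_eps (1 + 0 + 0) (\<lambda>\<epsilon>. (?Rot \<epsilon> - ?R0 \<epsilon>) ** M1 \<epsilon> ** transpose (?R0 \<epsilon>))"
    by (rule bm[OF bm[OF rot_orders(4) M1] tr[OF rot_orders(1)]])
  have eq: "r ** m ** transpose (r - r0) + r ** (m - m1) ** transpose r0 + (r - r0) ** m1 ** transpose r0
      = r ** m ** transpose r - r0 ** m1 ** transpose r0" for r m r0 m1 :: mat3
    by (simp add: bounded_linear.linear[OF bounded_linear_transpose, THEN linear_diff]
        bounded_bilinear.diff_left[OF bounded_bilinear_matrix_mult]
        bounded_bilinear.diff_right[OF bounded_bilinear_matrix_mult])
  from order_eps_add[OF order_eps_add[OF 1[unfolded add_0_left add_0_right] 2[unfolded add_0_left add_0_right]]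
      3[unfolded add_0_left add_0_right]]
  show ?thesis unfolding eq .
qed

text \<open>Volume and inner derivative leave \<epsilon>^2 times the rotated mean divergence, so the
  rotated mean is needed up to order 2. Multiplying the expansions of the rotation and of the mean
  divergence gives \<open>f1\<close> and \<open>f2\<close> with the mixed term in which the first
  correction of the rotation acts on \<open>f1\<close>.\<close>

lemma body_force_expansion:
  "\<forall>\<^sub>F \<epsilon> in at_right 0. set_integrable lborel (body S \<epsilon> (Q \<epsilon>) t) (mdiv (local_str \<epsilon> (Q \<epsilon>) t))"
  "order_eps 4 (\<lambda>\<epsilon>. (LINT \<xi>:body S \<epsilon> (Q \<epsilon>) t|lborel. mdiv (local_str \<epsilon> (Q \<epsilon>) t) \<xi>)
     - (\<epsilon>\<^sup>2 *\<^sub>R (rotc (Q \<epsilon>) 0 t *v f1 S (Q \<epsilon>) t)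
        + \<epsilon> ^ 3 *\<^sub>R (rotc (Q \<epsilon>) 0 t *v f2 S (u \<epsilon>) (p \<epsilon>) (Q \<epsilon>) t + rotc (Q \<epsilon>) 1 t *v f1 S (Q \<epsilon>) t)))"
proof -
  have "expands (shape S) [\<lambda>\<epsilon>. mdiv (lstrc (Q \<epsilon>) 1 t), \<lambda>\<epsilon>. mdiv (lstrc (Q \<epsilon>) 2 t)] (\<lambda>\<epsilon>. mdiv (lstr (Q \<epsilon>) t))"
    using ex by (simp add: particle_expansions_def)
  from expands_two[OF this] obtain C where
    C: "\<forall>\<^sub>F \<epsilon> in at_right 0. \<forall>y\<in>shape S. norm (mdiv (lstrc (Q \<epsilon>) 1 t) y) \<le> C * \<epsilon> ^ 0"
    "\<forall>\<^sub>F \<epsilon> in at_right 0. \<forall>y\<in>shape S. norm (mdiv (lstrc (Q \<epsilon>) 2 t) y) \<le> C * \<epsilon> ^ 0"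
    "\<forall>\<^sub>F \<epsilon> in at_right 0. \<forall>y\<in>shape S. norm (mdiv (lstr (Q \<epsilon>) t) y - (mdiv (lstrc (Q \<epsilon>) 1 t) y + \<epsilon> *\<^sub>R mdiv (lstrc (Q \<epsilon>) 2 t) y)) \<le> C * \<epsilon> ^ 2" .
  have reg: "\<forall>\<^sub>F \<epsilon> in at_right 0. Cdiff 1 (lstr (Q \<epsilon>) t) (shape S)"
    using ex unfolding particle_expansions_def by (auto elim: eventually_mono)
  have fh: "\<forall>\<^sub>F \<epsilon> in at_right 0. \<forall>y\<in>shape S. mdiv (lstrc (Q \<epsilon>) 1 t) y = fhat1 S (Q \<epsilon>) t \<and>
      mdiv (lstrc (Q \<epsilon>) 2 t) y = fhat2 S (u \<epsilon>) (p \<epsilon>) (Q \<epsilon>) t y"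
    using model by eventually_elim (simp add: model_at_def particle_stress_problem_def lstrc_def)
  let ?D1 = "\<lambda>\<epsilon>. f1 S (Q \<epsilon>) t" and ?D2 = "\<lambda>\<epsilon>. f2 S (u \<epsilon>) (p \<epsilon>) (Q \<epsilon>) t"
  let ?D = "\<lambda>\<epsilon>. (LINT y:shape S|lborel. mdiv (lstr (Q \<epsilon>) t) y)"
  have rem: "\<forall>\<^sub>F \<epsilon> in at_right 0. set_integrable lborel (shape S) (mdiv (lstr (Q \<epsilon>) t)) \<and>
      (LINT y:shape S|lborel. mdiv (lstrc (Q \<epsilon>) 1 t) y) = ?D1 \<epsilon> \<and>
      (LINT y:shape S|lborel. mdiv (lstrc (Q \<epsilon>) 2 t) y) = ?D2 \<epsilon> \<and>
      (LINT y:shape S|lborel. mdiv (lstr (Q \<epsilon>) t) y - (mdiv (lstrc (Q \<epsilon>) 1 t) y + \<epsilon> *\<^sub>R mdiv (lstrc (Q \<epsilon>) 2 t) y))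
        = ?D \<epsilon> - (?D1 \<epsilon> + \<epsilon> *\<^sub>R ?D2 \<epsilon>)"
    using C reg fh
  proof eventually_elim
    case (elim \<epsilon>)
    have i1: "set_integrable lborel (shape S) (mdiv (lstrc (Q \<epsilon>) 1 t))"
      by (rule set_integrable_image_bound[OF S _ elim(1)])
        (rule continuous_on_eq[OF continuous_on_const[of _ "fhat1 S (Q \<epsilon>) t"]], use elim(5) in simp)
    have i2: "set_integrable lborel (shape S) (mdiv (lstrc (Q \<epsilon>) 2 t))"
    proof (rule set_integrable_image_bound[OF S _ elim(2)])
      have "continuous_on (shape S) (fhat2 S (u \<epsilon>) (p \<epsilon>) (Q \<epsilon>) t)"
        by (rule continuous_on_fhat2)
      then show "continuous_on (shape S) (mdiv (lstrc (Q \<epsilon>) 2 t))"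
        by (rule continuous_on_eq) (use elim(5) in simp)
    qed
    have b: "\<forall>y\<in>shape S. norm (mdiv (lstr (Q \<epsilon>) t) y) \<le> C * \<epsilon> ^ 2 + (C + \<bar>\<epsilon>\<bar> * C)"
    proof
      fix y assume y: "y \<in> shape S"
      let ?a = "mdiv (lstrc (Q \<epsilon>) 1 t) y" and ?b = "mdiv (lstrc (Q \<epsilon>) 2 t) y" and ?m = "mdiv (lstr (Q \<epsilon>) t) y"
      have "norm ?m \<le> norm (?a + \<epsilon> *\<^sub>R ?b) + norm (?m - (?a + \<epsilon> *\<^sub>R ?b))"
        by (rule norm_triangle_sub)
      moreover have "norm (?a + \<epsilon> *\<^sub>R ?b) \<le> norm ?a + norm (\<epsilon> *\<^sub>R ?b)"
        by (rule norm_triangle_ineq)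
      moreover have "norm (\<epsilon> *\<^sub>R ?b) \<le> \<bar>\<epsilon>\<bar> * C"
        using bspec[OF elim(2) y] by (auto intro!: mult_left_mono)
      moreover have "norm ?a \<le> C" "norm (?m - (?a + \<epsilon> *\<^sub>R ?b)) \<le> C * \<epsilon> ^ 2"
        using bspec[OF elim(1) y] bspec[OF elim(3) y] by simp_all
      ultimately show "norm ?m \<le> C * \<epsilon> ^ 2 + (C + \<bar>\<epsilon>\<bar> * C)"
        by linarith
    qed
    have i0: "set_integrable lborel (shape S) (mdiv (lstr (Q \<epsilon>) t))"
      by (rule set_integrable_image_bound[OF S continuous_on_mdiv[OF shape_facts(1) elim(4)] b])
    have e1: "(LINT y:shape S|lborel. mdiv (lstrc (Q \<epsilon>) 1 t) y) = ?D1 \<epsilon>"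
      unfolding integral_fhat1[OF S, symmetric]
      by (rule set_lebesgue_integral_cong) (use elim(5) shape_facts in auto)
    have e2: "(LINT y:shape S|lborel. mdiv (lstrc (Q \<epsilon>) 2 t) y) = ?D2 \<epsilon>"
      unfolding integral_fhat2[OF S, symmetric]
      by (rule set_lebesgue_integral_cong) (use elim(5) shape_facts in auto)
    have i2': "set_integrable lborel (shape S) (\<lambda>y. \<epsilon> *\<^sub>R mdiv (lstrc (Q \<epsilon>) 2 t) y)"
      using i2 by simp
    show ?case
      using i0 unfolding set_integral_diff(2)[OF i0 set_integral_add(1)[OF i1 i2']]
        set_integral_add(2)[OF i1 i2'] set_integral_scaleR_right e1 e2 by simp
  qed
  \<comment> \<open>Boundedness of the forces for small \<epsilon> is read off here: they are
    integrals of the coefficients of the divergence, which the expansion bounds.\<close>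
  have oD1: "order_eps 0 ?D1"
    by (rule order_eps_cong[OF order_eps_set_integral[OF shape_measurable shape_facts(7) C(1)]])
      (use rem in eventually_elim, simp)
  have oD2: "order_eps 0 ?D2"
    by (rule order_eps_cong[OF order_eps_set_integral[OF shape_measurable shape_facts(7) C(2)]])
      (use rem in eventually_elim, simp)
  have oD: "order_eps 2 (\<lambda>\<epsilon>. ?D \<epsilon> - (?D1 \<epsilon> + \<epsilon> *\<^sub>R ?D2 \<epsilon>))"
    by (rule order_eps_cong[OF order_eps_set_integral[OF shape_measurable shape_facts(7) C(3)]])
      (use rem in eventually_elim, simp)
  have oD': "order_eps 1 (\<lambda>\<epsilon>. ?D \<epsilon> - ?D1 \<epsilon>)"
  proof -
    have "order_eps 1 (\<lambda>\<epsilon>. ?D \<epsilon> - (?D1 \<epsilon> + \<epsilon> *\<^sub>R ?D2 \<epsilon>))" by (rule order_eps_le[OF oD]) simp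
    moreover have "order_eps 1 (\<lambda>\<epsilon>. \<epsilon> *\<^sub>R ?D2 \<epsilon>)" using order_eps_scale[OF oD2, of 1] by simp
    ultimately have "order_eps 1 (\<lambda>\<epsilon>. ?D \<epsilon> - (?D1 \<epsilon> + \<epsilon> *\<^sub>R ?D2 \<epsilon>) + \<epsilon> *\<^sub>R ?D2 \<epsilon>)"
      by (rule order_eps_add)
    then show ?thesis by (simp add: algebra_simps)
  qed
  have oD0: "order_eps 0 ?D"
    using order_eps_add[OF order_eps_le[OF oD' le0] oD1] by simp
  note bm = order_eps_bilinear[OF bounded_bilinear_matrix_vector_mult]
  let ?Rot = "\<lambda>\<epsilon>. rot (Q \<epsilon>) t" and ?R0 = "\<lambda>\<epsilon>. rotc (Q \<epsilon>) 0 t" and ?R1 = "\<lambda>\<epsilon>. rotc (Q \<epsilon>) 1 t"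
  have 1: "order_eps (2 + 0) (\<lambda>\<epsilon>. (?Rot \<epsilon> - (?R0 \<epsilon> + \<epsilon> *\<^sub>R ?R1 \<epsilon>)) *v ?D \<epsilon>)"
    by (rule bm[OF rot_orders(3) oD0])
  have 2: "order_eps (0 + 2) (\<lambda>\<epsilon>. ?R0 \<epsilon> *v (?D \<epsilon> - (?D1 \<epsilon> + \<epsilon> *\<^sub>R ?D2 \<epsilon>)))"
    by (rule bm[OF rot_orders(1) oD])
  have 3: "order_eps (1 + (0 + 1)) (\<lambda>\<epsilon>. \<epsilon> ^ 1 *\<^sub>R (?R1 \<epsilon> *v (?D \<epsilon> - ?D1 \<epsilon>)))"
    by (rule order_eps_scale[OF bm[OF rot_orders(2) oD']])
  \<comment> \<open>An exact identity. In each summand on the left one factor is small: of order 2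
    in the first two, and of order 1 next to an explicit \<epsilon> in the third.\<close>
  have eq: "(r - (r0 + e *\<^sub>R r1)) *v d + r0 *v (d - (d1 + e *\<^sub>R d2)) + e ^ 1 *\<^sub>R (r1 *v (d - d1))
      = r *v d - (r0 *v d1 + e *\<^sub>R (r0 *v d2 + r1 *v d1))" for r r0 r1 :: mat3 and d d1 d2 :: vec3 and e :: real
    by (simp add: matrix_vector_mult_diff_rdistrib matrix_vector_mult_add_rdistrib matrix_vector_right_distrib
        matrix_vector_mult_diff_distrib matrix_vector_mult_scaleR scaleR_right_distrib scaleR_right_diff_distrib
        scaleR_matrix_vector_assoc[symmetric])
  have ord: "order_eps 2 (\<lambda>\<epsilon>. ?Rot \<epsilon> *v ?D \<epsilon> - (?R0 \<epsilon> *v ?D1 \<epsilon> + \<epsilon> *\<^sub>R (?R0 \<epsilon> *v ?D2 \<epsilon> + ?R1 \<epsilon> *v ?D1 \<epsilon>)))"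
    using order_eps_add[OF order_eps_add[OF 1[unfolded add_0_left add_0_right] 2[unfolded add_0_left add_0_right]]
      3[unfolded add_0_left one_add_one]]
    unfolding eq .
  have body: "\<forall>\<^sub>F \<epsilon> in at_right 0. set_integrable lborel (body S \<epsilon> (Q \<epsilon>) t) (mdiv (local_str \<epsilon> (Q \<epsilon>) t)) \<and>
      (LINT \<xi>:body S \<epsilon> (Q \<epsilon>) t|lborel. mdiv (local_str \<epsilon> (Q \<epsilon>) t) \<xi>) = \<epsilon>\<^sup>2 *\<^sub>R (?Rot \<epsilon> *v ?D \<epsilon>)"
    using rem model reg eventually_eps_pos
  proof eventually_elim
    case (elim \<epsilon>)
    then have e: "0 < \<epsilon>" and rm: "rotation_matrix (rot (Q \<epsilon>) t)"
      by (auto simp: model_at_def)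
    have bl: "bounded_linear (\<lambda>v. (1 / \<epsilon>) *\<^sub>R (?Rot \<epsilon> *v v))"
      by (intro bounded_linear_compose[OF bounded_linear_scaleR_right] matrix_vector_mul_bounded_linear)
    have i: "set_integrable lborel (shape S) (mdiv (lstr (Q \<epsilon>) t))" using elim by blast
    note T = set_integral_bounded_linear[OF bl i]
    have loc: "mdiv (local_str \<epsilon> (Q \<epsilon>) t) x = (1 / \<epsilon>) *\<^sub>R (?Rot \<epsilon> *v mdiv (lstr (Q \<epsilon>) t) (local_coord \<epsilon> (Q \<epsilon>) t x))"
      if "x \<in> body S \<epsilon> (Q \<epsilon>) t" for x
      by (rule mdiv_local_str[OF e rm])
        (use that Cdiff_1_D(1)[OF elim(3) shape_facts(1)] in \<open>simp add: body_eq_vimage[OF e rm]\<close>)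
    note B = integral_body[OF e rm T(1) loc]
    have "\<epsilon> ^ 3 *\<^sub>R (1 / \<epsilon>) *\<^sub>R (?Rot \<epsilon> *v ?D \<epsilon>) = \<epsilon>\<^sup>2 *\<^sub>R (?Rot \<epsilon> *v ?D \<epsilon>)"
      using e by (simp add: power2_eq_square power3_eq_cube)
    then show ?case using B unfolding T(2) by simp
  qed
  then show "\<forall>\<^sub>F \<epsilon> in at_right 0. set_integrable lborel (body S \<epsilon> (Q \<epsilon>) t) (mdiv (local_str \<epsilon> (Q \<epsilon>) t))"
    by (auto elim: eventually_mono)
  show "order_eps 4 (\<lambda>\<epsilon>. (LINT \<xi>:body S \<epsilon> (Q \<epsilon>) t|lborel. mdiv (local_str \<epsilon> (Q \<epsilon>) t) \<xi>)
     - (\<epsilon>\<^sup>2 *\<^sub>R (?R0 \<epsilon> *v ?D1 \<epsilon>) + \<epsilon> ^ 3 *\<^sub>R (?R0 \<epsilon> *v ?D2 \<epsilon> + ?R1 \<epsilon> *v ?D1 \<epsilon>)))"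
  proof (rule order_eps_cong)
    show "order_eps 4 (\<lambda>\<epsilon>. \<epsilon> ^ 2 *\<^sub>R (?Rot \<epsilon> *v ?D \<epsilon> - (?R0 \<epsilon> *v ?D1 \<epsilon> + \<epsilon> *\<^sub>R (?R0 \<epsilon> *v ?D2 \<epsilon> + ?R1 \<epsilon> *v ?D1 \<epsilon>))))"
      using order_eps_scale[OF ord, of 2] by simp
    show "\<forall>\<^sub>F \<epsilon> in at_right 0. \<epsilon> ^ 2 *\<^sub>R (?Rot \<epsilon> *v ?D \<epsilon> - (?R0 \<epsilon> *v ?D1 \<epsilon> + \<epsilon> *\<^sub>R (?R0 \<epsilon> *v ?D2 \<epsilon> + ?R1 \<epsilon> *v ?D1 \<epsilon>))) =
      (LINT \<xi>:body S \<epsilon> (Q \<epsilon>) t|lborel. mdiv (local_str \<epsilon> (Q \<epsilon>) t) \<xi>)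
      - (\<epsilon>\<^sup>2 *\<^sub>R (?R0 \<epsilon> *v ?D1 \<epsilon>) + \<epsilon> ^ 3 *\<^sub>R (?R0 \<epsilon> *v ?D2 \<epsilon> + ?R1 \<epsilon> *v ?D1 \<epsilon>))"
      using body by eventually_elim
        (simp add: scaleR_right_diff_distrib scaleR_right_distrib power2_eq_square power3_eq_cube)
  qed
qed

end

section \<open>Expansion of the particle stress\<close>

lemma order_eps_divide:
  assumes "order_eps (Suc k) f"
  shows "order_eps k (\<lambda>\<epsilon>. (1 / \<epsilon>) *\<^sub>R f \<epsilon>)"
proof -
  obtain C where C: "\<forall>\<^sub>F \<epsilon> in at_right 0. norm (f \<epsilon>) \<le> C * \<epsilon> ^ Suc k"
    using assms unfolding order_eps_def by blast
  show ?thesis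
    by (rule order_epsI[of _ C], use C eventually_eps_pos in eventually_elim) (auto simp: field_simps)
qed

context asymptotic_particle
begin

lemma stress_mean:
  "\<forall>\<^sub>F \<epsilon> in at_right 0. set_integrable lborel (shape S) (lstr (Q \<epsilon>) t)"
  "order_eps 0 (\<lambda>\<epsilon>. LINT y:shape S|lborel. lstrc (Q \<epsilon>) 1 t y)"
  "order_eps 1 (\<lambda>\<epsilon>. (LINT y:shape S|lborel. lstr (Q \<epsilon>) t y) - (LINT y:shape S|lborel. lstrc (Q \<epsilon>) 1 t y))"
proof -
  have "expands (shape S) [\<lambda>\<epsilon>. lstrc (Q \<epsilon>) 1 t, \<lambda>\<epsilon>. lstrc (Q \<epsilon>) 2 t] (\<lambda>\<epsilon>. lstr (Q \<epsilon>) t)"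
    using ex by (simp add: particle_expansions_def)
  from expands_two[OF this] obtain C where
    C: "\<forall>\<^sub>F \<epsilon> in at_right 0. \<forall>y\<in>shape S. norm (lstrc (Q \<epsilon>) 1 t y) \<le> C * \<epsilon> ^ 0"
    "\<forall>\<^sub>F \<epsilon> in at_right 0. \<forall>y\<in>shape S. norm (lstrc (Q \<epsilon>) 2 t y) \<le> C * \<epsilon> ^ 0"
    "\<forall>\<^sub>F \<epsilon> in at_right 0. \<forall>y\<in>shape S. norm (lstr (Q \<epsilon>) t y - (lstrc (Q \<epsilon>) 1 t y + \<epsilon> *\<^sub>R lstrc (Q \<epsilon>) 2 t y)) \<le> C * \<epsilon> ^ 2" .
  have reg: "\<forall>\<^sub>F \<epsilon> in at_right 0. Cdiff 1 (lstr (Q \<epsilon>) t) (shape S)"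
    using ex unfolding particle_expansions_def by (auto elim: eventually_mono)
  have d: "\<forall>\<^sub>F \<epsilon> in at_right 0. \<forall>y\<in>shape S. norm (lstr (Q \<epsilon>) t y - lstrc (Q \<epsilon>) 1 t y) \<le> (2 * C) * \<epsilon> ^ 1"
    using C eventually_eps_pos
  proof eventually_elim
    case (elim \<epsilon>)
    show ?case
    proof
      fix y assume y: "y \<in> shape S"
      let ?a = "lstrc (Q \<epsilon>) 1 t y" and ?b = "lstrc (Q \<epsilon>) 2 t y" and ?m = "lstr (Q \<epsilon>) t y"
      have C0: "0 \<le> C" using order_trans[OF norm_ge_zero bspec[OF elim(1) y]] by simp
      have a: "norm (?m - ?a) \<le> norm (?m - (?a + \<epsilon> *\<^sub>R ?b)) + norm (\<epsilon> *\<^sub>R ?b)"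
        using norm_triangle_ineq[of "?m - (?a + \<epsilon> *\<^sub>R ?b)" "\<epsilon> *\<^sub>R ?b"] by (simp add: algebra_simps)
      have b: "norm (\<epsilon> *\<^sub>R ?b) \<le> \<epsilon> * C"
        using bspec[OF elim(2) y] elim(4) by (auto intro!: mult_left_mono)
      have c: "C * \<epsilon> ^ 2 \<le> C * \<epsilon>"
        using elim(4) C0 by (intro mult_left_mono) (auto simp: power2_eq_square mult_le_one)
      have "C * \<epsilon> + \<epsilon> * C = (2 * C) * \<epsilon>" by simp
      with order_trans[OF a add_mono[OF order_trans[OF bspec[OF elim(3) y] c] b]]
      show "norm (?m - ?a) \<le> (2 * C) * \<epsilon> ^ 1" unfolding power_one_right by simp
    qed
  qed
  have int: "\<forall>\<^sub>F \<epsilon> in at_right 0. set_integrable lborel (shape S) (lstr (Q \<epsilon>) t) \<and>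
      set_integrable lborel (shape S) (lstrc (Q \<epsilon>) 1 t)"
    using C(1) d reg model eventually_eps_pos
  proof eventually_elim
    case (elim \<epsilon>)
    have "continuous_on (shape S) (lstrc (Q \<epsilon>) 1 t)"
      using elim(4) by (auto simp: model_at_def particle_stress_problem_def lstrc_def intro: Cdiff_2_sym_grad(3)[OF shape_facts(1)])
    from set_integrable_image_bound[OF S this elim(1)]
    have i1: "set_integrable lborel (shape S) (lstrc (Q \<epsilon>) 1 t)" .
    have "\<forall>y\<in>shape S. norm (lstr (Q \<epsilon>) t y) \<le> C + 2 * C * \<epsilon>"
    proof
      fix y assume y: "y \<in> shape S"
      have "norm (lstr (Q \<epsilon>) t y) \<le> norm (lstrc (Q \<epsilon>) 1 t y) + norm (lstr (Q \<epsilon>) t y - lstrc (Q \<epsilon>) 1 t y)"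
        by (rule norm_triangle_sub)
      then show "norm (lstr (Q \<epsilon>) t y) \<le> C + 2 * C * \<epsilon>"
        using bspec[OF elim(1) y] bspec[OF elim(2) y] by simp
    qed
    moreover have "continuous_on (shape S) (lstr (Q \<epsilon>) t)"
      using Cdiff_Suc_D[of 0 "lstr (Q \<epsilon>) t"] elim(3) by simp
    ultimately show ?case using i1 set_integrable_image_bound[OF S] by blast
  qed
  then show "\<forall>\<^sub>F \<epsilon> in at_right 0. set_integrable lborel (shape S) (lstr (Q \<epsilon>) t)"
    by (auto elim: eventually_mono)
  show "order_eps 0 (\<lambda>\<epsilon>. LINT y:shape S|lborel. lstrc (Q \<epsilon>) 1 t y)"
    by (rule order_eps_set_integral[OF shape_measurable shape_facts(7) C(1)])
  show "order_eps 1 (\<lambda>\<epsilon>. (LINT y:shape S|lborel. lstr (Q \<epsilon>) t y) - (LINT y:shape S|lborel. lstrc (Q \<epsilon>) 1 t y))"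
    by (rule order_eps_cong[OF order_eps_set_integral[OF shape_measurable shape_facts(7) d]])
      (use int in eventually_elim, simp add: set_integral_diff(2))
qed

text \<open>The expansion of the local velocity has no term of order 0, and the 1 / \<epsilon> from
  the chain rule compensates for that. The scaled gradient is therefore of order 0, as the stress
  is, and its leading coefficient is the gradient of the first local velocity.\<close>

lemma gradient_mean:
  "\<forall>\<^sub>F \<epsilon> in at_right 0. set_integrable lborel (shape S) (grad (lvel (Q \<epsilon>) t))"
  "order_eps 0 (\<lambda>\<epsilon>. LINT y:shape S|lborel. grad (lvelc (Q \<epsilon>) 1 t) y)"
  "order_eps 1 (\<lambda>\<epsilon>. (1 / \<epsilon>) *\<^sub>R (LINT y:shape S|lborel. grad (lvel (Q \<epsilon>) t) y)
      - (LINT y:shape S|lborel. grad (lvelc (Q \<epsilon>) 1 t) y))"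
proof -
  have "expands (shape S) [\<lambda>\<epsilon> y. 0, \<lambda>\<epsilon>. grad (lvelc (Q \<epsilon>) 1 t), \<lambda>\<epsilon>. grad (lvelc (Q \<epsilon>) 2 t)] (\<lambda>\<epsilon>. grad (lvel (Q \<epsilon>) t))"
    using ex by (simp add: particle_expansions_def)
  from expands_three[OF this] obtain C where
    C: "\<forall>\<^sub>F \<epsilon> in at_right 0. \<forall>y\<in>shape S. norm (grad (lvelc (Q \<epsilon>) 1 t) y) \<le> C * \<epsilon> ^ 0"
    "\<forall>\<^sub>F \<epsilon> in at_right 0. \<forall>y\<in>shape S. norm (grad (lvelc (Q \<epsilon>) 2 t) y) \<le> C * \<epsilon> ^ 0"
    "\<forall>\<^sub>F \<epsilon> in at_right 0. \<forall>y\<in>shape S. norm (grad (lvel (Q \<epsilon>) t) y - (0 + \<epsilon> *\<^sub>R grad (lvelc (Q \<epsilon>) 1 t) y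
        + \<epsilon>\<^sup>2 *\<^sub>R grad (lvelc (Q \<epsilon>) 2 t) y)) \<le> C * \<epsilon> ^ 3" .
  have reg: "\<forall>\<^sub>F \<epsilon> in at_right 0. Cdiff 1 (lvel (Q \<epsilon>) t) (shape S)"
    using ex unfolding particle_expansions_def by (auto elim: eventually_mono)
  have d: "\<forall>\<^sub>F \<epsilon> in at_right 0. \<forall>y\<in>shape S. norm (grad (lvel (Q \<epsilon>) t) y - \<epsilon> *\<^sub>R grad (lvelc (Q \<epsilon>) 1 t) y) \<le> (2 * C) * \<epsilon> ^ Suc 1"
    using C eventually_eps_pos
  proof eventually_elim
    case (elim \<epsilon>)
    show ?case
    proof
      fix y assume y: "y \<in> shape S"
      let ?a = "grad (lvelc (Q \<epsilon>) 1 t) y" and ?b = "grad (lvelc (Q \<epsilon>) 2 t) y" and ?m = "grad (lvel (Q \<epsilon>) t) y"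
      have C0: "0 \<le> C" using order_trans[OF norm_ge_zero bspec[OF elim(1) y]] by simp
      have a: "norm (?m - \<epsilon> *\<^sub>R ?a) \<le> norm (?m - (0 + \<epsilon> *\<^sub>R ?a + \<epsilon>\<^sup>2 *\<^sub>R ?b)) + norm (\<epsilon>\<^sup>2 *\<^sub>R ?b)"
        using norm_triangle_ineq[of "?m - (0 + \<epsilon> *\<^sub>R ?a + \<epsilon>\<^sup>2 *\<^sub>R ?b)" "\<epsilon>\<^sup>2 *\<^sub>R ?b"] by (simp add: algebra_simps)
      have b: "norm (\<epsilon>\<^sup>2 *\<^sub>R ?b) \<le> \<epsilon>\<^sup>2 * C"
        using bspec[OF elim(2) y] elim(4) by (auto intro!: mult_left_mono)
      have c: "C * \<epsilon> ^ 3 \<le> C * \<epsilon>\<^sup>2"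
        using elim(4) C0 by (intro mult_left_mono power_decreasing) auto
      have "C * \<epsilon>\<^sup>2 + \<epsilon>\<^sup>2 * C = (2 * C) * \<epsilon>\<^sup>2" by simp
      with order_trans[OF a add_mono[OF order_trans[OF bspec[OF elim(3) y] c] b]]
      show "norm (?m - \<epsilon> *\<^sub>R ?a) \<le> (2 * C) * \<epsilon> ^ Suc 1" unfolding Suc_1 by simp
    qed
  qed
  have int: "\<forall>\<^sub>F \<epsilon> in at_right 0. set_integrable lborel (shape S) (grad (lvel (Q \<epsilon>) t)) \<and>
      set_integrable lborel (shape S) (grad (lvelc (Q \<epsilon>) 1 t)) \<and> 0 < \<epsilon>"
    using C(1) d reg model eventually_eps_pos
  proof eventually_elim
    case (elim \<epsilon>)
    have diff: "(\<lambda>z. u \<epsilon> z t) differentiable at (posc (Q \<epsilon>) 0 t)"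
      and ext: "\<And>y. y \<in> shape S \<Longrightarrow> lvelc (Q \<epsilon>) 1 t y = h1 (u \<epsilon>) (Q \<epsilon>) t y"
      using elim(4) by (auto simp: model_at_def)
    note h = h1_has_derivative[where u="u \<epsilon>" and P="Q \<epsilon>" and t=t, OF diff]
    \<comment> \<open>The gradient of an affine field equals its value at 0. This supplies
      continuity inside the particle, where the first local velocity is given by
      \<open>h1\<close>.\<close>
    have "grad (h1 (u \<epsilon>) (Q \<epsilon>) t) 0 = grad (h1 (u \<epsilon>) (Q \<epsilon>) t) y" for y
      by (simp add: vec_eq_iff grad_nth pd_eqI[OF h])
    then have "grad (h1 (u \<epsilon>) (Q \<epsilon>) t) 0 = grad (lvelc (Q \<epsilon>) 1 t) y" if "y \<in> shape S" for y
      using grad_cong_open[where f="lvelc (Q \<epsilon>) 1 t", OF shape_facts(1) that ext] by simp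
    from continuous_on_eq[OF continuous_on_const this]
    have "continuous_on (shape S) (grad (lvelc (Q \<epsilon>) 1 t))" .
    from set_integrable_image_bound[OF S this elim(1)]
    have i1: "set_integrable lborel (shape S) (grad (lvelc (Q \<epsilon>) 1 t))" .
    have "\<forall>y\<in>shape S. norm (grad (lvel (Q \<epsilon>) t) y) \<le> \<epsilon> * C + 2 * C * \<epsilon>\<^sup>2"
    proof
      fix y assume y: "y \<in> shape S"
      have "norm (grad (lvel (Q \<epsilon>) t) y) \<le> norm (\<epsilon> *\<^sub>R grad (lvelc (Q \<epsilon>) 1 t) y)
          + norm (grad (lvel (Q \<epsilon>) t) y - \<epsilon> *\<^sub>R grad (lvelc (Q \<epsilon>) 1 t) y)"
        by (rule norm_triangle_sub)
      moreover have "norm (\<epsilon> *\<^sub>R grad (lvelc (Q \<epsilon>) 1 t) y) \<le> \<epsilon> * C"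
        using bspec[OF elim(1) y] elim(5) by (auto intro!: mult_left_mono)
      ultimately show "norm (grad (lvel (Q \<epsilon>) t) y) \<le> \<epsilon> * C + 2 * C * \<epsilon>\<^sup>2"
        using bspec[OF elim(2) y] by (simp add: power2_eq_square)
    qed
    from set_integrable_image_bound[OF S continuous_on_grad[OF shape_facts(1) elim(3)] this]
    show ?case using i1 elim(5) by blast
  qed
  then show "\<forall>\<^sub>F \<epsilon> in at_right 0. set_integrable lborel (shape S) (grad (lvel (Q \<epsilon>) t))"
    by (auto elim: eventually_mono)
  show "order_eps 0 (\<lambda>\<epsilon>. LINT y:shape S|lborel. grad (lvelc (Q \<epsilon>) 1 t) y)"
    by (rule order_eps_set_integral[OF shape_measurable shape_facts(7) C(1)])
  show "order_eps 1 (\<lambda>\<epsilon>. (1 / \<epsilon>) *\<^sub>R (LINT y:shape S|lborel. grad (lvel (Q \<epsilon>) t) y)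
      - (LINT y:shape S|lborel. grad (lvelc (Q \<epsilon>) 1 t) y))"
    by (rule order_eps_cong[OF order_eps_divide[OF order_eps_set_integral[OF shape_measurable shape_facts(7) d]]])
      (use int in eventually_elim, simp add: set_integral_diff(2) scaleR_right_diff_distrib)
qed

text \<open>The contribution of one particle to the averaged stress. The symmetrised gradient is
  subtracted because the fluid contributes minus the integral over the particles. The volume gives
  three powers of \<epsilon> and the replacement of rotation, stress and gradient by leading
  coefficients the fourth.\<close>

lemma body_stress_expansion:
  "\<forall>\<^sub>F \<epsilon> in at_right 0. set_integrable lborel (body S \<epsilon> (Q \<epsilon>) t) (local_str \<epsilon> (Q \<epsilon>) t) \<and>
     set_integrable lborel (body S \<epsilon> (Q \<epsilon>) t) (grad (local_vel \<epsilon> (Q \<epsilon>) t))"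
  "order_eps 4 (\<lambda>\<epsilon>. (LINT \<xi>:body S \<epsilon> (Q \<epsilon>) t|lborel. local_str \<epsilon> (Q \<epsilon>) t \<xi>)
     - ((LINT \<xi>:body S \<epsilon> (Q \<epsilon>) t|lborel. grad (local_vel \<epsilon> (Q \<epsilon>) t) \<xi>)
        + transpose (LINT \<xi>:body S \<epsilon> (Q \<epsilon>) t|lborel. grad (local_vel \<epsilon> (Q \<epsilon>) t) \<xi>))
     - \<epsilon> ^ 3 *\<^sub>R (rotc (Q \<epsilon>) 0 t **
          (LINT y|area S.
             outer (outer_trace (shape S) (newton_stress (lvelc (Q \<epsilon>) 1 t) (lprsc (Q \<epsilon>) 1 t)) y *v nrm S y) y
             - outer (h1 (u \<epsilon>) (Q \<epsilon>) t y) (nrm S y) - outer (nrm S y) (h1 (u \<epsilon>) (Q \<epsilon>) t y))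
          ** transpose (rotc (Q \<epsilon>) 0 t)))"
proof -
  let ?M = "\<lambda>\<epsilon>. LINT y:shape S|lborel. lstr (Q \<epsilon>) t y" and ?Mc = "\<lambda>\<epsilon>. LINT y:shape S|lborel. lstrc (Q \<epsilon>) 1 t y"
  let ?N = "\<lambda>\<epsilon>. LINT y:shape S|lborel. grad (lvel (Q \<epsilon>) t) y" and ?Nc = "\<lambda>\<epsilon>. LINT y:shape S|lborel. grad (lvelc (Q \<epsilon>) 1 t) y"
  let ?Rot = "\<lambda>\<epsilon>. rot (Q \<epsilon>) t" and ?Rc = "\<lambda>\<epsilon>. rotc (Q \<epsilon>) 0 t"
  let ?A = "\<lambda>\<epsilon>. ?Rot \<epsilon> ** ?M \<epsilon> ** transpose (?Rot \<epsilon>)" and ?Ac = "\<lambda>\<epsilon>. ?Rc \<epsilon> ** ?Mc \<epsilon> ** transpose (?Rc \<epsilon>)"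
  let ?G = "\<lambda>\<epsilon>. ?Rot \<epsilon> ** ((1 / \<epsilon>) *\<^sub>R ?N \<epsilon>) ** transpose (?Rot \<epsilon>)" and ?Gc = "\<lambda>\<epsilon>. ?Rc \<epsilon> ** ?Nc \<epsilon> ** transpose (?Rc \<epsilon>)"
  let ?I = "\<lambda>\<epsilon>. LINT y|area S.
             outer (outer_trace (shape S) (newton_stress (lvelc (Q \<epsilon>) 1 t) (lprsc (Q \<epsilon>) 1 t)) y *v nrm S y) y
             - outer (h1 (u \<epsilon>) (Q \<epsilon>) t y) (nrm S y) - outer (nrm S y) (h1 (u \<epsilon>) (Q \<epsilon>) t y)"
  let ?LS = "\<lambda>\<epsilon>. LINT \<xi>:body S \<epsilon> (Q \<epsilon>) t|lborel. local_str \<epsilon> (Q \<epsilon>) t \<xi>"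
  let ?LG = "\<lambda>\<epsilon>. LINT \<xi>:body S \<epsilon> (Q \<epsilon>) t|lborel. grad (local_vel \<epsilon> (Q \<epsilon>) t) \<xi>"
  have oA: "order_eps 1 (\<lambda>\<epsilon>. ?A \<epsilon> - ?Ac \<epsilon>)" by (rule congruence_order[OF stress_mean(3,2)])
  have oG: "order_eps 1 (\<lambda>\<epsilon>. ?G \<epsilon> - ?Gc \<epsilon>)" by (rule congruence_order[OF gradient_mean(3,2)])
  have oT: "order_eps 1 (\<lambda>\<epsilon>. transpose (?G \<epsilon> - ?Gc \<epsilon>))"
    by (rule order_eps_bounded_linear[OF bounded_linear_transpose oG])
  have o4: "order_eps (3 + 1) (\<lambda>\<epsilon>. \<epsilon> ^ 3 *\<^sub>R ((?A \<epsilon> - ?Ac \<epsilon>) - ((?G \<epsilon> - ?Gc \<epsilon>) + transpose (?G \<epsilon> - ?Gc \<epsilon>))))"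
    by (rule order_eps_scale[OF order_eps_diff[OF oA order_eps_add[OF oG oT]]])
  have reg: "\<forall>\<^sub>F \<epsilon> in at_right 0. Cdiff 1 (lvel (Q \<epsilon>) t) (shape S)"
    using ex unfolding particle_expansions_def by (auto elim: eventually_mono)
  have "expands (shape S) [\<lambda>\<epsilon>. lstrc (Q \<epsilon>) 1 t, \<lambda>\<epsilon>. lstrc (Q \<epsilon>) 2 t] (\<lambda>\<epsilon>. lstr (Q \<epsilon>) t)"
    using ex by (simp add: particle_expansions_def)
  from expands_two[OF this] obtain C where
    C: "\<forall>\<^sub>F \<epsilon> in at_right 0. \<forall>y\<in>shape S. norm (lstrc (Q \<epsilon>) 1 t y) \<le> C * \<epsilon> ^ 0"
    by blast
  have surf: "\<forall>\<^sub>F \<epsilon> in at_right 0. ?I \<epsilon> = ?Mc \<epsilon> - (?Nc \<epsilon> + transpose (?Nc \<epsilon>))"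
    using C model by eventually_elim (rule surface_moment[OF S])
  have body: "\<forall>\<^sub>F \<epsilon> in at_right 0. set_integrable lborel (body S \<epsilon> (Q \<epsilon>) t) (local_str \<epsilon> (Q \<epsilon>) t) \<and>
     set_integrable lborel (body S \<epsilon> (Q \<epsilon>) t) (grad (local_vel \<epsilon> (Q \<epsilon>) t)) \<and>
     ?LS \<epsilon> = \<epsilon> ^ 3 *\<^sub>R ?A \<epsilon> \<and> ?LG \<epsilon> = \<epsilon> ^ 3 *\<^sub>R ?G \<epsilon>"
    using stress_mean(1) gradient_mean(1) reg model eventually_eps_pos
  proof eventually_elim
    case (elim \<epsilon>)
    then have e: "0 < \<epsilon>" and rm: "rotation_matrix (rot (Q \<epsilon>) t)"
      by (auto simp: model_at_def)
    note T1 = set_integral_bounded_linear[OF bounded_linear_congruence[of "?Rot \<epsilon>" "transpose (?Rot \<epsilon>)"] elim(1)]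
    have loc1: "local_str \<epsilon> (Q \<epsilon>) t x = ?Rot \<epsilon> ** lstr (Q \<epsilon>) t (local_coord \<epsilon> (Q \<epsilon>) t x) ** transpose (?Rot \<epsilon>)" for x
      by (simp add: local_str_def)
    note B1 = integral_body[OF e rm T1(1) loc1]
    have bl: "bounded_linear (\<lambda>A. (1 / \<epsilon>) *\<^sub>R (?Rot \<epsilon> ** A ** transpose (?Rot \<epsilon>)))"
      by (rule bounded_linear_compose[OF bounded_linear_scaleR_right bounded_linear_congruence])
    note T2 = set_integral_bounded_linear[OF bl elim(2)]
    have loc2: "grad (local_vel \<epsilon> (Q \<epsilon>) t) x =
        (1 / \<epsilon>) *\<^sub>R (?Rot \<epsilon> ** grad (lvel (Q \<epsilon>) t) (local_coord \<epsilon> (Q \<epsilon>) t x) ** transpose (?Rot \<epsilon>))"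
      if "x \<in> body S \<epsilon> (Q \<epsilon>) t" for x
      by (rule grad_local_vel[OF e rm])
        (use that Cdiff_1_D(1)[OF elim(3) shape_facts(1)] in \<open>simp add: body_eq_vimage[OF e rm]\<close>)
    note B2 = integral_body[OF e rm T2(1) loc2]
    show ?case
      using B1 B2 unfolding T1(2) T2(2)
      by (simp add: matrix_scalar_ac scalar_matrix_assoc[symmetric])
  qed
  then show "\<forall>\<^sub>F \<epsilon> in at_right 0. set_integrable lborel (body S \<epsilon> (Q \<epsilon>) t) (local_str \<epsilon> (Q \<epsilon>) t) \<and>
     set_integrable lborel (body S \<epsilon> (Q \<epsilon>) t) (grad (local_vel \<epsilon> (Q \<epsilon>) t))"
    by (auto elim: eventually_mono)
  have td: "transpose (a - b) = transpose a - transpose b" "transpose (a + b) = transpose a + transpose b"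
    "transpose (c *\<^sub>R a) = c *\<^sub>R transpose a" for a b :: mat3 and c :: real
    by (simp_all add: transpose_def vec_eq_iff)
  have mm: "r ** (a - b) ** q = r ** a ** q - r ** b ** q" "r ** (a + b) ** q = r ** a ** q + r ** b ** q" for r a b q :: mat3
    by (simp_all add: linear_diff[OF bounded_linear.linear[OF bounded_linear_congruence]]
        linear_add[OF bounded_linear.linear[OF bounded_linear_congruence]])
  have tG: "transpose (r ** a ** transpose r) = r ** transpose a ** transpose r" for r a :: mat3
    by (simp add: matrix_transpose_mul matrix_mul_assoc)
  have lin: "c *\<^sub>R ((a - a') - ((b - b') + transpose (b - b'))) =
      c *\<^sub>R a - (c *\<^sub>R b + transpose (c *\<^sub>R b)) - c *\<^sub>R x"
    if "x = a' - (b' + transpose b')" for a a' b b' x :: mat3 and c :: real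
    unfolding that td by (simp add: algebra_simps)
  show "order_eps 4 (\<lambda>\<epsilon>. ?LS \<epsilon> - (?LG \<epsilon> + transpose (?LG \<epsilon>)) - \<epsilon> ^ 3 *\<^sub>R (?Rc \<epsilon> ** ?I \<epsilon> ** transpose (?Rc \<epsilon>)))"
  proof (rule order_eps_cong)
    show "order_eps 4 (\<lambda>\<epsilon>. \<epsilon> ^ 3 *\<^sub>R ((?A \<epsilon> - ?Ac \<epsilon>) - ((?G \<epsilon> - ?Gc \<epsilon>) + transpose (?G \<epsilon> - ?Gc \<epsilon>))))"
      using o4 by simp
    show "\<forall>\<^sub>F \<epsilon> in at_right 0. \<epsilon> ^ 3 *\<^sub>R ((?A \<epsilon> - ?Ac \<epsilon>) - ((?G \<epsilon> - ?Gc \<epsilon>) + transpose (?G \<epsilon> - ?Gc \<epsilon>))) =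
       ?LS \<epsilon> - (?LG \<epsilon> + transpose (?LG \<epsilon>)) - \<epsilon> ^ 3 *\<^sub>R (?Rc \<epsilon> ** ?I \<epsilon> ** transpose (?Rc \<epsilon>))"
      using body surf
    proof eventually_elim
      case (elim \<epsilon>)
      then have e: "?LS \<epsilon> = \<epsilon> ^ 3 *\<^sub>R ?A \<epsilon>" "?LG \<epsilon> = \<epsilon> ^ 3 *\<^sub>R ?G \<epsilon>"
        "?I \<epsilon> = ?Mc \<epsilon> - (?Nc \<epsilon> + transpose (?Nc \<epsilon>))" by blast+
      have "?Rc \<epsilon> ** ?I \<epsilon> ** transpose (?Rc \<epsilon>) = ?Ac \<epsilon> - (?Gc \<epsilon> + transpose (?Gc \<epsilon>))"
        unfolding e(3) mm tG ..
      from lin[OF this] show ?case unfolding e(1,2) .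
    qed
  qed
qed

end

section \<open>Decay of the local velocity\<close>

text \<open>Dyadic decomposition: on the shell \<open>2\<^sup>-\<^sup>n\<^sup>-\<^sup>1 \<le> |z| < 2\<^sup>-\<^sup>n\<close> the function \<open>1 / |z|\<^sup>2\<close> is at most \<open>4\<^sup>n\<^sup>+\<^sup>1\<close>.\<close>

lemma nn_integral_inverse_square_ball:
  "(\<integral>\<^sup>+ z. indicator (ball 0 1) z * ennreal (1 / (norm z)\<^sup>2) \<partial>(lborel :: vec3 measure)) < \<infinity>"
proof -
  let ?\<beta> = "unit_ball_vol 3"
  have bound: "indicator (ball 0 1) z * ennreal (1 / (norm z)\<^sup>2) \<le>
      (\<Sum>n. ennreal (4 ^ Suc n) * indicator (ball 0 ((1/2) ^ n)) z)" for z :: vec3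
  proof (cases "z \<in> ball 0 1 \<and> z \<noteq> 0")
    case True
    have "(\<lambda>n. (1/2 :: real) ^ n) \<longlonglongrightarrow> 0" by (rule LIMSEQ_power_zero) simp
    then have "\<forall>\<^sub>F n in sequentially. (1/2 :: real) ^ n < norm z"
      using True by (intro order_tendstoD) auto
    then have "\<exists>n. (1/2 :: real) ^ n \<le> norm z"
      by (metis eventually_sequentially less_imp_le order_refl)
    \<comment> \<open>z lies in the shell with index m - 1. Minimality of m puts it in the ball of
      that index, and m is positive because z is in the unit ball.\<close>
    define m where "m = (LEAST n. (1/2 :: real) ^ n \<le> norm z)"
    have m: "(1/2 :: real) ^ m \<le> norm z"
      unfolding m_def by (rule LeastI_ex) fact
    have "m \<noteq> 0" using m True by (intro notI) auto
    then obtain n where n: "m = Suc n" by (cases m) auto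
    have "\<not> (1/2 :: real) ^ n \<le> norm z"
      using not_less_Least[of n "\<lambda>n. (1/2 :: real) ^ n \<le> norm z"] n by (simp add: m_def)
    then have zn: "z \<in> ball 0 ((1/2) ^ n)" by simp
    have "1 / (norm z)\<^sup>2 \<le> 1 / ((1/2) ^ m)\<^sup>2"
      using m True by (intro divide_left_mono power_mono) auto
    also have "\<dots> = 4 ^ Suc n"
    proof -
      have "((1/2 :: real) ^ m)\<^sup>2 = ((1/2)\<^sup>2) ^ m"
        by (simp only: power_mult[symmetric] mult.commute)
      then show ?thesis by (simp add: n power_divide)
    qed
    finally have "ennreal (1 / (norm z)\<^sup>2) \<le> ennreal (4 ^ Suc n) * indicator (ball 0 ((1/2) ^ n)) z"
      using zn by (simp add: ennreal_leI)
    also have "\<dots> = (\<Sum>k\<in>{n}. ennreal (4 ^ Suc k) * indicator (ball 0 ((1/2) ^ k)) z)"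
      by (simp only: sum.empty sum.insert finite.emptyI empty_iff not_False_eq_True add_0_right)
    also have "\<dots> \<le> (\<Sum>n. ennreal (4 ^ Suc n) * indicator (ball 0 ((1/2) ^ n)) z)"
      by (rule sum_le_suminf) auto
    finally show ?thesis using True by simp
  qed auto
  have "(\<integral>\<^sup>+ z. indicator (ball 0 1) z * ennreal (1 / (norm z)\<^sup>2) \<partial>(lborel :: vec3 measure)) \<le>
      (\<integral>\<^sup>+ z. (\<Sum>n. ennreal (4 ^ Suc n) * indicator (ball 0 ((1/2) ^ n)) z) \<partial>(lborel :: vec3 measure))"
    by (intro nn_integral_mono bound)
  also have "\<dots> = (\<Sum>n. \<integral>\<^sup>+ z. ennreal (4 ^ Suc n) * indicator (ball 0 ((1/2) ^ n)) z \<partial>(lborel :: vec3 measure))"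
  proof (intro nn_integral_suminf)
    fix n
    have [measurable]: "ball (0 :: vec3) ((1/2) ^ n) \<in> sets borel" by simp
    show "(\<lambda>z. ennreal (4 ^ Suc n) * indicator (ball 0 ((1/2) ^ n)) z) \<in> borel_measurable (lborel :: vec3 measure)"
      by measurable
  qed
  \<comment> \<open>The ball of index n has 8^n times less volume than the unit ball and its weight
    is 4^(n + 1), which leaves the geometric series with ratio 1/2.\<close>
  also have "\<dots> = (\<Sum>n. ennreal (4 * ?\<beta> * (1/2) ^ n))"
  proof (intro suminf_cong)
    fix n
    have "(\<integral>\<^sup>+ z. ennreal (4 ^ Suc n) * indicator (ball 0 ((1/2) ^ n)) z \<partial>(lborel :: vec3 measure)) =
        ennreal (4 ^ Suc n) * emeasure lborel (ball 0 ((1/2) ^ n) :: vec3 set)"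
      by (subst nn_integral_cmult_indicator) auto
    also have "\<dots> = ennreal (4 ^ Suc n * (?\<beta> * ((1/2) ^ n) ^ 3))"
      by (subst emeasure_ball) (auto simp: ennreal_mult)
    also have "4 ^ Suc n * (?\<beta> * ((1/2) ^ n) ^ 3) = 4 * ?\<beta> * (1/2) ^ n"
    proof -
      have "(4::real) ^ n * ((1/2) ^ n) ^ 3 = (4 * (1/2) ^ 3) ^ n"
        unfolding power_mult_distrib by (simp add: power_mult[symmetric] mult.commute)
      then show ?thesis by (simp add: power3_eq_cube)
    qed
    finally show "(\<integral>\<^sup>+ z. ennreal (4 ^ Suc n) * indicator (ball 0 ((1/2) ^ n)) z \<partial>(lborel :: vec3 measure)) =
      ennreal (4 * ?\<beta> * (1/2) ^ n)" .
  qed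
  also have "\<dots> < \<infinity>"
  proof -
    have "summable (\<lambda>n. 4 * ?\<beta> * (1/2 :: real) ^ n)"
      by (intro summable_mult summable_geometric) simp
    then have "(\<Sum>n. ennreal (4 * ?\<beta> * (1/2) ^ n)) \<noteq> top"
      by (intro ennreal_suminf_neq_top) auto
    then show ?thesis by (simp add: less_top)
  qed
  finally show ?thesis .
qed

text \<open>Within distance 1 of c the integral is a translate of the fixed one over the unit ball;
  farther away the integrand is at most 1. Uniformity in c matters because the centres of the
  particles move with \<epsilon>.\<close>

lemma inverse_square_mean_bound:
  fixes V :: "vec3 set"
  assumes V: "V \<in> sets lborel" "emeasure lborel V < \<infinity>"
  obtains J where "0 \<le> J" "\<And>c. (\<integral>\<^sup>+ x. indicator V x * ennreal (1 / (norm (x - c))\<^sup>2) \<partial>lborel) \<le> ennreal J"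
proof -
  let ?g = "\<lambda>z::vec3. ennreal (1 / (norm z)\<^sup>2)"
  let ?K = "(\<integral>\<^sup>+ z. indicator (ball 0 1) z * ?g z \<partial>(lborel :: vec3 measure))"
  have gm: "(\<lambda>z. indicator (ball 0 1) z * ?g z) \<in> borel_measurable borel"
  proof -
    have [measurable]: "ball (0 :: vec3) 1 \<in> sets borel" by simp
    show ?thesis by measurable
  qed
  have "(\<integral>\<^sup>+ x. indicator V x * ?g (x - c) \<partial>lborel) \<le> emeasure lborel V + ?K" for c
  proof -
    have "(\<integral>\<^sup>+ x. indicator V x * ?g (x - c) \<partial>lborel) \<le>
        (\<integral>\<^sup>+ x. indicator V x + indicator (ball 0 1) (x - c) * ?g (x - c) \<partial>lborel)"
    proof (intro nn_integral_mono)
      fix x :: vec3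
      show "indicator V x * ?g (x - c) \<le> indicator V x + indicator (ball 0 1) (x - c) * ?g (x - c)"
      proof (cases "x \<in> V \<and> x - c \<notin> ball 0 1")
        case True
        then have "1 / (norm (x - c))\<^sup>2 \<le> 1"
          by (auto simp: divide_le_eq_1 one_le_power)
        then have "?g (x - c) \<le> ennreal 1" by (rule ennreal_leI)
        then show ?thesis using True by simp
      qed (auto simp: indicator_def)
    qed
    also have "\<dots> = emeasure lborel V + (\<integral>\<^sup>+ x. indicator (ball 0 1) (x - c) * ?g (x - c) \<partial>lborel)"
    proof (subst nn_integral_add)
      have "(\<lambda>x. x - c) \<in> borel_measurable borel" by measurable
      from measurable_compose[OF this gm]
      show "(\<lambda>x. indicator (ball 0 1) (x - c) * ?g (x - c)) \<in> borel_measurable lborel" by simp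
    qed (use V in auto)
    also have "(\<integral>\<^sup>+ x. indicator (ball 0 1) (x - c) * ?g (x - c) \<partial>lborel) =
        (\<integral>\<^sup>+ z. indicator (ball 0 1) z * ?g z \<partial>distr lborel borel ((+) (- c)))"
      using gm by (subst nn_integral_distr) (auto simp: add.commute)
    also have "\<dots> = ?K" by (simp add: lborel_distr_plus)
    finally show ?thesis .
  qed
  moreover have "emeasure lborel V + ?K < \<infinity>"
    using V(2) nn_integral_inverse_square_ball by simp
  ultimately show thesis
    by (intro that[of "enn2real (emeasure lborel V + ?K)"]) (auto simp: less_top)
qed

text \<open>An almost everywhere bound is the right hypothesis, since the bound on the fluctuation
  is singular at the centres. If \<open>f\<close> is not integrable its integral is 0 by convention,
  so the momentum flux of the fluctuation can be estimated directly.\<close>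

lemma norm_set_integral_le_nn_integral:
  fixes f :: "vec3 \<Rightarrow> 'b::{banach,second_countable_topology}"
  assumes "AE x in lborel. x \<in> V \<longrightarrow> norm (f x) \<le> g x"
    and "(\<integral>\<^sup>+ x. indicator V x * ennreal (g x) \<partial>lborel) \<le> ennreal B" "0 \<le> B"
  shows "norm (LINT x:V|lborel. f x) \<le> B"
proof (cases "set_integrable lborel V f")
  case True
  have "ennreal (norm (LINT x:V|lborel. f x)) \<le> (\<integral>\<^sup>+ x. norm (indicator V x *\<^sub>R f x) \<partial>lborel)"
    unfolding set_lebesgue_integral_def
    by (rule integral_norm_bound_ennreal) (use True in \<open>simp add: set_integrable_def\<close>)
  also have "\<dots> \<le> (\<integral>\<^sup>+ x. indicator V x * ennreal (g x) \<partial>lborel)"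
    using assms(1) by (intro nn_integral_mono_AE) (auto elim!: eventually_mono simp: indicator_def ennreal_leI)
  also note assms(2)
  finally show ?thesis using assms(3) by simp
next
  case False
  then have "(LINT x:V|lborel. f x) = 0"
    unfolding set_lebesgue_integral_def set_integrable_def by (rule not_integrable_integral_eq)
  then show ?thesis using assms(3) by simp
qed

lemma norm_outer: "norm (outer a b) = norm a * norm b"
proof -
  have "(norm (outer a b))\<^sup>2 = (norm a * norm b)\<^sup>2"
    unfolding power_mult_distrib power2_norm_eq_inner inner_vec_def
    by (simp add: sum_3 algebra_simps)
  then show ?thesis by (simp add: power2_eq_iff_nonneg)
qed

text \<open>For y = (x - c) / \<epsilon> in local coordinates, \<epsilon> K / |y| is \<epsilon>^2 K
  / |x - c|. The first coefficient thus gains a power of \<epsilon> from its decay, whereas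
  boundedness suffices for the second coefficient and the remainder; these make up the summand
  1.\<close>

lemma local_vel_bound:
  assumes ex: "particle_expansions S Q t" and dec: "local_decay S Q t"
    and rot: "\<forall>\<^sub>F \<epsilon> in at_right 0. rotation_matrix (rot (Q \<epsilon>) t)"
  obtains K where "0 \<le> K" "\<forall>\<^sub>F \<epsilon> in at_right 0. \<forall>x. x \<noteq> pos (Q \<epsilon>) t \<longrightarrow>
    norm (local_vel \<epsilon> (Q \<epsilon>) t x) \<le> \<epsilon>\<^sup>2 * (K * (1 / norm (x - pos (Q \<epsilon>) t) + 1))"
proof -
  have "expands UNIV [\<lambda>\<epsilon> y. 0, \<lambda>\<epsilon>. lvelc (Q \<epsilon>) 1 t, \<lambda>\<epsilon>. lvelc (Q \<epsilon>) 2 t] (\<lambda>\<epsilon>. lvel (Q \<epsilon>) t)"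
    using ex by (simp add: particle_expansions_def)
  from expands_three[OF this] obtain C where
    C: "\<forall>\<^sub>F \<epsilon> in at_right 0. \<forall>y\<in>UNIV. norm (lvelc (Q \<epsilon>) 1 t y) \<le> C * \<epsilon> ^ 0"
    "\<forall>\<^sub>F \<epsilon> in at_right 0. \<forall>y\<in>UNIV. norm (lvelc (Q \<epsilon>) 2 t y) \<le> C * \<epsilon> ^ 0"
    "\<forall>\<^sub>F \<epsilon> in at_right 0. \<forall>y\<in>UNIV. norm (lvel (Q \<epsilon>) t y - (0 + \<epsilon> *\<^sub>R lvelc (Q \<epsilon>) 1 t y
        + \<epsilon>\<^sup>2 *\<^sub>R lvelc (Q \<epsilon>) 2 t y)) \<le> C * \<epsilon> ^ 3" .
  obtain D D' D'' where D: "D'' > 0" "\<forall>\<^sub>F \<epsilon> in at_right 0. \<forall>y. norm y \<ge> D'' \<longrightarrow>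
        norm (lvelc (Q \<epsilon>) 1 t y) \<le> D / norm y \<and>
        norm (grad (lvelc (Q \<epsilon>) 1 t) y) \<le> D' / (norm y)\<^sup>2 \<and>
        \<bar>lprsc (Q \<epsilon>) 1 t y\<bar> \<le> D' / (norm y)\<^sup>2"
    using dec unfolding local_decay_def by blast
  \<comment> \<open>The three parts serve the first coefficient at distances below D'', the same
    coefficient at larger distances, and the second coefficient together with the remainder.\<close>
  define K where "K = \<bar>C\<bar> * D'' + \<bar>D\<bar> + 2 * \<bar>C\<bar>"
  have K: "0 \<le> K" "\<bar>C\<bar> * D'' \<le> K" "\<bar>D\<bar> \<le> K" "2 * \<bar>C\<bar> \<le> K"
    using D(1) by (auto simp: K_def)
  show thesis
  proof (rule that[OF K(1)], use C D(2) rot eventually_eps_pos in eventually_elim)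
    case (elim \<epsilon>)
    show ?case
    proof (intro allI impI)
      fix x assume x: "x \<noteq> pos (Q \<epsilon>) t"
      let ?y = "local_coord \<epsilon> (Q \<epsilon>) t x" and ?d = "norm (x - pos (Q \<epsilon>) t)"
      have e: "0 < \<epsilon>" "\<epsilon> < 1" and om: "orthogonal_matrix (rot (Q \<epsilon>) t)" "orthogonal_matrix (transpose (rot (Q \<epsilon>) t))"
        using elim by (auto simp: rotation_matrix_def)
      have nR: "norm (R *v v) = norm v" if "orthogonal_matrix R" for R :: mat3 and v
        using that orthogonal_transformation_matrix[of "(*v) R"] orthogonal_transformation_norm[of "(*v) R" v] by simp
      have ny: "norm ?y = ?d / \<epsilon>"
        using e by (simp add: local_coord_def nR[OF om(2)])
      have d: "0 < ?d" using x by simp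
      have y0: "0 < norm ?y" unfolding ny using d e by simp
      \<comment> \<open>The decay assumption starts at distance D''. At smaller distances the
        uniform bound does the same, since 1 / |y| is bounded below there.\<close>
      have v1: "norm (lvelc (Q \<epsilon>) 1 t ?y) \<le> K / norm ?y"
      proof (cases "D'' \<le> norm ?y")
        case True
        then have "norm (lvelc (Q \<epsilon>) 1 t ?y) \<le> D / norm ?y" using elim(4) by blast
        also have "\<dots> \<le> K / norm ?y" using K(3) y0 by (intro divide_right_mono) auto
        finally show ?thesis .
      next
        case False
        have "norm (lvelc (Q \<epsilon>) 1 t ?y) \<le> \<bar>C\<bar>" using elim(1) by (auto intro: order_trans)
        also have "\<bar>C\<bar> * norm ?y \<le> \<bar>C\<bar> * D''" using False by (intro mult_left_mono) auto
        then have "\<bar>C\<bar> * norm ?y \<le> K" using K(2) by simp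
        then have "\<bar>C\<bar> \<le> K / norm ?y" using y0 by (simp add: pos_le_divide_eq)
        finally show ?thesis .
      qed
      have v2: "norm (lvelc (Q \<epsilon>) 2 t ?y) \<le> \<bar>C\<bar>" using elim(2) by (auto intro: order_trans)
      have rem: "norm (lvel (Q \<epsilon>) t ?y - (\<epsilon> *\<^sub>R lvelc (Q \<epsilon>) 1 t ?y + \<epsilon>\<^sup>2 *\<^sub>R lvelc (Q \<epsilon>) 2 t ?y)) \<le> \<bar>C\<bar> * \<epsilon>\<^sup>2"
      proof -
        have "C * \<epsilon> ^ 3 \<le> \<bar>C\<bar> * \<epsilon>\<^sup>2"
          using e by (intro mult_mono power_decreasing) auto
        from order_trans[OF bspec[OF elim(3) UNIV_I] this] show ?thesis by (simp only: add_0_left)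
      qed
      have "norm (local_vel \<epsilon> (Q \<epsilon>) t x) = norm (lvel (Q \<epsilon>) t ?y)"
        by (simp add: local_vel_def nR[OF om(1)])
      also have "\<dots> \<le> norm (\<epsilon> *\<^sub>R lvelc (Q \<epsilon>) 1 t ?y + \<epsilon>\<^sup>2 *\<^sub>R lvelc (Q \<epsilon>) 2 t ?y) +
          norm (lvel (Q \<epsilon>) t ?y - (\<epsilon> *\<^sub>R lvelc (Q \<epsilon>) 1 t ?y + \<epsilon>\<^sup>2 *\<^sub>R lvelc (Q \<epsilon>) 2 t ?y))"
        by (rule norm_triangle_sub)
      also have "\<dots> \<le> (\<epsilon> * (K / norm ?y) + \<epsilon>\<^sup>2 * \<bar>C\<bar>) + \<bar>C\<bar> * \<epsilon>\<^sup>2"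
      proof (intro add_mono rem)
        have "norm (\<epsilon> *\<^sub>R lvelc (Q \<epsilon>) 1 t ?y) \<le> \<epsilon> * (K / norm ?y)"
          unfolding norm_scaleR using mult_left_mono[OF v1, of \<epsilon>] e by (simp only: abs_of_pos less_imp_le)
        moreover have "norm (\<epsilon>\<^sup>2 *\<^sub>R lvelc (Q \<epsilon>) 2 t ?y) \<le> \<epsilon>\<^sup>2 * \<bar>C\<bar>"
          using v2 e by (auto intro!: mult_left_mono)
        ultimately show "norm (\<epsilon> *\<^sub>R lvelc (Q \<epsilon>) 1 t ?y + \<epsilon>\<^sup>2 *\<^sub>R lvelc (Q \<epsilon>) 2 t ?y) \<le> \<epsilon> * (K / norm ?y) + \<epsilon>\<^sup>2 * \<bar>C\<bar>"
          by (rule order_trans[OF norm_triangle_ineq add_mono])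
      qed
      also have "\<dots> = \<epsilon>\<^sup>2 * (K / ?d + 2 * \<bar>C\<bar>)"
        unfolding ny using e d by (simp add: field_simps power2_eq_square)
      also have "\<dots> \<le> \<epsilon>\<^sup>2 * (K / ?d + K)"
        using K(4) by (intro mult_left_mono add_left_mono) auto
      also have "\<dots> = \<epsilon>\<^sup>2 * (K * (1 / ?d + 1))" by (simp add: algebra_simps)
      finally show "norm (local_vel \<epsilon> (Q \<epsilon>) t x) \<le> \<epsilon>\<^sup>2 * (K * (1 / ?d + 1))" .
    qed
  qed
qed

section \<open>The averaged balance equations\<close>

lemma pd_diff:
  assumes "f differentiable at x" "g differentiable at x"
  shows "pd j (\<lambda>z. f z - g z) x = pd j f x - pd j g x"
proof -
  have "((\<lambda>z. f z - g z) has_derivative (\<lambda>v. frechet_derivative f (at x) v - frechet_derivative g (at x) v)) (at x)"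
    by (rule has_derivative_diff) (use assms in \<open>simp_all add: frechet_derivative_works[symmetric]\<close>)
  from pd_eqI[OF this] show ?thesis by (simp add: pd_def)
qed

lemma mdiv_diff:
  assumes "f differentiable at x" "g differentiable at x"
  shows "mdiv (\<lambda>z. f z - g z) x = mdiv f x - mdiv g x"
  by (simp add: mdiv_def pd_diff[OF assms] vec_eq_iff sum_subtractf)

lemma mdiv_cong_open:
  assumes "open U" "x \<in> U" "\<And>y. y \<in> U \<Longrightarrow> f y = g y"
  shows "mdiv f x = mdiv g x"
  using pd_cong_open[OF assms] by (simp add: mdiv_def)

lemma bounded_bilinear_outer: "bounded_bilinear outer"
  unfolding bilinear_conv_bounded_bilinear[symmetric] bilinear_def
  using bounded_linear.linear[OF bounded_linear_outer_left] bounded_linear.linear[OF bounded_linear_outer_right]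
  by auto

lemma outer_self_differentiable:
  assumes "f differentiable at x"
  shows "(\<lambda>z. outer (f z) (f z)) differentiable at x"
proof -
  have "(f has_derivative frechet_derivative f (at x)) (at x)"
    using assms by (simp add: frechet_derivative_works[symmetric])
  from bounded_bilinear.FDERIV[OF bounded_bilinear_outer this this] show ?thesis
    by (auto simp: differentiable_def)
qed

lemma vdiv_eq_trace_jacobian: "vdiv f x = (\<Sum>j\<in>UNIV. jacobian f (at x) $ j $ j)"
  by (simp add: vdiv_def jacobian_nth)

text \<open>For divergence-free fields the convective and the conservative form of the inertia
  agree. This is used for each realisation and once more for the mean flow.\<close>

lemma mdiv_outer_self:
  assumes "f differentiable at x" "vdiv f x = 0"
  shows "mdiv (\<lambda>z. outer (f z) (f z)) x = conv f x"
proof -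
  have D: "(f has_derivative frechet_derivative f (at x)) (at x)"
    using assms by (simp add: frechet_derivative_works[symmetric])
  have pdo: "pd j (\<lambda>z. outer (f z) (f z)) x = outer (f x) (pd j f x) + outer (pd j f x) (f x)" for j
    using pd_eqI[OF bounded_bilinear.FDERIV[OF bounded_bilinear_outer D D]] by (simp add: pd_def)
  have "mdiv (\<lambda>z. outer (f z) (f z)) x $ i = conv f x $ i" for i
  proof -
    have "mdiv (\<lambda>z. outer (f z) (f z)) x $ i = f x $ i * vdiv f x + (\<Sum>j\<in>UNIV. pd j f x $ i * f x $ j)"
      by (simp add: mdiv_def pdo vdiv_def sum.distrib sum_distrib_left)
    also have "(\<Sum>j\<in>UNIV. pd j f x $ i * f x $ j) = conv f x $ i"
      by (simp add: conv_def matrix_vector_mult_def jacobian_nth)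
    finally show ?thesis using assms(2) by simp
  qed
  then show ?thesis by (simp add: vec_eq_iff)
qed

text \<open>Reynolds averaging. In conservative form the nonlinear term is quadratic under the
  divergence, and the mean of w \<otimes> w differs from u \<otimes> u by the mean of the products
  of fluctuations. The divergence of this difference is the Reynolds term.\<close>

theorem averaged_balance_of_random_balance:
  fixes M :: "'w measure" and F :: "'w suspension"
  assumes frame: "suspension_frame M F"
    and balance: "\<forall>\<epsilon>\<in>{0<..<eps0 F}. \<forall>x\<in>dom F. \<forall>t>0. AE \<omega> in M. random_balance S F \<epsilon> \<omega> x t"
    and averaging: "\<forall>\<epsilon>\<in>{0<..<eps0 F}. \<forall>x\<in>dom F. \<forall>t>0. averaging_rules M F \<epsilon> x t"
    and \<epsilon>: "\<epsilon> \<in> {0<..<eps0 F}" and x: "x \<in> dom F" and t: "0 < t"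
  shows "averaged_balance M S F \<epsilon> x t"
proof -
  interpret prob_space M using frame by (simp add: suspension_frame_def)
  have openD: "open (dom F)" using frame by (simp add: suspension_frame_def)
  let ?u = "umean M F \<epsilon>"
  let ?w = "\<lambda>\<omega> z. wvel F \<epsilon> \<omega> z t"
  let ?dt = "\<lambda>\<omega>. vector_derivative (\<lambda>s. wvel F \<epsilon> \<omega> x s) (at t)"
  let ?ww = "\<lambda>\<omega>. mdiv (\<lambda>z. outer (?w \<omega> z) (?w \<omega> z)) x"
  let ?S = "\<lambda>\<omega>. mdiv (\<lambda>z. Sigs F \<epsilon> \<omega> z t) x"
  let ?b = "\<lambda>\<omega>. bforce F \<epsilon> \<omega> x t"
  let ?g = "(Rey S / (Frn S)\<^sup>2) *\<^sub>R grav S"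
  have bal: "AE \<omega> in M. random_balance S F \<epsilon> \<omega> x t" using balance \<epsilon> x t by blast
  have rules: "averaging_rules M F \<epsilon> z t" if "z \<in> dom F" for z using averaging \<epsilon> t that by blast
  note rx = rules[OF x, unfolded averaging_rules_def]
  have "Cdiff 2 (\<lambda>z. ?u z t) (dom F)" using frame \<epsilon> t by (simp add: suspension_frame_def)
  then have "Cdiff (Suc 1) (\<lambda>z. ?u z t) (dom F)" by (simp only: Suc_1)
  from Cdiff_Suc_D[OF this] have du: "(\<lambda>z. ?u z t) differentiable at x" by (rule Cdiff_1_D(1)[OF _ openD x])
  have divw: "AE \<omega> in M. (\<Sum>j\<in>UNIV. jacobian (?w \<omega>) (at x) $ j $ j) = 0"
    using bal by eventually_elim (simp add: random_balance_def vdiv_eq_trace_jacobian)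
  \<comment> \<open>The divergence is the trace of the Jacobian, a bounded linear map, and so
    commutes with the expectation.\<close>
  have divu: "vdiv (\<lambda>z. ?u z t) x = 0"
  proof -
    have bl: "bounded_linear (\<lambda>A::mat3. \<Sum>j\<in>UNIV. A $ j $ j)"
      by (intro bounded_linear_sum bounded_linear_compose[OF bounded_linear_vec_nth bounded_linear_vec_nth])
    have int: "integrable M (\<lambda>\<omega>. jacobian (?w \<omega>) (at x))" using rx by blast
    have "vdiv (\<lambda>z. ?u z t) x = (\<Sum>j\<in>UNIV. (LINT \<omega>|M. jacobian (?w \<omega>) (at x)) $ j $ j)"
      using rx by (simp add: vdiv_eq_trace_jacobian)
    also have "\<dots> = (LINT \<omega>|M. (\<Sum>j\<in>UNIV. jacobian (?w \<omega>) (at x) $ j $ j))"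
      by (rule integral_bounded_linear[OF bl int, symmetric])
    also have "\<dots> = (LINT \<omega>|M. 0)"
      using divw integrable_bounded_linear[OF bl int] by (intro integral_cong_AE) auto
    finally show ?thesis by simp
  qed
  have ae: "AE \<omega> in M. Rey S *\<^sub>R (?dt \<omega> + ?ww \<omega>) = ?S \<omega> + ?b \<omega> + ?g"
    using bal
  proof eventually_elim
    case (elim \<omega>)
    then have "(\<lambda>z. ?w \<omega> z) differentiable at x" "vdiv (\<lambda>z. ?w \<omega> z) x = 0"
      and eq: "Rey S *\<^sub>R (?dt \<omega> + conv (\<lambda>z. ?w \<omega> z) x) = mdiv (\<lambda>z. Sig F \<epsilon> \<omega> z t) x + ?g"
      "mdiv (\<lambda>z. Sig F \<epsilon> \<omega> z t) x = ?S \<omega> + ?b \<omega>"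
      by (simp_all add: random_balance_def)
    from mdiv_outer_self[OF this(1,2)] eq show ?case by simp
  qed
  have ints: "integrable M ?dt" "integrable M ?ww" "integrable M ?S" "integrable M ?b"
    using rx by blast+
  have "(LINT \<omega>|M. Rey S *\<^sub>R (?dt \<omega> + ?ww \<omega>)) = (LINT \<omega>|M. ?S \<omega> + ?b \<omega> + ?g)"
    using ae ints by (intro integral_cong_AE) auto
  also have "(LINT \<omega>|M. ?S \<omega> + ?b \<omega> + ?g) = (LINT \<omega>|M. ?S \<omega>) + (LINT \<omega>|M. ?b \<omega>) + ?g"
    using ints by (simp add: prob_space)
  finally have mean_eq: "Rey S *\<^sub>R ((LINT \<omega>|M. ?dt \<omega>) + (LINT \<omega>|M. ?ww \<omega>)) = (LINT \<omega>|M. ?S \<omega>) + (LINT \<omega>|M. ?b \<omega>) + ?g"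
    using ints by simp
  let ?W = "\<lambda>z. mean M (\<lambda>\<omega> z t. outer (wvel F \<epsilon> \<omega> z t) (wvel F \<epsilon> \<omega> z t)) z t"
  \<comment> \<open>Stated on the whole open domain and not only at x, because the identity is
    differentiated afterwards.\<close>
  have rey: "mean M (reynolds M F \<epsilon>) z t = ?W z - outer (?u z t) (?u z t)" if z: "z \<in> dom F" for z
  proof -
    have i1: "integrable M (\<lambda>\<omega>. ?w \<omega> z)" and i2: "integrable M (\<lambda>\<omega>. outer (?w \<omega> z) (?w \<omega> z))"
      using rules[OF z] unfolding averaging_rules_def by blast+
    let ?c = "?u z t"
    have l: "integrable M (\<lambda>\<omega>. outer (?w \<omega> z) ?c)" "(LINT \<omega>|M. outer (?w \<omega> z) ?c) = outer ?c ?c"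
      using integrable_bounded_linear[OF bounded_linear_outer_left i1] integral_bounded_linear[OF bounded_linear_outer_left i1]
      by (auto simp: mean_def)
    have r: "integrable M (\<lambda>\<omega>. outer ?c (?w \<omega> z))" "(LINT \<omega>|M. outer ?c (?w \<omega> z)) = outer ?c ?c"
      using integrable_bounded_linear[OF bounded_linear_outer_right i1] integral_bounded_linear[OF bounded_linear_outer_right i1]
      by (auto simp: mean_def)
    have ex: "reynolds M F \<epsilon> \<omega> z t = outer (?w \<omega> z) (?w \<omega> z) - outer (?w \<omega> z) ?c - outer ?c (?w \<omega> z) + outer ?c ?c" for \<omega>
      by (simp add: reynolds_def fluct_vel_def bounded_bilinear.diff_left[OF bounded_bilinear_outer]
          bounded_bilinear.diff_right[OF bounded_bilinear_outer])
    have "mean M (reynolds M F \<epsilon>) z t = (LINT \<omega>|M. outer (?w \<omega> z) (?w \<omega> z)) - outer ?c ?c - outer ?c ?c + outer ?c ?c"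
      unfolding mean_def[of M "reynolds M F \<epsilon>"] ex using l r i2 by (simp add: prob_space)
    then show ?thesis by (simp add: mean_def)
  qed
  have "mdiv (\<lambda>z. mean M (reynolds M F \<epsilon>) z t) x = mdiv (\<lambda>z. ?W z - outer (?u z t) (?u z t)) x"
    by (rule mdiv_cong_open[OF openD x rey])
  also have "\<dots> = mdiv ?W x - mdiv (\<lambda>z. outer (?u z t) (?u z t)) x"
    by (rule mdiv_diff) (use rx outer_self_differentiable[OF du] in blast)+
  also have "mdiv (\<lambda>z. outer (?u z t) (?u z t)) x = conv (\<lambda>z. ?u z t) x"
    by (rule mdiv_outer_self[OF du divu])
  also have "mdiv ?W x = (LINT \<omega>|M. ?ww \<omega>)" using rx by blast
  finally have reydiv: "mdiv (\<lambda>z. mean M (reynolds M F \<epsilon>) z t) x = (LINT \<omega>|M. ?ww \<omega>) - conv (\<lambda>z. ?u z t) x" .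
  have dt: "vector_derivative (\<lambda>s. ?u x s) (at t) = (LINT \<omega>|M. ?dt \<omega>)"
    by (rule vector_derivative_at) (use rx in blast)
  have sig: "mdiv (\<lambda>z. mean M (Sigs F \<epsilon>) z t) x = (LINT \<omega>|M. ?S \<omega>)"
    using rx by blast
  show ?thesis
    unfolding averaged_balance_def dt sig reydiv
    using mean_eq divu by (simp add: mean_def[of M "bforce F \<epsilon>"] scaleR_right_diff_distrib scaleR_right_distrib algebra_simps)
qed

section \<open>Superposition of particles\<close>

text \<open>Serves particles that enter or leave the averaging region as \<epsilon> varies.\<close>

lemma order_eps_if:
  assumes "order_eps k f"
  shows "order_eps k (\<lambda>\<epsilon>. if P \<epsilon> then f \<epsilon> else 0)"
proof -
  obtain C where C: "0 \<le> C" "\<forall>\<^sub>F \<epsilon> in at_right 0. norm (f \<epsilon>) \<le> C * \<epsilon> ^ k" using order_epsE[OF assms] .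
  show ?thesis
    by (rule order_epsI[of _ C], use C(2) eventually_eps_pos in eventually_elim) (use C(1) in auto)
qed

text \<open>The distance from the boundary is assumed for the actual centre, while the model
  differentiates the flow at the leading-order centre. The two differ by order \<epsilon>, so the
  latter eventually lies in the ball of radius \<delta> around the former, inside the
  domain.\<close>

lemma asymptotic_particle_of_model:
  fixes u :: "real \<Rightarrow> vfield"
  assumes S: "valid_config S" and t: "0 < t"
    and ex: "particle_expansions S Q t"
    and model: "\<forall>\<^sub>F \<epsilon> in at_right 0. kinematics (u \<epsilon>) (Q \<epsilon>) \<and> dynamics_regular S (Q \<epsilon>) \<and>
        local_flow S (u \<epsilon>) (p \<epsilon>) (Q \<epsilon>) \<and> local_stress S (u \<epsilon>) (p \<epsilon>) (Q \<epsilon>)"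
    and dom: "\<forall>\<^sub>F \<epsilon> in at_right 0. cball (pos (Q \<epsilon>) t) \<delta> \<subseteq> D" "0 < \<delta>"
    and diff: "\<forall>\<^sub>F \<epsilon> in at_right 0. \<forall>x\<in>D. (\<lambda>z. u \<epsilon> z t) differentiable at x"
  shows "asymptotic_particle S u p Q t"
proof
  have "expands {t} [\<lambda>\<epsilon>. posc (Q \<epsilon>) 0, \<lambda>\<epsilon>. posc (Q \<epsilon>) 1, \<lambda>\<epsilon>. posc (Q \<epsilon>) 2] (\<lambda>\<epsilon>. pos (Q \<epsilon>))"
    using ex by (simp add: particle_expansions_def)
  from expands_three[OF this] obtain C where
    C: "\<forall>\<^sub>F \<epsilon> in at_right 0. \<forall>y\<in>{t}. norm (posc (Q \<epsilon>) 1 y) \<le> C * \<epsilon> ^ 0"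
    "\<forall>\<^sub>F \<epsilon> in at_right 0. \<forall>y\<in>{t}. norm (posc (Q \<epsilon>) 2 y) \<le> C * \<epsilon> ^ 0"
    "\<forall>\<^sub>F \<epsilon> in at_right 0. \<forall>y\<in>{t}. norm (pos (Q \<epsilon>) y - (posc (Q \<epsilon>) 0 y + \<epsilon> *\<^sub>R posc (Q \<epsilon>) 1 y
        + \<epsilon>\<^sup>2 *\<^sub>R posc (Q \<epsilon>) 2 y)) \<le> C * \<epsilon> ^ 3"
    by blast
  have o1: "order_eps 1 (\<lambda>\<epsilon>. \<epsilon> ^ 1 *\<^sub>R posc (Q \<epsilon>) 1 t)"
    using order_eps_scale[OF order_eps_of_ball[OF C(1)], of t 1] by simp
  have o2: "order_eps 1 (\<lambda>\<epsilon>. \<epsilon>\<^sup>2 *\<^sub>R posc (Q \<epsilon>) 2 t)"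
    by (rule order_eps_le[OF order_eps_scale[OF order_eps_of_ball[OF C(2)], of t 2]]) auto
  have o3: "order_eps 1 (\<lambda>\<epsilon>. pos (Q \<epsilon>) t - (posc (Q \<epsilon>) 0 t + \<epsilon> *\<^sub>R posc (Q \<epsilon>) 1 t + \<epsilon>\<^sup>2 *\<^sub>R posc (Q \<epsilon>) 2 t))"
    by (rule order_eps_le[OF order_eps_of_ball[OF C(3)], of t]) auto
  have "order_eps 1 (\<lambda>\<epsilon>. pos (Q \<epsilon>) t - posc (Q \<epsilon>) 0 t)"
    using order_eps_add[OF o3 order_eps_add[OF o1 o2]] by (simp add: algebra_simps)
  then obtain B where B: "0 \<le> B" "\<forall>\<^sub>F \<epsilon> in at_right 0. norm (pos (Q \<epsilon>) t - posc (Q \<epsilon>) 0 t) \<le> B * \<epsilon> ^ 1"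
    by (rule order_epsE)
  have small: "\<forall>\<^sub>F \<epsilon> in at_right 0. B * \<epsilon> < \<delta>"
  proof -
    have "((\<lambda>\<epsilon>. B * \<epsilon>) \<longlongrightarrow> B * 0) (at_right 0)" by (intro tendsto_intros)
    then show ?thesis using dom(2) by (intro order_tendstoD) simp
  qed
  show "\<forall>\<^sub>F \<epsilon> in at_right 0. model_at S (u \<epsilon>) (p \<epsilon>) (Q \<epsilon>) t"
    using B(2) small dom(1) diff model
  proof eventually_elim
    case (elim \<epsilon>)
    then have "posc (Q \<epsilon>) 0 t \<in> cball (pos (Q \<epsilon>) t) \<delta>" by (simp add: dist_norm)
    then have "(\<lambda>z. u \<epsilon> z t) differentiable at (posc (Q \<epsilon>) 0 t)" using elim by blast
    then show ?case
      using elim(5) t by (simp add: model_at_def kinematics_def local_flow_def local_stress_def)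
  qed
qed (rule S, rule ex)

text \<open>Since the region cuts no particle, multiplying the indicator of a particle by that of
  the region gives back the former or 0.\<close>

lemma set_integral_indicator_sum:
  fixes f :: "'j \<Rightarrow> vec3 \<Rightarrow> 'b::{banach,second_countable_topology}"
  assumes J: "finite J" and B: "\<And>j. j \<in> J \<Longrightarrow> B j \<subseteq> V \<or> B j \<inter> V = {}"
    and f: "\<And>j. j \<in> J \<Longrightarrow> set_integrable lborel (B j) (f j)"
  shows "(LINT \<xi>:V|lborel. (\<Sum>j\<in>J. indicator (B j) \<xi> *\<^sub>R f j \<xi>)) =
    (\<Sum>j\<in>{j \<in> J. B j \<subseteq> V}. LINT \<xi>:B j|lborel. f j \<xi>)"
proof -
  let ?J = "{j \<in> J. B j \<subseteq> V}"
  have "indicator V \<xi> *\<^sub>R (\<Sum>j\<in>J. indicator (B j) \<xi> *\<^sub>R f j \<xi>) = (\<Sum>j\<in>?J. indicator (B j) \<xi> *\<^sub>R f j \<xi>)" for \<xi>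
  proof -
    have "indicator V \<xi> *\<^sub>R (\<Sum>j\<in>J. indicator (B j) \<xi> *\<^sub>R f j \<xi>) =
        (\<Sum>j\<in>J. if B j \<subseteq> V then indicator (B j) \<xi> *\<^sub>R f j \<xi> else 0)"
      unfolding scaleR_sum_right
    proof (rule sum.cong)
      fix j assume "j \<in> J"
      then show "indicator V \<xi> *\<^sub>R indicator (B j) \<xi> *\<^sub>R f j \<xi> = (if B j \<subseteq> V then indicator (B j) \<xi> *\<^sub>R f j \<xi> else 0)"
        using B[of j] by (auto simp: indicator_def)
    qed simp
    also have "\<dots> = (\<Sum>j\<in>?J. indicator (B j) \<xi> *\<^sub>R f j \<xi>)"
      by (rule sum.inter_filter[OF J, symmetric])
    finally show ?thesis .
  qed
  then have "(LINT \<xi>:V|lborel. (\<Sum>j\<in>J. indicator (B j) \<xi> *\<^sub>R f j \<xi>)) =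
      (LINT \<xi>|lborel. (\<Sum>j\<in>?J. indicator (B j) \<xi> *\<^sub>R f j \<xi>))"
    by (simp add: set_lebesgue_integral_def)
  also have "\<dots> = (\<Sum>j\<in>?J. LINT \<xi>|lborel. indicator (B j) \<xi> *\<^sub>R f j \<xi>)"
    using f by (intro Bochner_Integration.integral_sum) (auto simp: set_integrable_def)
  finally show ?thesis by (simp add: set_lebesgue_integral_def)
qed

text \<open>The bound J on the integral of the squared singularity holds for all centres, so a
  factor \<open>e\<close> in the field becomes its square in the integral; with \<epsilon>^2 for
  \<open>e\<close> this is order 4. The finitely many centres, where the pointwise bound fails, form
  a null set.\<close>

lemma set_integral_outer_self_le:
  fixes f :: "vec3 \<Rightarrow> vec3" and K :: "'j \<Rightarrow> real" and e :: real
  assumes V: "V \<in> sets lborel" "emeasure lborel V < \<infinity>"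
    and J: "0 \<le> J" "\<And>c. (\<integral>\<^sup>+ x. indicator V x * ennreal (1 / (norm (x - c))\<^sup>2) \<partial>lborel) \<le> ennreal J"
    and I: "finite I" and K: "\<And>j. j \<in> I \<Longrightarrow> 0 \<le> K j" and e: "0 \<le> e"
    and f: "\<And>x. x \<in> V \<Longrightarrow> x \<notin> c ` I \<Longrightarrow> norm (f x) \<le> (\<Sum>j\<in>I. e * (K j * (1 / norm (x - c j) + 1)))"
  shows "norm (LINT x:V|lborel. outer (f x) (f x)) \<le> e\<^sup>2 * (\<Sum>j\<in>I. 2 * card I * (K j)\<^sup>2 * (J + measure lborel V))"
proof (rule norm_set_integral_le_nn_integral)
  \<comment> \<open>The factor \<open>card I\<close> comes from the Cauchy-Schwarz inequality for
    the sum over the particles, the factor 2 from (q + 1)^2 \<le> 2 (q^2 + 1).\<close>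
  let ?A = "\<lambda>j. e\<^sup>2 * (2 * card I * (K j)\<^sup>2)"
  let ?g = "\<lambda>x. \<Sum>j\<in>I. ?A j * (1 / (norm (x - c j))\<^sup>2 + 1)"
  have "AE x in lborel. x \<notin> c ` I"
    using I finite_imp_null_set_lborel[of "c ` I"] by (intro AE_not_in) auto
  then show "AE x in lborel. x \<in> V \<longrightarrow> norm (outer (f x) (f x)) \<le> ?g x"
  proof eventually_elim
    case (elim x)
    show ?case
    proof
      assume x: "x \<in> V"
      let ?a = "\<lambda>j. e * (K j * (1 / norm (x - c j) + 1))"
      have "norm (outer (f x) (f x)) = (norm (f x))\<^sup>2"
        by (simp add: norm_outer power2_eq_square)
      also have "\<dots> \<le> (\<Sum>j\<in>I. ?a j)\<^sup>2"
        using f[OF x elim] by (intro power_mono) auto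
      also have "\<dots> \<le> (\<Sum>j\<in>I. (?a j)\<^sup>2) * card I"
        by (rule sum_squared_le_sum_of_squares)
      also have "\<dots> = (\<Sum>j\<in>I. (?a j)\<^sup>2 * card I)" by (simp add: sum_distrib_right)
      also have "\<dots> \<le> ?g x"
      proof (rule sum_mono)
        fix j
        let ?q = "1 / norm (x - c j)"
        have "(?q + 1)\<^sup>2 \<le> 2 * (?q\<^sup>2 + 1)"
          using zero_le_power2[of "?q - 1"] by (simp add: power2_eq_square algebra_simps)
        then have "(e\<^sup>2 * (K j)\<^sup>2 * card I) * (?q + 1)\<^sup>2 \<le> (e\<^sup>2 * (K j)\<^sup>2 * card I) * (2 * (?q\<^sup>2 + 1))"
          by (intro mult_left_mono) auto
        moreover have "(?a j)\<^sup>2 * card I = (e\<^sup>2 * (K j)\<^sup>2 * card I) * (?q + 1)\<^sup>2"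
          by (simp add: power_mult_distrib mult_ac)
        moreover have "(e\<^sup>2 * (K j)\<^sup>2 * card I) * (2 * (?q\<^sup>2 + 1)) = ?A j * (1 / (norm (x - c j))\<^sup>2 + 1)"
          unfolding power_one_over by simp
        ultimately show "(?a j)\<^sup>2 * card I \<le> ?A j * (1 / (norm (x - c j))\<^sup>2 + 1)"
          by (simp only:)
      qed
      finally show "norm (outer (f x) (f x)) \<le> ?g x" .
    qed
  qed
  have [measurable]: "V \<in> sets borel" using V(1) by simp
  have summand: "(\<integral>\<^sup>+ x. indicator V x * ennreal (?A j * (1 / (norm (x - c j))\<^sup>2 + 1)) \<partial>lborel)
      \<le> ennreal (?A j * (J + measure lborel V))" for j
  proof -
    have "(\<integral>\<^sup>+ x. indicator V x * ennreal (?A j * (1 / (norm (x - c j))\<^sup>2 + 1)) \<partial>lborel) =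
        (\<integral>\<^sup>+ x. ennreal (?A j) * (indicator V x * ennreal (1 / (norm (x - c j))\<^sup>2) + indicator V x) \<partial>lborel)"
    proof (intro nn_integral_cong)
      fix x
      show "indicator V x * ennreal (?A j * (1 / (norm (x - c j))\<^sup>2 + 1)) =
          ennreal (?A j) * (indicator V x * ennreal (1 / (norm (x - c j))\<^sup>2) + indicator V x)"
        by (cases "x \<in> V") (simp_all add: ennreal_mult ennreal_plus)
    qed
    also have "\<dots> = ennreal (?A j) * ((\<integral>\<^sup>+ x. indicator V x * ennreal (1 / (norm (x - c j))\<^sup>2) \<partial>lborel) + emeasure lborel V)"
      by (subst nn_integral_cmult, measurable, subst nn_integral_add) auto
    also have "\<dots> \<le> ennreal (?A j) * (ennreal J + emeasure lborel V)"
      by (intro mult_left_mono add_right_mono J(2)) auto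
    also have "emeasure lborel V = ennreal (measure lborel V)"
      using V(2) by (intro emeasure_eq_ennreal_measure) auto
    also have "ennreal (?A j) * (ennreal J + ennreal (measure lborel V)) = ennreal (?A j * (J + measure lborel V))"
      using J(1) by (simp add: ennreal_mult ennreal_plus)
    finally show ?thesis .
  qed
  have "(\<integral>\<^sup>+ x. indicator V x * ennreal (?g x) \<partial>lborel) =
      (\<integral>\<^sup>+ x. (\<Sum>j\<in>I. indicator V x * ennreal (?A j * (1 / (norm (x - c j))\<^sup>2 + 1))) \<partial>lborel)"
  proof (intro nn_integral_cong)
    fix x
    have "ennreal (?g x) = (\<Sum>j\<in>I. ennreal (?A j * (1 / (norm (x - c j))\<^sup>2 + 1)))"
      by (rule sum_ennreal[symmetric]) simp
    then show "indicator V x * ennreal (?g x) = (\<Sum>j\<in>I. indicator V x * ennreal (?A j * (1 / (norm (x - c j))\<^sup>2 + 1)))"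
      by (simp only: sum_distrib_left)
  qed
  also have "\<dots> = (\<Sum>j\<in>I. \<integral>\<^sup>+ x. indicator V x * ennreal (?A j * (1 / (norm (x - c j))\<^sup>2 + 1)) \<partial>lborel)"
    by (rule nn_integral_sum) measurable
  also have "\<dots> \<le> (\<Sum>j\<in>I. ennreal (?A j * (J + measure lborel V)))"
    by (intro sum_mono summand)
  also have "\<dots> = ennreal (\<Sum>j\<in>I. ?A j * (J + measure lborel V))"
    using J(1) by (intro sum_ennreal) auto
  also have "(\<Sum>j\<in>I. ?A j * (J + measure lborel V)) = e\<^sup>2 * (\<Sum>j\<in>I. 2 * card I * (K j)\<^sup>2 * (J + measure lborel V))"
    by (simp add: sum_distrib_left mult_ac)
  finally show "(\<integral>\<^sup>+ x. indicator V x * ennreal (?g x) \<partial>lborel) \<le>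
    ennreal (e\<^sup>2 * (\<Sum>j\<in>I. 2 * card I * (K j)\<^sup>2 * (J + measure lborel V)))" .
  show "0 \<le> e\<^sup>2 * (\<Sum>j\<in>I. 2 * card I * (K j)\<^sup>2 * (J + measure lborel V))"
    using J(1) by (intro mult_nonneg_nonneg sum_nonneg) auto
qed

section \<open>From the suspension to its single particles\<close>

lemma suspension_frameD:
  assumes "suspension_frame M F" "x \<in> dom F" "0 < t"
  shows "avgV F x t \<in> sets lborel" "emeasure lborel (avgV F x t) < \<infinity>" "0 < measure lborel (avgV F x t)"
    "avgV F x t \<subseteq> dom F" "open (dom F)"
  using assms emeasure_bounded_finite[of "avgV F x t"] by (auto simp: suspension_frame_def)

lemma umean_differentiable:
  assumes "suspension_frame M F" "\<epsilon> \<in> {0<..<eps0 F}" "0 < t" "x \<in> dom F"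
  shows "(\<lambda>z. umean M F \<epsilon> z t) differentiable at x"
proof -
  have "Cdiff 2 (\<lambda>z. umean M F \<epsilon> z t) (dom F)" "open (dom F)"
    using assms by (simp_all add: suspension_frame_def)
  then show ?thesis
    using assms(4) by (auto simp: numeral_2_eq_2 differentiable_on_eq_differentiable_at)
qed

lemma particles_asymptotic:
  assumes data: "valid_config S" and frame: "suspension_frame M F" and A3: "suspended M F"
    and model: "particles_follow_model M S F" and t: "0 < t"
  shows "AE \<omega> in M. \<forall>j\<in>particles F.
    asymptotic_particle S (umean M F) (pmean M F) (\<lambda>\<epsilon>. part F \<epsilon> \<omega> j) t \<and> local_decay S (\<lambda>\<epsilon>. part F \<epsilon> \<omega> j) t"
proof -
  have eps: "\<forall>\<^sub>F \<epsilon> in at_right 0. \<epsilon> \<in> {0<..<eps0 F}"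
    using frame unfolding eventually_at_right_field
    by (intro exI[of _ "eps0 F"]) (simp add: suspension_frame_def)
  have diff: "\<forall>\<^sub>F \<epsilon> in at_right 0. \<forall>x\<in>dom F. (\<lambda>z. umean M F \<epsilon> z t) differentiable at x"
    using eps by eventually_elim (use umean_differentiable[OF frame _ t] in blast)
  have "AE \<omega> in M. \<forall>j\<in>particles F. \<exists>\<delta>>0. \<forall>\<^sub>F \<epsilon> in at_right 0. cball (pos (part F \<epsilon> \<omega> j) t) \<delta> \<subseteq> dom F"
    using A3 t unfolding suspended_def by (auto elim!: eventually_mono)
  then show ?thesis
    using model[unfolded particles_follow_model_def]
  proof eventually_elim
    case (elim \<omega>)
    show ?case
    proof
      fix j assume j: "j \<in> particles F"
      obtain \<delta> where \<delta>: "\<delta> > 0" "\<forall>\<^sub>F \<epsilon> in at_right 0. cball (pos (part F \<epsilon> \<omega> j) t) \<delta> \<subseteq> dom F"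
        using elim(1) j by blast
      have "particle_expansions S (\<lambda>\<epsilon>. part F \<epsilon> \<omega> j) t" "local_decay S (\<lambda>\<epsilon>. part F \<epsilon> \<omega> j) t"
        "\<forall>\<^sub>F \<epsilon> in at_right 0.
        kinematics (umean M F \<epsilon>) (part F \<epsilon> \<omega> j) \<and>
        dynamics_regular S (part F \<epsilon> \<omega> j) \<and>
        local_flow S (umean M F \<epsilon>) (pmean M F \<epsilon>) (part F \<epsilon> \<omega> j) \<and>
        local_stress S (umean M F \<epsilon>) (pmean M F \<epsilon>) (part F \<epsilon> \<omega> j)"
        using elim(2) j t by blast+
      then show "asymptotic_particle S (umean M F) (pmean M F) (\<lambda>\<epsilon>. part F \<epsilon> \<omega> j) t \<and> local_decay S (\<lambda>\<epsilon>. part F \<epsilon> \<omega> j) t"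
        using asymptotic_particle_of_model[OF data t, where Q="\<lambda>\<epsilon>. part F \<epsilon> \<omega> j" and u="umean M F" and p="pmean M F",
            OF _ _ \<delta>(2,1) diff] by blast
    qed
  qed
qed

text \<open>The set of particles in the averaging region varies with \<epsilon>. Written as a sum
  over all particles with conditional summands, the expression has a fixed finite index set and
  orders can be added.\<close>

lemma sum_inside_order:
  assumes "\<And>j. j \<in> particles F \<Longrightarrow> order_eps k (X j)"
  shows "order_eps k (\<lambda>\<epsilon>. c *\<^sub>R (\<Sum>j\<in>inside S F \<epsilon> \<omega> x t. X j \<epsilon>))"
proof -
  have "order_eps k (\<lambda>\<epsilon>. \<Sum>j\<in>particles F. if body S \<epsilon> (part F \<epsilon> \<omega> j) t \<subseteq> avgV F x t then X j \<epsilon> else 0)"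
    by (intro order_eps_sum order_eps_if assms)
  from order_eps_bounded_linear[OF bounded_linear_scaleR_right[of c] this]
  show ?thesis
    unfolding inside_def sum.inter_filter[OF finite_atLeastAtMost] .
qed

section \<open>Volume averages at a fixed sample point\<close>

context
  fixes M :: "'w measure" and S :: config and F :: "'w suspension" and \<omega> :: 'w and x :: vec3 and t :: real
  assumes data: "valid_config S" and frame: "suspension_frame M F" and x: "x \<in> dom F" and t: "0 < t"
    and part: "\<forall>j\<in>particles F. asymptotic_particle S (umean M F) (pmean M F) (\<lambda>\<epsilon>. part F \<epsilon> \<omega> j) t"
    and superpos: "\<forall>\<^sub>F \<epsilon> in at_right 0. superposition M S F \<epsilon> \<omega> t"
    and stressm: "\<forall>\<^sub>F \<epsilon> in at_right 0. averaged_stress_model M S F \<epsilon> \<omega> x t"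
begin

lemmas region_facts = suspension_frameD[OF frame x t]

lemma particle_force_expansion:
  assumes erg: "\<forall>\<^sub>F \<epsilon> in at_right 0. mean M (bforce F \<epsilon>) x t = vol_avg (avgV F x t) (\<lambda>\<xi>. bforce F \<epsilon> \<omega> \<xi> t)"
  shows "order_eps 4 (\<lambda>\<epsilon>. mean M (bforce F \<epsilon>) x t - particle_force M S F \<epsilon> \<omega> x t)"
proof -
  let ?V = "avgV F x t" and ?P = "\<lambda>\<epsilon> j. part F \<epsilon> \<omega> j" and ?B = "\<lambda>\<epsilon> j. body S \<epsilon> (part F \<epsilon> \<omega> j) t"
  let ?c = "1 / measure lborel (avgV F x t)"
  let ?m = "\<lambda>j \<epsilon>. \<epsilon>\<^sup>2 *\<^sub>R (rotc (?P \<epsilon> j) 0 t *v f1 S (?P \<epsilon> j) t)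
        + \<epsilon> ^ 3 *\<^sub>R (rotc (?P \<epsilon> j) 0 t *v f2 S (umean M F \<epsilon>) (pmean M F \<epsilon>) (?P \<epsilon> j) t + rotc (?P \<epsilon> j) 1 t *v f1 S (?P \<epsilon> j) t)"
  let ?X = "\<lambda>j \<epsilon>. (LINT \<xi>:?B \<epsilon> j|lborel. mdiv (local_str \<epsilon> (?P \<epsilon> j) t) \<xi>) - ?m j \<epsilon>"
  have X: "order_eps 4 (?X j)" if "j \<in> particles F" for j
  proof -
    interpret asymptotic_particle S "umean M F" "pmean M F" "\<lambda>\<epsilon>. part F \<epsilon> \<omega> j" t using part that by blast
    show ?thesis by (rule body_force_expansion(2))
  qed
  have "\<forall>j\<in>particles F. \<forall>\<^sub>F \<epsilon> in at_right 0. set_integrable lborel (?B \<epsilon> j) (mdiv (local_str \<epsilon> (?P \<epsilon> j) t))"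
  proof
    fix j assume "j \<in> particles F"
    then interpret asymptotic_particle S "umean M F" "pmean M F" "\<lambda>\<epsilon>. part F \<epsilon> \<omega> j" t using part by blast
    show "\<forall>\<^sub>F \<epsilon> in at_right 0. set_integrable lborel (?B \<epsilon> j) (mdiv (local_str \<epsilon> (?P \<epsilon> j) t))"
      by (rule body_force_expansion(1))
  qed
  then have int: "\<forall>\<^sub>F \<epsilon> in at_right 0. \<forall>j\<in>particles F. set_integrable lborel (?B \<epsilon> j) (mdiv (local_str \<epsilon> (?P \<epsilon> j) t))"
    by (simp add: eventually_ball_finite)
  have "order_eps 4 (\<lambda>\<epsilon>. ?c *\<^sub>R (\<Sum>j\<in>inside S F \<epsilon> \<omega> x t. ?X j \<epsilon>))"
    by (rule sum_inside_order[OF X])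
  then show ?thesis
  proof (rule order_eps_cong)
    show "\<forall>\<^sub>F \<epsilon> in at_right 0. ?c *\<^sub>R (\<Sum>j\<in>inside S F \<epsilon> \<omega> x t. ?X j \<epsilon>) =
        mean M (bforce F \<epsilon>) x t - particle_force M S F \<epsilon> \<omega> x t"
      using erg superpos stressm int
    proof eventually_elim
      case (elim \<epsilon>)
      have cut: "?B \<epsilon> j \<subseteq> ?V \<or> ?B \<epsilon> j \<inter> ?V = {}" if "j \<in> particles F" for j
        using elim(3) that by (simp add: averaged_stress_model_def)
      have "(LINT \<xi>:?V|lborel. bforce F \<epsilon> \<omega> \<xi> t) =
          (LINT \<xi>:?V|lborel. (\<Sum>j\<in>particles F. indicator (?B \<epsilon> j) \<xi> *\<^sub>R mdiv (local_str \<epsilon> (?P \<epsilon> j) t) \<xi>))"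
        using region_facts elim(2) by (intro set_lebesgue_integral_cong) (auto simp: superposition_def part_force_def)
      also have "\<dots> = (\<Sum>j\<in>inside S F \<epsilon> \<omega> x t. LINT \<xi>:?B \<epsilon> j|lborel. mdiv (local_str \<epsilon> (?P \<epsilon> j) t) \<xi>)"
        unfolding inside_def by (rule set_integral_indicator_sum) (use cut elim(4) in auto)
      finally have "mean M (bforce F \<epsilon>) x t = ?c *\<^sub>R \<dots>"
        unfolding elim(1) by (simp add: vol_avg_def)
      moreover have "particle_force M S F \<epsilon> \<omega> x t = ?c *\<^sub>R (\<Sum>j\<in>inside S F \<epsilon> \<omega> x t. ?m j \<epsilon>)"
        by (simp add: particle_force_def Let_def)
      ultimately show ?case by (simp add: sum_subtractf scaleR_right_diff_distrib)
    qed
  qed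
qed

text \<open>The isotropic contribution of the fluctuating pressure appears on both sides, in the
  fluid integral and in the modified pressure of \<open>mean_newton_stress\<close>, and cancels
  exactly. All of the error comes from the expansions at the single particles.\<close>

lemma particle_stress_expansion:
  assumes dil: "\<forall>\<^sub>F \<epsilon> in at_right 0. \<forall>i\<in>particles F. \<forall>j\<in>particles F. i \<noteq> j \<longrightarrow>
       closure (body S \<epsilon> (part F \<epsilon> \<omega> i) t) \<inter> closure (body S \<epsilon> (part F \<epsilon> \<omega> j) t) = {}"
    and erg: "\<forall>\<^sub>F \<epsilon> in at_right 0. mean M (Sigs F \<epsilon>) x t = vol_avg (avgV F x t) (\<lambda>\<xi>. Sigs F \<epsilon> \<omega> \<xi> t)"
  shows "order_eps 4 (\<lambda>\<epsilon>. mean M (Sigs F \<epsilon>) x t -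
      (mean_newton_stress M S F \<epsilon> \<omega> x t + particle_stress M S F \<epsilon> \<omega> x t))"
proof -
  let ?V = "avgV F x t" and ?P = "\<lambda>\<epsilon> j. part F \<epsilon> \<omega> j" and ?B = "\<lambda>\<epsilon> j. body S \<epsilon> (part F \<epsilon> \<omega> j) t"
  let ?O = "\<lambda>\<epsilon>. occupied S F \<epsilon> \<omega> t"
  let ?c = "1 / measure lborel (avgV F x t)"
  let ?LS = "\<lambda>j \<epsilon>. LINT \<xi>:?B \<epsilon> j|lborel. local_str \<epsilon> (?P \<epsilon> j) t \<xi>"
  let ?LG = "\<lambda>j \<epsilon>. LINT \<xi>:?B \<epsilon> j|lborel. grad (local_vel \<epsilon> (?P \<epsilon> j) t) \<xi>"
  let ?m = "\<lambda>j \<epsilon>. \<epsilon> ^ 3 *\<^sub>R (rotc (?P \<epsilon> j) 0 t **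
          (LINT y|area S.
             outer (outer_trace (shape S) (newton_stress (lvelc (?P \<epsilon> j) 1 t) (lprsc (?P \<epsilon> j) 1 t)) y *v nrm S y) y
             - outer (h1 (umean M F \<epsilon>) (?P \<epsilon> j) t y) (nrm S y) - outer (nrm S y) (h1 (umean M F \<epsilon>) (?P \<epsilon> j) t y))
          ** transpose (rotc (?P \<epsilon> j) 0 t))"
  let ?X = "\<lambda>j \<epsilon>. ?LS j \<epsilon> - (?LG j \<epsilon> + transpose (?LG j \<epsilon>)) - ?m j \<epsilon>"
  have X: "order_eps 4 (?X j)" if "j \<in> particles F" for j
  proof -
    interpret asymptotic_particle S "umean M F" "pmean M F" "\<lambda>\<epsilon>. part F \<epsilon> \<omega> j" t using part that by blast
    show ?thesis by (rule body_stress_expansion(2))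
  qed
  have "\<forall>j\<in>particles F. \<forall>\<^sub>F \<epsilon> in at_right 0. set_integrable lborel (?B \<epsilon> j) (local_str \<epsilon> (?P \<epsilon> j) t) \<and>
     set_integrable lborel (?B \<epsilon> j) (grad (local_vel \<epsilon> (?P \<epsilon> j) t)) \<and> open (?B \<epsilon> j)"
  proof
    fix j assume "j \<in> particles F"
    then interpret asymptotic_particle S "umean M F" "pmean M F" "\<lambda>\<epsilon>. part F \<epsilon> \<omega> j" t using part by blast
    show "\<forall>\<^sub>F \<epsilon> in at_right 0. set_integrable lborel (?B \<epsilon> j) (local_str \<epsilon> (?P \<epsilon> j) t) \<and>
     set_integrable lborel (?B \<epsilon> j) (grad (local_vel \<epsilon> (?P \<epsilon> j) t)) \<and> open (?B \<epsilon> j)"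
      using body_stress_expansion(1) model eventually_eps_pos
      by eventually_elim (use open_body[OF _ _ shape_facts(1)] in \<open>auto simp: model_at_def\<close>)
  qed
  then have int: "\<forall>\<^sub>F \<epsilon> in at_right 0. \<forall>j\<in>particles F. set_integrable lborel (?B \<epsilon> j) (local_str \<epsilon> (?P \<epsilon> j) t) \<and>
     set_integrable lborel (?B \<epsilon> j) (grad (local_vel \<epsilon> (?P \<epsilon> j) t)) \<and> open (?B \<epsilon> j)"
    by (simp add: eventually_ball_finite)
  have "order_eps 4 (\<lambda>\<epsilon>. ?c *\<^sub>R (\<Sum>j\<in>inside S F \<epsilon> \<omega> x t. ?X j \<epsilon>))"
    by (rule sum_inside_order[OF X])
  then show ?thesis
  proof (rule order_eps_cong)
    show "\<forall>\<^sub>F \<epsilon> in at_right 0. ?c *\<^sub>R (\<Sum>j\<in>inside S F \<epsilon> \<omega> x t. ?X j \<epsilon>) =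
        mean M (Sigs F \<epsilon>) x t - (mean_newton_stress M S F \<epsilon> \<omega> x t + particle_stress M S F \<epsilon> \<omega> x t)"
      using erg superpos stressm int dil
    proof eventually_elim
      case (elim \<epsilon>)
      let ?I = "inside S F \<epsilon> \<omega> x t"
      let ?g = "grad (\<lambda>z. fluct_vel M F \<epsilon> \<omega> z t)" and ?q = "\<lambda>\<xi>. fluct_prs M F \<epsilon> \<omega> \<xi> t"
      have cut: "?B \<epsilon> j \<subseteq> ?V \<or> ?B \<epsilon> j \<inter> ?V = {}" if "j \<in> particles F" for j
        using elim(3) that by (simp add: averaged_stress_model_def)
      have openB: "open (?B \<epsilon> j)" if "j \<in> particles F" for j using elim(4) that by blast
      have O: "?O \<epsilon> \<in> sets lborel"
        using openB by (auto simp: occupied_def intro!: sets.finite_UN)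
      have VO: "?V - ?O \<epsilon> \<in> sets lborel" "?V \<inter> ?O \<epsilon> \<in> sets lborel"
        using region_facts(1) O by auto
      have gV: "set_integrable lborel ?V ?g" and qV: "set_integrable lborel (?V - ?O \<epsilon>) ?q"
        and avg0: "vol_avg ?V ?g = 0"
        and avg: "vol_avg ?V (\<lambda>\<xi>. Sigs F \<epsilon> \<omega> \<xi> t) = stress_at (umean M F \<epsilon>) (pmean M F \<epsilon>) t x
       + ?c *\<^sub>R (LINT \<xi>:?V - ?O \<epsilon>|lborel. fluct_stress M F \<epsilon> \<omega> \<xi> t)
       + ?c *\<^sub>R (LINT \<xi>:?V \<inter> ?O \<epsilon>|lborel. part_stress S F \<epsilon> \<omega> \<xi> t)"
        using elim(3) by (simp_all add: averaged_stress_model_def)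
      have gO: "set_integrable lborel (?V - ?O \<epsilon>) ?g" "set_integrable lborel (?V \<inter> ?O \<epsilon>) ?g"
        using set_integrable_subset[OF gV] VO by auto
      have g0: "(LINT \<xi>:?V|lborel. ?g \<xi>) = 0"
        using avg0 region_facts(3) by (simp add: vol_avg_def)
      have "(LINT \<xi>:?V|lborel. ?g \<xi>) = (LINT \<xi>:?V - ?O \<epsilon>|lborel. ?g \<xi>) + (LINT \<xi>:?V \<inter> ?O \<epsilon>|lborel. ?g \<xi>)"
      proof -
        have "(?V - ?O \<epsilon>) \<inter> (?V \<inter> ?O \<epsilon>) = {}" by blast
        from set_integral_Un[OF this gO] show ?thesis by (simp only: Un_Diff_Int)
      qed
      \<comment> \<open>The one place where the vanishing mean gradient enters; it trades the
        unknown fluid integral for integrals over particles.\<close>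
      then have gneg: "(LINT \<xi>:?V - ?O \<epsilon>|lborel. ?g \<xi>) = - (LINT \<xi>:?V \<inter> ?O \<epsilon>|lborel. ?g \<xi>)"
        unfolding g0 by (simp add: eq_neg_iff_add_eq_0)
      \<comment> \<open>Equal gradients need equal fields on a neighbourhood, hence the open set
        formed by the body and the domain.\<close>
      have gbody: "?g \<xi> = grad (local_vel \<epsilon> (?P \<epsilon> j) t) \<xi>" if "j \<in> particles F" "\<xi> \<in> ?B \<epsilon> j" "\<xi> \<in> ?V" for j \<xi>
      proof (rule grad_cong_open[of "?B \<epsilon> j \<inter> dom F"])
        show "open (?B \<epsilon> j \<inter> dom F)" using openB[OF that(1)] region_facts(5) by auto
        show "\<xi> \<in> ?B \<epsilon> j \<inter> dom F" using that region_facts(4) by auto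
        fix z assume z: "z \<in> ?B \<epsilon> j \<inter> dom F"
        then have "z \<in> closure (?B \<epsilon> j)" using closure_subset by blast
        then show "fluct_vel M F \<epsilon> \<omega> z t = local_vel \<epsilon> (?P \<epsilon> j) t z"
          using elim(2) z that(1) by (simp add: superposition_def)
      qed
      \<comment> \<open>Diluteness is used here: a point of the occupied region lies in exactly one
        body, so the sum over all particles has a single nonzero term.\<close>
      have gsum: "(LINT \<xi>:?V \<inter> ?O \<epsilon>|lborel. ?g \<xi>) = (\<Sum>j\<in>?I. ?LG j \<epsilon>)"
      proof -
        have "indicator (?V \<inter> ?O \<epsilon>) \<xi> *\<^sub>R ?g \<xi> =
            indicator ?V \<xi> *\<^sub>R (\<Sum>j\<in>particles F. indicator (?B \<epsilon> j) \<xi> *\<^sub>R grad (local_vel \<epsilon> (?P \<epsilon> j) t) \<xi>)" for \<xi>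
        proof (cases "\<xi> \<in> ?V \<inter> ?O \<epsilon>")
          case True
          then obtain i where i: "i \<in> particles F" "\<xi> \<in> ?B \<epsilon> i" by (auto simp: occupied_def)
          have "indicator (?B \<epsilon> j) \<xi> *\<^sub>R grad (local_vel \<epsilon> (?P \<epsilon> j) t) \<xi> = (if j = i then ?g \<xi> else 0)"
            if "j \<in> particles F" for j
          proof (cases "j = i")
            case True
            then show ?thesis using gbody[OF i] \<open>\<xi> \<in> ?V \<inter> ?O \<epsilon>\<close> i by simp
          next
            case False
            then have "closure (?B \<epsilon> i) \<inter> closure (?B \<epsilon> j) = {}" using elim(5) i(1) that by blast
            then have "\<xi> \<notin> ?B \<epsilon> j" using i(2) closure_subset by blast
            then show ?thesis using False by simp
          qed
          then have "(\<Sum>j\<in>particles F. indicator (?B \<epsilon> j) \<xi> *\<^sub>R grad (local_vel \<epsilon> (?P \<epsilon> j) t) \<xi>) =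
              (\<Sum>j\<in>particles F. if j = i then ?g \<xi> else 0)" by (intro sum.cong) auto
          also have "\<dots> = ?g \<xi>" using i(1) by simp
          finally show ?thesis using True by simp
        next
          case False
          then show ?thesis
            by (cases "\<xi> \<in> ?V") (auto simp: occupied_def intro!: sum.neutral[symmetric])
        qed
        then have "(LINT \<xi>:?V \<inter> ?O \<epsilon>|lborel. ?g \<xi>) =
            (LINT \<xi>:?V|lborel. (\<Sum>j\<in>particles F. indicator (?B \<epsilon> j) \<xi> *\<^sub>R grad (local_vel \<epsilon> (?P \<epsilon> j) t) \<xi>))"
          by (simp add: set_lebesgue_integral_def)
        also have "\<dots> = (\<Sum>j\<in>?I. ?LG j \<epsilon>)"
          unfolding inside_def by (rule set_integral_indicator_sum) (use cut elim(4) in auto)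
        finally show ?thesis .
      qed
      have ssum: "(LINT \<xi>:?V \<inter> ?O \<epsilon>|lborel. part_stress S F \<epsilon> \<omega> \<xi> t) = (\<Sum>j\<in>?I. ?LS j \<epsilon>)"
      proof -
        have "indicator (?V \<inter> ?O \<epsilon>) \<xi> *\<^sub>R part_stress S F \<epsilon> \<omega> \<xi> t = indicator ?V \<xi> *\<^sub>R part_stress S F \<epsilon> \<omega> \<xi> t" for \<xi>
        proof (cases "\<xi> \<in> ?O \<epsilon>")
          case False
          then have "part_stress S F \<epsilon> \<omega> \<xi> t = 0"
            by (auto simp: part_stress_def occupied_def intro!: sum.neutral)
          then show ?thesis by simp
        qed (simp add: indicator_def)
        then have "(LINT \<xi>:?V \<inter> ?O \<epsilon>|lborel. part_stress S F \<epsilon> \<omega> \<xi> t) =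
            (LINT \<xi>:?V|lborel. (\<Sum>j\<in>particles F. indicator (?B \<epsilon> j) \<xi> *\<^sub>R local_str \<epsilon> (?P \<epsilon> j) t \<xi>))"
          unfolding set_lebesgue_integral_def part_stress_def by (simp only:)
        also have "\<dots> = (\<Sum>j\<in>?I. ?LS j \<epsilon>)"
          unfolding inside_def by (rule set_integral_indicator_sum) (use cut elim(4) in auto)
        finally show ?thesis .
      qed
      let ?Q = "LINT \<xi>:?V - ?O \<epsilon>|lborel. ?q \<xi>" and ?G = "\<Sum>j\<in>?I. ?LG j \<epsilon>"
      \<comment> \<open>Pressure and gradient are integrated separately; symmetrisation is linear
        and commutes with the integral.\<close>
      have fsum: "(LINT \<xi>:?V - ?O \<epsilon>|lborel. fluct_stress M F \<epsilon> \<omega> \<xi> t) = - (?Q *\<^sub>R mat 1) - (?G + transpose ?G)"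
      proof -
        note qm = set_integral_bounded_linear[OF bounded_linear_scaleR_left[of "mat 1 :: mat3"] qV]
        note gt = set_integral_bounded_linear[OF bounded_linear_transpose gO(1)]
        have "(LINT \<xi>:?V - ?O \<epsilon>|lborel. fluct_stress M F \<epsilon> \<omega> \<xi> t) =
            (LINT \<xi>:?V - ?O \<epsilon>|lborel. (?g \<xi> + transpose (?g \<xi>)) - ?q \<xi> *\<^sub>R mat 1)"
          by (simp add: fluct_stress_def newton_stress_def sym_grad_def)
        also have "\<dots> = ((LINT \<xi>:?V - ?O \<epsilon>|lborel. ?g \<xi>) + transpose (LINT \<xi>:?V - ?O \<epsilon>|lborel. ?g \<xi>)) - ?Q *\<^sub>R mat 1"
          unfolding set_integral_diff(2)[OF set_integral_add(1)[OF gO(1) gt(1)] qm(1)]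
            set_integral_add(2)[OF gO(1) gt(1)] qm(2) gt(2) ..
        also have "\<dots> = - (?Q *\<^sub>R mat 1) - (?G + transpose ?G)"
          unfolding gneg gsum by (simp add: vec_eq_iff transpose_def)
        finally show ?thesis .
      qed
      have tG: "transpose ?G = (\<Sum>j\<in>?I. transpose (?LG j \<epsilon>))"
        by (rule linear_sum[OF bounded_linear.linear[OF bounded_linear_transpose]])
      have mn: "mean_newton_stress M S F \<epsilon> \<omega> x t = stress_at (umean M F \<epsilon>) (pmean M F \<epsilon>) t x - (?c * ?Q) *\<^sub>R mat 1"
        by (simp add: mean_newton_stress_def newton_stress_def iso_prs_def scaleR_left_distrib)
      have ps: "particle_stress M S F \<epsilon> \<omega> x t = ?c *\<^sub>R (\<Sum>j\<in>?I. ?m j \<epsilon>)"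
        by (simp add: particle_stress_def Let_def)
      have lin: "c *\<^sub>R (ls - (g + g') - m) = s + c *\<^sub>R (- (q *\<^sub>R mat 1) - (g + g')) + c *\<^sub>R ls - (s - (c * q) *\<^sub>R mat 1 + c *\<^sub>R m)"
        for c q :: real and ls g g' m s :: mat3
        by (simp add: algebra_simps)
      have "?c *\<^sub>R (\<Sum>j\<in>?I. ?X j \<epsilon>) = ?c *\<^sub>R ((\<Sum>j\<in>?I. ?LS j \<epsilon>) - (?G + transpose ?G) - (\<Sum>j\<in>?I. ?m j \<epsilon>))"
        unfolding tG sum_subtractf sum.distrib ..
      then show ?case
        unfolding elim(1) avg fsum ssum mn ps lin[symmetric] .
    qed
  qed
qed

text \<open>In the bound on the field the constants depend on the particle and on the sample point,
  but not on \<epsilon>. Ergodicity turns the mean into an integral over a fixed region, to which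
  the square-integrable singularities apply.\<close>

lemma reynolds_order:
  assumes dec: "\<forall>j\<in>particles F. local_decay S (\<lambda>\<epsilon>. part F \<epsilon> \<omega> j) t"
    and erg: "\<forall>\<^sub>F \<epsilon> in at_right 0. mean M (reynolds M F \<epsilon>) x t = vol_avg (avgV F x t) (\<lambda>\<xi>. reynolds M F \<epsilon> \<omega> \<xi> t)"
  shows "order_eps 4 (\<lambda>\<epsilon>. mean M (reynolds M F \<epsilon>) x t)"
proof -
  let ?V = "avgV F x t" and ?P = "\<lambda>\<epsilon> j. part F \<epsilon> \<omega> j" and ?N = "particles F"
  have "\<forall>j\<in>?N. \<exists>K. 0 \<le> K \<and> (\<forall>\<^sub>F \<epsilon> in at_right 0. \<forall>\<xi>. \<xi> \<noteq> pos (?P \<epsilon> j) t \<longrightarrow>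
    norm (local_vel \<epsilon> (?P \<epsilon> j) t \<xi>) \<le> \<epsilon>\<^sup>2 * (K * (1 / norm (\<xi> - pos (?P \<epsilon> j) t) + 1)))"
  proof
    fix j assume j: "j \<in> ?N"
    then interpret asymptotic_particle S "umean M F" "pmean M F" "\<lambda>\<epsilon>. part F \<epsilon> \<omega> j" t using part by blast
    have rot: "\<forall>\<^sub>F \<epsilon> in at_right 0. rotation_matrix (rot (?P \<epsilon> j) t)"
      using model by eventually_elim (simp add: model_at_def)
    have "local_decay S (\<lambda>\<epsilon>. part F \<epsilon> \<omega> j) t" using dec j by blast
    from local_vel_bound[OF ex this rot]
    show "\<exists>K. 0 \<le> K \<and> (\<forall>\<^sub>F \<epsilon> in at_right 0. \<forall>\<xi>. \<xi> \<noteq> pos (?P \<epsilon> j) t \<longrightarrow>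
    norm (local_vel \<epsilon> (?P \<epsilon> j) t \<xi>) \<le> \<epsilon>\<^sup>2 * (K * (1 / norm (\<xi> - pos (?P \<epsilon> j) t) + 1)))" by blast
  qed
  from bchoice[OF this] obtain K where K: "\<forall>j\<in>?N. 0 \<le> K j \<and> (\<forall>\<^sub>F \<epsilon> in at_right 0. \<forall>\<xi>. \<xi> \<noteq> pos (?P \<epsilon> j) t \<longrightarrow>
    norm (local_vel \<epsilon> (?P \<epsilon> j) t \<xi>) \<le> \<epsilon>\<^sup>2 * (K j * (1 / norm (\<xi> - pos (?P \<epsilon> j) t) + 1)))" ..
  then have bnd: "\<forall>\<^sub>F \<epsilon> in at_right 0. \<forall>j\<in>?N. \<forall>\<xi>. \<xi> \<noteq> pos (?P \<epsilon> j) t \<longrightarrow>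
    norm (local_vel \<epsilon> (?P \<epsilon> j) t \<xi>) \<le> \<epsilon>\<^sup>2 * (K j * (1 / norm (\<xi> - pos (?P \<epsilon> j) t) + 1))"
    by (simp add: eventually_ball_finite)
  \<comment> \<open>Fixed before \<epsilon> is chosen; this requires a bound valid for all
    centres.\<close>
  obtain J where J: "0 \<le> J" "\<And>c. (\<integral>\<^sup>+ x. indicator ?V x * ennreal (1 / (norm (x - c))\<^sup>2) \<partial>lborel) \<le> ennreal J"
    using inverse_square_mean_bound[OF region_facts(1,2)] by blast
  let ?C = "\<Sum>j\<in>?N. 2 * card ?N * (K j)\<^sup>2 * (J + measure lborel ?V)"
  show ?thesis
  proof (rule order_epsI[of _ "(1 / measure lborel ?V) * ?C"], use bnd superpos erg in eventually_elim)
    fix \<epsilon> :: real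
    assume e: "\<forall>j\<in>?N. \<forall>\<xi>. \<xi> \<noteq> pos (?P \<epsilon> j) t \<longrightarrow>
      norm (local_vel \<epsilon> (?P \<epsilon> j) t \<xi>) \<le> \<epsilon>\<^sup>2 * (K j * (1 / norm (\<xi> - pos (?P \<epsilon> j) t) + 1))"
      "superposition M S F \<epsilon> \<omega> t" "mean M (reynolds M F \<epsilon>) x t = vol_avg ?V (\<lambda>\<xi>. reynolds M F \<epsilon> \<omega> \<xi> t)"
    let ?b = "\<lambda>\<xi> j. \<epsilon>\<^sup>2 * (K j * (1 / norm (\<xi> - pos (?P \<epsilon> j) t) + 1))"
    \<comment> \<open>In or on a particle only its own field counts, elsewhere all fields do. As the
      individual bounds are nonnegative, their sum over all particles dominates in both
      cases.\<close>
    have fl: "norm (fluct_vel M F \<epsilon> \<omega> \<xi> t) \<le> (\<Sum>j\<in>?N. ?b \<xi> j)"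
      if \<xi>: "\<xi> \<in> ?V" "\<xi> \<notin> (\<lambda>j. pos (?P \<epsilon> j) t) ` ?N" for \<xi>
    proof -
      have lv: "norm (local_vel \<epsilon> (?P \<epsilon> j) t \<xi>) \<le> ?b \<xi> j" if "j \<in> ?N" for j
        using e(1) \<xi>(2) that by blast
      have b0: "0 \<le> ?b \<xi> j" if "j \<in> ?N" for j
        using K that by (intro mult_nonneg_nonneg) auto
      have D: "\<xi> \<in> dom F" using \<xi>(1) region_facts(4) by blast
      show ?thesis
      proof (cases "\<exists>j\<in>?N. \<xi> \<in> closure (body S \<epsilon> (?P \<epsilon> j) t)")
        case True
        then obtain j where j: "j \<in> ?N" "\<xi> \<in> closure (body S \<epsilon> (?P \<epsilon> j) t)" by blast
        then have "fluct_vel M F \<epsilon> \<omega> \<xi> t = local_vel \<epsilon> (?P \<epsilon> j) t \<xi>"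
          using e(2) D unfolding superposition_def by blast
        then have "norm (fluct_vel M F \<epsilon> \<omega> \<xi> t) \<le> ?b \<xi> j" using lv[OF j(1)] by simp
        also have "\<dots> \<le> (\<Sum>j\<in>?N. ?b \<xi> j)"
          using member_le_sum[of j ?N "?b \<xi>"] j(1) b0 by blast
        finally show ?thesis .
      next
        case False
        then have "fluct_vel M F \<epsilon> \<omega> \<xi> t = (\<Sum>j\<in>?N. local_vel \<epsilon> (?P \<epsilon> j) t \<xi>)"
          using e(2) D unfolding superposition_def by blast
        then show ?thesis
          using order_trans[OF norm_sum sum_mono[of ?N "\<lambda>j. norm (local_vel \<epsilon> (?P \<epsilon> j) t \<xi>)" "?b \<xi>"]] lv by simp
      qed
    qed
    have "norm (LINT \<xi>:?V|lborel. outer (fluct_vel M F \<epsilon> \<omega> \<xi> t) (fluct_vel M F \<epsilon> \<omega> \<xi> t)) \<le> (\<epsilon>\<^sup>2)\<^sup>2 * ?C"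
      using K by (intro set_integral_outer_self_le[OF region_facts(1,2) J _ _ _ fl]) auto
    then have "(1 / measure lborel ?V) * norm (LINT \<xi>:?V|lborel. reynolds M F \<epsilon> \<omega> \<xi> t) \<le> (1 / measure lborel ?V) * ((\<epsilon>\<^sup>2)\<^sup>2 * ?C)"
      using region_facts(3) by (intro mult_left_mono) (auto simp: reynolds_def)
    moreover have "norm (mean M (reynolds M F \<epsilon>) x t) = (1 / measure lborel ?V) * norm (LINT \<xi>:?V|lborel. reynolds M F \<epsilon> \<omega> \<xi> t)"
      unfolding e(3) using region_facts(3) by (simp add: vol_avg_def)
    ultimately show "norm (mean M (reynolds M F \<epsilon>) x t) \<le> (1 / measure lborel ?V) * ?C * \<epsilon> ^ 4"
      by (simp add: mult_ac flip: power_mult)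
  qed
qed

end

text \<open>The averaged balance is exact for every \<epsilon>; orders concern only the terms that
  enter it. The means are deterministic while the particle terms belong to one realisation, hence
  the almost sure form, with an exceptional set that may depend on x and t as it does in the
  ergodicity assumption.\<close>

theorem theorem11:
  fixes M :: "'w measure" and S :: config and F :: "'w suspension"
  assumes data: "valid_config S"
    and frame: "suspension_frame M F"
    and balance: "\<forall>\<epsilon>\<in>{0<..<eps0 F}. \<forall>x\<in>dom F. \<forall>t>0. AE \<omega> in M. random_balance S F \<epsilon> \<omega> x t"
    and averaging: "\<forall>\<epsilon>\<in>{0<..<eps0 F}. \<forall>x\<in>dom F. \<forall>t>0. averaging_rules M F \<epsilon> x t"
    and A1: "iid_particles M F"
    and A2: "dilute M S F"
    and A3: "suspended M F"
    and model: "particles_follow_model M S F"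
    and A6: "fluctuation_model M S F"
    and A7: "newtonian_up_to_first_order M S F"
    and A8: "locally_homogeneous M F (Sigs F)" "locally_homogeneous M F (bforce F)"
      "locally_homogeneous M F (reynolds M F)"
    and A9: "ergodic M F (Sigs F)" "ergodic M F (bforce F)" "ergodic M F (reynolds M F)"
  shows "(\<forall>\<epsilon>\<in>{0<..<eps0 F}. \<forall>x\<in>dom F. \<forall>t>0. averaged_balance M S F \<epsilon> x t) \<and>
    (\<forall>x\<in>dom F. \<forall>t>0.
      (AE \<omega> in M.
        (\<lambda>\<epsilon>. norm (mean M (Sigs F \<epsilon>) x t -
            (mean_newton_stress M S F \<epsilon> \<omega> x t + particle_stress M S F \<epsilon> \<omega> x t)))
          \<in> O[at_right 0](\<lambda>\<epsilon>. \<epsilon> ^ 4) \<and>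
        (\<lambda>\<epsilon>. norm (mean M (bforce F \<epsilon>) x t - particle_force M S F \<epsilon> \<omega> x t))
          \<in> O[at_right 0](\<lambda>\<epsilon>. \<epsilon> ^ 4)) \<and>
      (\<lambda>\<epsilon>. norm (mean M (reynolds M F \<epsilon>) x t)) \<in> O[at_right 0](\<lambda>\<epsilon>. \<epsilon> ^ 4))"
proof (intro conjI ballI allI impI)
  fix \<epsilon> x and t :: real assume "\<epsilon> \<in> {0<..<eps0 F}" "x \<in> dom F" "0 < t"
  then show "averaged_balance M S F \<epsilon> x t"
    by (rule averaged_balance_of_random_balance[OF frame balance averaging])
next
  fix x and t :: real assume x: "x \<in> dom F" and t: "0 < t"
  interpret prob_space M using frame by (simp add: suspension_frame_def)
  have part: "AE \<omega> in M. \<forall>j\<in>particles F.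
    asymptotic_particle S (umean M F) (pmean M F) (\<lambda>\<epsilon>. part F \<epsilon> \<omega> j) t \<and> local_decay S (\<lambda>\<epsilon>. part F \<epsilon> \<omega> j) t"
    by (rule particles_asymptotic[OF data frame A3 model t])
  have superpos: "AE \<omega> in M. \<forall>\<^sub>F \<epsilon> in at_right 0. superposition M S F \<epsilon> \<omega> t"
    and stressm: "AE \<omega> in M. \<forall>\<^sub>F \<epsilon> in at_right 0. averaged_stress_model M S F \<epsilon> \<omega> x t"
    using A6 x t unfolding fluctuation_model_def by blast+
  have dil: "AE \<omega> in M. \<forall>\<^sub>F \<epsilon> in at_right 0. \<forall>i\<in>particles F. \<forall>j\<in>particles F. i \<noteq> j \<longrightarrow>
       closure (body S \<epsilon> (part F \<epsilon> \<omega> i) t) \<inter> closure (body S \<epsilon> (part F \<epsilon> \<omega> j) t) = {}"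
    using A2 t unfolding dilute_def by blast
  have ergS: "AE \<omega> in M. \<forall>\<^sub>F \<epsilon> in at_right 0. mean M (Sigs F \<epsilon>) x t = vol_avg (avgV F x t) (\<lambda>\<xi>. Sigs F \<epsilon> \<omega> \<xi> t)"
    and ergb: "AE \<omega> in M. \<forall>\<^sub>F \<epsilon> in at_right 0. mean M (bforce F \<epsilon>) x t = vol_avg (avgV F x t) (\<lambda>\<xi>. bforce F \<epsilon> \<omega> \<xi> t)"
    and ergr: "AE \<omega> in M. \<forall>\<^sub>F \<epsilon> in at_right 0. mean M (reynolds M F \<epsilon>) x t = vol_avg (avgV F x t) (\<lambda>\<xi>. reynolds M F \<epsilon> \<omega> \<xi> t)"
    using A9 x t unfolding ergodic_def by blast+
  show "AE \<omega> in M.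
        (\<lambda>\<epsilon>. norm (mean M (Sigs F \<epsilon>) x t -
            (mean_newton_stress M S F \<epsilon> \<omega> x t + particle_stress M S F \<epsilon> \<omega> x t)))
          \<in> O[at_right 0](\<lambda>\<epsilon>. \<epsilon> ^ 4) \<and>
        (\<lambda>\<epsilon>. norm (mean M (bforce F \<epsilon>) x t - particle_force M S F \<epsilon> \<omega> x t))
          \<in> O[at_right 0](\<lambda>\<epsilon>. \<epsilon> ^ 4)"
    using part superpos stressm dil ergS ergb
  proof eventually_elim
    case (elim \<omega>)
    then have p: "\<forall>j\<in>particles F. asymptotic_particle S (umean M F) (pmean M F) (\<lambda>\<epsilon>. part F \<epsilon> \<omega> j) t" by blast
    note ctxt = data frame x t p elim(2,3)
    show ?case
      using order_eps_bigo[OF particle_stress_expansion[OF ctxt elim(4,5)]]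
        order_eps_bigo[OF particle_force_expansion[OF ctxt elim(6)]] by blast
  qed
  have "AE \<omega> in M. order_eps 4 (\<lambda>\<epsilon>. mean M (reynolds M F \<epsilon>) x t)"
    using part superpos stressm ergr
  proof eventually_elim
    case (elim \<omega>)
    then have "\<forall>j\<in>particles F. asymptotic_particle S (umean M F) (pmean M F) (\<lambda>\<epsilon>. part F \<epsilon> \<omega> j) t"
      "\<forall>j\<in>particles F. local_decay S (\<lambda>\<epsilon>. part F \<epsilon> \<omega> j) t" by blast+
    from reynolds_order[OF data frame x t this(1) elim(2,3) this(2) elim(4)] show ?case .
  qed
  \<comment> \<open>The statement does not involve the sample point any more, and on a probability
    space an almost sure constant statement is true.\<close>
  then have "order_eps 4 (\<lambda>\<epsilon>. mean M (reynolds M F \<epsilon>) x t)" by simp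
  then show "(\<lambda>\<epsilon>. norm (mean M (reynolds M F \<epsilon>) x t)) \<in> O[at_right 0](\<lambda>\<epsilon>. \<epsilon> ^ 4)"
    by (rule order_eps_bigo)
qed

end
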